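(* Let $I=(a,b)$ be an interval. Suppose that the coefficients $w,p,q$ and, for each $n\in\mathbb{N}$, the coefficients $w_n,p_n,q_n$ are real-valued functions on $I$ such that: (1) $w,p^{-1},q\in L^1_{loc}(I,\mathrm{d}x)$ and $p,w>0$ a.e. in $I$, and likewise for $w_n,p_n,q_n$; (2) $w,p\ge\delta$ for some constant $\delta>0$ and $\sup_{k\in\mathbb{Z}}\int_{[k,k+1)\cap I}|q(x)|\,\mathrm{d}x<\infty$, and likewise for $w_n,p_n,q_n$; (3) $q_n,q\ge\gamma$ for some constant $\gamma\in\mathbb{R}$. Let $T$ and $T_n$ be the self-adjoint Sturm--Liouville operators in $L^2(I,w(x)\mathrm{d}x)$ and $L^2(I,w_n(x)\mathrm{d}x)$ associated with $(w,p,q)$ and $(w_n,p_n,q_n)$, respectively, as defined in the context (either all with form domain of type $\mathfrak{Q}_0$ or all with form domain of type $\mathfrak{Q}$). If $$\frac{w_n}{w}\to1,\qquad\frac{p_n}{p}\to1\quad\text{uniformly on } I,\qquad\text{and}\qquad C_n:=\sup_{k\in\mathbb{Z}}\int_{[k,k+1)\cap I}|q_n(x)-q(x)|\,\mathrm{d}x\to0,$$ then $T_n$ converges to $T$ in generalized norm resolvent sense with respect to the natural identification maps $J_n:L^2(I,w(x)\mathrm{d}x)\to L^2(I,w_n(x)\mathrm{d}x)$, $J_nf=f$ (defined for $n$ sufficiently large).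
   Context: Sturm--Liouville operators. For coefficients $w,p,q$ as in (1) and (2), let $AC(I)$ denote the (locally) absolutely continuous functions on $I$ and set $$\mathfrak{D}(A_+)=\{f\in L^2(I,w\,\mathrm{d}x): f\in AC(I),\ \sqrt{p}\,f'\in L^2(I,\mathrm{d}x)\},$$ $$\mathfrak{D}(A_-)=\{g\in L^2(I,w\,\mathrm{d}x): \sqrt{wp}\,g\in AC(I),\ \tfrac{1}{\sqrt w}(\sqrt{wp}\,g)'\in L^2(I,\mathrm{d}x)\},$$ $$\mathfrak{Q}:=\mathfrak{D}(A_+),\qquad \mathfrak{Q}_0:=\{f\in\mathfrak{Q}: \lim_{x\to a,b}(\sqrt{wp}\,g)(x)f(x)=0\ \ \forall g\in\mathfrak{D}(A_-)\}.$$ (Here $x\to a,b$ means both limits $x\downarrow a$ and $x\uparrow b$.) Under (1) and (2) the quadratic form $$\int_a^b\big(p(x)f'(x)^*g'(x)+q(x)f(x)^*g(x)\big)\mathrm{d}x$$ with form domain either $\mathfrak{Q}_0$ or $\mathfrak{Q}$ is closed and bounded from below in $L^2(I,w\,\mathrm{d}x)$, and $T$ is the self-adjoint operator in $L^2(I,w\,\mathrm{d}x)$ associated with it, for one of these two choices of form domain; it is a self-adjoint realization of $\frac1w\big(-\frac{\mathrm{d}}{\mathrm{d}x}p\frac{\mathrm{d}}{\mathrm{d}x}+q\big)$. The operator $T_n$ is defined in the same way from $w_n,p_n,q_n$, with the same type of choice. Generalized norm resolvent convergence. Let $A$ and $A_n$ be self-adjoint operators in separable Hilbert spaces $\mathfrak{H}$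 and $\mathfrak{H}_n$, let $J_n\in\mathcal{B}(\mathfrak{H},\mathfrak{H}_n)$, $R_A(z)=(A-z)^{-1}$ and $\Gamma:=\mathbb{C}\setminus\overline{\sigma(A)\cup\bigcup_n\sigma(A_n)}$. Then $A_n$ converges to $A$ in generalized norm resolvent sense if $\|J_n\|\le C$ for some constant $C>0$, $\|J_n^*J_n-\mathbb{I}\|=\|J_nJ_n^*-\mathbb{I}\|\to0$, and $\lim_{n\to\infty}\|J_n^*R_{A_n}(z)J_n-R_A(z)\|=0$ for one $z\in\Gamma$. *)

theory Defs
  imports "HOL-Analysis.Analysis"
begin

section \<open>Operators between complex inner product spaces\<close>

text \<open>
  The spaces \<open>L\<^sup>2(I, w dx)\<close> depend on the function \<open>w\<close>, so they cannot be types. A space is a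
  record carrying its underlying set and operations; \<open>hinner\<close> is linear in the second argument.
  The definitions of this section are meant for Hilbert spaces.
\<close>

record 'v hspace =
  hcarrier :: "'v set"
  hadd :: "'v \<Rightarrow> 'v \<Rightarrow> 'v"
  hscale :: "complex \<Rightarrow> 'v \<Rightarrow> 'v"
  hinner :: "'v \<Rightarrow> 'v \<Rightarrow> complex"

definition hnorm :: "'v hspace \<Rightarrow> 'v \<Rightarrow> real" where
  "hnorm H x = sqrt (Re (hinner H x x))"

definition hdiff :: "'v hspace \<Rightarrow> 'v \<Rightarrow> 'v \<Rightarrow> 'v" where
  "hdiff H x y = hadd H x (hscale H (-1) y)"

definition bounded_op :: "'v hspace \<Rightarrow> 'u hspace \<Rightarrow> ('v \<Rightarrow> 'u) \<Rightarrow> bool" where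
  "bounded_op H K B \<longleftrightarrow>
     (\<forall>x\<in>hcarrier H. B x \<in> hcarrier K) \<and>
     (\<forall>x\<in>hcarrier H. \<forall>y\<in>hcarrier H. B (hadd H x y) = hadd K (B x) (B y)) \<and>
     (\<forall>c. \<forall>x\<in>hcarrier H. B (hscale H c x) = hscale K c (B x)) \<and>
     (\<exists>C. \<forall>x\<in>hcarrier H. hnorm K (B x) \<le> C * hnorm H x)"

definition opnorm :: "'v hspace \<Rightarrow> 'u hspace \<Rightarrow> ('v \<Rightarrow> 'u) \<Rightarrow> real" where
  "opnorm H K B = (SUP x\<in>{x \<in> hcarrier H. hnorm H x \<le> 1}. hnorm K (B x))"

definition hadjoint :: "'v hspace \<Rightarrow> 'u hspace \<Rightarrow> ('v \<Rightarrow> 'u) \<Rightarrow> 'u \<Rightarrow> 'v" where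
  "hadjoint H K B y =
     (THE x. x \<in> hcarrier H \<and> (\<forall>u\<in>hcarrier H. hinner K y (B u) = hinner H x u))"

text \<open>Unbounded operators in \<open>H\<close> are given by their graphs.\<close>

definition linear_operator :: "'v hspace \<Rightarrow> ('v \<times> 'v) set \<Rightarrow> bool" where
  "linear_operator H A \<longleftrightarrow>
     A \<subseteq> hcarrier H \<times> hcarrier H \<and> A \<noteq> {} \<and>
     (\<forall>(f, h)\<in>A. \<forall>(f', h')\<in>A. (hadd H f f', hadd H h h') \<in> A) \<and>
     (\<forall>c. \<forall>(f, h)\<in>A. (hscale H c f, hscale H c h) \<in> A) \<and>
     single_valued A"

definition densely_defined :: "'v hspace \<Rightarrow> ('v \<times> 'v) set \<Rightarrow> bool" where
  "densely_defined H A \<longleftrightarrow>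
     (\<forall>x\<in>hcarrier H. \<forall>e>0. \<exists>f\<in>Domain A. hnorm H (hdiff H x f) < e)"

definition adjoint_graph :: "'v hspace \<Rightarrow> ('v \<times> 'v) set \<Rightarrow> ('v \<times> 'v) set" where
  "adjoint_graph H A =
     {(u, v). u \<in> hcarrier H \<and> v \<in> hcarrier H \<and>
              (\<forall>(f, h)\<in>A. hinner H u h = hinner H v f)}"

definition self_adjoint :: "'v hspace \<Rightarrow> ('v \<times> 'v) set \<Rightarrow> bool" where
  "self_adjoint H A \<longleftrightarrow>
     linear_operator H A \<and> densely_defined H A \<and> adjoint_graph H A = A"

definition resolvent :: "'v hspace \<Rightarrow> ('v \<times> 'v) set \<Rightarrow> complex \<Rightarrow> 'v \<Rightarrow> 'v" where
  "resolvent H A z g = (THE f. \<exists>h. (f, h) \<in> A \<and> hdiff H h (hscale H z f) = g)"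

definition resolvent_set :: "'v hspace \<Rightarrow> ('v \<times> 'v) set \<Rightarrow> complex set" where
  "resolvent_set H A =
     {z. (\<forall>g\<in>hcarrier H. \<exists>!f. \<exists>h. (f, h) \<in> A \<and> hdiff H h (hscale H z f) = g) \<and>
         bounded_op H H (resolvent H A z)}"

definition spectrum :: "'v hspace \<Rightarrow> ('v \<times> 'v) set \<Rightarrow> complex set" where
  "spectrum H A = - resolvent_set H A"

text \<open>
  Generalized norm resolvent convergence of \<open>An\<close> to \<open>A\<close> with respect to \<open>J\<close>. The maps \<open>J n\<close> need
  to be bounded operators only for \<open>n\<close> sufficiently large, since the identification maps
  considered below are defined only for such \<open>n\<close>.
\<close>

definition gen_norm_resolvent_conv ::
  "'v hspace \<Rightarrow> ('v \<times> 'v) set \<Rightarrow> (nat \<Rightarrow> 'u hspace) \<Rightarrow> (nat \<Rightarrow> ('u \<times> 'u) set) \<Rightarrow>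
   (nat \<Rightarrow> 'v \<Rightarrow> 'u) \<Rightarrow> bool" where
  "gen_norm_resolvent_conv H A Hn An J \<longleftrightarrow>
     self_adjoint H A \<and> (\<forall>n. self_adjoint (Hn n) (An n)) \<and>
     (\<exists>C>0. \<forall>\<^sub>F n in sequentially. bounded_op H (Hn n) (J n) \<and> opnorm H (Hn n) (J n) \<le> C) \<and>
     (\<forall>\<^sub>F n in sequentially.
        opnorm H H (\<lambda>x. hdiff H (hadjoint H (Hn n) (J n) (J n x)) x) =
        opnorm (Hn n) (Hn n) (\<lambda>y. hdiff (Hn n) (J n (hadjoint H (Hn n) (J n) y)) y)) \<and>
     (\<lambda>n. opnorm H H (\<lambda>x. hdiff H (hadjoint H (Hn n) (J n) (J n x)) x)) \<longlonglongrightarrow> 0 \<and>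
     (\<exists>z\<in>- closure (spectrum H A \<union> (\<Union>n. spectrum (Hn n) (An n))).
        (\<lambda>n. opnorm H H
           (\<lambda>x. hdiff H (hadjoint H (Hn n) (J n) (resolvent (Hn n) (An n) z (J n x)))
                        (resolvent H A z x))) \<longlonglongrightarrow> 0)"

section \<open>The space \<open>L\<^sup>2(M)\<close>\<close>

definition square_integrable :: "'x measure \<Rightarrow> ('x \<Rightarrow> complex) \<Rightarrow> bool" where
  "square_integrable M f \<longleftrightarrow>
     f \<in> borel_measurable M \<and> integrable M (\<lambda>x. (cmod (f x))\<^sup>2)"

definition ae_class :: "'x measure \<Rightarrow> ('x \<Rightarrow> complex) \<Rightarrow> ('x \<Rightarrow> complex) set" where
  "ae_class M f = {g \<in> borel_measurable M. AE x in M. g x = f x}"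

definition ae_rep :: "('x \<Rightarrow> complex) set \<Rightarrow> 'x \<Rightarrow> complex" where
  "ae_rep U = (SOME f. f \<in> U)"

definition L2_space :: "'x measure \<Rightarrow> ('x \<Rightarrow> complex) set hspace" where
  "L2_space M =
     \<lparr> hcarrier = ae_class M ` {f. square_integrable M f},
       hadd = (\<lambda>U V. ae_class M (\<lambda>x. ae_rep U x + ae_rep V x)),
       hscale = (\<lambda>c U. ae_class M (\<lambda>x. c * ae_rep U x)),
       hinner = (\<lambda>U V. LINT x|M. cnj (ae_rep U x) * ae_rep V x) \<rparr>"

section \<open>Absolutely continuous functions\<close>

definition abs_continuous_on_Icc :: "real \<Rightarrow> real \<Rightarrow> (real \<Rightarrow> complex) \<Rightarrow> bool" where
  "abs_continuous_on_Icc c d f \<longleftrightarrow>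
     (\<forall>e>0. \<exists>\<delta>>0. \<forall>P :: (real \<times> real) set.
        finite P \<longrightarrow> (\<forall>(s, t)\<in>P. c \<le> s \<and> s \<le> t \<and> t \<le> d) \<longrightarrow>
        disjoint_family_on (\<lambda>(s, t). {s<..<t}) P \<longrightarrow>
        (\<Sum>(s, t)\<in>P. t - s) < \<delta> \<longrightarrow>
        (\<Sum>(s, t)\<in>P. norm (f t - f s)) < e)"

definition AC_loc :: "real set \<Rightarrow> (real \<Rightarrow> complex) set" where
  "AC_loc I = {f. \<forall>c d. {c..d} \<subseteq> I \<longrightarrow> abs_continuous_on_Icc c d f}"

text \<open>
  For \<open>f \<in> AC_loc I\<close> this is the derivative at almost every point of the open interval \<open>I\<close>; the
  value at the remaining points is irrelevant.
\<close>

definition vderiv :: "(real \<Rightarrow> complex) \<Rightarrow> real \<Rightarrow> complex" where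
  "vderiv f x = vector_derivative f (at x)"

section \<open>Sturm--Liouville operators\<close>

definition L1_loc :: "real set \<Rightarrow> (real \<Rightarrow> real) set" where
  "L1_loc I = {h. \<forall>K. compact K \<and> K \<subseteq> I \<longrightarrow> h absolutely_integrable_on K}"

text \<open>A Lebesgue integral with values in \<open>[0, \<infinity>]\<close>: for \<open>h \<in> L1_loc I\<close> it may be infinite.\<close>

definition unif_loc_norm :: "real set \<Rightarrow> (real \<Rightarrow> real) \<Rightarrow> ennreal" where
  "unif_loc_norm I h =
     (SUP k::int. \<integral>\<^sup>+x\<in>{real_of_int k..<real_of_int k + 1} \<inter> I. ennreal \<bar>h x\<bar> \<partial>lebesgue)"

definition sl_coeffs ::
  "real set \<Rightarrow> (real \<Rightarrow> real) \<Rightarrow> (real \<Rightarrow> real) \<Rightarrow> (real \<Rightarrow> real) \<Rightarrow> bool" where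
  "sl_coeffs I w p q \<longleftrightarrow>
     w \<in> L1_loc I \<and> (\<lambda>x. 1 / p x) \<in> L1_loc I \<and> q \<in> L1_loc I \<and>
     (AE x in lebesgue_on I. p x > 0 \<and> w x > 0)"

definition sl_bounds ::
  "real set \<Rightarrow> (real \<Rightarrow> real) \<Rightarrow> (real \<Rightarrow> real) \<Rightarrow> (real \<Rightarrow> real) \<Rightarrow> bool" where
  "sl_bounds I w p q \<longleftrightarrow>
     (\<exists>\<delta>>0. AE x in lebesgue_on I. w x \<ge> \<delta> \<and> p x \<ge> \<delta>) \<and> unif_loc_norm I q < \<infinity>"

definition weighted :: "real set \<Rightarrow> (real \<Rightarrow> real) \<Rightarrow> real measure" where
  "weighted I w = density (lebesgue_on I) (\<lambda>x. ennreal (w x))"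

definition dom_A_plus ::
  "real set \<Rightarrow> (real \<Rightarrow> real) \<Rightarrow> (real \<Rightarrow> real) \<Rightarrow> (real \<Rightarrow> complex) set" where
  "dom_A_plus I w p =
     {f. square_integrable (weighted I w) f \<and> f \<in> AC_loc I \<and>
         square_integrable (lebesgue_on I) (\<lambda>x. complex_of_real (sqrt (p x)) * vderiv f x)}"

text \<open>
  Membership of \<open>\<surd>(w p) g\<close> in \<open>AC_loc I\<close> refers to an almost everywhere equal function \<open>G\<close>,
  which is unique on \<open>I\<close> by continuity. A pointwise equation would be too strict, because
  \<open>w p\<close> may vanish on a null set.
\<close>

definition ac_version ::
  "real set \<Rightarrow> (real \<Rightarrow> real) \<Rightarrow> (real \<Rightarrow> real) \<Rightarrow> (real \<Rightarrow> complex) \<Rightarrow> (real \<Rightarrow> complex) \<Rightarrow> bool" where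
  "ac_version I w p g G \<longleftrightarrow>
     G \<in> AC_loc I \<and> (AE x in lebesgue_on I. G x = complex_of_real (sqrt (w x * p x)) * g x)"

definition dom_A_minus ::
  "real set \<Rightarrow> (real \<Rightarrow> real) \<Rightarrow> (real \<Rightarrow> real) \<Rightarrow> (real \<Rightarrow> complex) set" where
  "dom_A_minus I w p =
     {g. square_integrable (weighted I w) g \<and>
         (\<exists>G. ac_version I w p g G \<and>
              square_integrable (lebesgue_on I) (\<lambda>x. vderiv G x / complex_of_real (sqrt (w x))))}"

datatype form_dom_type = Type_Q0 | Type_Q

text \<open>
  Elements of the form domains are represented by their locally absolutely continuous
  representatives. The endpoints are extended reals, so that \<open>I = einterval a b\<close> may be unbounded.
\<close>

definition form_dom ::
  "form_dom_type \<Rightarrow> ereal \<Rightarrow> ereal \<Rightarrow> (real \<Rightarrow> real) \<Rightarrow> (real \<Rightarrow> real) \<Rightarrow> (real \<Rightarrow> complex) set" where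
  "form_dom ty a b w p =
     (case ty of
        Type_Q \<Rightarrow> dom_A_plus (einterval a b) w p
      | Type_Q0 \<Rightarrow>
          {f \<in> dom_A_plus (einterval a b) w p.
             \<forall>g\<in>dom_A_minus (einterval a b) w p. \<forall>G. ac_version (einterval a b) w p g G \<longrightarrow>
               ((\<lambda>x. G (real_of_ereal x) * f (real_of_ereal x)) \<longlongrightarrow> 0) (at_right a) \<and>
               ((\<lambda>x. G (real_of_ereal x) * f (real_of_ereal x)) \<longlongrightarrow> 0) (at_left b)})"

definition sl_form ::
  "real set \<Rightarrow> (real \<Rightarrow> real) \<Rightarrow> (real \<Rightarrow> real) \<Rightarrow> (real \<Rightarrow> complex) \<Rightarrow> (real \<Rightarrow> complex) \<Rightarrow> complex" where
  "sl_form I p q f g =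
     (LINT x|lebesgue_on I.
        complex_of_real (p x) * cnj (vderiv f x) * vderiv g x +
        complex_of_real (q x) * cnj (f x) * g x)"

definition sl_space :: "ereal \<Rightarrow> ereal \<Rightarrow> (real \<Rightarrow> real) \<Rightarrow> (real \<Rightarrow> complex) set hspace" where
  "sl_space a b w = L2_space (weighted (einterval a b) w)"

text \<open>
  The operator associated with the form: \<open>T f = V\<close> if and only if \<open>f\<close> is in the form domain and
  the form at \<open>(g, f)\<close> equals \<open>\<langle>g, V\<rangle>\<close> for all \<open>g\<close> in the form domain.
\<close>

definition sl_operator ::
  "form_dom_type \<Rightarrow> ereal \<Rightarrow> ereal \<Rightarrow> (real \<Rightarrow> real) \<Rightarrow> (real \<Rightarrow> real) \<Rightarrow> (real \<Rightarrow> real) \<Rightarrow>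
   ((real \<Rightarrow> complex) set \<times> (real \<Rightarrow> complex) set) set" where
  "sl_operator ty a b w p q =
     {(ae_class (weighted (einterval a b) w) f, V) | f V.
        f \<in> form_dom ty a b w p \<and> V \<in> hcarrier (sl_space a b w) \<and>
        (\<forall>g\<in>form_dom ty a b w p.
           sl_form (einterval a b) p q g f =
           hinner (sl_space a b w) (ae_class (weighted (einterval a b) w) g) V)}"

end

theory Submission
  imports Defs
begin

text \<open>If \<open>w'/w\<close> and \<open>p'/p\<close> are close to \<open>1\<close>, both pairs of coefficients have the same Hilbert space up
  to equivalence of norms and the same form domain, and \<open>J* J\<close> is multiplication by \<open>w'/w\<close>. Put
  \<open>W f = \<integral> w |f|\<^sup>2 + p |f'|\<^sup>2\<close>. Since \<open>w, p \<ge> \<delta>\<close>, the Sobolev inequality on intervals of fixed length gives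
  \<open>\<bar>f\<bar>\<^sup>2 \<le> K W f\<close> together with \<open>\<integral> |r| |f|\<^sup>2 \<le> K (sup\<^sub>k \<integral>\<^bsub>[k, k+1)\<^esub> |r|) W f\<close>. Hence the form with potential \<open>q\<close>
  is closed and bounded below, and the two forms differ by at most a small multiple of \<open>W\<close>. At a real
  point below both spectra the resolvents solve \<open>t(g, f) - z \<langle>g, f\<rangle> = \<langle>g, h\<rangle>\<close>; testing the difference of
  these equations with \<open>g\<close> the difference of the two solutions bounds its energy. Membership of almost
  everywhere limits and primitives in the form domain rests on the fundamental theorem of calculus for
  absolutely continuous functions: the monotone parts of the variation decomposition have densities by
  Radon--Nikodym, and indefinite integrals are differentiable almost everywhere.\<close>

section \<open>Differentiation of indefinite integrals\<close>

text \<open>All limits follow from estimates for a pair of coefficient triples that are linear in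
  one distance \<epsilon> and whose constants do not depend on the second triple. This is possible
  since both lower bounds come from the shared \<gamma> together with \<delta> and \<delta>/2: the
  second operator is bounded below by twice the bound of the first. The finitely many indices that
  are not yet close have bounds of their own; they only influence where the test point is placed,
  for it must keep a positive distance from the union of all spectra. Hence a complex disc of common
  radius is needed in every resolvent set, and a contraction argument around a real point supplies
  it.

  The boundary condition of \<open>Type_Q0\<close> is the delicate part of the form domain. It
  survives form limits because the products it tests are bounded on I by the form norm, and it is
  the same for comparable coefficients because the test functions can be described with the weights
  1/p and 1/w alone.

  Form domains contain functions whereas vectors are classes, and values off I are arbitrary. The
  abstract part therefore works with semidefinite products and a map \<iota> into the Hilbert
  space.\<close>

text \<open>The Henstock lemma bounds the total error over a disjoint family of bad intervals, and the
  Vitali covering lemma bounds the measure of the bad set by the total length of such a family.\<close>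

lemma negligible_bad_derivative_set:
  fixes h :: "real \<Rightarrow> 'a::euclidean_space"
  assumes h: "h integrable_on {c..d}" and "c < d" and "e > 0"
  shows "negligible {x. c \<le> x \<and> x \<le> d \<and> (\<forall>r>0. \<exists>u v. u < v \<and> v - u < r \<and> c \<le> u \<and> v \<le> d \<and> (x = u \<or> x = v) \<and>
           norm ((v - u) *\<^sub>R h x - integral {u..v} h) \<ge> (v - u) * e)}" (is "negligible ?E")
  unfolding negligible_outer_le
proof (intro allI impI)
  fix \<epsilon> :: real assume "\<epsilon> > 0"
  \<comment> \<open>The 10 is the length of a ball of radius 5 r divided by r: 5 comes from the
    Vitali dilation, 2 from the two sides of the centre.\<close>
  define \<eta> where "\<eta> = \<epsilon> * e / 10"
  have "\<eta> > 0" using \<open>\<epsilon> > 0\<close> \<open>e > 0\<close> by (simp add: \<eta>_def)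
  have hc: "h integrable_on cbox c d" using h by simp
  obtain \<gamma> where "gauge \<gamma>" and \<gamma>: "\<And>p. \<lbrakk>p tagged_partial_division_of (cbox c d); \<gamma> fine p\<rbrakk> \<Longrightarrow>
             (\<Sum>(x,k)\<in>p. norm (measure lborel k *\<^sub>R h x - integral k h)) < \<eta>"
    using Henstock_lemma[OF hc \<open>\<eta> > 0\<close>] by blast
  \<comment> \<open>A witness of badness is a tagged interval with the tag at one of its end points;
    it also has to be \<gamma>-fine for the Henstock lemma to apply to it.\<close>
  define K where "K = {(x,u,v). u < v \<and> c \<le> u \<and> v \<le> d \<and> (x = u \<or> x = v) \<and> {u..v} \<subseteq> \<gamma> x \<and>
           norm ((v - u) *\<^sub>R h x - integral {u..v} h) \<ge> (v - u) * e}"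
  define ctr where "ctr = (\<lambda>(x::real,u::real,v::real). x)"
  \<comment> \<open>The radius is the full length, not half of it: the centre is an end point, so
    only then does the ball contain the interval, and disjoint balls give disjoint
    intervals.\<close>
  define rad where "rad = (\<lambda>(x::real,u::real,v::real). v - u)"
  have cov: "?E \<subseteq> (\<Union>i\<in>K. cball (ctr i) (rad i))"
  proof
    fix x assume x: "x \<in> ?E"
    have "open (\<gamma> x)" "x \<in> \<gamma> x" using \<open>gauge \<gamma>\<close> by (auto simp: gauge_def)
    then obtain r where r: "r > 0" "ball x r \<subseteq> \<gamma> x" by (meson openE)
    from x \<open>r > 0\<close> obtain u v where uv: "u < v" "v - u < r" "c \<le> u" "v \<le> d" "x = u \<or> x = v"
       "norm ((v - u) *\<^sub>R h x - integral {u..v} h) \<ge> (v - u) * e" by blast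
    have "{u..v} \<subseteq> ball x r" using uv by (auto simp: dist_real_def)
    with r uv have "(x,u,v) \<in> K" by (auto simp: K_def)
    then show "x \<in> (\<Union>i\<in>K. cball (ctr i) (rad i))"
      using uv by (force simp: ctr_def rad_def)
  qed
  have rad: "0 < rad i \<and> rad i \<le> d - c" if "i \<in> K" for i
    using that by (auto simp: K_def rad_def)
  obtain C where C: "countable C" "C \<subseteq> K"
     "pairwise (\<lambda>i j. disjnt (cball (ctr i) (rad i)) (cball (ctr j) (rad j))) C"
     "?E \<subseteq> (\<Union>i\<in>C. cball (ctr i) (5 * rad i))"
    by (rule Vitali_covering_lemma_cballs[OF cov rad]) (assumption | rule that)+
  \<comment> \<open>A bound for all finite subfamilies passes to the countable union. For a finite
    family of disjoint intervals the total Henstock error is below \<eta>, whereas each bad interval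
    alone contributes at least e times its length.\<close>
  have fin: "measure lebesgue (\<Union>i\<in>D. cball (ctr i) (5 * rad i)) \<le> \<epsilon>" if D: "D \<subseteq> C" "finite D" for D
  proof -
    define \<phi> where "\<phi> = (\<lambda>(x::real,u::real,v::real). (x, cbox u v))"
    have DK: "D \<subseteq> K" using D C by auto
    have inj: "inj_on \<phi> D"
    proof (rule inj_onI)
      fix i j assume "i \<in> D" "j \<in> D" "\<phi> i = \<phi> j"
      moreover obtain x u v x' u' v' where "i = (x,u,v)" "j = (x',u',v')" by (cases i, cases j)
      moreover have "u < v" "u' < v'" using calculation DK by (auto simp: K_def subset_iff)
      ultimately show "i = j" by (auto simp: \<phi>_def Icc_eq_Icc)
    qed
    have disj: "disjnt (cball (ctr i) (rad i)) (cball (ctr j) (rad j))" if "i \<in> D" "j \<in> D" "i \<noteq> j" for i j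
      using C(3) D(1) that unfolding pairwise_def by blast
    have sub: "snd (\<phi> i) \<subseteq> cball (ctr i) (rad i)" if "i \<in> K" for i
      using that by (auto simp: \<phi>_def ctr_def rad_def K_def dist_real_def)
    have "\<phi> ` D tagged_partial_division_of (cbox c d)"
      unfolding tagged_partial_division_of_def
    proof (intro conjI allI impI)
      show "finite (\<phi> ` D)" using D by simp
      fix x k assume "(x,k) \<in> \<phi> ` D"
      then obtain i where i: "i \<in> D" "\<phi> i = (x,k)" by auto
      obtain x' u v where iv: "i = (x',u,v)" by (cases i)
      show "x \<in> k" "k \<subseteq> cbox c d" "\<exists>a b. k = cbox a b"
      proof -
        have "(x',u,v) \<in> K" using i DK iv by auto
        then show "x \<in> k" "k \<subseteq> cbox c d" "\<exists>a b. k = cbox a b"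
          using i iv by (auto simp: \<phi>_def K_def)
      qed
    next
      fix x1 k1 x2 k2 assume *: "(x1,k1) \<in> \<phi> ` D \<and> (x2,k2) \<in> \<phi> ` D \<and> (x1,k1) \<noteq> (x2,k2)"
      then obtain i j where ij: "i \<in> D" "\<phi> i = (x1,k1)" "j \<in> D" "\<phi> j = (x2,k2)" by (metis imageE)
      then have "i \<noteq> j" using * by (metis prod.inject)
      then have "disjnt (cball (ctr i) (rad i)) (cball (ctr j) (rad j))" by (rule disj[OF ij(1,3)])
      moreover have "k1 \<subseteq> cball (ctr i) (rad i)" "k2 \<subseteq> cball (ctr j) (rad j)"
        using sub[of i] sub[of j] ij DK by auto
      ultimately have "disjnt k1 k2" by (meson disjnt_subset1 disjnt_subset2)
      then show "interior k1 \<inter> interior k2 = {}"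
        using interior_subset by (fastforce simp: disjnt_def)
    qed
    moreover have "\<gamma> fine \<phi> ` D"
      using DK by (auto simp: fine_def \<phi>_def K_def subset_iff)
    ultimately have "(\<Sum>(x,k)\<in>\<phi> ` D. norm (measure lborel k *\<^sub>R h x - integral k h)) < \<eta>"
      by (rule \<gamma>)
    also have "(\<Sum>(x,k)\<in>\<phi> ` D. norm (measure lborel k *\<^sub>R h x - integral k h)) =
       (\<Sum>(x,u,v)\<in>D. norm ((v - u) *\<^sub>R h x - integral {u..v} h))"
      unfolding sum.reindex[OF inj]
    proof (rule sum.cong[OF refl])
      fix i assume "i \<in> D"
      then have "i \<in> K" using DK by auto
      then show "((\<lambda>(x,k). norm (measure lborel k *\<^sub>R h x - integral k h)) \<circ> \<phi>) i =
          (case i of (x,u,v) \<Rightarrow> norm ((v - u) *\<^sub>R h x - integral {u..v} h))"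
        by (auto simp: \<phi>_def K_def)
    qed
    finally have lt: "(\<Sum>(x,u,v)\<in>D. norm ((v - u) *\<^sub>R h x - integral {u..v} h)) < \<eta>" .
    have "(\<Sum>i\<in>D. rad i * e) \<le> (\<Sum>(x,u,v)\<in>D. norm ((v - u) *\<^sub>R h x - integral {u..v} h))"
      by (rule sum_mono) (use DK in \<open>auto simp: rad_def K_def subset_iff\<close>)
    with lt have "(\<Sum>i\<in>D. rad i) * e < \<eta>" by (simp add: sum_distrib_right)
    then have s: "(\<Sum>i\<in>D. rad i) * 10 \<le> \<epsilon>" using \<open>e > 0\<close> unfolding \<eta>_def
      by (simp add: field_simps)
    have "measure lebesgue (\<Union>i\<in>D. cball (ctr i) (5 * rad i)) \<le> (\<Sum>i\<in>D. measure lebesgue (cball (ctr i) (5 * rad i)))"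
      by (rule measure_UNION_le) (use D in auto)
    also have "\<dots> = (\<Sum>i\<in>D. 10 * rad i)"
    proof (rule sum.cong[OF refl])
      fix i assume "i \<in> D"
      then have "rad i > 0" using DK rad by (meson subsetD)
      then show "measure lebesgue (cball (ctr i) (5 * rad i)) = 10 * rad i"
        by (simp add: cball_eq_atLeastAtMost)
    qed
    also have "\<dots> \<le> \<epsilon>" using s by (simp flip: sum_distrib_left)
    finally show ?thesis .
  qed
  show "\<exists>T. ?E \<subseteq> T \<and> T \<in> lmeasurable \<and> measure lebesgue T \<le> \<epsilon>"
    using C(4) fmeasurable_UN_bound[OF C(1) _ fin] measure_UN_bound[OF C(1) _ fin]
    by (intro exI[of _ "\<Union>i\<in>C. cball (ctr i) (5 * rad i)"]) auto
qed

text \<open>If the difference quotient at x does not tend to h x, then x is bad for some error level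
  of the form 1/(m+1), hence lies in a countable union of negligible sets. Increments to the right
  and to the left of x correspond to intervals having x as left or right end point.\<close>

lemma integral_has_vector_derivative_ae:
  fixes h :: "real \<Rightarrow> 'a::euclidean_space"
  assumes h: "h integrable_on {c..d}"
  shows "\<exists>N. negligible N \<and>
    (\<forall>x\<in>{c<..<d} - N. ((\<lambda>u. integral {c..u} h) has_vector_derivative h x) (at x))"
proof (cases "c < d")
  case True
  define B where "B e = {x. c \<le> x \<and> x \<le> d \<and> (\<forall>r>0. \<exists>u v. u < v \<and> v - u < r \<and> c \<le> u \<and> v \<le> d \<and> (x = u \<or> x = v) \<and>
           norm ((v - u) *\<^sub>R h x - integral {u..v} h) \<ge> (v - u) * e)}" for e
  define N where "N = (\<Union>m::nat. B (inverse (Suc m)))"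
  have "negligible N" unfolding N_def
    by (rule negligible_countable_Union)
       (auto simp: B_def intro!: negligible_bad_derivative_set[OF h True])
  moreover have "((\<lambda>u. integral {c..u} h) has_vector_derivative h x) (at x)" if x: "x \<in> {c<..<d} - N" for x
    unfolding has_vector_derivative_def has_derivative_at_within
  proof (intro conjI bounded_linear_scaleR_left)
    show "((\<lambda>y. (integral {c..y} h - integral {c..x} h - (y - x) *\<^sub>R h x) /\<^sub>R norm (y - x)) \<longlongrightarrow> 0) (at x)"
    proof (rule tendstoI)
      fix e :: real assume "e > 0"
      then obtain m :: nat where m: "inverse (Suc m) < e" using reals_Archimedean by blast
      have "x \<notin> B (inverse (Suc m))" using x by (auto simp: N_def)
      then have "\<not> (\<forall>r>0. \<exists>u v. u < v \<and> v - u < r \<and> c \<le> u \<and> v \<le> d \<and> (x = u \<or> x = v) \<and>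
           norm ((v - u) *\<^sub>R h x - integral {u..v} h) \<ge> (v - u) * inverse (Suc m))"
        using x unfolding B_def by simp
      then obtain r where r: "r > 0" "\<And>u v. \<lbrakk>u < v; v - u < r; c \<le> u; v \<le> d; x = u \<or> x = v\<rbrakk> \<Longrightarrow>
           norm ((v - u) *\<^sub>R h x - integral {u..v} h) < (v - u) * inverse (Suc m)"
        unfolding not_all not_ex not_imp not_le de_Morgan_conj by (metis not_less)
      have "dist ((integral {c..y} h - integral {c..x} h - (y - x) *\<^sub>R h x) /\<^sub>R norm (y - x)) 0 < e"
        if y: "y \<in> {c<..<d}" "y \<noteq> x" "dist y x < r" for y
      proof (cases "x < y")
        case True
        have "integral {c..x} h + integral {x..y} h = integral {c..y} h"
          by (rule Henstock_Kurzweil_Integration.integral_combine)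
             (use True x y in \<open>auto intro: integrable_on_subinterval[OF h]\<close>)
        then have "norm (integral {c..y} h - integral {c..x} h - (y - x) *\<^sub>R h x)
            = norm ((y - x) *\<^sub>R h x - integral {x..y} h)"
          by (metis add_diff_cancel_left' norm_minus_commute)
        also have "\<dots> < (y - x) * inverse (Suc m)"
          using r(2)[of x y] True x y by (auto simp: dist_real_def)
        finally have "norm (integral {c..y} h - integral {c..x} h - (y - x) *\<^sub>R h x) < (y - x) * inverse (Suc m)" .
        then have "norm (integral {c..y} h - integral {c..x} h - (y - x) *\<^sub>R h x) / (y - x) < inverse (Suc m)"
          using True by (simp add: pos_divide_less_eq mult.commute)
        then show ?thesis using True m by (simp add: divide_inverse mult.commute)
      next
        case False
        with y have False: "y < x" by auto
        have "integral {c..y} h + integral {y..x} h = integral {c..x} h"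
          by (rule Henstock_Kurzweil_Integration.integral_combine)
             (use False x y in \<open>auto intro: integrable_on_subinterval[OF h]\<close>)
        then have "integral {c..y} h - integral {c..x} h - (y - x) *\<^sub>R h x
            = (x - y) *\<^sub>R h x - integral {y..x} h"
          by (simp add: algebra_simps)
        moreover have "norm ((x - y) *\<^sub>R h x - integral {y..x} h) < (x - y) * inverse (Suc m)"
          using r(2)[of y x] False x y by (auto simp: dist_real_def)
        ultimately have "norm (integral {c..y} h - integral {c..x} h - (y - x) *\<^sub>R h x) < (x - y) * inverse (Suc m)"
          by simp
        then have "norm (integral {c..y} h - integral {c..x} h - (y - x) *\<^sub>R h x) / (x - y) < inverse (Suc m)"
          using False by (simp add: pos_divide_less_eq mult.commute)
        then show ?thesis using False m by (simp add: divide_inverse mult.commute)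
      qed
      then have *: "\<And>y. y \<in> {c<..<d} \<Longrightarrow> y \<noteq> x \<and> dist y x < r \<longrightarrow> dist ((integral {c..y} h - integral {c..x} h - (y - x) *\<^sub>R h x) /\<^sub>R norm (y - x)) 0 < e" by blast
      have "eventually (\<lambda>y. y \<in> {c<..<d}) (at x)"
        using x by (intro eventually_at_in_open') auto
      moreover have "eventually (\<lambda>y. y \<noteq> x \<and> dist y x < r) (at x)"
        using r(1) by (auto simp: eventually_at intro!: exI[of _ r])
      ultimately show "\<forall>\<^sub>F y in at x. dist ((integral {c..y} h - integral {c..x} h - (y - x) *\<^sub>R h x) /\<^sub>R norm (y - x)) 0 < e"
        by eventually_elim (use * in blast)
    qed
  qed
  ultimately show ?thesis by blast
qed (auto intro: exI[of _ "{}"])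

section \<open>Absolutely continuous functions\<close>

text \<open>Degenerate pairs are excluded: with s < t the open intervals are nonempty, so families
  placed in disjoint intervals are disjoint as sets of pairs, and sums over their unions
  split.\<close>

definition subinterval_families :: "real \<Rightarrow> real \<Rightarrow> (real \<times> real) set set" where
  "subinterval_families x y = {P. finite P \<and> (\<forall>(s,t)\<in>P. x \<le> s \<and> s < t \<and> t \<le> y) \<and>
     disjoint_family_on (\<lambda>(s,t). {s<..<t}) P}"

lemma disjoint_intervals_D:
  "\<lbrakk>disjoint_family_on (\<lambda>(s,t). {s<..<t}) P; (s,t) \<in> P; (s',t') \<in> P; (s,t) \<noteq> (s',t')\<rbrakk> \<Longrightarrow> {s<..<t} \<inter> {s'<..<t' :: real} = {}"
  unfolding disjoint_family_on_def by fast

text \<open>The real-valued form of absolute continuity, tested on nondegenerate intervals; the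
  order of the real line is what the decomposition into monotone functions needs.\<close>

definition abs_cont :: "real \<Rightarrow> real \<Rightarrow> (real \<Rightarrow> real) \<Rightarrow> bool" where
  "abs_cont c d f \<longleftrightarrow> (\<forall>e>0. \<exists>\<delta>>0. \<forall>P\<in>subinterval_families c d.
     (\<Sum>(s,t)\<in>P. t - s) < \<delta> \<longrightarrow> (\<Sum>(s,t)\<in>P. \<bar>f t - f s\<bar>) < e)"

lemma abs_cont_Re_Im:
  assumes "abs_continuous_on_Icc c d f"
  shows "abs_cont c d (\<lambda>x. Re (f x))" "abs_cont c d (\<lambda>x. Im (f x))"
proof -
  have *: "abs_cont c d g" if g: "\<And>s t. \<bar>g t - g s\<bar> \<le> norm (f t - f s)" for g
    unfolding abs_cont_def
  proof (intro allI impI)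
    fix e :: real assume "e > 0"
    then obtain \<delta> where \<delta>: "\<delta> > 0" "\<And>P :: (real \<times> real) set. \<lbrakk>finite P; \<forall>(s, t)\<in>P. c \<le> s \<and> s \<le> t \<and> t \<le> d;
        disjoint_family_on (\<lambda>(s, t). {s<..<t}) P; (\<Sum>(s, t)\<in>P. t - s) < \<delta>\<rbrakk> \<Longrightarrow>
        (\<Sum>(s, t)\<in>P. norm (f t - f s)) < e"
      using assms unfolding abs_continuous_on_Icc_def by meson
    have "(\<Sum>(s,t)\<in>P. \<bar>g t - g s\<bar>) < e"
      if P: "P \<in> subinterval_families c d" "(\<Sum>(s,t)\<in>P. t - s) < \<delta>" for P
    proof -
      have "(\<Sum>(s,t)\<in>P. \<bar>g t - g s\<bar>) \<le> (\<Sum>(s,t)\<in>P. norm (f t - f s))"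
        by (rule sum_mono) (auto simp: g)
      also have "\<dots> < e"
        using P by (intro \<delta>(2)) (auto simp: subinterval_families_def)
      finally show ?thesis .
    qed
    then show "\<exists>\<delta>>0. \<forall>P\<in>subinterval_families c d. (\<Sum>(s,t)\<in>P. t - s) < \<delta> \<longrightarrow> (\<Sum>(s,t)\<in>P. \<bar>g t - g s\<bar>) < e"
      using \<delta>(1) by blast
  qed
  show "abs_cont c d (\<lambda>x. Re (f x))" "abs_cont c d (\<lambda>x. Im (f x))"
    by (rule *, metis abs_Re_le_cmod minus_complex.simps(1), rule *, metis abs_Im_le_cmod minus_complex.simps(2))
qed

lemma empty_subinterval_family [simp]: "{} \<in> subinterval_families x y"
  by (auto simp: subinterval_families_def disjoint_family_on_def)

lemma singleton_subinterval_family: "x \<le> s \<Longrightarrow> s < t \<Longrightarrow> t \<le> y \<Longrightarrow> {(s,t)} \<in> subinterval_families x y"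
  by (auto simp: subinterval_families_def disjoint_family_on_def)

lemma subinterval_families_mono: "x' \<le> x \<Longrightarrow> y \<le> y' \<Longrightarrow> P \<in> subinterval_families x y \<Longrightarrow> P \<in> subinterval_families x' y'"
  by (fastforce simp: subinterval_families_def)

text \<open>Intervals inside disjoint intervals are disjoint, so every interval of a family may be
  refined by a family of its own. This turns a choice of nearly optimal partitions, one for each
  interval, into a single family to which absolute continuity can be applied.\<close>

lemma subinterval_families_UN:
  assumes "finite P" "disjoint_family_on (\<lambda>(s,t). {s<..<t}) P"
    "\<And>s t. (s,t) \<in> P \<Longrightarrow> x \<le> s \<and> t \<le> y" "\<And>s t. (s,t) \<in> P \<Longrightarrow> Q (s,t) \<in> subinterval_families s t"
  shows "(\<Union>p\<in>P. Q p) \<in> subinterval_families x y" "disjoint_family_on Q P"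
proof -
  have sub: "{u<..<v} \<subseteq> {s<..<t} \<and> u < v" if "(u,v) \<in> Q (s,t)" "(s,t) \<in> P" for u v s t
    using assms(4)[OF that(2)] that(1) by (auto simp: subinterval_families_def)
  show "disjoint_family_on Q P"
    unfolding disjoint_family_on_def
  proof (intro ballI impI)
    fix p p' assume p: "p \<in> P" "p' \<in> P" "p \<noteq> p'"
    obtain s t s' t' where st: "p = (s,t)" "p' = (s',t')" by (cases p, cases p')
    have d: "{s<..<t} \<inter> {s'<..<t'} = {}"
      using disjoint_intervals_D[OF assms(2)] p st by blast
    show "Q p \<inter> Q p' = {}"
    proof (rule ccontr)
      assume "Q p \<inter> Q p' \<noteq> {}"
      then obtain u v where "(u,v) \<in> Q p" "(u,v) \<in> Q p'" by auto
      then have "{u<..<v} \<subseteq> {s<..<t} \<inter> {s'<..<t'}" "u < v"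
        using sub[of u v s t] sub[of u v s' t'] st p by blast+
      then show False using d dense[of u v] by auto
    qed
  qed
  show "(\<Union>p\<in>P. Q p) \<in> subinterval_families x y"
    unfolding subinterval_families_def mem_Collect_eq
  proof (intro conjI)
    show "finite (\<Union>p\<in>P. Q p)"
      using assms by (auto simp: subinterval_families_def)
    show "\<forall>(s,t)\<in>\<Union>p\<in>P. Q p. x \<le> s \<and> s < t \<and> t \<le> y"
      using assms(3,4) by (fastforce simp: subinterval_families_def)
    show "disjoint_family_on (\<lambda>(s, t). {s<..<t}) (\<Union>p\<in>P. Q p)"
      unfolding disjoint_family_on_def
    proof (intro ballI impI)
      fix i j assume ij: "i \<in> (\<Union>p\<in>P. Q p)" "j \<in> (\<Union>p\<in>P. Q p)" "i \<noteq> j"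
      obtain u v u' v' where uv: "i = (u,v)" "j = (u',v')" by (cases i, cases j)
      from ij obtain s t s' t' where st: "(s,t) \<in> P" "(s',t') \<in> P" "i \<in> Q (s,t)" "j \<in> Q (s',t')" by auto
      show "(\<lambda>(s, t). {s<..<t}) i \<inter> (\<lambda>(s, t). {s<..<t}) j = {}"
      proof (cases "(s,t) = (s',t')")
        case True
        then show ?thesis using assms(4)[OF st(1)] st ij(3)
          by (auto simp: subinterval_families_def disjoint_family_on_def)
      next
        case False
        then have "{s<..<t} \<inter> {s'<..<t'} = {}"
          using disjoint_intervals_D[OF assms(2)] st by blast
        moreover have "{u<..<v} \<subseteq> {s<..<t}" "{u'<..<v'} \<subseteq> {s'<..<t'}"
          using sub[of u v s t] sub[of u' v' s' t'] st uv by blast+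
        ultimately show ?thesis unfolding uv by blast
      qed
    qed
  qed
qed

lemma subinterval_families_length_le_measure:
  assumes "P \<in> subinterval_families x y" "U \<in> fmeasurable lborel" "\<And>s t. (s,t) \<in> P \<Longrightarrow> {s<..<t} \<subseteq> U"
  shows "(\<Sum>(s,t)\<in>P. t - s) \<le> measure lborel U"
proof -
  have P: "finite P" "disjoint_family_on (\<lambda>(s,t). {s<..<t}) P" "\<And>s t. (s,t) \<in> P \<Longrightarrow> x \<le> s \<and> s < t \<and> t \<le> y"
    using assms by (auto simp: subinterval_families_def)
  have "(\<Sum>(s,t)\<in>P. t - s) = (\<Sum>p\<in>P. measure lborel ((\<lambda>(s,t). {s<..<t}) p))"
    by (rule sum.cong) (use P(3) in \<open>auto simp: less_imp_le\<close>)
  also have "\<dots> = measure lborel (\<Union>p\<in>P. (\<lambda>(s,t). {s<..<t}) p)"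
    by (rule measure_finite_Union[symmetric]) (use P in \<open>auto simp: less_imp_le split: prod.splits\<close>)
  also have "\<dots> \<le> measure lborel U"
  proof (rule measure_mono_fmeasurable[OF _ _ assms(2)])
    show "(\<Union>p\<in>P. (\<lambda>(s,t). {s<..<t}) p) \<subseteq> U" using assms(3) by auto
    show "(\<Union>p\<in>P. (\<lambda>(s,t). {s<..<t}) p) \<in> sets lborel"
      using P(1) by (intro sets.finite_UN) (auto split: prod.splits)
  qed
  finally show ?thesis .
qed

lemma subinterval_families_length_le:
  assumes "P \<in> subinterval_families x y" "x \<le> y"
  shows "(\<Sum>(s,t)\<in>P. t - s) \<le> y - x"
proof -
  have "(\<Sum>(s,t)\<in>P. t - s) \<le> measure lborel {x..y}"
  proof (rule subinterval_families_length_le_measure[OF assms(1)])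
    show "{x..y} \<in> fmeasurable lborel" by (rule fmeasurableI) (auto simp: emeasure_lborel_Icc_eq)
    show "{s<..<t} \<subseteq> {x..y}" if "(s,t) \<in> P" for s t
      using assms(1) that by (force simp: subinterval_families_def)
  qed
  then show ?thesis using assms by simp
qed

text \<open>Cutting at y is done by clamping all end points with \<open>min\<close> and
  \<open>max\<close> against y. At most one interval straddles y and is really cut, which the
  triangle inequality pays for; intervals that collapse to a point are dropped and have increment
  0.\<close>

lemma subinterval_families_split:
  assumes P: "P \<in> subinterval_families x z" and xyz: "x \<le> y" "y \<le> z"
  obtains P1 P2 where "P1 \<in> subinterval_families x y" "P2 \<in> subinterval_families y z"
    "(\<Sum>(s,t)\<in>P. \<bar>f t - f s\<bar>) \<le> (\<Sum>(s,t)\<in>P1. \<bar>f t - f s\<bar>) + (\<Sum>(s,t)\<in>P2. \<bar>f t - f s :: real\<bar>)"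
proof -
  have Pf: "finite P" "disjoint_family_on (\<lambda>(s,t). {s<..<t}) P" "\<And>s t. (s,t) \<in> P \<Longrightarrow> x \<le> s \<and> s < t \<and> t \<le> z"
    using assms by (auto simp: subinterval_families_def)
  define g where "g = (\<lambda>(s,t). \<bar>f t - f s\<bar>)"
  \<comment> \<open>Both clamps are treated at once. The last assumption on k says that an interval
    that does not collapse only shrinks, which preserves disjointness.\<close>
  have restr: "(\<lambda>(s,t). (k s, k t)) ` P \<inter> {(s,t). s < t} \<in> subinterval_families u v \<and>
     (\<Sum>(s,t)\<in>P. \<bar>f (k t) - f (k s)\<bar>) = sum g ((\<lambda>(s,t). (k s, k t)) ` P \<inter> {(s,t). s < t})"
    if k: "\<And>s. x \<le> s \<Longrightarrow> s \<le> z \<Longrightarrow> u \<le> k s \<and> k s \<le> v" "mono k"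
      "\<And>s t. k s < k t \<Longrightarrow> {k s<..<k t} \<subseteq> {s<..<t}" for u v k
  proof
    let ?\<phi> = "\<lambda>(s,t). (k s, k t)"
    \<comment> \<open>Distinct pairs can have the same image only if it is degenerate; such images
      have weight 0, so reindexing the sum loses nothing.\<close>
    have nd: "k s = k t" if "p \<in> P" "p' \<in> P" "p \<noteq> p'" "?\<phi> p = ?\<phi> p'" "p = (s,t)" for p p' s t
    proof (rule ccontr)
      assume ne: "k s \<noteq> k t"
      obtain s' t' where p': "p' = (s',t')" by (cases p')
      have "k s \<le> k t" using Pf(3)[of s t] that k(2) by (auto simp: mono_def)
      with ne have lt: "k s < k t" by simp
      have eq: "k s = k s'" "k t = k t'" using that p' by auto
      have "{k s<..<k t} \<subseteq> {s<..<t} \<inter> {s'<..<t'}" using k(3)[of s t] k(3)[of s' t'] lt eq by (intro Int_greatest) simp_all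
      moreover have "{s<..<t} \<inter> {s'<..<t'} = {}" using disjoint_intervals_D[OF Pf(2)] that p' by blast
      ultimately show False using dense[OF lt] by auto
    qed
    show "?\<phi> ` P \<inter> {(s,t). s < t} \<in> subinterval_families u v"
      unfolding subinterval_families_def mem_Collect_eq
    proof (intro conjI)
      show "finite (?\<phi> ` P \<inter> {(s,t). s < t})" using Pf by simp
      show "\<forall>(s,t)\<in>?\<phi> ` P \<inter> {(s,t). s < t}. u \<le> s \<and> s < t \<and> t \<le> v"
      proof
        fix i assume "i \<in> ?\<phi> ` P \<inter> {(s,t). s < t}"
        then obtain s t where "(s,t) \<in> P" "i = (k s, k t)" "k s < k t" by auto
        then show "case i of (s,t) \<Rightarrow> u \<le> s \<and> s < t \<and> t \<le> v"
          using Pf(3)[of s t] k(1)[of s] k(1)[of t] by simp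
      qed
      show "disjoint_family_on (\<lambda>(s, t). {s<..<t}) (?\<phi> ` P \<inter> {(s,t). s < t})"
        unfolding disjoint_family_on_def
      proof (intro ballI impI)
        fix i j assume ij: "i \<in> ?\<phi> ` P \<inter> {(s,t). s < t}" "j \<in> ?\<phi> ` P \<inter> {(s,t). s < t}" "i \<noteq> j"
        then obtain s t s' t' where st: "(s,t) \<in> P" "(s',t') \<in> P" "i = (k s,k t)" "j = (k s', k t')" "k s < k t" "k s' < k t'"
          by auto
        have "{s<..<t} \<inter> {s'<..<t'} = {}" using disjoint_intervals_D[OF Pf(2) st(1,2)] st ij(3) by blast
        then show "(\<lambda>(s, t). {s<..<t}) i \<inter> (\<lambda>(s, t). {s<..<t}) j = {}"
          using k(3)[OF st(5)] k(3)[OF st(6)] unfolding st(3,4) by blast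
      qed
    qed
    have "sum g (?\<phi> ` P) = sum (g \<circ> ?\<phi>) P"
    proof (rule sum.reindex_nontrivial[OF Pf(1)])
      fix p p' assume *: "p \<in> P" "p' \<in> P" "p \<noteq> p'" "?\<phi> p = ?\<phi> p'"
      obtain s t where "p = (s,t)" by (cases p)
      with nd[OF * this] show "g (?\<phi> p) = 0" by (simp add: g_def)
    qed
    also have "\<dots> = (\<Sum>(s,t)\<in>P. \<bar>f (k t) - f (k s)\<bar>)"
      by (rule sum.cong) (auto simp: g_def)
    finally have "(\<Sum>(s,t)\<in>P. \<bar>f (k t) - f (k s)\<bar>) = sum g (?\<phi> ` P)" ..
    also have "\<dots> = sum g (?\<phi> ` P \<inter> {(s,t). s < t})"
    proof (rule sum.mono_neutral_right)
      show "\<forall>i\<in>?\<phi> ` P - ?\<phi> ` P \<inter> {(s, t). s < t}. g i = 0"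
      proof
        fix i assume "i \<in> ?\<phi> ` P - ?\<phi> ` P \<inter> {(s, t). s < t}"
        then obtain s t where "(s,t) \<in> P" "i = (k s, k t)" "\<not> k s < k t" by auto
        moreover have "k s \<le> k t" using Pf(3)[of s t] calculation k(2) by (auto simp: mono_def)
        ultimately show "g i = 0" by (auto simp: g_def)
      qed
    qed (use Pf in auto)
    finally show "(\<Sum>(s,t)\<in>P. \<bar>f (k t) - f (k s)\<bar>) = sum g (?\<phi> ` P \<inter> {(s,t). s < t})" .
  qed
  have r1: "(\<lambda>(s,t). (min s y, min t y)) ` P \<inter> {(s,t). s < t} \<in> subinterval_families x y \<and>
     (\<Sum>(s,t)\<in>P. \<bar>f (min t y) - f (min s y)\<bar>) = sum g ((\<lambda>(s,t). (min s y, min t y)) ` P \<inter> {(s,t). s < t})"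
    by (rule restr) (use xyz in \<open>auto simp: mono_def\<close>)
  have r2: "(\<lambda>(s,t). (max s y, max t y)) ` P \<inter> {(s,t). s < t} \<in> subinterval_families y z \<and>
     (\<Sum>(s,t)\<in>P. \<bar>f (max t y) - f (max s y)\<bar>) = sum g ((\<lambda>(s,t). (max s y, max t y)) ` P \<inter> {(s,t). s < t})"
    by (rule restr) (use xyz in \<open>auto simp: mono_def\<close>)
  \<comment> \<open>For every pair the increment of f is the sum of the increments over the two
    clamped pairs.\<close>
  have "(\<Sum>(s,t)\<in>P. \<bar>f t - f s\<bar>) \<le> (\<Sum>p\<in>P. (\<lambda>(s,t). \<bar>f (min t y) - f (min s y)\<bar>) p + (\<lambda>(s,t). \<bar>f (max t y) - f (max s y)\<bar>) p)"
    by (rule sum_mono) (auto simp: min_def max_def)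
  also have "\<dots> = (\<Sum>(s,t)\<in>P. \<bar>f (min t y) - f (min s y)\<bar>) + (\<Sum>(s,t)\<in>P. \<bar>f (max t y) - f (max s y)\<bar>)"
    by (rule sum.distrib)
  finally show ?thesis
    using that[OF conjunct1[OF r1] conjunct1[OF r2]] conjunct2[OF r1] conjunct2[OF r2] unfolding g_def by simp
qed

lemma subinterval_families_Un:
  assumes P: "P \<in> subinterval_families x y" and Q: "Q \<in> subinterval_families y z" and xyz: "x \<le> y" "y \<le> z"
  shows "P \<union> Q \<in> subinterval_families x z" "P \<inter> Q = {}"
proof -
  have "s < y" if "(s,t) \<in> P" for s t using P that by (auto simp: subinterval_families_def)
  moreover have "y \<le> s" if "(s,t) \<in> Q" for s t using Q that by (auto simp: subinterval_families_def)
  ultimately show "P \<inter> Q = {}" by fastforce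
  have 1: "x \<le> s \<and> s < t \<and> t \<le> y" if "(s,t) \<in> P" for s t using P that by (auto simp: subinterval_families_def)
  have 2: "y \<le> s \<and> s < t \<and> t \<le> z" if "(s,t) \<in> Q" for s t using Q that by (auto simp: subinterval_families_def)
  have d: "disjoint_family_on (\<lambda>(s, t). {s<..<t}) P" "disjoint_family_on (\<lambda>(s, t). {s<..<t}) Q"
    using P Q by (auto simp: subinterval_families_def)
  have "disjoint_family_on (\<lambda>(s, t). {s<..<t}) (P \<union> Q)"
    unfolding disjoint_family_on_def
  proof (intro ballI impI)
    fix i j assume ij: "i \<in> P \<union> Q" "j \<in> P \<union> Q" "i \<noteq> j"
    obtain u v u' v' where uv: "i = (u,v)" "j = (u',v')" by (cases i, cases j)
    consider "i \<in> P" "j \<in> P" | "i \<in> Q" "j \<in> Q" | "i \<in> P" "j \<in> Q" | "i \<in> Q" "j \<in> P" using ij by auto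
    then show "(\<lambda>(s, t). {s<..<t}) i \<inter> (\<lambda>(s, t). {s<..<t}) j = {}"
    proof cases
      case 1 then show ?thesis using d(1) ij(3) unfolding disjoint_family_on_def by blast
    next
      case 2 then show ?thesis using d(2) ij(3) unfolding disjoint_family_on_def by blast
    next
      case 3 then show ?thesis using 1[of u v] 2[of u' v'] uv by auto
    next
      case 4 then show ?thesis using 1[of u' v'] 2[of u v] uv by auto
    qed
  qed
  then show "P \<union> Q \<in> subinterval_families x z"
  proof -
    have "\<forall>(s,t)\<in>P \<union> Q. x \<le> s \<and> s < t \<and> t \<le> z"
    proof
      fix i assume "i \<in> P \<union> Q"
      then show "case i of (s,t) \<Rightarrow> x \<le> s \<and> s < t \<and> t \<le> z"
        using 1[of "fst i" "snd i"] 2[of "fst i" "snd i"] xyz by (auto simp: split_beta)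
    qed
    then show ?thesis using P Q \<open>disjoint_family_on _ (P \<union> Q)\<close> by (simp add: subinterval_families_def)
  qed
qed

text \<open>With \<delta> belonging to e = 1, a piece of length below \<delta> carries variation at
  most 1, and [c, d] is covered by N such pieces. The bound obtained is N, by induction on the
  number of pieces.\<close>

lemma abs_cont_bounded_variation:
  assumes f: "abs_cont c d f" and "c \<le> d"
  shows "\<exists>B. \<forall>P\<in>subinterval_families c d. (\<Sum>(s,t)\<in>P. \<bar>f t - f s\<bar>) \<le> B"
proof -
  obtain \<delta> where \<delta>: "\<delta> > 0" "\<And>P. \<lbrakk>P \<in> subinterval_families c d; (\<Sum>(s,t)\<in>P. t - s) < \<delta>\<rbrakk> \<Longrightarrow> (\<Sum>(s,t)\<in>P. \<bar>f t - f s\<bar>) < 1"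
    using f unfolding abs_cont_def by (meson zero_less_one)
  obtain N :: nat where N: "(d - c) / \<delta> < real N" using reals_Archimedean2 by blast
  have "0 \<le> (d - c) / \<delta>" using \<delta>(1) \<open>c \<le> d\<close> by simp
  with N have N0: "N > 0" by (cases N) auto
  define h where "h = (d - c) / N"
  have h: "h \<ge> 0" "h < \<delta>" using N N0 \<delta>(1) \<open>c \<le> d\<close> by (auto simp: h_def field_simps)
  have "\<forall>P\<in>subinterval_families c (c + k * h). (\<Sum>(s,t)\<in>P. \<bar>f t - f s\<bar>) \<le> k" if "k \<le> N" for k :: nat
    using that
  proof (induction k)
    case 0
    have "P = {}" if "P \<in> subinterval_families c c" for P
      using that by (fastforce simp: subinterval_families_def)
    then show ?case by force
  next
    case (Suc k)
    show ?case
    proof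
      fix P assume P: "P \<in> subinterval_families c (c + real (Suc k) * h)"
      have le: "c \<le> c + k * h" "c + k * h \<le> c + real (Suc k) * h"
        using h by (auto simp: algebra_simps)
      obtain P1 P2 where P12: "P1 \<in> subinterval_families c (c + k * h)" "P2 \<in> subinterval_families (c + k * h) (c + real (Suc k) * h)"
        "(\<Sum>(s,t)\<in>P. \<bar>f t - f s\<bar>) \<le> (\<Sum>(s,t)\<in>P1. \<bar>f t - f s\<bar>) + (\<Sum>(s,t)\<in>P2. \<bar>f t - f s\<bar>)"
        using subinterval_families_split[OF P le, of f] by metis
      have "real (Suc k) * h \<le> N * h" using Suc.prems h by (intro mult_right_mono) auto
      then have "c + real (Suc k) * h \<le> d" using N0 by (simp add: h_def)
      then have P2': "P2 \<in> subinterval_families c d"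
        using subinterval_families_mono[OF le(1) _ P12(2)] by auto
      have "(\<Sum>(s,t)\<in>P2. t - s) \<le> h"
        using subinterval_families_length_le[OF P12(2) le(2)] by (simp add: algebra_simps)
      then have "(\<Sum>(s,t)\<in>P2. \<bar>f t - f s\<bar>) < 1" using \<delta>(2)[OF P2'] h by simp
      moreover have "(\<Sum>(s,t)\<in>P1. \<bar>f t - f s\<bar>) \<le> k" using Suc P12(1) by auto
      ultimately show "(\<Sum>(s,t)\<in>P. \<bar>f t - f s\<bar>) \<le> real (Suc k)" using P12(3) by simp
    qed
  qed
  from this[of N] show ?thesis using N0 by (auto simp: h_def)
qed

text \<open>This is the Jordan decomposition with V the variation of f on [c, x]. The point that
  needs work is that V inherits absolute continuity from f.\<close>

lemma abs_cont_diff_mono: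
  assumes f: "abs_cont c d f" and "c \<le> d"
  shows "\<exists>V. abs_cont c d V \<and> mono_on {c..d} V \<and> abs_cont c d (\<lambda>x. V x - f x) \<and> mono_on {c..d} (\<lambda>x. V x - f x)"
proof -
  define v where "v P = (\<Sum>(s,t)\<in>P. \<bar>f t - f s\<bar>)" for P
  define var where "var x y = (SUP P\<in>subinterval_families x y. v P)" for x y
  obtain B where B: "\<And>P. P \<in> subinterval_families c d \<Longrightarrow> v P \<le> B"
    using abs_cont_bounded_variation[OF assms] unfolding v_def by blast
  have bdd: "bdd_above (v ` subinterval_families x y)" if "c \<le> x" "y \<le> d" for x y
    using B subinterval_families_mono[OF that] by (auto simp: bdd_above_def)
  have var_ge: "v P \<le> var x y" if P: "P \<in> subinterval_families x y" and xy: "c \<le> x" "y \<le> d" for P x y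
    unfolding var_def by (rule cSUP_upper[OF P bdd[OF xy]])
  have ne: "subinterval_families x y \<noteq> {}" for x y using empty_subinterval_family by blast
  have var_le: "var c y \<le> var c x + var x y" if xy: "c \<le> x" "x \<le> y" "y \<le> d" for x y
    unfolding var_def[of c y]
  proof (rule cSUP_least[OF ne])
    fix P assume "P \<in> subinterval_families c y"
    then obtain P1 P2 where "P1 \<in> subinterval_families c x" "P2 \<in> subinterval_families x y" "v P \<le> v P1 + v P2"
      unfolding v_def using subinterval_families_split[OF _ xy(1,2)] by metis
    then show "v P \<le> var c x + var x y"
      using var_ge[of P1 c x] var_ge[of P2 x y] xy by auto
  qed
  \<comment> \<open>The single interval from x to y is appended to a family for [c, x]. This one
    inequality gives monotonicity of both V and V - f.\<close>
  have var_ge_f: "var c x + \<bar>f y - f x\<bar> \<le> var c y" if "c \<le> x" "x \<le> y" "y \<le> d" for x y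
  proof (cases "x = y")
    case False
    have "v P + \<bar>f y - f x\<bar> \<le> var c y" if P: "P \<in> subinterval_families c x" for P
    proof -
      have Q: "{(x,y)} \<in> subinterval_families x y" using False \<open>x \<le> y\<close> by (intro singleton_subinterval_family) auto
      note U = subinterval_families_Un[OF P Q \<open>c \<le> x\<close> \<open>x \<le> y\<close>]
      have "v P + \<bar>f y - f x\<bar> = v (P \<union> {(x,y)})"
        unfolding v_def using P U(2) by (subst sum.union_disjoint) (auto simp: subinterval_families_def)
      also have "\<dots> \<le> var c y" using var_ge[OF U(1)] \<open>y \<le> d\<close> by simp
      finally show ?thesis .
    qed
    then have "var c x \<le> var c y - \<bar>f y - f x\<bar>"
      unfolding var_def[of c x] by (intro cSUP_least[OF ne]) (simp add: algebra_simps)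
    then show ?thesis by simp
  qed auto
  have acV: "abs_cont c d (var c)"
    unfolding abs_cont_def
  proof (intro allI impI)
    fix e :: real assume "e > 0"
    then obtain \<delta> where \<delta>: "\<delta> > 0" "\<And>P. \<lbrakk>P \<in> subinterval_families c d; (\<Sum>(s,t)\<in>P. t - s) < \<delta>\<rbrakk> \<Longrightarrow> v P < e / 2"
      using f unfolding abs_cont_def v_def by (meson half_gt_zero)
    have "(\<Sum>(s,t)\<in>P. \<bar>var c t - var c s\<bar>) < e" if P: "P \<in> subinterval_families c d" "(\<Sum>(s,t)\<in>P. t - s) < \<delta>" for P
    proof -
      have Pf: "finite P" "disjoint_family_on (\<lambda>(s,t). {s<..<t}) P" "\<And>s t. (s,t) \<in> P \<Longrightarrow> c \<le> s \<and> s < t \<and> t \<le> d"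
        using P by (auto simp: subinterval_families_def)
      \<comment> \<open>The tolerance per interval: all intervals together lose less than e/2.
        Adding 1 to the cardinality covers the empty family and makes the inequality strict.\<close>
      define k where "k = e / (2 * (card P + 1))"
      have "k > 0" using \<open>e > 0\<close> by (simp add: k_def)
      have "\<exists>Q\<in>subinterval_families (fst p) (snd p). var (fst p) (snd p) < v Q + k" if "p \<in> P" for p
      proof -
        have "var (fst p) (snd p) - k < var (fst p) (snd p)" using \<open>k > 0\<close> by simp
        then show ?thesis unfolding var_def[of "fst p" "snd p"]
          using less_cSUP_iff[OF ne bdd, of "fst p" "snd p"] Pf(3)[of "fst p" "snd p"] that by fastforce
      qed
      then obtain Q where Q: "\<And>p. p \<in> P \<Longrightarrow> Q p \<in> subinterval_families (fst p) (snd p)"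
        "\<And>p. p \<in> P \<Longrightarrow> var (fst p) (snd p) < v (Q p) + k" by metis
      have U: "(\<Union>p\<in>P. Q p) \<in> subinterval_families c d" "disjoint_family_on Q P"
        using subinterval_families_UN[OF Pf(1,2), of c d Q] Pf(3) Q(1) by force+
      have sumU: "sum g (\<Union>p\<in>P. Q p) = (\<Sum>p\<in>P. sum g (Q p))" for g :: "real \<times> real \<Rightarrow> real"
        by (rule sum.UNION_disjoint) (use Pf Q(1) U(2) in \<open>auto simp: subinterval_families_def disjoint_family_on_def\<close>)
      \<comment> \<open>Refinement does not increase the total length, so the choice of \<delta> for
        f applies to the refined family.\<close>
      have "(\<Sum>(s,t)\<in>(\<Union>p\<in>P. Q p). t - s) \<le> (\<Sum>(s,t)\<in>P. t - s)"
        unfolding sumU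
      proof (rule sum_mono)
        fix p assume "p \<in> P"
        then show "(\<Sum>(s,t)\<in>Q p. t - s) \<le> (case p of (s,t) \<Rightarrow> t - s)"
          using subinterval_families_length_le[OF Q(1)[of p]] Pf(3)[of "fst p" "snd p"] by (auto simp: split_beta)
      qed
      with P(2) have "v (\<Union>p\<in>P. Q p) < e / 2" by (intro \<delta>(2)[OF U(1)]) simp
      then have vQ: "(\<Sum>p\<in>P. v (Q p)) < e / 2" unfolding v_def sumU .
      have "(\<Sum>(s,t)\<in>P. \<bar>var c t - var c s\<bar>) \<le> (\<Sum>p\<in>P. v (Q p) + k)"
      proof (rule sum_mono)
        fix p assume p: "p \<in> P"
        obtain s t where st: "p = (s,t)" by (cases p)
        have "c \<le> s" "s < t" "t \<le> d" using Pf(3) p st by auto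
        then show "(case p of (s,t) \<Rightarrow> \<bar>var c t - var c s\<bar>) \<le> v (Q p) + k"
          using var_le[of s t] var_ge_f[of s t] Q(2)[OF p] st by auto
      qed
      also have "\<dots> = (\<Sum>p\<in>P. v (Q p)) + card P * k" by (simp add: sum.distrib)
      also have "\<dots> < e / 2 + e / 2"
      proof (rule add_strict_mono[OF vQ])
        have "card P * k < (card P + 1) * k" using \<open>k > 0\<close> by simp
        also have "\<dots> = e / 2" by (simp add: k_def field_simps)
        finally show "card P * k < e / 2" .
      qed
      finally show ?thesis by simp
    qed
    then show "\<exists>\<delta>>0. \<forall>P\<in>subinterval_families c d. (\<Sum>(s,t)\<in>P. t - s) < \<delta> \<longrightarrow> (\<Sum>(s,t)\<in>P. \<bar>var c t - var c s\<bar>) < e"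
      using \<delta>(1) by blast
  qed
  have acd: "abs_cont c d (\<lambda>x. var c x - f x)"
    unfolding abs_cont_def
  proof (intro allI impI)
    fix e :: real assume "e > 0"
    obtain \<delta>1 where \<delta>1: "\<delta>1 > 0" "\<And>P. \<lbrakk>P \<in> subinterval_families c d; (\<Sum>(s,t)\<in>P. t - s) < \<delta>1\<rbrakk> \<Longrightarrow> (\<Sum>(s,t)\<in>P. \<bar>f t - f s\<bar>) < e / 2"
      using f \<open>e > 0\<close> unfolding abs_cont_def by (meson half_gt_zero)
    obtain \<delta>2 where \<delta>2: "\<delta>2 > 0" "\<And>P. \<lbrakk>P \<in> subinterval_families c d; (\<Sum>(s,t)\<in>P. t - s) < \<delta>2\<rbrakk> \<Longrightarrow> (\<Sum>(s,t)\<in>P. \<bar>var c t - var c s\<bar>) < e / 2"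
      using acV \<open>e > 0\<close> unfolding abs_cont_def by (meson half_gt_zero)
    have "(\<Sum>(s,t)\<in>P. \<bar>(var c t - f t) - (var c s - f s)\<bar>) < e"
      if P: "P \<in> subinterval_families c d" "(\<Sum>(s,t)\<in>P. t - s) < min \<delta>1 \<delta>2" for P
    proof -
      have "(\<Sum>(s,t)\<in>P. \<bar>(var c t - f t) - (var c s - f s)\<bar>) \<le> (\<Sum>p\<in>P. (case p of (s,t) \<Rightarrow> \<bar>f t - f s\<bar>) + (case p of (s,t) \<Rightarrow> \<bar>var c t - var c s\<bar>))"
        by (rule sum_mono) auto
      also have "\<dots> < e / 2 + e / 2"
        unfolding sum.distrib using P by (intro add_strict_mono \<delta>1(2) \<delta>2(2)) auto
      finally show ?thesis by simp
    qed
    then show "\<exists>\<delta>>0. \<forall>P\<in>subinterval_families c d. (\<Sum>(s,t)\<in>P. t - s) < \<delta> \<longrightarrow> (\<Sum>(s,t)\<in>P. \<bar>(var c t - f t) - (var c s - f s)\<bar>) < e"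
      using \<delta>1(1) \<delta>2(1) by (intro exI[of _ "min \<delta>1 \<delta>2"]) auto
  qed
  show ?thesis
    using acV acd var_ge_f by (intro exI[of _ "var c"] conjI) (fastforce simp: mono_on_def)+
qed

section \<open>Densities of absolutely continuous functions\<close>

lemma abs_cont_uniformly_continuous:
  assumes "abs_cont c d F" "e > 0"
  shows "\<exists>\<delta>>0. \<forall>s\<in>{c..d}. \<forall>t\<in>{c..d}. \<bar>t - s\<bar> < \<delta> \<longrightarrow> \<bar>F t - F s\<bar> < e"
proof -
  obtain \<delta> where \<delta>: "\<delta> > 0" "\<And>P. \<lbrakk>P \<in> subinterval_families c d; (\<Sum>(s,t)\<in>P. t - s) < \<delta>\<rbrakk> \<Longrightarrow> (\<Sum>(s,t)\<in>P. \<bar>F t - F s\<bar>) < e"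
    using assms unfolding abs_cont_def by meson
  have *: "\<bar>F t - F s\<bar> < e" if "s \<in> {c..d}" "t \<in> {c..d}" "s < t" "t - s < \<delta>" for s t
    using \<delta>(2)[OF singleton_subinterval_family, of s t] that by simp
  have "\<bar>F t - F s\<bar> < e" if "s \<in> {c..d}" "t \<in> {c..d}" "\<bar>t - s\<bar> < \<delta>" for s t
    using *[of s t] *[of t s] that \<open>e > 0\<close> by (cases s t rule: linorder_cases) auto
  then show ?thesis using \<delta>(1) by blast
qed

text \<open>Absolute continuity of F makes the Stieltjes measure of F vanish on Lebesgue null sets;
  the density of this measure is the required integrand.\<close>

lemma abs_cont_mono_integral:
  assumes ac: "abs_cont c d F" and mono: "mono_on {c..d} F" and "c < d"
  shows "\<exists>h. h absolutely_integrable_on {c..d} \<and> (\<forall>x\<in>{c..d}. (h has_integral (F x - F c)) {c..x})"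
proof -
  \<comment> \<open>Clamping extends F by constants beyond [c, d], since an interval measure
    requires a monotone and continuous function on the whole line.\<close>
  define cl where "cl x = max c (min x d)" for x
  define G where "G x = F (cl x)" for x
  have cl: "cl x \<in> {c..d}" for x using \<open>c < d\<close> by (auto simp: cl_def)
  have cl_id: "cl x = x" if "x \<in> {c..d}" for x using that by (auto simp: cl_def)
  have Gm: "G x \<le> G y" if "x \<le> y" for x y
    unfolding G_def using that by (intro mono_onD[OF mono cl cl]) (auto simp: cl_def)
  have cont: "continuous_on UNIV G"
    unfolding continuous_on_iff
  proof (intro ballI allI impI)
    fix x e :: real assume "e > 0"
    from abs_cont_uniformly_continuous[OF ac this]
    obtain \<delta> where \<delta>: "\<delta> > 0" "\<And>s t. \<lbrakk>s\<in>{c..d}; t\<in>{c..d}; \<bar>t - s\<bar> < \<delta>\<rbrakk> \<Longrightarrow> \<bar>F t - F s\<bar> < e" by blast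
    have "\<bar>cl y - cl x\<bar> \<le> \<bar>y - x\<bar>" for y by (auto simp: cl_def)
    then have "\<forall>y\<in>UNIV. dist y x < \<delta> \<longrightarrow> dist (G y) (G x) < e"
      unfolding G_def dist_real_def using \<delta>(2)[OF cl cl] by (meson le_less_trans)
    then show "\<exists>\<delta>>0. \<forall>y\<in>UNIV. dist y x < \<delta> \<longrightarrow> dist (G y) (G x) < e" using \<delta>(1) by blast
  qed
  define \<mu> where "\<mu> = interval_measure G"
  have \<mu>_Icc: "emeasure \<mu> {x..y} = ennreal (G y - G x)" if "x \<le> y" for x y
    unfolding \<mu>_def by (rule emeasure_interval_measure_Icc[OF that Gm cont])
  have [simp]: "sets \<mu> = sets borel" by (simp add: \<mu>_def)
  \<comment> \<open>The null set is enclosed in an open U of measure below \<delta> and covered by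
    nonoverlapping intervals inside U. Their total length is below \<delta>, so F grows by less than
    e over any finitely many of them.\<close>
  have null: "emeasure \<mu> N = 0" if N: "N \<in> sets borel" "emeasure lborel N = 0" "N \<subseteq> {c..d}" for N
  proof (rule antisym[OF ennreal_le_epsilon])
    fix e :: real assume "e > 0"
    obtain \<delta> where \<delta>: "\<delta> > 0" "\<And>P. \<lbrakk>P \<in> subinterval_families c d; (\<Sum>(s,t)\<in>P. t - s) < \<delta>\<rbrakk> \<Longrightarrow> (\<Sum>(s,t)\<in>P. \<bar>F t - F s\<bar>) < e"
      using ac \<open>e > 0\<close> unfolding abs_cont_def by meson
    obtain U where U: "open U" "N \<subseteq> U" "emeasure lborel (U - N) < ennreal \<delta>"
      using outer_regular_lborel[OF N(1) \<delta>(1)] by blast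
    have "emeasure lborel U \<le> emeasure lborel N + emeasure lborel (U - N)"
      using U(1,2) N(1) by (metis Diff_partition emeasure_subadditive open_Diff sets.Diff borel_open sets_lborel)
    then have emU: "emeasure lborel U < ennreal \<delta>" using U(3) N(2) by simp
    then have Ufm: "U \<in> fmeasurable lborel" using U(1) by (intro fmeasurableI) (auto simp: less_top[symmetric])
    have mU: "measure lborel U < \<delta>"
      using emU \<delta>(1) by (simp add: emeasure_eq_measure2[OF Ufm] ennreal_less_iff)
    \<comment> \<open>A gauge has to be defined everywhere, but the covering intervals have tags in
      N, where its value is U.\<close>
    have g: "gauge (\<lambda>x. if x \<in> N then U else UNIV)" using U by (auto simp: gauge_def)
    have Ncb: "N \<subseteq> cbox c d" using N by simp
    have ne: "box c d \<noteq> {}" using \<open>c < d\<close> by simp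
    obtain \<D> where \<D>: "countable \<D>"  "\<Union>\<D> \<subseteq> cbox c d"
      "\<And>K. K \<in> \<D> \<Longrightarrow> interior K \<noteq> {} \<and> (\<exists>c d. K = cbox c d)"
      "pairwise (\<lambda>A B. interior A \<inter> interior B = {}) \<D>"
      "\<And>K. K \<in> \<D> \<Longrightarrow> \<exists>x \<in> N \<inter> K. K \<subseteq> (if x \<in> N then U else UNIV)"
      "N \<subseteq> \<Union>\<D>"
      by (rule covering_lemma[OF Ncb ne g]) (assumption | rule that)+
    have K: "\<exists>u v. K = {u..v} \<and> u < v \<and> c \<le> u \<and> v \<le> d \<and> K \<subseteq> U" if KD: "K \<in> \<D>" for K
    proof -
      obtain u v where uv: "K = cbox u v" using \<D>(3)[OF KD] by blast
      have "interior K = {u<..<v}" using uv by (simp add: interior_cbox box_real)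
      then have "u < v" using \<D>(3)[OF KD] by auto
      moreover have "K \<subseteq> {c..d}" using \<D>(2) KD by auto
      moreover have "K \<subseteq> U" using \<D>(5)[OF KD] by auto
      ultimately show ?thesis using uv by auto
    qed
    have bound: "measure \<mu> (\<Union>K\<in>D. K) \<le> e" if D: "D \<subseteq> \<D>" "finite D" for D
    proof -
      obtain lo hi where lh: "\<And>K. K \<in> \<D> \<Longrightarrow> K = {lo K..hi K} \<and> lo K < hi K \<and> c \<le> lo K \<and> hi K \<le> d \<and> K \<subseteq> U"
        using K by metis
      define P where "P = (\<lambda>K. (lo K, hi K)) ` D"
      have inj: "inj_on (\<lambda>K. (lo K, hi K)) D"
      proof (rule inj_onI)
        fix A B assume "A \<in> D" "B \<in> D" "(lo A, hi A) = (lo B, hi B)"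
        moreover have "A = {lo A..hi A}" "B = {lo B..hi B}" using lh D(1) calculation by blast+
        ultimately show "A = B" by simp
      qed
      have P: "P \<in> subinterval_families c d"
        unfolding subinterval_families_def mem_Collect_eq
      proof (intro conjI)
        show "finite P" using D by (simp add: P_def)
        show "\<forall>(s, t)\<in>P. c \<le> s \<and> s < t \<and> t \<le> d" using lh D by (auto simp: P_def)
        show "disjoint_family_on (\<lambda>(s, t). {s<..<t}) P"
          unfolding disjoint_family_on_def
        proof (intro ballI impI)
          fix i j assume "i \<in> P" "j \<in> P" "i \<noteq> j"
          then obtain A B where AB: "A \<in> D" "B \<in> D" "A \<noteq> B" "i = (lo A, hi A)" "j = (lo B, hi B)"
            by (auto simp: P_def)
          have "interior A = {lo A<..<hi A}" "interior B = {lo B<..<hi B}"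
            using lh AB D by (metis interior_atLeastAtMost_real subsetD)+
          moreover have "interior A \<inter> interior B = {}"
            using \<D>(4) AB D unfolding pairwise_def by blast
          ultimately show "(\<lambda>(s, t). {s<..<t}) i \<inter> (\<lambda>(s, t). {s<..<t}) j = {}" using AB by simp
        qed
      qed
      have "(\<Sum>(s,t)\<in>P. t - s) \<le> measure lborel U"
      proof (rule subinterval_families_length_le_measure[OF P Ufm])
        fix s t assume "(s,t) \<in> P"
        then obtain A where A: "A \<in> D" "s = lo A" "t = hi A" by (auto simp: P_def)
        then have "A = {s..t}" "A \<subseteq> U" using lh D by auto
        then show "{s<..<t} \<subseteq> U" by auto
      qed
      then have lt: "(\<Sum>(s,t)\<in>P. \<bar>F t - F s\<bar>) < e" using mU by (intro \<delta>(2)[OF P]) simp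
      have m: "measure \<mu> A = F (hi A) - F (lo A)" "A \<in> fmeasurable \<mu>" "F (lo A) \<le> F (hi A)" if "A \<in> D" for A
      proof -
        have A: "A = {lo A..hi A}" "lo A < hi A" "c \<le> lo A" "hi A \<le> d" using lh D that by auto
        have GF: "G (lo A) = F (lo A)" "G (hi A) = F (hi A)" using A cl_id by (auto simp: G_def)
        have em: "emeasure \<mu> A = ennreal (F (hi A) - F (lo A))"
          using \<mu>_Icc[of "lo A" "hi A"] A GF by simp
        show le: "F (lo A) \<le> F (hi A)" using Gm[of "lo A" "hi A"] A GF by simp
        show "measure \<mu> A = F (hi A) - F (lo A)" using em le by (simp add: measure_def)
        have "A \<in> sets borel" using A(1) by (metis atLeastAtMost_borel)
        then show "A \<in> fmeasurable \<mu>" using em by (intro fmeasurableI) auto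
      qed
      have "measure \<mu> (\<Union>K\<in>D. K) \<le> (\<Sum>K\<in>D. measure \<mu> K)"
        by (rule measure_UNION_le) (use D m(2) fmeasurableD in blast)+
      also have "\<dots> = (\<Sum>K\<in>D. \<bar>F (hi K) - F (lo K)\<bar>)" by (rule sum.cong) (use m in auto)
      also have "\<dots> = (\<Sum>(s,t)\<in>P. \<bar>F t - F s\<bar>)" unfolding P_def sum.reindex[OF inj] by simp
      finally show ?thesis using lt by simp
    qed
    have fm: "K \<in> fmeasurable \<mu>" if "K \<in> \<D>" for K
    proof -
      have "\<exists>u v. K = {u..v} \<and> u < v" using K[OF that] by blast
      then obtain u v where "K = {u..v}" "u < v" by blast
      then show ?thesis using \<mu>_Icc[of u v] by (intro fmeasurableI) auto
    qed
    have "(\<Union>K\<in>\<D>. K) \<in> fmeasurable \<mu>" "measure \<mu> (\<Union>K\<in>\<D>. K) \<le> e"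
      using fmeasurable_UN_bound[OF \<D>(1) fm bound] measure_UN_bound[OF \<D>(1) fm bound] by auto
    then have "emeasure \<mu> (\<Union>\<D>) \<le> ennreal e" by (simp add: emeasure_eq_measure2 ennreal_leI)
    moreover have "emeasure \<mu> N \<le> emeasure \<mu> (\<Union>\<D>)"
      using \<D>(6) \<open>(\<Union>K\<in>\<D>. K) \<in> fmeasurable \<mu>\<close> by (intro emeasure_mono) auto
    ultimately show "emeasure \<mu> N \<le> 0 + ennreal e" by simp
  qed simp
  \<comment> \<open>The measure is restricted to [c, d] because null sets have been controlled only
    there.\<close>
  define \<mu>' where "\<mu>' = density \<mu> (indicator {c..d})"
  have em': "emeasure \<mu>' A = emeasure \<mu> (A \<inter> {c..d})" if "A \<in> sets borel" for A
    unfolding \<mu>'_def using that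
  proof (subst emeasure_density)
    have "{c..d} \<in> sets \<mu>" by simp
    then show "indicator {c..d} \<in> borel_measurable \<mu>" by (rule borel_measurable_indicator)
    have "(\<integral>\<^sup>+x. indicator {c..d} x * indicator A x \<partial>\<mu>) = (\<integral>\<^sup>+x. indicator (A \<inter> {c..d}) x \<partial>\<mu>)"
      by (intro nn_integral_cong) (auto simp: indicator_def)
    also have "\<dots> = emeasure \<mu> (A \<inter> {c..d})" using that by (intro nn_integral_indicator) auto
    finally show "(\<integral>\<^sup>+x. indicator {c..d} x * indicator A x \<partial>\<mu>) = emeasure \<mu> (A \<inter> {c..d})" .
  qed auto
  have "absolutely_continuous lborel \<mu>'"
    unfolding absolutely_continuous_def
  proof
    fix N :: "real set" assume N: "N \<in> null_sets lborel"
    then have Nb: "N \<in> sets borel" by auto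
    have "N \<inter> {c..d} \<in> null_sets lborel" using N by (rule null_set_Int2) simp
    then have "emeasure \<mu> (N \<inter> {c..d}) = 0" by (intro null) auto
    then show "N \<in> null_sets \<mu>'" using em'[OF Nb] Nb by (auto simp: \<mu>'_def)
  qed
  then obtain f where f: "f \<in> borel_measurable lborel" "density lborel f = \<mu>'"
    using sigma_finite_measure.Radon_Nikodym[OF sigma_finite_lborel, of \<mu>'] by (auto simp: \<mu>'_def)
  have nn: "(\<integral>\<^sup>+u. f u * indicator {c..x} u \<partial>lborel) = ennreal (F x - F c)" if "x \<in> {c..d}" for x
  proof -
    have "(\<integral>\<^sup>+u. f u * indicator {c..x} u \<partial>lborel) = emeasure \<mu>' {c..x}"
      using f by (auto simp: emeasure_density[symmetric])
    also have "\<dots> = emeasure \<mu> {c..x}" using that by (subst em') (auto intro!: arg_cong[where f="emeasure \<mu>"])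
    also have "\<dots> = ennreal (F x - F c)" using that \<mu>_Icc[of c x] cl_id \<open>c < d\<close> by (simp add: G_def)
    finally show ?thesis .
  qed
  \<comment> \<open>The density takes values in [0, \<infinity>]; its integral over [c, d] is
    finite, so \<open>enn2real\<close> changes it only on a null subset of [c, d].\<close>
  have "AE u in lborel. f u * indicator {c..d} u \<noteq> \<infinity>"
    using f(1) nn[of d] \<open>c < d\<close> by (intro nn_integral_PInf_AE) auto
  then have fin: "AE u in lborel. u \<in> {c..d} \<longrightarrow> ennreal (enn2real (f u)) = f u"
    by eventually_elim (auto simp: less_top)
  define h where "h u = enn2real (f u)" for u
  have hm: "h \<in> borel_measurable borel" unfolding h_def using f(1) by simp
  have hi: "(h has_integral (F x - F c)) {c..x}" if x: "x \<in> {c..d}" for x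
  proof -
    have "F c \<le> F x" using x \<open>c < d\<close> by (intro mono_onD[OF mono]) auto
    moreover have "(\<integral>\<^sup>+u. ennreal (h u * indicator {c..x} u) \<partial>lborel) = ennreal (F x - F c)"
      unfolding nn[OF x, symmetric]
      by (rule nn_integral_cong_AE) (use fin x in \<open>auto simp: h_def indicator_def elim!: eventually_mono\<close>)
    ultimately have "((\<lambda>u. h u * indicator {c..x} u) has_integral (F x - F c)) UNIV"
      using hm by (intro nn_integral_has_integral) (auto simp: h_def[abs_def])
    moreover have "(\<lambda>u. h u * indicator {c..x} u) = (\<lambda>u. if u \<in> {c..x} then h u else 0)"
      by (auto simp: indicator_def)
    ultimately show ?thesis by (simp only: has_integral_restrict_UNIV)
  qed
  have "h absolutely_integrable_on {c..d}"
    by (rule nonnegative_absolutely_integrable_1) (use hi[of d] \<open>c < d\<close> in \<open>auto simp: h_def\<close>)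
  with hi show ?thesis by blast
qed

lemma abs_cont_integral:
  assumes "abs_cont c d F" "c < d"
  shows "\<exists>h. h absolutely_integrable_on {c..d} \<and> (\<forall>x\<in>{c..d}. (h has_integral (F x - F c)) {c..x})"
proof -
  obtain V where V: "abs_cont c d V" "mono_on {c..d} V" "abs_cont c d (\<lambda>x. V x - F x)" "mono_on {c..d} (\<lambda>x. V x - F x)"
    using abs_cont_diff_mono[OF assms(1)] assms(2) by fastforce
  obtain h1 where h1: "h1 absolutely_integrable_on {c..d}" "\<forall>x\<in>{c..d}. (h1 has_integral (V x - V c)) {c..x}"
    using abs_cont_mono_integral[OF V(1,2) assms(2)] by blast
  obtain h2 where h2: "h2 absolutely_integrable_on {c..d}" "\<forall>x\<in>{c..d}. (h2 has_integral ((V x - F x) - (V c - F c))) {c..x}"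
    using abs_cont_mono_integral[OF V(3,4) assms(2)] by blast
  show ?thesis
  proof (intro exI[of _ "\<lambda>x. h1 x - h2 x"] conjI ballI)
    show "(\<lambda>x. h1 x - h2 x) absolutely_integrable_on {c..d}"
      using h1 h2 by (intro set_integral_diff) auto
    fix x assume "x \<in> {c..d}"
    then show "((\<lambda>x. h1 x - h2 x) has_integral (F x - F c)) {c..x}"
      using has_integral_diff[OF h1(2)[rule_format] h2(2)[rule_format]] by simp
  qed
qed

lemma abs_continuous_on_Icc_integral:
  assumes "abs_continuous_on_Icc c d f" "c < d"
  shows "\<exists>h. h absolutely_integrable_on {c..d} \<and> (\<forall>x\<in>{c..d}. (h has_integral (f x - f c)) {c..x})"
proof -
  obtain h1 where h1: "h1 absolutely_integrable_on {c..d}" "\<forall>x\<in>{c..d}. (h1 has_integral (Re (f x) - Re (f c))) {c..x}"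
    using abs_cont_integral[OF abs_cont_Re_Im(1)[OF assms(1)] assms(2)] by blast
  obtain h2 where h2: "h2 absolutely_integrable_on {c..d}" "\<forall>x\<in>{c..d}. (h2 has_integral (Im (f x) - Im (f c))) {c..x}"
    using abs_cont_integral[OF abs_cont_Re_Im(2)[OF assms(1)] assms(2)] by blast
  show ?thesis
  proof (intro exI[of _ "\<lambda>x. complex_of_real (h1 x) + \<i> * complex_of_real (h2 x)"] conjI ballI)
    show "(\<lambda>x. complex_of_real (h1 x) + \<i> * complex_of_real (h2 x)) absolutely_integrable_on {c..d}"
      using h1 h2 by (intro set_integral_add set_integrable_mult_right) (auto simp: set_integrable_def scaleR_conv_of_real
           intro!: integrable_of_real simp flip: of_real_mult)
    fix x assume x: "x \<in> {c..d}"
    have "((\<lambda>x. complex_of_real (h1 x) + \<i> * complex_of_real (h2 x)) has_integral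
       (complex_of_real (Re (f x) - Re (f c)) + \<i> * complex_of_real (Im (f x) - Im (f c)))) {c..x}"
      using h1(2) h2(2) x by (intro has_integral_add has_integral_mult_right has_integral_of_real) auto
    also have "(complex_of_real (Re (f x) - Re (f c)) + \<i> * complex_of_real (Im (f x) - Im (f c))) = f x - f c"
      by (simp add: complex_eq_iff)
    finally show "((\<lambda>x. complex_of_real (h1 x) + \<i> * complex_of_real (h2 x)) has_integral (f x - f c)) {c..x}" .
  qed
qed

text \<open>At each point at most one of the open intervals is active, so the sum of the restricted
  integrands stays below g. Replacing closed by open intervals changes no integral.\<close>

lemma sum_integral_disjoint_le:
  fixes g :: "real \<Rightarrow> real"
  assumes g: "g absolutely_integrable_on {c..d}" and nonneg: "\<And>x. x \<in> {c..d} \<Longrightarrow> 0 \<le> g x"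
    and P: "finite P" "\<And>s t. (s,t) \<in> P \<Longrightarrow> c \<le> s \<and> s \<le> t \<and> t \<le> d" "disjoint_family_on (\<lambda>(s,t). {s<..<t}) P"
  shows "(\<Sum>(s,t)\<in>P. integral {s..t} g) \<le> integral {c..d} g"
proof -
  let ?A = "\<lambda>(s::real,t). {s<..<t}"
  let ?g = "\<lambda>p x. if x \<in> ?A p then g x else 0"
  have gi: "?g p integrable_on {c..d} \<and> integral {c..d} (?g p) = (case p of (s,t) \<Rightarrow> integral {s..t} g)" if "p \<in> P" for p
  proof -
    obtain s t where st: "p = (s,t)" by (cases p)
    have "c \<le> s" "s \<le> t" "t \<le> d" using P(2) that st by auto
    then have sub: "{s<..<t} \<subseteq> {c..d}" "{s..t} \<subseteq> {c..d}" by auto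
    have "g integrable_on {s..t}" using g sub(2) by (metis absolutely_integrable_on_subinterval set_lebesgue_integral_eq_integral(1) absolutely_integrable_on_def)
    then have "(g has_integral integral {s..t} g) {s<..<t}"
      using has_integral_Icc_iff_Ioo[of g "integral {s..t} g" s t] integrable_integral[of g "{s..t}"] by simp
    then have "((\<lambda>x. if x \<in> {s<..<t} then g x else 0) has_integral integral {s..t} g) {c..d}"
      using has_integral_restrict[OF sub(1)] by blast
    then show ?thesis using st by (auto simp: has_integral_iff)
  qed
  have "(\<Sum>(s,t)\<in>P. integral {s..t} g) = (\<Sum>p\<in>P. integral {c..d} (?g p))"
    by (rule sum.cong) (use gi in auto)
  also have "\<dots> = integral {c..d} (\<lambda>x. \<Sum>p\<in>P. ?g p x)"
    by (rule integral_sum[symmetric]) (use P gi in auto)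
  also have "\<dots> \<le> integral {c..d} g"
  proof (rule integral_le)
    show "(\<lambda>x. \<Sum>p\<in>P. ?g p x) integrable_on {c..d}" by (rule integrable_sum) (use P gi in auto)
    show "g integrable_on {c..d}" using g by (simp add: absolutely_integrable_on_def)
    fix x assume x: "x \<in> {c..d}"
    show "(\<Sum>p\<in>P. ?g p x) \<le> g x"
    proof (cases "\<exists>p\<in>P. x \<in> ?A p")
      case True
      then obtain p where p: "p \<in> P" "x \<in> ?A p" by blast
      have "?g p' x = 0" if "p' \<in> P - {p}" for p'
      proof -
        have "?A p \<inter> ?A p' = {}" using P(3) p(1) that unfolding disjoint_family_on_def by blast
        then show ?thesis using p(2) by auto
      qed
      then have "(\<Sum>p\<in>P. ?g p x) = ?g p x"
        using sum.remove[OF P(1) p(1), of "\<lambda>p. ?g p x"] by simp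
      then show ?thesis using p by simp
    next
      case False
      then have "(\<Sum>p\<in>P. ?g p x) = 0" by (intro sum.neutral) auto
      then show ?thesis using nonneg[OF x] by simp
    qed
  qed
  finally show ?thesis .
qed

text \<open>The dominating function is split at a height M. The part above M has small integral for
  large M by dominated convergence; the part below contributes at most M times the total length of
  the intervals.\<close>

lemma abs_continuous_on_Icc_if_dominated:
  assumes k: "k absolutely_integrable_on {c..d}" and nonneg: "\<And>x. x \<in> {c..d} \<Longrightarrow> 0 \<le> k x"
    and le: "\<And>s t. c \<le> s \<Longrightarrow> s \<le> t \<Longrightarrow> t \<le> d \<Longrightarrow> norm (f t - f s) \<le> integral {s..t} k"
  shows "abs_continuous_on_Icc c d f"
  unfolding abs_continuous_on_Icc_def
proof (intro allI impI)
  fix e :: real assume "e > 0"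
  define km where "km M x = min (k x) (real M)" for M x
  have kmi: "km M absolutely_integrable_on {c..d}" for M
    unfolding km_def by (rule absolutely_integrable_min_1[OF k]) (rule absolutely_integrable_on_const, simp)
  have "(\<lambda>M. integral {c..d} (km M)) \<longlonglongrightarrow> integral {c..d} k"
  proof (rule dominated_convergence(2))
    show "km M integrable_on {c..d}" for M using kmi by (simp add: absolutely_integrable_on_def)
    show "k integrable_on {c..d}" using k by (simp add: absolutely_integrable_on_def)
    show "norm (km M x) \<le> k x" if "x \<in> {c..d}" for M x using nonneg[OF that] by (auto simp: km_def)
    show "(\<lambda>M. km M x) \<longlonglongrightarrow> k x" if "x \<in> {c..d}" for x
    proof (rule tendsto_eventually)
      obtain N :: nat where "k x < N" using reals_Archimedean2 by blast
      then show "\<forall>\<^sub>F M in sequentially. km M x = k x"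
        by (intro eventually_sequentiallyI[of N]) (auto simp: km_def min_def)
    qed
  qed
  from LIMSEQ_D[OF this, of "e/2"] obtain M where M: "\<bar>integral {c..d} (km M) - integral {c..d} k\<bar> < e / 2"
    using \<open>e > 0\<close> by (metis half_gt_zero order_refl real_norm_def)
  have di: "(\<lambda>x. k x - km M x) absolutely_integrable_on {c..d}"
    by (rule set_integral_diff[OF k kmi])
  have "integral {c..d} (\<lambda>x. k x - km M x) = integral {c..d} k - integral {c..d} (km M)"
    by (rule integral_diff) (use k kmi in \<open>auto simp: absolutely_integrable_on_def\<close>)
  then have small: "integral {c..d} (\<lambda>x. k x - km M x) < e / 2" using M by linarith
  \<comment> \<open>Chosen so that M \<delta> is at most e/2; the 1 avoids a zero denominator when M
    = 0.\<close>
  define \<delta> where "\<delta> = e / (2 * (real M + 1))"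
  have "\<delta> > 0" using \<open>e > 0\<close> by (simp add: \<delta>_def)
  have "(\<Sum>(s, t)\<in>P. norm (f t - f s)) < e"
    if P: "finite P" "\<forall>(s, t)\<in>P. c \<le> s \<and> s \<le> t \<and> t \<le> d" "disjoint_family_on (\<lambda>(s, t). {s<..<t}) P"
      and len: "(\<Sum>(s, t)\<in>P. t - s) < \<delta>" for P
  proof -
    have "(\<Sum>(s, t)\<in>P. norm (f t - f s)) \<le> (\<Sum>p\<in>P. (case p of (s,t) \<Rightarrow> integral {s..t} (\<lambda>x. k x - km M x)) + M * (case p of (s,t) \<Rightarrow> t - s))"
    proof (rule sum_mono)
      fix p assume p: "p \<in> P"
      obtain s t where st: "p = (s,t)" by (cases p)
      have cst: "c \<le> s" "s \<le> t" "t \<le> d" using P(2) p st by auto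
      then have sub: "{s..t} \<subseteq> {c..d}" by auto
      have ii: "k integrable_on {s..t}" "km M integrable_on {s..t}" "(\<lambda>x. k x - km M x) integrable_on {s..t}"
        using k kmi[of M] di integrable_on_subinterval[OF _ sub] by (auto simp: absolutely_integrable_on_def)
      have "integral {s..t} k = integral {s..t} (\<lambda>x. k x - km M x) + integral {s..t} (km M)"
        using ii by (simp add: Henstock_Kurzweil_Integration.integral_diff)
      also have "integral {s..t} (km M) \<le> integral {s..t} (\<lambda>x. real M)"
        using ii by (intro integral_le) (auto simp: km_def)
      finally show "(case p of (s,t) \<Rightarrow> norm (f t - f s)) \<le> (case p of (s,t) \<Rightarrow> integral {s..t} (\<lambda>x. k x - km M x)) + M * (case p of (s,t) \<Rightarrow> t - s)"
        using le[OF cst] cst st by (simp add: mult.commute)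
    qed
    also have "\<dots> = (\<Sum>(s,t)\<in>P. integral {s..t} (\<lambda>x. k x - km M x)) + M * (\<Sum>(s,t)\<in>P. t - s)"
      by (simp add: sum.distrib sum_distrib_left)
    also have "(\<Sum>(s,t)\<in>P. integral {s..t} (\<lambda>x. k x - km M x)) \<le> integral {c..d} (\<lambda>x. k x - km M x)"
      by (rule sum_integral_disjoint_le[OF di]) (use P in \<open>auto simp: km_def\<close>)
    also have "M * (\<Sum>(s,t)\<in>P. t - s) \<le> M * \<delta>" using len by (intro mult_left_mono) auto
    also have "M * \<delta> \<le> e / 2" using \<open>e > 0\<close> by (simp add: \<delta>_def field_simps)
    finally show ?thesis using small by simp
  qed
  then show "\<exists>\<delta>>0. \<forall>P. finite P \<longrightarrow> (\<forall>(s, t)\<in>P. c \<le> s \<and> s \<le> t \<and> t \<le> d) \<longrightarrow>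
            disjoint_family_on (\<lambda>(s, t). {s<..<t}) P \<longrightarrow> (\<Sum>(s, t)\<in>P. t - s) < \<delta> \<longrightarrow> (\<Sum>(s, t)\<in>P. norm (f t - f s)) < e"
    using \<open>\<delta> > 0\<close> by blast
qed

section \<open>The fundamental theorem of calculus on open sets\<close>

lemma AE_lebesgue_onI:
  assumes "negligible N" "\<And>x. x \<in> S - N \<Longrightarrow> P x" "S \<in> sets lebesgue"
  shows "AE x in lebesgue_on S. P x"
proof -
  have "AE x in lebesgue. x \<notin> N"
    using assms(1) by (simp add: AE_not_in negligible_iff_null_sets)
  then show ?thesis
    using assms(2,3) by (auto simp: AE_restrict_space_iff elim!: eventually_mono)
qed

lemma AC_loc_vector_derivative:
  assumes f: "f \<in> AC_loc I" and "c < d" "{c..d} \<subseteq> I"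
  shows "\<exists>N. negligible N \<and> (\<forall>x\<in>{c<..<d} - N. (f has_vector_derivative vderiv f x) (at x))"
    and "vderiv f absolutely_integrable_on {c..d}"
    and "(vderiv f has_integral (f d - f c)) {c..d}"
proof -
  have "abs_continuous_on_Icc c d f" using f assms(3) by (auto simp: AC_loc_def)
  then obtain h where h: "h absolutely_integrable_on {c..d}" "\<forall>x\<in>{c..d}. (h has_integral (f x - f c)) {c..x}"
    using abs_continuous_on_Icc_integral assms(2) by blast
  then have "h integrable_on {c..d}" by (simp add: absolutely_integrable_on_def)
  then obtain N where N: "negligible N" "\<forall>x\<in>{c<..<d} - N. ((\<lambda>u. integral {c..u} h) has_vector_derivative h x) (at x)"
    using integral_has_vector_derivative_ae by blast
  have der: "(f has_vector_derivative h x) (at x)" if x: "x \<in> {c<..<d} - N" for x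
  proof -
    have "((\<lambda>u. integral {c..u} h + f c) has_vector_derivative h x) (at x)"
      using bspec[OF N(2) x] by (simp add: has_vector_derivative_add_const)
    then show ?thesis
    proof (rule has_vector_derivative_transform_within_open[where S="{c<..<d}"])
      fix y assume "y \<in> {c<..<d}"
      then have "integral {c..y} h = f y - f c" using h(2) by (intro integral_unique) auto
      then show "integral {c..y} h + f c = f y" by simp
    qed (use x in auto)
  qed
  then have vd: "vderiv f x = h x" if "x \<in> {c<..<d} - N" for x
    unfolding vderiv_def using that by (intro vector_derivative_at) auto
  show "\<exists>N. negligible N \<and> (\<forall>x\<in>{c<..<d} - N. (f has_vector_derivative vderiv f x) (at x))"
    using N(1) der vd by (intro exI[of _ N]) auto
  \<comment> \<open>At c and d the two-sided derivative \<open>vderiv\<close> depends on values of f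
    outside [c, d], so the end points join the exceptional set.\<close>
  have N': "negligible (N \<union> {c,d})" using N(1) by simp
  have eq: "vderiv f x = h x" if "x \<in> {c..d} - (N \<union> {c,d})" for x using vd that by auto
  show "vderiv f absolutely_integrable_on {c..d}"
    using absolutely_integrable_spike[OF h(1) N' eq] .
  show "(vderiv f has_integral (f d - f c)) {c..d}"
  proof (rule has_integral_spike[OF N' eq])
    show "(h has_integral (f d - f c)) {c..d}" using h(2) assms(2) by auto
  qed
qed

lemma AC_loc_integrable:
  assumes "f \<in> AC_loc I" "{c..d} \<subseteq> I"
  shows "vderiv f absolutely_integrable_on {c..d}"
proof (cases "c < d")
  case False
  then show ?thesis using absolutely_integrable_on_null[of c d "vderiv f"] by simp
qed (use AC_loc_vector_derivative[OF assms(1)] assms(2) in blast)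

lemma AC_loc_has_integral:
  assumes "f \<in> AC_loc I" "c \<le> d" "{c..d} \<subseteq> I"
  shows "(vderiv f has_integral (f d - f c)) {c..d}"
proof (cases "c < d")
  case False
  then have "c = d" using assms by simp
  then show ?thesis by (simp add: has_integral_refl)
qed (use AC_loc_vector_derivative[OF assms(1)] assms(3) in blast)

text \<open>Rational end points make the cover countable, so statements proved almost everywhere on
  compact subintervals extend to all of I.\<close>

lemma open_real_covering:
  fixes I :: "real set"
  assumes "open I"
  shows "\<exists>C. countable C \<and> (\<forall>(c,d)\<in>C. c < d \<and> {c..d} \<subseteq> I) \<and> I = (\<Union>(c,d)\<in>C. {c<..<d})"
proof (intro exI conjI)
  let ?C = "{(c,d). c \<in> \<rat> \<and> d \<in> \<rat> \<and> c < d \<and> {c..d} \<subseteq> I}"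
  show "countable ?C"
    by (rule countable_subset[of _ "\<rat> \<times> \<rat>"]) (auto intro: countable_rat countable_SIGMA)
  show "\<forall>(c,d)\<in>?C. c < d \<and> {c..d} \<subseteq> I" by auto
  show "I = (\<Union>(c,d)\<in>?C. {c<..<d})"
  proof (intro equalityI subsetI)
    fix x assume "x \<in> I"
    then obtain e where e: "e > 0" "ball x e \<subseteq> I" using assms openE by blast
    obtain c where c: "c \<in> \<rat>" "x - e < c" "c < x" using Rats_dense_in_real[of "x - e" x] e by auto
    obtain d where d: "d \<in> \<rat>" "x < d" "d < x + e" using Rats_dense_in_real[of x "x + e"] e by auto
    have "{c..d} \<subseteq> ball x e" using c d by (auto simp: dist_real_def)
    then have "(c,d) \<in> ?C" using c d e by auto
    then show "x \<in> (\<Union>(c,d)\<in>?C. {c<..<d})" using c d by force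
  qed force
qed

lemma AC_loc_AE_vector_derivative:
  assumes f: "f \<in> AC_loc I" and I: "open I"
  shows "AE x in lebesgue_on I. (f has_vector_derivative vderiv f x) (at x)"
proof -
  obtain C where C: "countable C" "\<forall>(c,d)\<in>C. c < d \<and> {c..d} \<subseteq> I" "I = (\<Union>(c,d)\<in>C. {c<..<d})"
    using open_real_covering[OF I] by blast
  have "\<exists>N. negligible N \<and> (\<forall>x\<in>{fst p<..<snd p} - N. (f has_vector_derivative vderiv f x) (at x))" if "p \<in> C" for p
    using AC_loc_vector_derivative(1)[OF f] C(2) that by (auto simp: split_beta)
  then obtain N where N: "\<And>p. p \<in> C \<Longrightarrow> negligible (N p)"
    "\<And>p x. p \<in> C \<Longrightarrow> x \<in> {fst p<..<snd p} - N p \<Longrightarrow> (f has_vector_derivative vderiv f x) (at x)" by metis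
  show ?thesis
  proof (rule AE_lebesgue_onI)
    show "negligible (\<Union>p\<in>C. N p)"
      using negligible_countable_Union[of "N ` C"] C(1) N(1) by auto
    fix x assume x: "x \<in> I - (\<Union>p\<in>C. N p)"
    then obtain c d where "(c,d) \<in> C" "x \<in> {c<..<d}" using C(3) by auto
    then show "(f has_vector_derivative vderiv f x) (at x)" using N(2)[of "(c,d)" x] x by auto
  qed (use I in auto)
qed

lemma AC_locI:
  fixes k :: "real \<Rightarrow> complex"
  assumes k: "\<And>c d. {c..d} \<subseteq> I \<Longrightarrow> k absolutely_integrable_on {c..d}"
    and le: "\<And>s t. s \<le> t \<Longrightarrow> {s..t} \<subseteq> I \<Longrightarrow> norm (f t - f s) \<le> integral {s..t} (\<lambda>x. norm (k x))"
  shows "f \<in> AC_loc I"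
  unfolding AC_loc_def mem_Collect_eq
proof (intro allI impI)
  fix c d assume "{c..d} \<subseteq> I"
  show "abs_continuous_on_Icc c d f"
  proof (rule abs_continuous_on_Icc_if_dominated[where k="\<lambda>x. norm (k x)"])
    show "(\<lambda>x. norm (k x)) absolutely_integrable_on {c..d}"
      using absolutely_integrable_norm[OF k[OF \<open>{c..d} \<subseteq> I\<close>]] by (simp add: o_def)
    fix s t assume "c \<le> s" "s \<le> t" "t \<le> d"
    then show "norm (f t - f s) \<le> integral {s..t} (\<lambda>x. norm (k x))"
      using \<open>{c..d} \<subseteq> I\<close> by (intro le) auto
  qed simp
qed

text \<open>Increments of f are dominated by the integral of the norm of h, and almost everywhere
  differentiability of indefinite integrals identifies \<open>vderiv\<close>. Derivatives of sums,
  multiples, cutoffs and form limits are all obtained from this converse half of the fundamental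
  theorem.\<close>

lemma AC_loc_indefinite_integral:
  fixes h :: "real \<Rightarrow> complex"
  assumes I: "open I" and h: "\<And>c d. {c..d} \<subseteq> I \<Longrightarrow> h absolutely_integrable_on {c..d}"
    and f: "\<And>c d. c \<le> d \<Longrightarrow> {c..d} \<subseteq> I \<Longrightarrow> (h has_integral (f d - f c)) {c..d}"
  shows "f \<in> AC_loc I" "AE x in lebesgue_on I. vderiv f x = h x"
proof -
  show fAC: "f \<in> AC_loc I"
  proof (rule AC_locI[OF h])
    fix s t :: real assume st: "s \<le> t" "{s..t} \<subseteq> I"
    have "norm (integral {s..t} h) \<le> integral {s..t} (\<lambda>x. norm (h x))"
      using h[OF st(2)] by (intro integral_norm_bound_integral) (auto simp: absolutely_integrable_on_def)
    then show "norm (f t - f s) \<le> integral {s..t} (\<lambda>x. norm (h x))"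
      using integral_unique[OF f[OF st]] by simp
  qed
  obtain C where C: "countable C" "\<forall>(c,d)\<in>C. c < d \<and> {c..d} \<subseteq> I" "I = (\<Union>(c,d)\<in>C. {c<..<d})"
    using open_real_covering[OF I] by blast
  have "\<exists>N. negligible N \<and> (\<forall>x\<in>{fst p<..<snd p} - N. vderiv f x = h x)" if p: "p \<in> C" for p
  proof -
    obtain c d where cd: "p = (c,d)" by (cases p)
    have cdI: "c < d" "{c..d} \<subseteq> I" using C(2) p cd by auto
    have "h absolutely_integrable_on {c..d}" by (rule h) (rule cdI)
    then have "h integrable_on {c..d}" by (simp add: absolutely_integrable_on_def)
    then obtain N where N: "negligible N" "\<forall>x\<in>{c<..<d} - N. ((\<lambda>u. integral {c..u} h) has_vector_derivative h x) (at x)"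
      using integral_has_vector_derivative_ae by blast
    have "vderiv f x = h x" if x: "x \<in> {c<..<d} - N" for x
    proof -
      have "((\<lambda>u. integral {c..u} h + f c) has_vector_derivative h x) (at x)"
        using bspec[OF N(2) x] by (simp add: has_vector_derivative_add_const)
      then have "(f has_vector_derivative h x) (at x)"
      proof (rule has_vector_derivative_transform_within_open[where S="{c<..<d}"])
        fix y assume "y \<in> {c<..<d}"
        then have "integral {c..y} h = f y - f c" using cdI by (intro integral_unique f) auto
        then show "integral {c..y} h + f c = f y" by simp
      qed (use x in auto)
      then show ?thesis unfolding vderiv_def by (rule vector_derivative_at)
    qed
    then show ?thesis using N(1) cd by auto
  qed
  then obtain N where N: "\<And>p. p \<in> C \<Longrightarrow> negligible (N p)"
    "\<And>p x. p \<in> C \<Longrightarrow> x \<in> {fst p<..<snd p} - N p \<Longrightarrow> vderiv f x = h x" by metis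
  show "AE x in lebesgue_on I. vderiv f x = h x"
  proof (rule AE_lebesgue_onI)
    show "negligible (\<Union>p\<in>C. N p)"
      using negligible_countable_Union[of "N ` C"] C(1) N(1) by auto
    fix x assume x: "x \<in> I - (\<Union>p\<in>C. N p)"
    then obtain c d where "(c,d) \<in> C" "x \<in> {c<..<d}" using C(3) by auto
    then show "vderiv f x = h x" using N(2)[of "(c,d)" x] x by auto
  qed (use I in auto)
qed

lemma AC_loc_continuous:
  assumes "f \<in> AC_loc I" "open I"
  shows "continuous_on I f"
proof -
  have "isCont f x" if xI: "x \<in> I" for x
  proof -
    obtain e where e: "e > 0" "cball x e \<subseteq> I" using assms(2) xI by (meson open_contains_cball)
    have cd: "{x - e..x + e} \<subseteq> I" using e by (simp add: cball_eq_atLeastAtMost)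
    have hi: "(vderiv f has_integral (f y - f (x - e))) {x - e..y}" if "y \<in> {x - e..x + e}" for y
      using that cd by (intro AC_loc_has_integral[OF assms(1)]) auto
    have "vderiv f integrable_on {x - e..x + e}" using hi[of "x + e"] e by auto
    then have "continuous_on {x - e..x + e} (\<lambda>y. integral {x - e..y} (vderiv f) + f (x - e))"
      by (intro continuous_intros indefinite_integral_continuous_1)
    moreover have "integral {x - e..y} (vderiv f) + f (x - e) = f y" if "y \<in> {x - e..x + e}" for y
      using integral_unique[OF hi[OF that]] by simp
    ultimately have "continuous_on {x - e..x + e} f" by (rule continuous_on_eq)
    then show ?thesis using e by (intro continuous_on_interior[of "{x - e..x + e}"]) auto
  qed
  then show ?thesis by (simp add: continuous_at_imp_continuous_on)
qed

section \<open>Closed semibounded forms\<close>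

text \<open>Carrier and operations are parameters so that the same calculus serves L2 spaces of
  classes and form domains of functions. No vector space laws are among the axioms: identities
  between vectors are read off from E, which is linear in its second argument and Hermitian.\<close>

locale semi_inner =
  fixes S :: "'v set" and add :: "'v \<Rightarrow> 'v \<Rightarrow> 'v" and scl :: "complex \<Rightarrow> 'v \<Rightarrow> 'v"
    and E :: "'v \<Rightarrow> 'v \<Rightarrow> complex"
  assumes add_closed: "x \<in> S \<Longrightarrow> y \<in> S \<Longrightarrow> add x y \<in> S"
    and scl_closed: "x \<in> S \<Longrightarrow> scl c x \<in> S"
    and E_add: "x \<in> S \<Longrightarrow> y \<in> S \<Longrightarrow> z \<in> S \<Longrightarrow> E x (add y z) = E x y + E x z"
    and E_scl: "x \<in> S \<Longrightarrow> y \<in> S \<Longrightarrow> E x (scl c y) = c * E x y"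
    and E_cnj: "x \<in> S \<Longrightarrow> y \<in> S \<Longrightarrow> cnj (E x y) = E y x"
    and E_nonneg: "x \<in> S \<Longrightarrow> 0 \<le> Re (E x x)"
begin

definition dif :: "'v \<Rightarrow> 'v \<Rightarrow> 'v" where "dif x y = add x (scl (-1) y)"

definition Q :: "'v \<Rightarrow> real" where "Q x = Re (E x x)"

definition nrm :: "'v \<Rightarrow> real" where "nrm x = sqrt (Q x)"

definition complete :: bool where
  "complete \<longleftrightarrow> (\<forall>u. (\<forall>n. u n \<in> S) \<longrightarrow> (\<forall>e>0. \<exists>N. \<forall>m\<ge>N. \<forall>n\<ge>N. Q (dif (u m) (u n)) < e) \<longrightarrow>
     (\<exists>f\<in>S. (\<lambda>n::nat. Q (dif (u n) f)) \<longlonglongrightarrow> 0))"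

lemma dif_closed: "x \<in> S \<Longrightarrow> y \<in> S \<Longrightarrow> dif x y \<in> S"
  by (simp add: dif_def add_closed scl_closed)

lemma E_add_left: "x \<in> S \<Longrightarrow> y \<in> S \<Longrightarrow> z \<in> S \<Longrightarrow> E (add x y) z = E x z + E y z"
  by (metis E_add E_cnj add_closed complex_cnj_add)

lemma E_scl_left: "x \<in> S \<Longrightarrow> y \<in> S \<Longrightarrow> E (scl c x) y = cnj c * E x y"
  by (metis E_cnj E_scl complex_cnj_mult scl_closed)

lemma E_dif: "x \<in> S \<Longrightarrow> y \<in> S \<Longrightarrow> z \<in> S \<Longrightarrow> E x (dif y z) = E x y - E x z"
  by (simp add: dif_def E_add E_scl scl_closed)

lemma E_dif_left: "x \<in> S \<Longrightarrow> y \<in> S \<Longrightarrow> z \<in> S \<Longrightarrow> E (dif x y) z = E x z - E y z"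
  by (simp add: dif_def E_add_left E_scl_left scl_closed)

lemma E_self: "x \<in> S \<Longrightarrow> E x x = complex_of_real (Q x)"
  using E_cnj[of x x] unfolding Q_def by (metis Reals_cnj_iff of_real_Re)

lemma Re_E_sym: "x \<in> S \<Longrightarrow> y \<in> S \<Longrightarrow> Re (E x y) = Re (E y x)"
  using arg_cong[OF E_cnj, of x y Re] by simp

lemma Q_nonneg: "x \<in> S \<Longrightarrow> 0 \<le> Q x"
  by (simp add: Q_def E_nonneg)

lemma Q_scl: "x \<in> S \<Longrightarrow> Q (scl c x) = (cmod c)\<^sup>2 * Q x"
proof -
  assume x: "x \<in> S"
  have "E (scl c x) (scl c x) = (c * cnj c) * E x x"
    using x by (simp add: E_scl E_scl_left scl_closed)
  also have "\<dots> = complex_of_real ((cmod c)\<^sup>2 * Q x)"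
    by (simp only: complex_norm_square[symmetric] E_self[OF x] of_real_mult of_real_power)
  finally show ?thesis by (simp add: Q_def[of "scl c x"])
qed

lemma Q_add: "x \<in> S \<Longrightarrow> y \<in> S \<Longrightarrow> Q (add x y) = Q x + Q y + 2 * Re (E x y)"
  using Re_E_sym[of x y] by (simp add: Q_def E_add E_add_left add_closed)

lemma Q_dif: "x \<in> S \<Longrightarrow> y \<in> S \<Longrightarrow> Q (dif x y) = Q x + Q y - 2 * Re (E x y)"
  using Re_E_sym[of x y] by (simp add: Q_def E_dif E_dif_left dif_closed)

lemma Q_dif_sym: "x \<in> S \<Longrightarrow> y \<in> S \<Longrightarrow> Q (dif x y) = Q (dif y x)"
  using Re_E_sym[of x y] by (simp add: Q_dif)

lemma cauchy_schwarz: 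
  assumes "x \<in> S" "y \<in> S"
  shows "cmod (E x y) \<le> nrm x * nrm y"
proof -
  have *: "(cmod (E x y))\<^sup>2 \<le> Q x * Q y + e * Q x" if "e > 0" for e
  proof -
    define a where "a = E y x / complex_of_real (Q y + e)"
    have pos: "Q y + e > 0" using Q_nonneg[OF assms(2)] that by simp
    have Eyx: "E x y = cnj (E y x)" using E_cnj[OF assms(2,1)] by simp
    have cm: "cmod (E x y) = cmod (E y x)" unfolding Eyx by simp
    have "0 \<le> Q (dif x (scl a y))" using assms by (intro Q_nonneg dif_closed scl_closed)
    also have "\<dots> = Q x + (cmod a)\<^sup>2 * Q y - 2 * Re (a * cnj (E y x))"
      using assms by (simp add: Q_dif Q_scl scl_closed E_scl Eyx)
    also have "a * cnj (E y x) = complex_of_real ((cmod (E x y))\<^sup>2 / (Q y + e))"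
      using complex_norm_square[of "E y x"] by (simp add: a_def cm)
    also have "(cmod a)\<^sup>2 = (cmod (E x y))\<^sup>2 / (Q y + e)\<^sup>2"
      using pos by (simp add: a_def cm norm_divide power_divide del: of_real_add)
    finally have "2 * ((cmod (E x y))\<^sup>2 / (Q y + e)) \<le> Q x + (cmod (E x y))\<^sup>2 / (Q y + e)\<^sup>2 * Q y" by simp
    also have "(cmod (E x y))\<^sup>2 / (Q y + e)\<^sup>2 * Q y \<le> (cmod (E x y))\<^sup>2 / (Q y + e)\<^sup>2 * (Q y + e)"
      using that by (intro mult_left_mono) auto
    also have "\<dots> = (cmod (E x y))\<^sup>2 / (Q y + e)" using pos by (simp add: power2_eq_square)
    finally have "(cmod (E x y))\<^sup>2 / (Q y + e) \<le> Q x" by simp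
    then show ?thesis using pos by (simp add: field_simps)
  qed
  have "(cmod (E x y))\<^sup>2 \<le> Q x * Q y"
  proof (rule field_le_epsilon)
    fix e :: real assume "e > 0"
    have "e / (Q x + 1) * Q x \<le> e" using \<open>e > 0\<close> Q_nonneg[OF assms(1)] by (simp add: field_simps)
    moreover have "e / (Q x + 1) > 0" using \<open>e > 0\<close> Q_nonneg[OF assms(1)] by simp
    ultimately show "(cmod (E x y))\<^sup>2 \<le> Q x * Q y + e" using *[of "e / (Q x + 1)"] by linarith
  qed
  then show ?thesis unfolding nrm_def real_sqrt_mult[symmetric] by (rule real_le_rsqrt)
qed

lemma nrm_nonneg: "x \<in> S \<Longrightarrow> 0 \<le> nrm x" by (simp add: nrm_def Q_nonneg)

lemma nrm_sq: "x \<in> S \<Longrightarrow> (nrm x)\<^sup>2 = Q x" by (simp add: nrm_def Q_nonneg)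

lemma nrm_add: assumes "x \<in> S" "y \<in> S" shows "nrm (add x y) \<le> nrm x + nrm y"
proof -
  have "Q (add x y) \<le> (nrm x + nrm y)\<^sup>2"
    using assms cauchy_schwarz[OF assms] complex_Re_le_cmod[of "E x y"]
    by (simp add: Q_add power2_sum nrm_sq)
  then show ?thesis unfolding nrm_def[of "add x y"]
    using nrm_nonneg assms by (intro real_le_lsqrt) auto
qed

lemma nrm_scl: "x \<in> S \<Longrightarrow> nrm (scl c x) = cmod c * nrm x"
  by (simp add: nrm_def Q_scl real_sqrt_mult)

lemma nrm_dif_sym: "x \<in> S \<Longrightarrow> y \<in> S \<Longrightarrow> nrm (dif x y) = nrm (dif y x)"
  by (simp add: nrm_def Q_dif_sym)

lemma nrm_dif_triangle:
  assumes "x \<in> S" "y \<in> S" "z \<in> S" shows "nrm (dif x z) \<le> nrm (dif x y) + nrm (dif y z)"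
proof -
  \<comment> \<open>The two vectors are not known to be equal as elements of S, but Q does not
    distinguish them.\<close>
  have "Q (dif x z) = Q (add (dif x y) (dif y z))"
    using assms by (simp add: Q_def dif_closed add_closed E_add E_add_left E_dif E_dif_left)
  then have "nrm (dif x z) = nrm (add (dif x y) (dif y z))" by (simp add: nrm_def)
  also have "\<dots> \<le> nrm (dif x y) + nrm (dif y z)" using assms by (intro nrm_add dif_closed)
  finally show ?thesis .
qed

text \<open>A minimizing sequence of \<open>Q x - 2 Re (l x)\<close> on a subspace is Cauchy by the parallelogram
  identity. With \<open>T = S\<close> this is the Riesz representation theorem, and for \<open>l = E \<sqdot> x\<close> it is the
  orthogonal projection onto the closure of \<open>T\<close>.\<close>

lemma antilinear_functional_representation:
  assumes T: "T \<subseteq> S" "T \<noteq> {}" "\<And>x y. x \<in> T \<Longrightarrow> y \<in> T \<Longrightarrow> add x y \<in> T" "\<And>c x. x \<in> T \<Longrightarrow> scl c x \<in> T"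
    and l_add: "\<And>x y. x \<in> T \<Longrightarrow> y \<in> T \<Longrightarrow> l (add x y) = l x + l y"
    and l_scl: "\<And>c x. x \<in> T \<Longrightarrow> l (scl c x) = cnj c * l x"
    and l_bound: "\<And>x. x \<in> T \<Longrightarrow> cmod (l x) \<le> C * nrm x"
    and "complete"
  shows "\<exists>f\<in>S. \<exists>u. (\<forall>n. u n \<in> T) \<and> (\<lambda>n::nat. Q (dif (u n) f)) \<longlonglongrightarrow> 0 \<and> (\<forall>g\<in>T. E g f = l g)"
proof -
  define J where "J x = Q x - 2 * Re (l x)" for x
  have J_lb: "- C\<^sup>2 \<le> J x" if "x \<in> T" for x
  proof -
    have xS: "x \<in> S" using that T by auto
    have "Re (l x) \<le> C * nrm x" using l_bound[OF that] complex_Re_le_cmod[of "l x"] by simp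
    \<comment> \<open>Completing the square bounds Q x - 2 C nrm x from below by minus the square of
      C.\<close>
    moreover have "0 \<le> (nrm x - C)\<^sup>2" by simp
    moreover have "(nrm x - C)\<^sup>2 = Q x + C\<^sup>2 - 2 * (C * nrm x)" using nrm_sq[OF xS] by (simp add: power2_diff)
    ultimately show ?thesis by (simp add: J_def)
  qed
  define m where "m = (INF x\<in>T. J x)"
  define eps where "eps = (\<lambda>n::nat. 1 / real (Suc n))"
  have eps: "eps n > 0" "N \<le> n \<Longrightarrow> eps n \<le> eps N" "eps \<longlonglongrightarrow> 0" for n N
    using LIMSEQ_inverse_real_of_nat by (auto simp: eps_def divide_simps inverse_eq_divide)
  have bdd: "bdd_below (J ` T)" using J_lb by (auto simp: bdd_below_def)
  have m_le: "m \<le> J x" if "x \<in> T" for x unfolding m_def by (rule cINF_lower[OF bdd that])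
  have "\<exists>x\<in>T. J x < m + eps n" for n
    using cINF_less_iff[OF T(2) bdd, of "m + eps n"] eps(1)[of n] by (simp add: m_def)
  then obtain u where u: "\<And>n. u n \<in> T" "\<And>n. J (u n) < m + eps n" by metis
  have uS: "u n \<in> S" for n using u T by auto
  \<comment> \<open>The parallelogram identity with the midpoint z, where J z is at least m: points
    that are nearly minimal are close to each other.\<close>
  have par: "Q (dif x y) \<le> 2 * (J x - m) + 2 * (J y - m)" if "x \<in> T" "y \<in> T" for x y
  proof -
    have S: "x \<in> S" "y \<in> S" using that T by auto
    define z where "z = scl (1/2) (add x y)"
    have "z \<in> T" using that T by (simp add: z_def)
    have Qz: "Q z = Q (add x y) / 4" using S by (simp add: z_def Q_scl add_closed norm_divide power2_eq_square)
    have lz: "l z = (l x + l y) / 2" using that T by (simp add: z_def l_scl l_add)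
    have "4 * J z = Q x + Q y + 2 * Re (E x y) - 4 * Re (l x) - 4 * Re (l y)"
      using S by (simp add: J_def Qz lz Q_add field_simps)
    then have "Q (dif x y) = 2 * J x + 2 * J y - 4 * J z"
      using S by (simp add: J_def Q_dif)
    then show ?thesis using m_le[OF \<open>z \<in> T\<close>] by simp
  qed
  have cauchy: "\<exists>N. \<forall>i\<ge>N. \<forall>j\<ge>N. Q (dif (u i) (u j)) < e" if "e > 0" for e
  proof -
    obtain N where N: "eps N < e / 4"
      using order_tendstoD(2)[OF eps(3), of "e / 4"] \<open>e > 0\<close> by (auto simp: eventually_sequentially)
    have "Q (dif (u i) (u j)) < e" if "i \<ge> N" "j \<ge> N" for i j
    proof -
      have "eps i \<le> eps N" "eps j \<le> eps N" using eps(2) that by auto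
      moreover have "J (u i) - m < eps i" "J (u j) - m < eps j" using u(2)[of i] u(2)[of j] by simp_all
      ultimately have "J (u i) - m < e / 4" "J (u j) - m < e / 4" using N by linarith+
      then show ?thesis using par[OF u(1) u(1), of i j] by simp
    qed
    then show ?thesis by blast
  qed
  obtain f where f: "f \<in> S" "(\<lambda>n. Q (dif (u n) f)) \<longlonglongrightarrow> 0"
    using \<open>complete\<close> uS cauchy unfolding complete_def by blast
  have conv: "(\<lambda>n. E g (u n)) \<longlonglongrightarrow> E g f" if "g \<in> S" for g
  proof (rule Lim_null[THEN iffD2], rule Lim_null_comparison)
    show "\<forall>\<^sub>F n in sequentially. norm (E g (u n) - E g f) \<le> nrm g * nrm (dif (u n) f)"
      using cauchy_schwarz[OF that] f(1) uS that by (auto simp: E_dif[symmetric] dif_closed)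
    have "(\<lambda>n. nrm (dif (u n) f)) \<longlonglongrightarrow> sqrt 0"
      unfolding nrm_def by (intro tendsto_real_sqrt f)
    then show "(\<lambda>n. nrm g * nrm (dif (u n) f)) \<longlonglongrightarrow> 0"
      by (auto intro!: tendsto_mult_right_zero)
  qed
  have "E g f = l g" if g: "g \<in> T" for g
  proof -
    have gS: "g \<in> S" using g T by auto
    define D where "D = E g f - l g"
    \<comment> \<open>Perturbing u n by s g cannot lower J below m, and J (u n) exceeds m by less
      than eps n. In the limit this is a quadratic inequality in s.\<close>
    have ineq: "0 \<le> 2 * Re (cnj s * D) + (cmod s)\<^sup>2 * Q g" for s
    proof (rule LIMSEQ_le[OF tendsto_const])
      have "(\<lambda>n. eps n + (2 * Re (cnj s * (E g (u n) - l g)) + (cmod s)\<^sup>2 * Q g)) \<longlonglongrightarrow> 0 + (2 * Re (cnj s * (E g f - l g)) + (cmod s)\<^sup>2 * Q g)"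
        by (intro tendsto_intros conv[OF gS] eps(3))
      then show "(\<lambda>n. eps n + (2 * Re (cnj s * (E g (u n) - l g)) + (cmod s)\<^sup>2 * Q g)) \<longlonglongrightarrow> 2 * Re (cnj s * D) + (cmod s)\<^sup>2 * Q g"
        by (simp add: D_def)
      show "\<exists>N. \<forall>n\<ge>N. 0 \<le> eps n + (2 * Re (cnj s * (E g (u n) - l g)) + (cmod s)\<^sup>2 * Q g)"
      proof (intro exI allI impI)
        fix n :: nat
        have sg: "scl s g \<in> T" using g by (rule T(4))
        then have sgS: "scl s g \<in> S" using T(1) by auto
        have "m \<le> J (add (u n) (scl s g))" using u(1) sg T(3) by (intro m_le) auto
        also have "\<dots> = J (u n) + 2 * Re (s * E (u n) g) + (cmod s)\<^sup>2 * Q g - 2 * Re (cnj s * l g)"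
          using uS sg sgS gS by (simp add: J_def Q_add Q_scl E_scl l_add l_scl u(1) g)
        also have "Re (s * E (u n) g) = Re (cnj s * E g (u n))"
          using arg_cong[OF E_cnj[OF gS uS], of "\<lambda>z. Re (s * z)" n] by simp
        finally show "0 \<le> eps n + (2 * Re (cnj s * (E g (u n) - l g)) + (cmod s)\<^sup>2 * Q g)"
          using u(2)[of n] by (simp add: algebra_simps)
      qed
    qed
    \<comment> \<open>With s = -t D the linear term is -2 t times the squared modulus of D, and t Q
      g \<le> 1 keeps the quadratic term at most half as large; hence D = 0.\<close>
    define t where "t = 1 / (Q g + 1)"
    have Qg: "0 \<le> Q g" using gS by (rule Q_nonneg)
    have t: "t > 0" "t * Q g \<le> 1" using Qg by (auto simp: t_def)
    have "cnj (- complex_of_real t * D) * D = - complex_of_real (t * (cmod D)\<^sup>2)"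
    proof -
      have "cnj (- complex_of_real t * D) * D = - (complex_of_real t * (D * cnj D))"
        by (simp only: complex_cnj_mult complex_cnj_minus complex_cnj_complex_of_real mult_minus_left mult_minus_right mult_ac)
      then show ?thesis by (simp only: complex_norm_square[symmetric] of_real_mult of_real_power)
    qed
    from arg_cong[OF this, of Re] have "Re (cnj (- complex_of_real t * D) * D) = - (t * (cmod D)\<^sup>2)"
      by (simp only: uminus_complex.simps Re_complex_of_real)
    moreover have "(cmod (- complex_of_real t * D))\<^sup>2 = t * t * (cmod D)\<^sup>2"
      by (simp add: norm_mult power2_eq_square)
    ultimately have "2 * t * (cmod D)\<^sup>2 \<le> t * (t * Q g) * (cmod D)\<^sup>2"
      using ineq[of "- complex_of_real t * D"] by (simp add: mult_ac)
    also have "\<dots> \<le> t * 1 * (cmod D)\<^sup>2" using t by (intro mult_right_mono mult_left_mono) auto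
    finally have "t * (cmod D)\<^sup>2 \<le> 0" by simp
    then have "D = 0" using t by (simp add: mult_le_0_iff)
    then show ?thesis by (simp add: D_def)
  qed
  then show ?thesis using f u(1) by blast
qed

end

text \<open>Definiteness speaks of differences because no zero vector belongs to the data. Vectors
  are identified through their inner products with all others, see \<open>vec_eqI\<close>.\<close>

locale hilbert = semi_inner "hcarrier H" "hadd H" "hscale H" "hinner H" for H :: "'v hspace" +
  assumes carrier_ne: "hcarrier H \<noteq> {}"
    and definite: "x \<in> hcarrier H \<Longrightarrow> y \<in> hcarrier H \<Longrightarrow> Q (dif x y) = 0 \<Longrightarrow> x = y"
    and complete: "complete"
begin

lemma hdiff_eq: "hdiff H = dif" by (auto simp: fun_eq_iff dif_def hdiff_def)

lemma hnorm_eq: "hnorm H = nrm" by (auto simp: fun_eq_iff nrm_def Q_def hnorm_def)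

lemma vec_eqI:
  assumes "x \<in> hcarrier H" "y \<in> hcarrier H" "\<And>z. z \<in> hcarrier H \<Longrightarrow> hinner H z x = hinner H z y"
  shows "x = y"
proof (rule definite[OF assms(1,2)])
  show "Q (dif x y) = 0" using assms by (simp add: Q_def E_dif dif_closed)
qed

lemma vec_eqI_left:
  assumes "x \<in> hcarrier H" "y \<in> hcarrier H" "\<And>z. z \<in> hcarrier H \<Longrightarrow> hinner H x z = hinner H y z"
  shows "x = y"
  using assms by (intro vec_eqI) (metis E_cnj)+

lemma nrm_eq_0: "x \<in> hcarrier H \<Longrightarrow> nrm x = 0 \<Longrightarrow> z \<in> hcarrier H \<Longrightarrow> hinner H z x = 0"
  using cauchy_schwarz[of z x] by simp

end

text \<open>Form domains consist of functions, vectors of \<open>H\<close> are classes modulo null sets;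
  \<open>\<iota>\<close> sends a function to its class.\<close>

locale closed_form = hilbert H for H :: "'v hspace" +
  fixes F :: "'f set" and fadd :: "'f \<Rightarrow> 'f \<Rightarrow> 'f" and fscl :: "complex \<Rightarrow> 'f \<Rightarrow> 'f"
    and \<iota> :: "'f \<Rightarrow> 'v" and t :: "'f \<Rightarrow> 'f \<Rightarrow> complex" and m :: real
  assumes F_ne: "F \<noteq> {}"
    and fadd: "f \<in> F \<Longrightarrow> g \<in> F \<Longrightarrow> fadd f g \<in> F"
    and fscl: "f \<in> F \<Longrightarrow> fscl c f \<in> F"
    and emb: "f \<in> F \<Longrightarrow> \<iota> f \<in> hcarrier H"
    and emb_add: "f \<in> F \<Longrightarrow> g \<in> F \<Longrightarrow> \<iota> (fadd f g) = hadd H (\<iota> f) (\<iota> g)"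
    and emb_scl: "f \<in> F \<Longrightarrow> \<iota> (fscl c f) = hscale H c (\<iota> f)"
    and t_add: "f \<in> F \<Longrightarrow> g \<in> F \<Longrightarrow> h \<in> F \<Longrightarrow> t f (fadd g h) = t f g + t f h"
    and t_scl: "f \<in> F \<Longrightarrow> g \<in> F \<Longrightarrow> t f (fscl c g) = c * t f g"
    and t_cnj: "f \<in> F \<Longrightarrow> g \<in> F \<Longrightarrow> cnj (t f g) = t g f"
    and lower_bound: "f \<in> F \<Longrightarrow> m * Q (\<iota> f) \<le> Re (t f f)"
    and form_complete: "\<And>u. (\<And>n. u n \<in> F) \<Longrightarrow>
      (\<And>e. e > 0 \<Longrightarrow> \<exists>N. \<forall>j\<ge>N. \<forall>k\<ge>N. (let d = fadd (u j) (fscl (-1) (u k)) in Re (t d d) + (1 - m) * Q (\<iota> d)) < e) \<Longrightarrow>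
      \<exists>f\<in>F. (\<lambda>n::nat. let d = fadd (u n) (fscl (-1) f) in Re (t d d) + (1 - m) * Q (\<iota> d)) \<longlonglongrightarrow> 0"
    and dense: "x \<in> hcarrier H \<Longrightarrow> (\<And>f. f \<in> F \<Longrightarrow> hinner H (\<iota> f) x = 0) \<Longrightarrow> Q x = 0"
    and t_kernel: "f \<in> F \<Longrightarrow> g \<in> F \<Longrightarrow> Q (\<iota> f) = 0 \<Longrightarrow> t g f = 0"
begin

section \<open>The self-adjoint operator of a closed semibounded form\<close>

definition op :: "('v \<times> 'v) set" where
  "op = {(\<iota> f, V) | f V. f \<in> F \<and> V \<in> hcarrier H \<and> (\<forall>g\<in>F. t g f = hinner H (\<iota> g) V)}"

definition shifted :: "real \<Rightarrow> 'f \<Rightarrow> 'f \<Rightarrow> complex" where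
  "shifted z f g = t f g - z * hinner H (\<iota> f) (\<iota> g)"

lemma semi_inner_shifted:
  assumes "z < m"
  shows "semi_inner F fadd fscl (shifted z)"
proof
  fix x y w c assume *: "x \<in> F" "y \<in> F" "w \<in> F"
  show "fadd x y \<in> F" "fscl c x \<in> F" using * fadd fscl by auto
  show "shifted z x (fadd y w) = shifted z x y + shifted z x w"
    using * by (simp add: shifted_def t_add emb_add E_add emb algebra_simps)
  show "shifted z x (fscl c y) = c * shifted z x y"
    using * by (simp add: shifted_def t_scl emb_scl E_scl emb algebra_simps)
  show "cnj (shifted z x y) = shifted z y x"
    using * by (simp add: shifted_def t_cnj E_cnj emb)
  have "z * Q (\<iota> x) \<le> m * Q (\<iota> x)" using assms Q_nonneg[OF emb[OF *(1)]] by (intro mult_right_mono) auto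
  then show "0 \<le> Re (shifted z x x)"
    using lower_bound[OF *(1)] by (simp add: shifted_def E_self[OF emb[OF *(1)]])
qed

text \<open>The axiom provides completeness for the form norm with shift m - 1; all shifts z < m
  give equivalent norms, so completeness carries over.\<close>

lemma complete_shifted:
  assumes "z < m"
  shows "semi_inner.complete F fadd fscl (shifted z)"
proof -
  interpret Z: semi_inner F fadd fscl "shifted z" by (rule semi_inner_shifted[OF assms])
  define N1 where "N1 d = Re (t d d) + (1 - m) * Q (\<iota> d)" for d
  \<comment> \<open>In terms of a = t(d,d) - m Q and Q the two squared norms are a + Q and a + (m -
    z) Q. C dominates 1, m - z and 1 / (m - z), as the two comparisons require.\<close>
  define C where "C = max 1 (1 / (m - z)) + (m - z)"
  have C: "C > 0" "C \<ge> 1" "C \<ge> m - z" "1 \<le> C * (m - z)"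
  proof -
    show "C > 0" "C \<ge> 1" "C \<ge> m - z" using assms by (auto simp: C_def)
    have "1 = 1 / (m - z) * (m - z)" using assms by simp
    also have "\<dots> \<le> C * (m - z)" using assms by (intro mult_right_mono) (auto simp: C_def)
    finally show "1 \<le> C * (m - z)" .
  qed
  have QZ: "Z.Q d = Re (t d d) - z * Q (\<iota> d)" if "d \<in> F" for d
    using that by (simp add: Z.Q_def shifted_def E_self emb)
  have le1: "N1 d \<le> C * Z.Q d" and le2: "Z.Q d \<le> C * N1 d" if d: "d \<in> F" for d
  proof -
    define a where "a = Re (t d d) - m * Q (\<iota> d)"
    have a: "a \<ge> 0" "Q (\<iota> d) \<ge> 0" using lower_bound[OF d] Q_nonneg[OF emb[OF d]] by (auto simp: a_def)
    have N1: "N1 d = a + Q (\<iota> d)" "Z.Q d = a + (m - z) * Q (\<iota> d)"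
      by (auto simp: N1_def QZ[OF d] a_def algebra_simps)
    have "a \<le> C * a" "Q (\<iota> d) \<le> (C * (m - z)) * Q (\<iota> d)" "(m - z) * Q (\<iota> d) \<le> C * Q (\<iota> d)"
      using mult_right_mono[OF C(2) a(1)] mult_right_mono[OF C(4) a(2)] mult_right_mono[OF C(3) a(2)] by simp_all
    then show "N1 d \<le> C * Z.Q d" "Z.Q d \<le> C * N1 d"
      using a unfolding N1 by (simp_all add: algebra_simps)
  qed
  have dif: "Z.dif x y = fadd x (fscl (-1) y)" for x y by (simp add: Z.dif_def)
  show ?thesis
    unfolding Z.complete_def
  proof (intro allI impI)
    fix u :: "nat \<Rightarrow> 'f" assume u: "\<forall>n. u n \<in> F" and cauchy: "\<forall>e>0. \<exists>N. \<forall>j\<ge>N. \<forall>k\<ge>N. Z.Q (Z.dif (u j) (u k)) < e"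
    have "\<exists>f\<in>F. (\<lambda>n::nat. let d = fadd (u n) (fscl (-1) f) in Re (t d d) + (1 - m) * Q (\<iota> d)) \<longlonglongrightarrow> 0"
    proof (rule form_complete)
      fix e :: real assume "e > 0"
      then have "e / C > 0" using C by simp
      then obtain N where N: "\<And>j k. j \<ge> N \<Longrightarrow> k \<ge> N \<Longrightarrow> Z.Q (Z.dif (u j) (u k)) < e / C"
        using cauchy by meson
      have "N1 (Z.dif (u j) (u k)) < e" if "j \<ge> N" "k \<ge> N" for j k
      proof -
        have "N1 (Z.dif (u j) (u k)) \<le> C * Z.Q (Z.dif (u j) (u k))"
          using u by (intro le1 Z.dif_closed) auto
        also have "\<dots> < C * (e / C)" using N[OF that] C(1) by (intro mult_strict_left_mono)
        finally show ?thesis using C by simp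
      qed
      then show "\<exists>N. \<forall>j\<ge>N. \<forall>k\<ge>N. (let d = fadd (u j) (fscl (-1) (u k)) in Re (t d d) + (1 - m) * Q (\<iota> d)) < e"
        unfolding Let_def N1_def dif by blast
    qed (use u in auto)
    then obtain f where f: "f \<in> F" "(\<lambda>n. N1 (Z.dif (u n) f)) \<longlonglongrightarrow> 0"
      unfolding Let_def N1_def dif by blast
    have "(\<lambda>n. Z.Q (Z.dif (u n) f)) \<longlonglongrightarrow> 0"
    proof (rule Lim_null_comparison)
      show "\<forall>\<^sub>F n in sequentially. norm (Z.Q (Z.dif (u n) f)) \<le> C * N1 (Z.dif (u n) f)"
        using u f(1) le2 Z.Q_nonneg by (auto simp: Z.dif_closed)
      show "(\<lambda>n. C * N1 (Z.dif (u n) f)) \<longlonglongrightarrow> 0" using f(2) by (rule tendsto_mult_right_zero)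
    qed
    then show "\<exists>f\<in>F. (\<lambda>n. Z.Q (Z.dif (u n) f)) \<longlonglongrightarrow> 0" using f(1) by blast
  qed
qed

lemma shifted_self_ge:
  assumes "f \<in> F" shows "(m - z) * Q (\<iota> f) \<le> Re (shifted z f f)"
  using lower_bound[OF assms] assms by (simp add: shifted_def E_self emb algebra_simps)

text \<open>Riesz representation in the inner product given by the shifted form: coercivity bounds
  \<open>nrm (\<iota> g)\<close> by the form norm divided by the root of m - z, so pairing
  \<open>\<iota> g\<close> with x is a bounded functional of g.\<close>

lemma shifted_solution:
  assumes z: "z < m" and x: "x \<in> hcarrier H"
  shows "\<exists>f\<in>F. \<forall>g\<in>F. shifted z g f = hinner H (\<iota> g) x"
proof -
  interpret Z: semi_inner F fadd fscl "shifted z" by (rule semi_inner_shifted[OF z])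
  have "\<exists>f\<in>F. \<exists>u. (\<forall>n. u n \<in> F) \<and> (\<lambda>n::nat. Z.Q (Z.dif (u n) f)) \<longlonglongrightarrow> 0 \<and> (\<forall>g\<in>F. shifted z g f = hinner H (\<iota> g) x)"
  proof (rule Z.antilinear_functional_representation[where C="nrm x / sqrt (m - z)"])
    show "Z.complete" by (rule complete_shifted[OF z])
    fix g assume g: "g \<in> F"
    have "(m - z) * Q (\<iota> g) \<le> Z.Q g" using shifted_self_ge[OF g] by (simp add: Z.Q_def)
    then have "sqrt (m - z) * nrm (\<iota> g) \<le> Z.nrm g"
      unfolding nrm_def Z.nrm_def real_sqrt_mult[symmetric] by (rule real_sqrt_le_mono)
    then have "nrm (\<iota> g) \<le> Z.nrm g / sqrt (m - z)" using z by (simp add: pos_le_divide_eq mult.commute)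
    then have "nrm (\<iota> g) * nrm x \<le> Z.nrm g / sqrt (m - z) * nrm x"
      using nrm_nonneg[OF x] by (rule mult_right_mono)
    then show "cmod (hinner H (\<iota> g) x) \<le> nrm x / sqrt (m - z) * Z.nrm g"
      using cauchy_schwarz[OF emb[OF g] x] by (simp add: mult.commute)
  qed (use F_ne x in \<open>auto simp: fadd fscl emb_add emb_scl E_add_left E_scl_left emb\<close>)
  then show ?thesis by blast
qed

lemma op_subset: "op \<subseteq> hcarrier H \<times> hcarrier H"
  by (auto simp: op_def emb)

lemma op_add: "(x, h) \<in> op \<Longrightarrow> (x', h') \<in> op \<Longrightarrow> (hadd H x x', hadd H h h') \<in> op"
  unfolding op_def by clarsimp (metis add_closed emb emb_add fadd t_add E_add)

lemma op_scl: "(x, h) \<in> op \<Longrightarrow> (hscale H c x, hscale H c h) \<in> op"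
  unfolding op_def by clarsimp (metis scl_closed emb emb_scl fscl t_scl E_scl)

lemma op_dif: "(x, h) \<in> op \<Longrightarrow> (x', h') \<in> op \<Longrightarrow> (dif x x', dif h h') \<in> op"
  unfolding dif_def by (intro op_add op_scl)

text \<open>Since \<iota> forgets null sets, distinct functions may represent one vector. A function
  of class zero has vanishing form against everything, and density of the form domain then forces h
  to vanish. Single-valuedness of the operator rests on this.\<close>

lemma op_kernel:
  assumes "(x, h) \<in> op" "Q x = 0" shows "Q h = 0"
proof -
  obtain f where f: "x = \<iota> f" "f \<in> F" "h \<in> hcarrier H" "\<forall>g\<in>F. t g f = hinner H (\<iota> g) h"
    using assms(1) by (auto simp: op_def)
  then have "hinner H (\<iota> g) h = 0" if "g \<in> F" for g
    using t_kernel[OF f(2) that] assms(2) that by auto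
  then show ?thesis using f(3) dense by auto
qed

lemma op_lower_bound:
  assumes "(x, h) \<in> op" shows "m * Q x \<le> Re (hinner H x h)"
proof -
  obtain f where f: "x = \<iota> f" "f \<in> F" "\<forall>g\<in>F. t g f = hinner H (\<iota> g) h" using assms by (auto simp: op_def)
  then show ?thesis using lower_bound[OF f(2)] bspec[OF f(3,2)] by simp
qed

lemma op_symmetric:
  assumes "(x, h) \<in> op" "(y, k) \<in> op" shows "hinner H x k = hinner H h y"
proof -
  obtain f g where fg: "x = \<iota> f" "f \<in> F" "h \<in> hcarrier H" "\<forall>j\<in>F. t j f = hinner H (\<iota> j) h"
    "y = \<iota> g" "g \<in> F" "k \<in> hcarrier H" "\<forall>j\<in>F. t j g = hinner H (\<iota> j) k"
    using assms by (auto simp: op_def)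
  then have "hinner H x k = t f g" by auto
  also have "\<dots> = cnj (hinner H y h)" using fg t_cnj by metis
  also have "\<dots> = hinner H h y" using fg emb by (auto simp: E_cnj)
  finally show ?thesis .
qed

lemma op_range:
  assumes "z < m" "x \<in> hcarrier H"
  shows "\<exists>y h. (y, h) \<in> op \<and> dif h (hscale H (complex_of_real z) y) = x"
proof -
  obtain f where f: "f \<in> F" "\<forall>g\<in>F. shifted z g f = hinner H (\<iota> g) x"
    using shifted_solution[OF assms] by blast
  define h where "h = hadd H x (hscale H z (\<iota> f))"
  have h: "h \<in> hcarrier H" using f assms by (simp add: h_def add_closed scl_closed emb)
  have "(\<iota> f, h) \<in> op"
    using f assms h by (auto simp: op_def h_def shifted_def E_add E_scl emb scl_closed algebra_simps)
  moreover have "dif h (hscale H z (\<iota> f)) = x"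
    by (rule vec_eqI) (use f assms h in \<open>auto simp: dif_closed E_dif scl_closed emb h_def E_add E_scl add_closed\<close>)
  ultimately show ?thesis by blast
qed

text \<open>Pairing (A - z) y with y and using the lower bound gives an estimate for Q y; one factor
  nrm y is then cancelled. As it holds for every complex z with real part below m, it makes A - z
  injective there.\<close>

lemma op_shift_bound:
  assumes "(y, h) \<in> op" "Re z < m"
  shows "(m - Re z) * nrm y \<le> nrm (dif h (hscale H z y))"
proof -
  have c: "y \<in> hcarrier H" "h \<in> hcarrier H" using assms(1) op_subset by auto
  have "(m - Re z) * Q y \<le> Re (hinner H y (dif h (hscale H z y)))"
    using op_lower_bound[OF assms(1)] c by (simp add: E_dif E_scl scl_closed E_self algebra_simps)
  also have "\<dots> \<le> nrm y * nrm (dif h (hscale H z y))"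
    using cauchy_schwarz[of y "dif h (hscale H z y)"] complex_Re_le_cmod c
    by (meson dif_closed order_trans scl_closed)
  finally have *: "nrm y * ((m - Re z) * nrm y) \<le> nrm y * nrm (dif h (hscale H z y))"
    using c by (simp add: nrm_sq[symmetric] power2_eq_square algebra_simps)
  show ?thesis
  proof (cases "nrm y = 0")
    case True then show ?thesis using c by (simp add: nrm_nonneg dif_closed scl_closed)
  next
    case False
    then have "nrm y > 0" using nrm_nonneg[OF c(1)] by simp
    then show ?thesis using * by simp
  qed
qed

lemma op_shift_dif:
  assumes "(y, h) \<in> op" "(y', h') \<in> op"
  shows "dif (dif h h') (hscale H z (dif y y')) = dif (dif h (hscale H z y)) (dif h' (hscale H z y'))"
proof (rule vec_eqI)
  have c: "y \<in> hcarrier H" "h \<in> hcarrier H" "y' \<in> hcarrier H" "h' \<in> hcarrier H" using assms op_subset by auto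
  then show "dif (dif h h') (hscale H z (dif y y')) \<in> hcarrier H"
     "dif (dif h (hscale H z y)) (dif h' (hscale H z y')) \<in> hcarrier H" by (auto intro!: dif_closed scl_closed)
  fix w assume "w \<in> hcarrier H"
  with c show "hinner H w (dif (dif h h') (hscale H z (dif y y'))) = hinner H w (dif (dif h (hscale H z y)) (dif h' (hscale H z y')))"
    by (simp add: E_dif E_scl dif_closed scl_closed algebra_simps)
qed

lemma op_shift_inj:
  assumes "(y, h) \<in> op" "(y', h') \<in> op" "Re z < m" "dif h (hscale H z y) = dif h' (hscale H z y')"
  shows "y = y'"
proof -
  have c: "y \<in> hcarrier H" "y' \<in> hcarrier H" "h' \<in> hcarrier H" using assms op_subset by auto
  have k: "dif h' (hscale H z y') \<in> hcarrier H" using c by (intro dif_closed scl_closed)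
  have "(m - Re z) * nrm (dif y y') \<le> nrm (dif (dif h (hscale H z y)) (dif h' (hscale H z y')))"
    using op_shift_bound[OF op_dif[OF assms(1,2)] assms(3)] op_shift_dif[OF assms(1,2)] by simp
  also have "\<dots> = 0" unfolding assms(4) using k by (simp add: nrm_def Q_def E_dif E_dif_left dif_closed)
  finally have "nrm (dif y y') = 0" using assms(3) nrm_nonneg[OF dif_closed[OF c(1,2)]]
    by (simp add: mult_le_0_iff)
  then have "Q (dif y y') = 0" using nrm_sq[OF dif_closed[OF c(1,2)]] by simp
  then show ?thesis by (rule definite[OF c(1,2)])
qed

text \<open>A symmetric, densely defined operator whose shift by a real number is onto is
  self-adjoint, and z = m - 1 is a convenient number below the lower bound. Surjectivity comes from
  the Riesz argument, and it also yields density of the domain.\<close>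

lemma self_adjoint_op: "self_adjoint H op"
proof -
  define z where "z = m - 1"
  have z: "z < m" "Re (complex_of_real z) < m" by (auto simp: z_def)
  have ne: "op \<noteq> {}" using op_range[OF z(1)] carrier_ne by blast
  have "single_valued op"
  proof (rule single_valuedI)
    fix x h h' assume a: "(x, h) \<in> op" "(x, h') \<in> op"
    then have c: "x \<in> hcarrier H" "h \<in> hcarrier H" "h' \<in> hcarrier H" using op_subset by auto
    have "Q (dif x x) = 0" using c by (simp add: Q_def E_dif E_dif_left dif_closed)
    then have "Q (dif h h') = 0" by (rule op_kernel[OF op_dif[OF a]])
    then show "h = h'" by (rule definite[OF c(2,3)])
  qed
  then have lin: "linear_operator H op"
    unfolding linear_operator_def using op_subset ne op_add op_scl by auto
  have "densely_defined H op"
    unfolding densely_defined_def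
  proof (intro ballI allI impI)
    fix x and e :: real assume x: "x \<in> hcarrier H" and "e > 0"
    \<comment> \<open>y is the projection of x onto the closure of the domain, so w = x - y is
      orthogonal to the domain. Writing w = (A - z) f and testing with f gives <f, A f> = z <f, f>,
      which contradicts the lower bound m > z unless f is null; then w is null too.\<close>
    have "\<exists>y\<in>hcarrier H. \<exists>u. (\<forall>n. u n \<in> Domain op) \<and> (\<lambda>n::nat. Q (dif (u n) y)) \<longlonglongrightarrow> 0 \<and>
        (\<forall>g\<in>Domain op. hinner H g y = hinner H g x)"
    proof (rule antilinear_functional_representation[where C="nrm x"])
      show "Domain op \<subseteq> hcarrier H" using op_subset by auto
      show "Domain op \<noteq> {}" using ne by auto
      show "complete" by (rule complete)
      show "hadd H f g \<in> Domain op" if "f \<in> Domain op" "g \<in> Domain op" for f g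
        using that op_add by blast
      show "hscale H c f \<in> Domain op" if "f \<in> Domain op" for c f
        using that op_scl by blast
      fix f g c assume f: "f \<in> Domain op"
      then have fH: "f \<in> hcarrier H" using op_subset by auto
      show "cmod (hinner H f x) \<le> nrm x * nrm f"
        using cauchy_schwarz[OF fH x] by (simp add: mult.commute)
      show "hinner H (hscale H c f) x = cnj c * hinner H f x" using fH x by (rule E_scl_left)
      assume "g \<in> Domain op"
      then have gH: "g \<in> hcarrier H" using op_subset by auto
      show "hinner H (hadd H f g) x = hinner H f x + hinner H g x" using fH gH x by (rule E_add_left)
    qed
    then obtain y u where yu: "y \<in> hcarrier H" "\<And>n. u n \<in> Domain op" "(\<lambda>n::nat. Q (dif (u n) y)) \<longlonglongrightarrow> 0"
      "\<And>g. g \<in> Domain op \<Longrightarrow> hinner H g y = hinner H g x" by blast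
    define w where "w = dif x y"
    have w: "w \<in> hcarrier H" using x yu by (simp add: w_def dif_closed)
    have orth: "hinner H g w = 0" if "g \<in> Domain op" for g
      using yu(4)[OF that] that op_subset x yu(1) by (auto simp: w_def E_dif)
    obtain f h where fh: "(f, h) \<in> op" "dif h (hscale H z f) = w" using op_range[OF z(1) w] by blast
    then have c: "f \<in> hcarrier H" "h \<in> hcarrier H" using op_subset by auto
    have "hinner H f w = 0" using fh orth by auto
    then have "hinner H f h - z * hinner H f f = 0" using c unfolding fh(2)[symmetric] by (simp add: E_dif E_scl scl_closed)
    then have "Re (hinner H f h) = z * Q f" by (simp add: E_self[OF c(1)])
    then have "m * Q f \<le> z * Q f" using op_lower_bound[OF fh(1)] by simp
    then have Qf: "Q f = 0" using Q_nonneg[OF c(1)] by (simp add: z_def algebra_simps)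
    have "Q h = 0" by (rule op_kernel[OF fh(1) Qf])
    have nf: "nrm f = 0" "nrm h = 0" using Qf \<open>Q h = 0\<close> by (auto simp: nrm_def)
    have "Q w = 0" unfolding fh(2)[symmetric]
      using Qf \<open>Q h = 0\<close> c nrm_eq_0[OF c(1) nf(1) c(2)] by (simp add: Q_dif Q_scl scl_closed E_scl)
    then have "x = y" unfolding w_def by (rule definite[OF x yu(1)])
    have "0 < e\<^sup>2" using \<open>e > 0\<close> by simp
    from order_tendstoD(2)[OF yu(3) this] obtain n where "Q (dif (u n) y) < e\<^sup>2"
      by (auto simp: eventually_sequentially)
    moreover have "u n \<in> hcarrier H" using yu(2)[of n] op_subset by auto
    ultimately have "nrm (dif x (u n)) < e"
      using \<open>x = y\<close> yu(1) \<open>e > 0\<close> unfolding nrm_def by (subst Q_dif_sym) (auto intro: real_less_lsqrt)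
    then show "\<exists>f\<in>Domain op. hnorm H (hdiff H x f) < e"
      using yu(2)[of n] by (auto simp: hdiff_eq hnorm_eq)
  qed
  moreover have "adjoint_graph H op = op"
  proof (intro equalityI subsetI)
    fix p assume "p \<in> op"
    then show "p \<in> adjoint_graph H op"
      using op_subset op_symmetric by (cases p) (auto simp: adjoint_graph_def)
  next
    fix p assume p: "p \<in> adjoint_graph H op"
    obtain u v where uv: "p = (u, v)" by (cases p)
    have c: "u \<in> hcarrier H" "v \<in> hcarrier H" and adj: "\<And>f h. (f, h) \<in> op \<Longrightarrow> hinner H u h = hinner H v f"
      using p uv by (auto simp: adjoint_graph_def)
    \<comment> \<open>For (u, v) in the adjoint, (A - z) f = v - z u is solvable. Then u and f have
      the same inner products with the range of A - z, which is the whole space.\<close>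
    obtain f h where fh: "(f, h) \<in> op" "dif h (hscale H z f) = dif v (hscale H z u)"
      using op_range[OF z(1), of "dif v (hscale H z u)"] c by (auto simp: dif_closed scl_closed)
    have cf: "f \<in> hcarrier H" "h \<in> hcarrier H" using fh op_subset by auto
    have "u = f"
    proof (rule vec_eqI_left[OF c(1) cf(1)])
      fix x assume x: "x \<in> hcarrier H"
      obtain y k where yk: "(y, k) \<in> op" "dif k (hscale H z y) = x" using op_range[OF z(1) x] by blast
      have cy: "y \<in> hcarrier H" "k \<in> hcarrier H" using yk op_subset by auto
      have "hinner H u x = hinner H (dif v (hscale H z u)) y"
        using adj[OF yk(1)] c cy unfolding yk(2)[symmetric]
        by (simp add: E_dif E_scl E_dif_left E_scl_left scl_closed)
      also have "\<dots> = hinner H (dif h (hscale H z f)) y" by (simp add: fh)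
      also have "\<dots> = hinner H f x"
        using op_symmetric[OF fh(1) yk(1)] cf cy unfolding yk(2)[symmetric]
        by (simp add: E_dif E_scl E_dif_left E_scl_left scl_closed)
      finally show "hinner H u x = hinner H f x" .
    qed
    have "v = h"
    proof (rule vec_eqI[OF c(2) cf(2)])
      fix x assume x: "x \<in> hcarrier H"
      have "hinner H x (dif v (hscale H z u)) = hinner H x (dif h (hscale H z f))" by (simp add: fh)
      then show "hinner H x v = hinner H x h"
        using x c cf \<open>u = f\<close> by (simp add: E_dif scl_closed)
    qed
    then show "p \<in> op" using uv fh \<open>u = f\<close> by simp
  qed
  ultimately show ?thesis using lin by (simp add: self_adjoint_def)
qed

lemma resolvent_eqI:
  assumes "(y, h) \<in> op" "dif h (hscale H z y) = x" "Re z < m"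
  shows "resolvent H op z x = y"
  unfolding resolvent_def hdiff_eq
proof (rule the_equality)
  show "\<exists>h. (y, h) \<in> op \<and> dif h (hscale H z y) = x" using assms by blast
  fix y' assume "\<exists>h. (y', h) \<in> op \<and> dif h (hscale H z y') = x"
  then show "y' = y" using op_shift_inj[OF _ assms(1,3)] assms(2) by metis
qed

text \<open>Later estimates use resolvents through this weak formulation, in which two operators
  with a common form domain can be tested against the same functions.\<close>

lemma resolvent_form:
  assumes "z < m" "x \<in> hcarrier H"
  shows "\<exists>f\<in>F. resolvent H op (complex_of_real z) x = \<iota> f \<and> (\<forall>g\<in>F. shifted z g f = hinner H (\<iota> g) x)"
proof -
  obtain y h where yh: "(y, h) \<in> op" "dif h (hscale H (complex_of_real z) y) = x"
    using op_range[OF assms] by blast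
  then obtain f where f: "y = \<iota> f" "f \<in> F" "h \<in> hcarrier H" "\<forall>g\<in>F. t g f = hinner H (\<iota> g) h" by (auto simp: op_def)
  have "shifted z g f = hinner H (\<iota> g) x" if "g \<in> F" for g
    using f that unfolding yh(2)[symmetric] by (simp add: shifted_def E_dif E_scl scl_closed emb)
  then show ?thesis using resolvent_eqI[OF yh] assms f by auto
qed

text \<open>The equation (A - z) y = x is the fixed point equation y = R (x + s y) with R the
  inverse of A - z0 and s = z - z0. Since R has Lipschitz constant 1 / (m - z0), the map is a
  contraction with factor 1/2. This reaches a disc of complex z around the real z0.\<close>

lemma op_range_complex:
  assumes z0: "z0 < m" and z: "2 * cmod (z - complex_of_real z0) \<le> m - z0" and x: "x \<in> hcarrier H"
  shows "\<exists>y h. (y, h) \<in> op \<and> dif h (hscale H z y) = x"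
proof -
  define s where "s = z - complex_of_real z0"
  have "\<forall>x\<in>hcarrier H. \<exists>y h. (y, h) \<in> op \<and> dif h (hscale H (complex_of_real z0) y) = x"
    using op_range[OF z0] by blast
  then obtain R K where RK: "\<And>x. x \<in> hcarrier H \<Longrightarrow> (R x, K x) \<in> op \<and> dif (K x) (hscale H (complex_of_real z0) (R x)) = x"
    by metis
  have Rc: "R x \<in> hcarrier H" "K x \<in> hcarrier H" if "x \<in> hcarrier H" for x
    using RK[OF that] op_subset by auto
  \<comment> \<open>R is a mere choice of solutions, so its Lipschitz bound is derived from the
    estimate for differences of pairs in the graph.\<close>
  have R_bound: "(m - z0) * nrm (dif (R x) (R y)) \<le> nrm (dif x y)" if "x \<in> hcarrier H" "y \<in> hcarrier H" for x y
  proof -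
    have RKx: "(R x, K x) \<in> op" "(R y, K y) \<in> op" using RK that by auto
    show ?thesis
      using op_shift_bound[OF op_dif[OF RKx], of "complex_of_real z0"] z0 op_shift_dif[OF RKx, of "complex_of_real z0"] RK that by simp
  qed
  define \<Phi> where "\<Phi> y = R (hadd H x (hscale H s y))" for y
  have arg: "hadd H x (hscale H s y) \<in> hcarrier H" if "y \<in> hcarrier H" for y
    using that x by (simp add: add_closed scl_closed)
  have \<Phi>c: "\<Phi> y \<in> hcarrier H" if "y \<in> hcarrier H" for y
    unfolding \<Phi>_def using arg[OF that] by (rule Rc)
  have contr: "nrm (dif (\<Phi> u) (\<Phi> v)) \<le> nrm (dif u v) / 2" if uv: "u \<in> hcarrier H" "v \<in> hcarrier H" for u v
  proof -
    have "Q (dif (hadd H x (hscale H s u)) (hadd H x (hscale H s v))) = Q (hscale H s (dif u v))"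
      unfolding Q_def using uv x
      by (simp add: E_dif E_dif_left E_add E_add_left E_scl E_scl_left dif_closed add_closed scl_closed algebra_simps)
    then have "nrm (dif (hadd H x (hscale H s u)) (hadd H x (hscale H s v))) = cmod s * nrm (dif u v)"
      using nrm_scl[OF dif_closed[OF uv], of s] by (simp add: nrm_def)
    then have "(m - z0) * nrm (dif (\<Phi> u) (\<Phi> v)) \<le> cmod s * nrm (dif u v)"
      unfolding \<Phi>_def using R_bound[OF arg[OF uv(1)] arg[OF uv(2)]] by simp
    also have "\<dots> \<le> (m - z0) / 2 * nrm (dif u v)"
      using z nrm_nonneg[OF dif_closed[OF uv]] by (intro mult_right_mono) (auto simp: s_def)
    finally have "(m - z0) * nrm (dif (\<Phi> u) (\<Phi> v)) \<le> (m - z0) * (nrm (dif u v) / 2)" by simp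
    then show ?thesis using z0 by (subst (asm) mult_le_cancel_left_pos) auto
  qed
  define u where "u n = (\<Phi> ^^ n) x" for n
  have uc: "u n \<in> hcarrier H" for n by (induction n) (auto simp: u_def x \<Phi>c)
  have uS: "u (Suc n) = \<Phi> (u n)" for n by (simp add: u_def)
  define c where "c = nrm (dif (u 1) (u 0))"
  have c0: "c \<ge> 0" unfolding c_def using uc by (intro nrm_nonneg dif_closed)
  have step: "nrm (dif (u (Suc n)) (u n)) \<le> c * (1/2) ^ n" for n
  proof (induction n)
    case (Suc n)
    have "nrm (dif (u (Suc (Suc n))) (u (Suc n))) \<le> nrm (dif (u (Suc n)) (u n)) / 2"
      using contr[OF uc uc, of "Suc n" n] by (simp add: uS)
    then show ?case using Suc by simp
  qed (simp add: c_def)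
  have far: "nrm (dif (u (n + k)) (u n)) \<le> 2 * c * (1/2) ^ n" for n k
  proof (induction k arbitrary: n)
    case 0
    have "nrm (dif (u n) (u n)) = 0" using uc by (simp add: nrm_def Q_dif) (simp add: Q_def)
    then show ?case using c0 by simp
  next
    case (Suc k)
    have "nrm (dif (u (n + Suc k)) (u n)) \<le> nrm (dif (u (Suc n + k)) (u (Suc n))) + nrm (dif (u (Suc n)) (u n))"
      using nrm_dif_triangle[of "u (Suc n + k)" "u (Suc n)" "u n"] uc by simp
    also have "\<dots> \<le> 2 * c * (1/2) ^ Suc n + c * (1/2) ^ n" by (rule add_mono[OF Suc step])
    finally show ?case by simp
  qed
  have cauchy: "\<exists>N. \<forall>i\<ge>N. \<forall>j\<ge>N. Q (dif (u i) (u j)) < e" if "e > 0" for e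
  proof -
    have "(\<lambda>n. 4 * c * (1/2) ^ n) \<longlonglongrightarrow> 4 * c * 0" by (intro tendsto_intros LIMSEQ_realpow_zero) auto
    then obtain N where N: "4 * c * (1/2) ^ N < sqrt e"
      using order_tendstoD(2)[of _ 0 sequentially "sqrt e"] \<open>e > 0\<close> by (force simp: eventually_sequentially)
    have "Q (dif (u i) (u j)) < e" if "i \<ge> N" "j \<ge> N" for i j
    proof -
      have "nrm (dif (u i) (u j)) \<le> nrm (dif (u i) (u N)) + nrm (dif (u N) (u j))"
        by (rule nrm_dif_triangle[OF uc uc uc])
      also have "nrm (dif (u N) (u j)) = nrm (dif (u j) (u N))" by (rule nrm_dif_sym[OF uc uc])
      also have "nrm (dif (u i) (u N)) + nrm (dif (u j) (u N)) \<le> 2 * c * (1/2) ^ N + 2 * c * (1/2) ^ N"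
        using far[of N "i - N"] far[of N "j - N"] that by (intro add_mono) auto
      finally have "nrm (dif (u i) (u j)) < sqrt e" using N by simp
      then show ?thesis by (simp add: nrm_def)
    qed
    then show ?thesis by blast
  qed
  obtain y where y: "y \<in> hcarrier H" "(\<lambda>n. Q (dif (u n) y)) \<longlonglongrightarrow> 0"
    using complete uc cauchy unfolding complete_def by blast
  have lim: "(\<lambda>n. nrm (dif (u n) y)) \<longlonglongrightarrow> 0"
    using tendsto_real_sqrt[OF y(2)] by (simp add: nrm_def)
  have "nrm (dif y (\<Phi> y)) \<le> 0"
  proof (rule LIMSEQ_le[OF tendsto_const])
    have "(\<lambda>n. nrm (dif (u (Suc n)) y) + nrm (dif (u n) y) / 2) \<longlonglongrightarrow> 0 + 0 / 2"
      by (intro tendsto_intros LIMSEQ_Suc[OF lim] lim) auto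
    then show "(\<lambda>n. nrm (dif (u (Suc n)) y) + nrm (dif (u n) y) / 2) \<longlonglongrightarrow> 0" by simp
    have "nrm (dif y (\<Phi> y)) \<le> nrm (dif (u (Suc n)) y) + nrm (dif (u n) y) / 2" for n
    proof -
      have "nrm (dif y (\<Phi> y)) \<le> nrm (dif y (u (Suc n))) + nrm (dif (u (Suc n)) (\<Phi> y))"
        using y uc \<Phi>c by (intro nrm_dif_triangle)
      also have "nrm (dif y (u (Suc n))) = nrm (dif (u (Suc n)) y)" using y uc by (intro nrm_dif_sym)
      also have "nrm (dif (u (Suc n)) (\<Phi> y)) \<le> nrm (dif (u n) y) / 2"
        unfolding uS by (rule contr[OF uc y(1)])
      finally show ?thesis by simp
    qed
    then show "\<exists>N. \<forall>n\<ge>N. nrm (dif y (\<Phi> y)) \<le> nrm (dif (u (Suc n)) y) + nrm (dif (u n) y) / 2" by blast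
  qed
  then have "Q (dif y (\<Phi> y)) = 0"
    using Q_nonneg[OF dif_closed[OF y(1) \<Phi>c[OF y(1)]]] by (simp add: nrm_def)
  then have fix_y: "y = \<Phi> y" by (rule definite[OF y(1) \<Phi>c[OF y(1)]])
  define h where "h = K (hadd H x (hscale H s y))"
  have h: "(y, h) \<in> op" "dif h (hscale H (complex_of_real z0) y) = hadd H x (hscale H s y)"
    using RK[OF arg[OF y(1)]] fix_y by (auto simp: h_def \<Phi>_def)
  have hc: "h \<in> hcarrier H" using h(1) op_subset by auto
  have "dif h (hscale H z y) = x"
  proof (rule vec_eqI)
    fix w assume w: "w \<in> hcarrier H"
    have "hinner H w (dif h (hscale H (complex_of_real z0) y)) = hinner H w (hadd H x (hscale H s y))" using h(2) by simp
    then show "hinner H w (dif h (hscale H z y)) = hinner H w x"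
      using w hc y(1) x by (simp add: E_dif E_scl E_add scl_closed s_def algebra_simps)
  qed (use hc y(1) x in \<open>auto intro: dif_closed scl_closed\<close>)
  then show ?thesis using h(1) by blast
qed

text \<open>Existence is the contraction argument; uniqueness and the bound follow from
  \<open>op_shift_bound\<close>, since a z this close to z0 has real part below m.\<close>

lemma resolvent_set_op:
  assumes z0: "z0 < m" and z: "2 * cmod (z - complex_of_real z0) \<le> m - z0"
  shows "z \<in> resolvent_set H op"
proof -
  have Rez: "Re z < m"
    using z z0 complex_Re_le_cmod[of "z - complex_of_real z0"] by simp
  let ?R = "resolvent H op z"
  have ex: "\<exists>h. (?R x, h) \<in> op \<and> dif h (hscale H z (?R x)) = x" if "x \<in> hcarrier H" for x
    using op_range_complex[OF z0 z that] resolvent_eqI Rez by metis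
  have "\<exists>!f. \<exists>h. (f, h) \<in> op \<and> hdiff H h (hscale H z f) = g" if "g \<in> hcarrier H" for g
    unfolding hdiff_eq using ex[OF that] op_shift_inj[OF _ _ Rez] by blast
  moreover have "bounded_op H H ?R"
    unfolding bounded_op_def
  proof (intro conjI ballI allI)
    fix x assume x: "x \<in> hcarrier H"
    obtain h where h: "(?R x, h) \<in> op" "dif h (hscale H z (?R x)) = x" using ex[OF x] by blast
    have c: "?R x \<in> hcarrier H" "h \<in> hcarrier H" using h(1) op_subset by auto
    show "?R x \<in> hcarrier H" by (rule c)
    show "?R (hscale H c x) = hscale H c (?R x)" for c
    proof (rule resolvent_eqI[OF op_scl[OF h(1)] _ Rez])
      show "dif (hscale H c h) (hscale H z (hscale H c (?R x))) = hscale H c x"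
      proof (rule vec_eqI)
        fix w assume w: "w \<in> hcarrier H"
        have "hinner H w (hscale H c x) = c * hinner H w (dif h (hscale H z (?R x)))"
          unfolding h(2) using w x by (simp add: E_scl)
        then show "hinner H w (dif (hscale H c h) (hscale H z (hscale H c (?R x)))) = hinner H w (hscale H c x)"
          using \<open>?R x \<in> hcarrier H\<close> \<open>h \<in> hcarrier H\<close> w by (simp add: dif_closed scl_closed E_dif E_scl algebra_simps)
      qed (use \<open>?R x \<in> hcarrier H\<close> \<open>h \<in> hcarrier H\<close> x in \<open>auto intro!: dif_closed scl_closed\<close>)
    qed
    fix y assume y: "y \<in> hcarrier H"
    obtain k where k: "(?R y, k) \<in> op" "dif k (hscale H z (?R y)) = y" using ex[OF y] by blast
    have c': "?R y \<in> hcarrier H" "k \<in> hcarrier H" using k(1) op_subset by auto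
    show "?R (hadd H x y) = hadd H (?R x) (?R y)"
    proof (rule resolvent_eqI[OF op_add[OF h(1) k(1)] _ Rez])
      show "dif (hadd H h k) (hscale H z (hadd H (?R x) (?R y))) = hadd H x y"
      proof (rule vec_eqI)
        fix w assume w: "w \<in> hcarrier H"
        have "hinner H w (hadd H x y) = hinner H w (dif h (hscale H z (?R x))) + hinner H w (dif k (hscale H z (?R y)))"
          unfolding h(2) k(2) using w x y by (simp add: E_add)
        then show "hinner H w (dif (hadd H h k) (hscale H z (hadd H (?R x) (?R y)))) = hinner H w (hadd H x y)"
          using c c' w by (simp add: dif_closed scl_closed E_dif E_scl E_add add_closed algebra_simps)
      qed (use c c' x y in \<open>auto intro!: dif_closed scl_closed add_closed\<close>)
    qed
  next
    have "nrm (?R x) \<le> 1 / (m - Re z) * nrm x" if xH: "x \<in> hcarrier H" for x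
    proof -
      obtain h where h: "(?R x, h) \<in> op" "dif h (hscale H z (?R x)) = x" using ex[OF xH] by blast
      show ?thesis using op_shift_bound[OF h(1) Rez] h(2) Rez by (simp add: field_simps)
    qed
    then show "\<exists>C. \<forall>x\<in>hcarrier H. hnorm H (?R x) \<le> C * hnorm H x" unfolding hnorm_eq by blast
  qed
  ultimately show ?thesis by (simp add: resolvent_set_def)
qed

end

section \<open>Weighted square-integrable functions\<close>

lemma borel_measurable_cnj [measurable]:
  "f \<in> borel_measurable M \<Longrightarrow> (\<lambda>x. cnj (f x)) \<in> borel_measurable M"
  by (rule borel_measurable_continuous_on) (auto intro: continuous_intros)

lemma square_integrable_measurable: "square_integrable M f \<Longrightarrow> f \<in> borel_measurable M"
  by (simp add: square_integrable_def)

lemma square_integrable_mult: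
  assumes "square_integrable M f" "square_integrable M g"
  shows "integrable M (\<lambda>x. cnj (f x) * g x)" "integrable M (\<lambda>x. cmod (f x) * cmod (g x))"
proof -
  have [measurable]: "f \<in> borel_measurable M" "g \<in> borel_measurable M" using assms by (auto simp: square_integrable_def)
  have int: "integrable M (\<lambda>x. (cmod (f x))\<^sup>2 + (cmod (g x))\<^sup>2)"
    using assms by (auto simp: square_integrable_def)
  have le: "cmod (f x) * cmod (g x) \<le> (cmod (f x))\<^sup>2 + (cmod (g x))\<^sup>2" for x
  proof -
    have "2 * (cmod (f x) * cmod (g x)) \<le> (cmod (f x))\<^sup>2 + (cmod (g x))\<^sup>2"
      using sum_squares_bound[of "cmod (f x)" "cmod (g x)"] by simp
    moreover have "0 \<le> cmod (f x) * cmod (g x)" by simp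
    ultimately show ?thesis by linarith
  qed
  show "integrable M (\<lambda>x. cnj (f x) * g x)"
    by (rule Bochner_Integration.integrable_bound[OF int]) (use le in \<open>auto simp: norm_mult intro!: AE_I2\<close>)
  show "integrable M (\<lambda>x. cmod (f x) * cmod (g x))"
    by (rule Bochner_Integration.integrable_bound[OF int]) (use le in \<open>auto simp: norm_mult intro!: AE_I2\<close>)
qed

lemma square_integrable_if_le:
  assumes "square_integrable M g" "f \<in> borel_measurable M" "AE x in M. cmod (f x) \<le> C * cmod (g x)"
  shows "square_integrable M f"
  unfolding square_integrable_def
proof
  have int: "integrable M (\<lambda>x. C\<^sup>2 * (cmod (g x))\<^sup>2)" using assms by (simp add: square_integrable_def)
  show "integrable M (\<lambda>x. (cmod (f x))\<^sup>2)"
  proof (rule Bochner_Integration.integrable_bound[OF int])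
    show "AE x in M. norm ((cmod (f x))\<^sup>2) \<le> norm (C\<^sup>2 * (cmod (g x))\<^sup>2)"
      using assms(3)
    proof eventually_elim
      case (elim x)
      then have "(cmod (f x))\<^sup>2 \<le> (C * cmod (g x))\<^sup>2" by (intro power_mono) auto
      then show ?case by (simp add: power_mult_distrib)
    qed
  qed (use assms in simp)
qed fact

lemma square_integrable_scale:
  "square_integrable M f \<Longrightarrow> square_integrable M (\<lambda>x. c * f x)"
  by (rule square_integrable_if_le[where C="cmod c"]) (auto simp: norm_mult square_integrable_def)

lemma square_integrable_add:
  assumes "square_integrable M f" "square_integrable M g"
  shows "square_integrable M (\<lambda>x. f x + g x)"
  unfolding square_integrable_def
proof
  have [measurable]: "f \<in> borel_measurable M" "g \<in> borel_measurable M" using assms by (auto simp: square_integrable_def)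
  show "(\<lambda>x. f x + g x) \<in> borel_measurable M" by simp
  have int: "integrable M (\<lambda>x. 2 * (cmod (f x))\<^sup>2 + 2 * (cmod (g x))\<^sup>2)"
    using assms by (auto simp: square_integrable_def)
  have "(cmod (f x + g x))\<^sup>2 \<le> 2 * (cmod (f x))\<^sup>2 + 2 * (cmod (g x))\<^sup>2" for x
  proof -
    have "(cmod (f x + g x))\<^sup>2 \<le> (cmod (f x) + cmod (g x))\<^sup>2" by (intro power_mono norm_triangle_ineq) auto
    also have "\<dots> \<le> 2 * (cmod (f x))\<^sup>2 + 2 * (cmod (g x))\<^sup>2"
      using sum_squares_bound[of "cmod (f x)" "cmod (g x)"] by (simp add: power2_sum)
    finally show ?thesis .
  qed
  then show "integrable M (\<lambda>x. (cmod (f x + g x))\<^sup>2)"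
    by (intro Bochner_Integration.integrable_bound[OF int]) auto
qed

lemma square_integrable_diff:
  assumes "square_integrable M f" "square_integrable M g"
  shows "square_integrable M (\<lambda>x. f x - g x)"
  using square_integrable_add[OF assms(1) square_integrable_scale[OF assms(2), of "-1"]] by simp

lemma square_integrable_cong_AE:
  assumes "square_integrable M f" "g \<in> borel_measurable M" "AE x in M. g x = f x"
  shows "square_integrable M g"
  using assms(3) by (intro square_integrable_if_le[OF assms(1,2), of 1]) (auto elim: eventually_mono)

text \<open>Riesz--Fischer. Along a subsequence whose consecutive squared distances are below
  (1/4)^i, the series of 2^i |d i|^2 has finite integral; where it is finite, |d i| is at most a
  constant times the i-th power of the root of 1/2, so the telescoping series converges. By Fatou
  the pointwise limit is the L2 limit.\<close>

lemma square_integrable_complete: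
  assumes u: "\<And>n::nat. square_integrable M (u n)"
    and cauchy: "\<And>e. e > 0 \<Longrightarrow> \<exists>N. \<forall>j\<ge>N. \<forall>k\<ge>N. (LINT x|M. (cmod (u j x - u k x))\<^sup>2) < e"
  shows "\<exists>f. square_integrable M f \<and> (\<lambda>n. LINT x|M. (cmod (u n x - f x))\<^sup>2) \<longlonglongrightarrow> 0"
proof -
  have [measurable]: "u n \<in> borel_measurable M" for n using u by (simp add: square_integrable_def)
  have nn: "(\<integral>\<^sup>+x. ennreal ((cmod (u j x - u k x))\<^sup>2) \<partial>M) = ennreal (LINT x|M. (cmod (u j x - u k x))\<^sup>2)" for j k
    using square_integrable_diff[OF u u, of j k] by (intro nn_integral_eq_integral) (auto simp: square_integrable_def)
  have "\<exists>N. \<forall>j\<ge>N. \<forall>k\<ge>N. (LINT x|M. (cmod (u j x - u k x))\<^sup>2) < (1/4) ^ i" for i :: nat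
    by (rule cauchy) simp
  then obtain N where N: "\<And>i j k. j \<ge> N i \<Longrightarrow> k \<ge> N i \<Longrightarrow> (LINT x|M. (cmod (u j x - u k x))\<^sup>2) < (1/4) ^ i"
    by metis
  \<comment> \<open>The sum makes r monotone and at least N i; the summand i sends r to
    infinity.\<close>
  define r where "r i = (\<Sum>k\<le>i. N k) + i" for i
  have r: "r i \<ge> N i" "r (Suc i) \<ge> r i" "r i \<ge> i" for i
    using member_le_sum[of i "{..i}" N] by (auto simp: r_def)
  define d where "d i x = u (r (Suc i)) x - u (r i) x" for i x
  have [measurable]: "d i \<in> borel_measurable M" for i unfolding d_def[abs_def] by measurable
  have d_int: "(\<integral>\<^sup>+x. ennreal (2 ^ i * (cmod (d i x))\<^sup>2) \<partial>M) \<le> ennreal ((1/2) ^ i)" for i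
  proof -
    have "(\<integral>\<^sup>+x. ennreal (2 ^ i * (cmod (d i x))\<^sup>2) \<partial>M) = ennreal (2 ^ i) * (\<integral>\<^sup>+x. ennreal ((cmod (d i x))\<^sup>2) \<partial>M)"
      by (simp add: ennreal_mult nn_integral_cmult)
    also have "\<dots> = ennreal (2 ^ i * (LINT x|M. (cmod (d i x))\<^sup>2))"
      unfolding d_def nn by (subst ennreal_mult) (auto intro!: integral_nonneg_AE)
    also have "\<dots> \<le> ennreal (2 ^ i * (1/4) ^ i)"
      using N[of i "r (Suc i)" "r i"] r(1)[of i] r(2)[of i]
      unfolding d_def by (intro ennreal_leI mult_left_mono) auto
    also have "(2::real) ^ i * (1/4) ^ i = (1/2) ^ i" by (simp flip: power_mult_distrib)
    finally show ?thesis .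
  qed
  have "(\<integral>\<^sup>+x. (\<Sum>i. ennreal (2 ^ i * (cmod (d i x))\<^sup>2)) \<partial>M) = (\<Sum>i. \<integral>\<^sup>+x. ennreal (2 ^ i * (cmod (d i x))\<^sup>2) \<partial>M)"
    by (rule nn_integral_suminf) measurable
  also have "\<dots> \<le> (\<Sum>i. ennreal ((1/2) ^ i))" by (intro suminf_le d_int) auto
  also have "\<dots> = ennreal (\<Sum>i. (1/2) ^ i)" by (intro suminf_ennreal2) auto
  also have "\<dots> < \<infinity>" by simp
  finally have "(\<integral>\<^sup>+x. (\<Sum>i. ennreal (2 ^ i * (cmod (d i x))\<^sup>2)) \<partial>M) \<noteq> \<infinity>" by simp
  then have "AE x in M. (\<Sum>i. ennreal (2 ^ i * (cmod (d i x))\<^sup>2)) \<noteq> \<infinity>"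
    by (intro nn_integral_PInf_AE) measurable
  then have conv: "AE x in M. convergent (\<lambda>i. u (r i) x)"
  proof eventually_elim
    case (elim x)
    define C where "C = enn2real (\<Sum>i. ennreal (2 ^ i * (cmod (d i x))\<^sup>2))"
    have C: "(\<Sum>i. ennreal (2 ^ i * (cmod (d i x))\<^sup>2)) = ennreal C" "C \<ge> 0"
      using elim by (auto simp: C_def less_top)
    have "2 ^ i * (cmod (d i x))\<^sup>2 \<le> C" for i
    proof -
      have "(\<Sum>i\<in>{i}. ennreal (2 ^ i * (cmod (d i x))\<^sup>2)) \<le> (\<Sum>i. ennreal (2 ^ i * (cmod (d i x))\<^sup>2))"
        by (rule sum_le_suminf) auto
      then have "ennreal (2 ^ i * (cmod (d i x))\<^sup>2) \<le> (\<Sum>i. ennreal (2 ^ i * (cmod (d i x))\<^sup>2))" by simp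
      then show ?thesis using C by (simp add: ennreal_le_iff)
    qed
    then have "(cmod (d i x))\<^sup>2 \<le> C * (1/2) ^ i" for i
      by (simp add: power_one_over field_simps)
    then have "cmod (d i x) \<le> sqrt (C * (1/2) ^ i)" for i by (rule real_le_rsqrt)
    then have le: "cmod (d i x) \<le> sqrt C * (sqrt (1/2)) ^ i" for i
      by (simp add: real_sqrt_mult real_sqrt_power)
    have "summable (\<lambda>i. sqrt C * (sqrt (1/2)) ^ i)"
      by (intro summable_mult summable_geometric) (auto simp: real_less_lsqrt)
    then have "summable (\<lambda>i. d i x)"
      by (rule summable_comparison_test[rotated]) (use le in auto)
    then have "convergent (\<lambda>n. \<Sum>i<n. d i x)" by (simp add: summable_iff_convergent)
    moreover have "(\<Sum>i<n. d i x) = u (r n) x - u (r 0) x" for n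
      unfolding d_def by (rule sum_lessThan_telescope)
    ultimately have "convergent (\<lambda>n. u (r n) x - u (r 0) x)" by simp
    from convergent_add[OF this convergent_const[of "u (r 0) x"]]
    show ?case by simp
  qed
  define f where "f x = lim (\<lambda>i. u (r i) x)" for x
  have fm [measurable]: "f \<in> borel_measurable M" unfolding f_def[abs_def] by (rule borel_measurable_lim_metric) measurable
  \<comment> \<open>Fatou along the subsequence r turns a Cauchy bound beyond K into a bound for the
    distance to the limit.\<close>
  have bound: "(\<integral>\<^sup>+x. ennreal ((cmod (u n x - f x))\<^sup>2) \<partial>M) \<le> ennreal e"
    if K: "\<forall>j\<ge>K. \<forall>k\<ge>K. (LINT x|M. (cmod (u j x - u k x))\<^sup>2) < e" "n \<ge> K" for e K n
  proof -
    have "(\<integral>\<^sup>+x. ennreal ((cmod (u n x - f x))\<^sup>2) \<partial>M) = (\<integral>\<^sup>+x. liminf (\<lambda>i. ennreal ((cmod (u n x - u (r i) x))\<^sup>2)) \<partial>M)"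
    proof (rule nn_integral_cong_AE)
      show "AE x in M. ennreal ((cmod (u n x - f x))\<^sup>2) = liminf (\<lambda>i. ennreal ((cmod (u n x - u (r i) x))\<^sup>2))"
        using conv
      proof eventually_elim
        case (elim x)
        then have "(\<lambda>i. u (r i) x) \<longlonglongrightarrow> f x" unfolding f_def by (simp add: convergent_LIMSEQ_iff)
        then have "(\<lambda>i. ennreal ((cmod (u n x - u (r i) x))\<^sup>2)) \<longlonglongrightarrow> ennreal ((cmod (u n x - f x))\<^sup>2)"
          by (intro tendsto_intros)
        then show ?case using lim_imp_Liminf[OF sequentially_bot] by metis
      qed
    qed
    also have "\<dots> \<le> liminf (\<lambda>i. \<integral>\<^sup>+x. ennreal ((cmod (u n x - u (r i) x))\<^sup>2) \<partial>M)"
      by (rule nn_integral_liminf) measurable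
    also have "\<dots> \<le> ennreal e"
    proof (rule order_trans[OF Liminf_le_Limsup[OF sequentially_bot] Limsup_bounded])
      have "(\<integral>\<^sup>+x. ennreal ((cmod (u n x - u (r i) x))\<^sup>2) \<partial>M) \<le> ennreal e" if "i \<ge> K" for i
        using that r(3)[of i] \<open>n \<ge> K\<close> K unfolding nn by (intro ennreal_leI less_imp_le) auto
      then show "\<forall>\<^sub>F i in sequentially. (\<integral>\<^sup>+x. ennreal ((cmod (u n x - u (r i) x))\<^sup>2) \<partial>M) \<le> ennreal e"
        by (rule eventually_sequentiallyI)
    qed
    finally show ?thesis .
  qed
  have sq: "square_integrable M (\<lambda>x. u n x - f x)" if "\<forall>j\<ge>K. \<forall>k\<ge>K. (LINT x|M. (cmod (u j x - u k x))\<^sup>2) < e" "n \<ge> K" for e K n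
  proof -
    have "(\<integral>\<^sup>+x. ennreal ((cmod (u n x - f x))\<^sup>2) \<partial>M) < \<infinity>" using bound[OF that] by (simp add: le_less_trans)
    then show ?thesis unfolding square_integrable_def by (auto intro!: integrableI_nonneg)
  qed
  obtain K where K: "\<forall>j\<ge>K. \<forall>k\<ge>K. (LINT x|M. (cmod (u j x - u k x))\<^sup>2) < 1" using cauchy[of 1] by auto
  have "square_integrable M f"
    using square_integrable_diff[OF u[of K] sq[OF K order_refl]] by simp
  moreover have "(\<lambda>n. LINT x|M. (cmod (u n x - f x))\<^sup>2) \<longlonglongrightarrow> 0"
  proof (rule LIMSEQ_I)
    fix e :: real assume "e > 0"
    then obtain K where K: "\<forall>j\<ge>K. \<forall>k\<ge>K. (LINT x|M. (cmod (u j x - u k x))\<^sup>2) < e / 2" using cauchy[of "e/2"] by auto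
    have "norm ((LINT x|M. (cmod (u n x - f x))\<^sup>2) - 0) < e" if "n \<ge> K" for n
    proof -
      have "ennreal (LINT x|M. (cmod (u n x - f x))\<^sup>2) = (\<integral>\<^sup>+x. ennreal ((cmod (u n x - f x))\<^sup>2) \<partial>M)"
        using sq[OF K that] by (intro nn_integral_eq_integral[symmetric]) (auto simp: square_integrable_def)
      also have "\<dots> \<le> ennreal (e / 2)" by (rule bound[OF K that])
      finally show ?thesis using \<open>e > 0\<close> by (simp add: integral_nonneg_AE)
    qed
    then show "\<exists>no. \<forall>n\<ge>no. norm ((LINT x|M. (cmod (u n x - f x))\<^sup>2) - 0) < e" by blast
  qed
  ultimately show ?thesis by blast
qed

section \<open>Classes modulo null sets as vectors of \<open>L2_space\<close>\<close>

lemma ae_class_cong: "AE x in M. f x = g x \<Longrightarrow> ae_class M f = ae_class M g"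
  unfolding ae_class_def by (auto elim!: eventually_elim2)

lemma ae_rep_class:
  assumes "f \<in> borel_measurable M"
  shows "ae_rep (ae_class M f) \<in> borel_measurable M" "AE x in M. ae_rep (ae_class M f) x = f x"
proof -
  have "f \<in> ae_class M f" using assms by (simp add: ae_class_def)
  then have "ae_rep (ae_class M f) \<in> ae_class M f" unfolding ae_rep_def by (rule someI[of "\<lambda>h. h \<in> ae_class M f"])
  then show "ae_rep (ae_class M f) \<in> borel_measurable M" "AE x in M. ae_rep (ae_class M f) x = f x"
    by (auto simp: ae_class_def)
qed

lemma L2_carrierI: "square_integrable M f \<Longrightarrow> ae_class M f \<in> hcarrier (L2_space M)"
  by (simp add: L2_space_def)

lemma L2_carrierE:
  assumes "U \<in> hcarrier (L2_space M)"
  obtains f where "square_integrable M f" "U = ae_class M f"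
  using assms by (auto simp: L2_space_def)

lemma L2_add:
  assumes "f \<in> borel_measurable M" "g \<in> borel_measurable M"
  shows "hadd (L2_space M) (ae_class M f) (ae_class M g) = ae_class M (\<lambda>x. f x + g x)"
  unfolding L2_space_def hspace.simps
  by (rule ae_class_cong) (use ae_rep_class(2)[OF assms(1)] ae_rep_class(2)[OF assms(2)] in \<open>eventually_elim, simp\<close>)

lemma L2_scale:
  assumes "f \<in> borel_measurable M"
  shows "hscale (L2_space M) c (ae_class M f) = ae_class M (\<lambda>x. c * f x)"
  unfolding L2_space_def hspace.simps
  by (rule ae_class_cong) (use ae_rep_class(2)[OF assms(1)] in \<open>eventually_elim, simp\<close>)

lemma L2_inner:
  assumes "f \<in> borel_measurable M" "g \<in> borel_measurable M"
  shows "hinner (L2_space M) (ae_class M f) (ae_class M g) = (LINT x|M. cnj (f x) * g x)"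
  unfolding L2_space_def hspace.simps
proof (rule integral_cong_AE)
  show "AE x in M. cnj (ae_rep (ae_class M f) x) * ae_rep (ae_class M g) x = cnj (f x) * g x"
    using ae_rep_class(2)[OF assms(1)] ae_rep_class(2)[OF assms(2)] by eventually_elim simp
  have [measurable]: "f \<in> borel_measurable M" "g \<in> borel_measurable M"
    "ae_rep (ae_class M f) \<in> borel_measurable M" "ae_rep (ae_class M g) \<in> borel_measurable M"
    using assms ae_rep_class(1) by auto
  show "(\<lambda>x. cnj (ae_rep (ae_class M f) x) * ae_rep (ae_class M g) x) \<in> borel_measurable M"
    "(\<lambda>x. cnj (f x) * g x) \<in> borel_measurable M" by measurable
qed

lemma L2_diff:
  assumes "f \<in> borel_measurable M" "g \<in> borel_measurable M"
  shows "hdiff (L2_space M) (ae_class M f) (ae_class M g) = ae_class M (\<lambda>x. f x - g x)"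
  unfolding hdiff_def using assms by (simp add: L2_scale L2_add)

lemma L2_norm:
  assumes "f \<in> borel_measurable M"
  shows "hnorm (L2_space M) (ae_class M f) = sqrt (LINT x|M. (cmod (f x))\<^sup>2)"
proof -
  have "(LINT x|M. cnj (f x) * f x) = (LINT x|M. complex_of_real ((cmod (f x))\<^sup>2))"
    by (intro Bochner_Integration.integral_cong refl) (metis complex_norm_square mult.commute)
  also have "\<dots> = complex_of_real (LINT x|M. (cmod (f x))\<^sup>2)" by (rule integral_complex_of_real)
  finally show ?thesis by (simp add: hnorm_def L2_inner assms)
qed

lemma semi_inner_L2: "semi_inner (hcarrier (L2_space M)) (hadd (L2_space M)) (hscale (L2_space M)) (hinner (L2_space M))"
proof
  fix U V W and c :: complex
  assume U: "U \<in> hcarrier (L2_space M)"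
  obtain f where f: "square_integrable M f" "U = ae_class M f" using U by (rule L2_carrierE)
  note fm = square_integrable_measurable[OF f(1)]
  show "hscale (L2_space M) c U \<in> hcarrier (L2_space M)"
    using square_integrable_scale[OF f(1)] fm by (simp add: f L2_scale L2_carrierI)
  show "0 \<le> Re (hinner (L2_space M) U U)"
  proof -
    have "(LINT x|M. cnj (f x) * f x) = (LINT x|M. complex_of_real ((cmod (f x))\<^sup>2))"
      by (intro Bochner_Integration.integral_cong refl) (metis complex_norm_square mult.commute)
    also have "\<dots> = complex_of_real (LINT x|M. (cmod (f x))\<^sup>2)" by (rule integral_complex_of_real)
    finally show ?thesis by (simp add: f(2) L2_inner fm integral_nonneg_AE)
  qed
  assume V: "V \<in> hcarrier (L2_space M)"
  obtain g where g: "square_integrable M g" "V = ae_class M g" using V by (rule L2_carrierE)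
  note gm = square_integrable_measurable[OF g(1)]
  show "hadd (L2_space M) U V \<in> hcarrier (L2_space M)"
    using square_integrable_add[OF f(1) g(1)] fm gm by (simp add: f g L2_add L2_carrierI)
  show "hinner (L2_space M) U (hscale (L2_space M) c V) = c * hinner (L2_space M) U V"
    using fm gm square_integrable_mult(1)[OF f(1) g(1)]
    by (simp add: f g L2_inner L2_scale mult.left_commute[of _ c] square_integrable_scale square_integrable_measurable)
  show "cnj (hinner (L2_space M) U V) = hinner (L2_space M) V U"
  proof -
    have "cnj (LINT x|M. cnj (f x) * g x) = (LINT x|M. cnj (cnj (f x) * g x))"
      by (simp only: Bochner_Integration.integral_cnj)
    then show ?thesis by (simp add: f(2) g(2) L2_inner fm gm mult.commute)
  qed
  assume W: "W \<in> hcarrier (L2_space M)"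
  obtain h where h: "square_integrable M h" "W = ae_class M h" using W by (rule L2_carrierE)
  note hm = square_integrable_measurable[OF h(1)]
  show "hinner (L2_space M) U (hadd (L2_space M) V W) = hinner (L2_space M) U V + hinner (L2_space M) U W"
    using fm gm hm square_integrable_mult(1)[OF f(1) g(1)] square_integrable_mult(1)[OF f(1) h(1)]
    by (simp add: f g h L2_inner L2_add ring_distribs)
qed

lemma hilbert_L2: "hilbert (L2_space M)"
proof -
  interpret L: semi_inner "hcarrier (L2_space M)" "hadd (L2_space M)" "hscale (L2_space M)" "hinner (L2_space M)"
    by (rule semi_inner_L2)
  have Q: "L.Q (ae_class M f) = (LINT x|M. (cmod (f x))\<^sup>2)" if "square_integrable M f" for f
  proof -
    have "L.nrm (ae_class M f) = sqrt (LINT x|M. (cmod (f x))\<^sup>2)"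
      using L2_norm[OF square_integrable_measurable[OF that]] by (simp add: L.nrm_def L.Q_def hnorm_def)
    then show ?thesis by (simp add: L.nrm_def)
  qed
  have dif: "L.dif (ae_class M f) (ae_class M g) = ae_class M (\<lambda>x. f x - g x)" if "square_integrable M f" "square_integrable M g" for f g
    using L2_diff[OF that[THEN square_integrable_measurable]] by (simp add: L.dif_def hdiff_def)
  show ?thesis
  proof
    have "square_integrable M (\<lambda>x. 0)" by (simp add: square_integrable_def)
    then show "hcarrier (L2_space M) \<noteq> {}" using L2_carrierI by blast
    fix x y assume x: "x \<in> hcarrier (L2_space M)" and y: "y \<in> hcarrier (L2_space M)" and 0: "L.Q (L.dif x y) = 0"
    obtain f where f: "square_integrable M f" "x = ae_class M f" using x by (rule L2_carrierE)
    obtain g where g: "square_integrable M g" "y = ae_class M g" using y by (rule L2_carrierE)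
    have "(LINT x|M. (cmod (f x - g x))\<^sup>2) = 0"
      using 0 Q[OF square_integrable_diff[OF f(1) g(1)]] f g by (simp add: dif)
    then have "AE x in M. (cmod (f x - g x))\<^sup>2 = 0"
      using square_integrable_diff[OF f(1) g(1)] by (subst (asm) integral_nonneg_eq_0_iff_AE) (auto simp: square_integrable_def)
    then show "x = y" unfolding f g by (intro ae_class_cong) (auto elim: eventually_mono)
  next
    show "L.complete"
      unfolding L.complete_def
    proof (intro allI impI)
      fix U :: "nat \<Rightarrow> ('a \<Rightarrow> complex) set"
      assume "\<forall>n. U n \<in> hcarrier (L2_space M)" and cauchy: "\<forall>e>0. \<exists>N. \<forall>j\<ge>N. \<forall>k\<ge>N. L.Q (L.dif (U j) (U k)) < e"
      then have "\<forall>n. \<exists>f. square_integrable M f \<and> U n = ae_class M f" by (metis L2_carrierE)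
      then obtain u where u: "\<And>n. square_integrable M (u n)" "\<And>n. U n = ae_class M (u n)" by metis
      have QU: "L.Q (L.dif (ae_class M (u j)) (ae_class M f)) = (LINT x|M. (cmod (u j x - f x))\<^sup>2)" if "square_integrable M f" for j f
        using Q[OF square_integrable_diff[OF u(1) that]] dif[OF u(1) that] by simp
      have c: "\<exists>N. \<forall>j\<ge>N. \<forall>k\<ge>N. (LINT x|M. (cmod (u j x - u k x))\<^sup>2) < e" if "e > 0" for e
        using cauchy that unfolding u(2) QU[OF u(1)] by blast
      have "\<exists>f. square_integrable M f \<and> (\<lambda>n. LINT x|M. (cmod (u n x - f x))\<^sup>2) \<longlonglongrightarrow> 0"
        by (rule square_integrable_complete[OF u(1) c])
      then obtain f where f: "square_integrable M f" "(\<lambda>n. LINT x|M. (cmod (u n x - f x))\<^sup>2) \<longlonglongrightarrow> 0"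
        by blast
      then show "\<exists>f\<in>hcarrier (L2_space M). (\<lambda>n. L.Q (L.dif (U n) f)) \<longlonglongrightarrow> 0"
        using QU[OF f(1)] L2_carrierI[OF f(1)] u(2) by (intro bexI[of _ "ae_class M f"]) simp_all
    qed
  qed
qed

section \<open>Sturm--Liouville forms\<close>

lemma AC_loc_add:
  assumes "f \<in> AC_loc I" "g \<in> AC_loc I" "open I"
  shows "(\<lambda>x. f x + g x) \<in> AC_loc I" "AE x in lebesgue_on I. vderiv (\<lambda>x. f x + g x) x = vderiv f x + vderiv g x"
proof -
  have i: "(\<lambda>x. vderiv f x + vderiv g x) absolutely_integrable_on {c..d}" if "{c..d} \<subseteq> I" for c d
    using AC_loc_integrable[OF assms(1) that] AC_loc_integrable[OF assms(2) that] by (rule set_integral_add)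
  have h: "((\<lambda>x. vderiv f x + vderiv g x) has_integral (f d + g d - (f c + g c))) {c..d}" if "c \<le> d" "{c..d} \<subseteq> I" for c d
    using has_integral_add[OF AC_loc_has_integral[OF assms(1) that] AC_loc_has_integral[OF assms(2) that]]
    by (simp add: algebra_simps)
  show "(\<lambda>x. f x + g x) \<in> AC_loc I" "AE x in lebesgue_on I. vderiv (\<lambda>x. f x + g x) x = vderiv f x + vderiv g x"
    by (rule AC_loc_indefinite_integral[OF assms(3) i h]; assumption)+
qed

lemma AC_loc_scale:
  assumes "f \<in> AC_loc I" "open I"
  shows "(\<lambda>x. c * f x) \<in> AC_loc I" "AE x in lebesgue_on I. vderiv (\<lambda>x. c * f x) x = c * vderiv f x"
proof -
  have i: "(\<lambda>x. c * vderiv f x) absolutely_integrable_on {s..t}" if "{s..t} \<subseteq> I" for s t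
    using AC_loc_integrable[OF assms(1) that] by (intro set_integrable_mult_right) auto
  have h: "((\<lambda>x. c * vderiv f x) has_integral (c * f t - c * f s)) {s..t}" if "s \<le> t" "{s..t} \<subseteq> I" for s t
    using has_integral_mult_right[OF AC_loc_has_integral[OF assms(1) that], of c] by (simp add: algebra_simps)
  show "(\<lambda>x. c * f x) \<in> AC_loc I" "AE x in lebesgue_on I. vderiv (\<lambda>x. c * f x) x = c * vderiv f x"
    by (rule AC_loc_indefinite_integral[OF assms(2) i h]; assumption)+
qed

text \<open>On a compact interval the factors are bounded by A and B, so increments of the product
  are dominated by the integral of A |g'| + B |f'|. The product rule itself is pointwise, at the
  points where both factors are differentiable.\<close>

lemma AC_loc_mult:
  assumes f: "f \<in> AC_loc I" and g: "g \<in> AC_loc I" and I: "open I"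
  shows "(\<lambda>x. f x * g x) \<in> AC_loc I"
    and "AE x in lebesgue_on I. vderiv (\<lambda>x. f x * g x) x = vderiv f x * g x + f x * vderiv g x"
proof -
  show "(\<lambda>x. f x * g x) \<in> AC_loc I"
    unfolding AC_loc_def mem_Collect_eq
  proof (intro allI impI)
    fix c d assume cd: "{c..d} \<subseteq> I"
    have "continuous_on {c..d} f" "continuous_on {c..d} g"
      using AC_loc_continuous[OF f I] AC_loc_continuous[OF g I] cd continuous_on_subset by blast+
    then have "bounded (f ` {c..d})" "bounded (g ` {c..d})"
      by (meson compact_Icc compact_continuous_image compact_imp_bounded)+
    then obtain A B where AB: "\<And>x. x \<in> {c..d} \<Longrightarrow> cmod (f x) \<le> A" "\<And>x. x \<in> {c..d} \<Longrightarrow> cmod (g x) \<le> B" "A > 0" "B > 0"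
      by (metis bounded_pos imageI)
    have fi: "vderiv f absolutely_integrable_on {s..t}" and gi: "vderiv g absolutely_integrable_on {s..t}"
      if "c \<le> s" "t \<le> d" for s t
      using AC_loc_integrable f g cd that by (meson atLeastatMost_subset_iff order_trans)+
    have ki: "(\<lambda>x. A * cmod (vderiv g x) + B * cmod (vderiv f x)) absolutely_integrable_on {s..t}" if "c \<le> s" "t \<le> d" for s t
      using absolutely_integrable_norm[OF fi[OF that]] absolutely_integrable_norm[OF gi[OF that]]
      by (intro set_integral_add set_integrable_mult_right) (auto simp: o_def)
    show "abs_continuous_on_Icc c d (\<lambda>x. f x * g x)"
    proof (rule abs_continuous_on_Icc_if_dominated[OF ki[OF order_refl order_refl]])
      fix s t assume st: "c \<le> s" "s \<le> t" "t \<le> d"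
      then have sub: "{s..t} \<subseteq> I" using cd by auto
      have f1: "cmod (f t - f s) \<le> integral {s..t} (\<lambda>x. cmod (vderiv f x))"
        unfolding integral_unique[OF AC_loc_has_integral[OF f st(2) sub], symmetric]
        using fi[OF st(1,3)] by (intro integral_norm_bound_integral) (auto simp: absolutely_integrable_on_def)
      have g1: "cmod (g t - g s) \<le> integral {s..t} (\<lambda>x. cmod (vderiv g x))"
        unfolding integral_unique[OF AC_loc_has_integral[OF g st(2) sub], symmetric]
        using gi[OF st(1,3)] by (intro integral_norm_bound_integral) (auto simp: absolutely_integrable_on_def)
      have "f t * g t - f s * g s = f t * (g t - g s) + (f t - f s) * g s" by (simp add: algebra_simps)
      then have "cmod (f t * g t - f s * g s) \<le> cmod (f t) * cmod (g t - g s) + cmod (f t - f s) * cmod (g s)"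
        by (metis norm_mult norm_triangle_ineq)
      also have "\<dots> \<le> A * integral {s..t} (\<lambda>x. cmod (vderiv g x)) + integral {s..t} (\<lambda>x. cmod (vderiv f x)) * B"
        using AB(1)[of t] AB(2)[of s] st AB(3,4) f1 g1 norm_ge_zero[of "f t - f s"]
        by (intro add_mono mult_mono) (auto intro: order_trans[OF norm_ge_zero])
      also have "\<dots> = integral {s..t} (\<lambda>x. A * cmod (vderiv g x) + B * cmod (vderiv f x))"
        using fi[OF st(1,3)] gi[OF st(1,3)]
        by (subst Henstock_Kurzweil_Integration.integral_add) (auto simp: absolutely_integrable_on_def mult.commute intro!: integrable_on_mult_right)
      finally show "cmod (f t * g t - f s * g s) \<le> integral {s..t} (\<lambda>x. A * cmod (vderiv g x) + B * cmod (vderiv f x))" .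
    qed (use AB in auto)
  qed
  show "AE x in lebesgue_on I. vderiv (\<lambda>x. f x * g x) x = vderiv f x * g x + f x * vderiv g x"
    using AC_loc_AE_vector_derivative[OF f I] AC_loc_AE_vector_derivative[OF g I]
  proof eventually_elim
    case (elim x)
    have "((\<lambda>x. f x * g x) has_vector_derivative (f x * vderiv g x + vderiv f x * g x)) (at x)"
      by (rule has_vector_derivative_mult[OF elim])
    then show ?case by (subst vderiv_def) (simp add: vector_derivative_at)
  qed
qed

section \<open>Measurability and local Sobolev estimates\<close>

lemma borel_measurable_if_locally_integrable:
  fixes h :: "real \<Rightarrow> 'a::euclidean_space"
  assumes I: "open I" and h: "\<And>c d. {c..d} \<subseteq> I \<Longrightarrow> h absolutely_integrable_on {c..d}"
  shows "h \<in> borel_measurable (lebesgue_on I)"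
proof -
  obtain C where C: "countable C" "\<forall>(c,d)\<in>C. c < d \<and> {c..d} \<subseteq> I" "I = (\<Union>(c,d)\<in>C. {c<..<d})"
    using open_real_covering[OF I] by blast
  show ?thesis
  proof (rule measurable_piecewise_restrict[of "(\<lambda>(c,d). {c..d}) ` C"])
    show "countable ((\<lambda>(c,d). {c..d}) ` C)" using C by simp
    show "space (lebesgue_on I) \<subseteq> \<Union> ((\<lambda>(c,d). {c..d}) ` C)"
    proof
      fix x assume "x \<in> space (lebesgue_on I)"
      then have "x \<in> (\<Union>(c,d)\<in>C. {c<..<d})" using C(3) by simp
      then obtain c d where "(c,d) \<in> C" "x \<in> {c<..<d}" by auto
      then have "x \<in> {c..d}" by auto
      then show "x \<in> \<Union> ((\<lambda>(c,d). {c..d}) ` C)" using \<open>(c,d) \<in> C\<close> by force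
    qed
    fix \<Omega> assume "\<Omega> \<in> (\<lambda>(c,d). {c..d}) ` C"
    then obtain c d where cd: "\<Omega> = {c..d}" "{c..d} \<subseteq> I" using C(2) by auto
    have Iset: "I \<in> sets lebesgue" using I by auto
    have "{c..d} \<in> sets (lebesgue_on I)"
      using cd(2) Iset by (auto simp: sets_restrict_space_iff)
    then show "\<Omega> \<inter> space (lebesgue_on I) \<in> sets (lebesgue_on I)" using cd by (simp add: Int_absorb2)
    have "h \<in> borel_measurable (lebesgue_on {c..d})"
      using h[OF cd(2)] absolutely_integrable_measurable[of "{c..d}" h] by auto
    moreover have "restrict_space (lebesgue_on I) \<Omega> = lebesgue_on {c..d}"
      using cd Iset by (subst restrict_restrict_space) (auto simp: Int_absorb1)
    ultimately show "h \<in> borel_measurable (restrict_space (lebesgue_on I) \<Omega>)" by simp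
  qed
qed

lemma AC_loc_measurable:
  assumes "f \<in> AC_loc I" "open I"
  shows "f \<in> borel_measurable (lebesgue_on I)" "vderiv f \<in> borel_measurable (lebesgue_on I)"
proof -
  show "f \<in> borel_measurable (lebesgue_on I)"
    using AC_loc_continuous[OF assms] assms(2) by (intro continuous_imp_measurable_on_sets_lebesgue) auto
  show "vderiv f \<in> borel_measurable (lebesgue_on I)"
    by (rule borel_measurable_if_locally_integrable[OF assms(2) AC_loc_integrable[OF assms(1)]])
qed

text \<open>The set where f and g differ is open and negligible, hence empty.\<close>

lemma AE_eq_continuous_open:
  fixes f g :: "real \<Rightarrow> complex"
  assumes "open I" "continuous_on I f" "continuous_on I g" "AE x in lebesgue_on I. f x = g x" "x \<in> I"
  shows "f x = g x"
proof (rule ccontr)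
  assume ne: "f x \<noteq> g x"
  let ?U = "{y \<in> I. f y - g y \<noteq> 0}"
  have U: "open ?U"
    using assms(1-3) continuous_open_preimage[of I "\<lambda>y. f y - g y" "- {0}"]
    by (auto simp: vimage_def Int_def intro: continuous_intros)
  have "AE x in lebesgue. x \<notin> ?U"
    using assms(1,4) by (auto simp: AE_restrict_space_iff elim!: eventually_mono)
  then have "negligible ?U" using U by (simp add: AE_iff_null_sets negligible_iff_null_sets)
  then have "?U = {}" using U open_not_negligible by blast
  then show False using assms(5) ne by auto
qed

text \<open>Near the end points the cell \<open>[k, k + 1) \<inter> I\<close> may be arbitrarily short, hence the estimate
  uses an interval of fixed length in \<open>I\<close> that need not lie in the cell.\<close>

lemma sobolev_interval:
  assumes f: "f \<in> AC_loc I" and L: "0 < L" "L \<le> 1" "{c..c+L} \<subseteq> I" and x: "x \<in> {c..c+L}"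
    and f2: "(\<lambda>x. (cmod (vderiv f x))\<^sup>2) absolutely_integrable_on {c..c+L}" and I: "open I"
  shows "L * (cmod (f x))\<^sup>2 \<le> 2 * integral {c..c+L} (\<lambda>y. (cmod (f y))\<^sup>2 + (cmod (vderiv f y))\<^sup>2)"
proof -
  let ?J = "{c..c+L}"
  define D where "D = integral ?J (\<lambda>y. cmod (vderiv f y))"
  define D2 where "D2 = integral ?J (\<lambda>y. (cmod (vderiv f y))\<^sup>2)"
  have fi: "vderiv f absolutely_integrable_on ?J" using f L(3) by (rule AC_loc_integrable)
  then have fin: "(\<lambda>y. cmod (vderiv f y)) integrable_on ?J" by (simp add: absolutely_integrable_on_def)
  have f2i: "(\<lambda>y. (cmod (vderiv f y))\<^sup>2) integrable_on ?J" using f2 by (simp add: absolutely_integrable_on_def)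
  have contf: "continuous_on ?J f" using AC_loc_continuous[OF f I] L(3) continuous_on_subset by blast
  \<comment> \<open>Cauchy--Schwarz on the interval, read off from the integral of the square of
    |f'| minus its mean D / L.\<close>
  have cs: "D\<^sup>2 \<le> L * D2"
  proof -
    have "0 \<le> integral ?J (\<lambda>y. (cmod (vderiv f y) - D / L)\<^sup>2)"
    proof (rule integral_nonneg)
      show "(\<lambda>y. (cmod (vderiv f y) - D / L)\<^sup>2) integrable_on ?J"
        unfolding power2_diff using fin f2i
        by (intro integrable_add integrable_diff integrable_on_mult_left integrable_on_mult_right integrable_const_ivl) auto
    qed simp
    also have "integral ?J (\<lambda>y. (cmod (vderiv f y) - D / L)\<^sup>2) =
       integral ?J (\<lambda>y. ((cmod (vderiv f y))\<^sup>2 + (D / L)\<^sup>2) - 2 * (D / L) * cmod (vderiv f y))"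
      by (intro integral_cong) (simp add: power2_diff)
    also have "\<dots> = (D2 + L * (D / L)\<^sup>2) - 2 * (D / L) * D"
    proof (rule integral_unique, intro has_integral_diff has_integral_add has_integral_mult_right)
      show "((\<lambda>y. (cmod (vderiv f y))\<^sup>2) has_integral D2) ?J" "((\<lambda>y. cmod (vderiv f y)) has_integral D) ?J"
        using fin f2i by (auto simp: D_def D2_def integrable_integral)
      show "((\<lambda>y. (D / L)\<^sup>2) has_integral L * (D / L)\<^sup>2) ?J"
        using has_integral_const_real[of "(D / L)\<^sup>2" c "c + L"] L by simp
    qed
    also have "\<dots> = D2 - D\<^sup>2 / L" using L by (simp add: power2_eq_square field_simps)
    finally show ?thesis using L by (simp add: field_simps)
  qed
  \<comment> \<open>x is compared with an arbitrary y; integrating the inequality over y then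
    replaces the value at y by the integral of |f|^2.\<close>
  have pt: "(cmod (f x))\<^sup>2 \<le> 2 * (cmod (f y))\<^sup>2 + 2 * D\<^sup>2" if y: "y \<in> ?J" for y
  proof -
    have *: "cmod (f t - f s) \<le> D" if "s \<le> t" "s \<in> ?J" "t \<in> ?J" for s t
    proof -
      have sub: "{s..t} \<subseteq> ?J" using that by auto
      then have "{s..t} \<subseteq> I" using L by auto
      have "(\<lambda>y. cmod (vderiv f y)) integrable_on {s..t}" using fin sub by (rule integrable_on_subinterval)
      then have "cmod (f t - f s) \<le> integral {s..t} (\<lambda>x. cmod (vderiv f x))"
        unfolding integral_unique[OF AC_loc_has_integral[OF f that(1) \<open>{s..t} \<subseteq> I\<close>], symmetric]
        using AC_loc_integrable[OF f \<open>{s..t} \<subseteq> I\<close>] by (intro integral_norm_bound_integral) (auto simp: absolutely_integrable_on_def)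
      also have "\<dots> \<le> D" unfolding D_def
        using sub \<open>(\<lambda>y. cmod (vderiv f y)) integrable_on {s..t}\<close> fin by (intro integral_subset_le) auto
      finally show ?thesis .
    qed
    have "cmod (f x - f y) \<le> D" using *[of x y] *[of y x] x y by (cases "x \<le> y") (auto simp: norm_minus_commute)
    then have "cmod (f x) \<le> cmod (f y) + D" using norm_triangle_ineq2[of "f x" "f y"] by simp
    then have "(cmod (f x))\<^sup>2 \<le> (cmod (f y) + D)\<^sup>2" by (intro power_mono) auto
    also have "\<dots> \<le> 2 * (cmod (f y))\<^sup>2 + 2 * D\<^sup>2"
      using sum_squares_bound[of "cmod (f y)" D] by (simp add: power2_sum)
    finally show ?thesis .
  qed
  have fsq: "(\<lambda>y. (cmod (f y))\<^sup>2) integrable_on ?J"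
    by (intro integrable_continuous_real continuous_intros contf)
  have "L * (cmod (f x))\<^sup>2 = integral ?J (\<lambda>y. (cmod (f x))\<^sup>2)" using L by simp
  also have "\<dots> \<le> integral ?J (\<lambda>y. 2 * (cmod (f y))\<^sup>2 + 2 * D\<^sup>2)"
    using fsq pt by (intro integral_le integrable_add integrable_on_mult_right) auto
  also have "\<dots> = 2 * integral ?J (\<lambda>y. (cmod (f y))\<^sup>2) + L * (2 * D\<^sup>2)"
    using fsq L by (subst Henstock_Kurzweil_Integration.integral_add) (auto intro!: integrable_on_mult_right)
  also have "\<dots> \<le> 2 * integral ?J (\<lambda>y. (cmod (f y))\<^sup>2) + 2 * D2"
  proof -
    have D2: "0 \<le> D2" unfolding D2_def by (rule integral_nonneg[OF f2i]) auto
    have "L * D\<^sup>2 \<le> 1 * D\<^sup>2" using L by (intro mult_right_mono) auto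
    also have "1 * D\<^sup>2 \<le> 1 * D2" using cs mult_right_mono[OF L(2) D2] by simp
    finally show ?thesis by simp
  qed
  also have "\<dots> = 2 * integral ?J (\<lambda>y. (cmod (f y))\<^sup>2 + (cmod (vderiv f y))\<^sup>2)"
    using fsq f2i by (simp add: Henstock_Kurzweil_Integration.integral_add D2_def)
  finally show ?thesis .
qed

text \<open>Integer cells are enumerated by \<open>int_decode\<close>, because series run over
  natural numbers. The shift j allows a window of three neighbouring cells to be counted as three
  such series.\<close>

lemma suminf_indicator_unit_cells:
  "(\<Sum>n. indicator {real_of_int (int_decode n + j)..<real_of_int (int_decode n + j) + 1} x) = (1::ennreal)"
proof -
  define n0 where "n0 = int_encode (\<lfloor>x\<rfloor> - j)"
  let ?f = "\<lambda>n. indicator {real_of_int (int_decode n + j)..<real_of_int (int_decode n + j) + 1} x :: ennreal"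
  have "?f n = 0" if "n \<notin> {n0}" for n
  proof (rule ccontr)
    assume "?f n \<noteq> 0"
    then have "real_of_int (int_decode n + j) \<le> x" "x < real_of_int (int_decode n + j) + 1"
      by (auto simp: indicator_def split: if_splits)
    then have "\<lfloor>x\<rfloor> = int_decode n + j" by (simp add: floor_eq_iff)
    then have "n = n0" by (simp add: n0_def)
    then show False using that by simp
  qed
  then have "(\<Sum>n. ?f n) = (\<Sum>n\<in>{n0}. ?f n)" by (intro suminf_finite) auto
  also have "\<dots> = 1" by (simp add: n0_def)
  finally show ?thesis .
qed

lemma unif_loc_norm_cell:
  assumes "I \<in> sets lebesgue" "unif_loc_norm I r \<le> B"
  shows "(\<integral>\<^sup>+x. ennreal \<bar>r x\<bar> * indicator {real_of_int k..<real_of_int k + 1} x \<partial>lebesgue_on I) \<le> B"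
proof -
  have "(\<integral>\<^sup>+x. ennreal \<bar>r x\<bar> * indicator {real_of_int k..<real_of_int k + 1} x \<partial>lebesgue_on I) =
    (\<integral>\<^sup>+x\<in>{real_of_int k..<real_of_int k + 1} \<inter> I. ennreal \<bar>r x\<bar> \<partial>lebesgue)"
    using assms(1) by (subst nn_integral_restrict_space) (auto simp: indicator_inter_arith mult.assoc)
  also have "\<dots> \<le> unif_loc_norm I r"
    unfolding unif_loc_norm_def by (rule SUP_upper) simp
  finally show ?thesis using assms(2) by simp
qed

text \<open>On the cell k the hypothesis bounds \<phi> by C times the energy of the cells k - 1, k,
  k + 1, while the integral of |r| over the cell is at most B. Summing over k counts the energy of
  every cell three times.\<close>

lemma nn_integral_potential_le:
  fixes E :: "real \<Rightarrow> ennreal"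
  assumes I: "I \<in> sets lebesgue" and r [measurable]: "r \<in> borel_measurable (lebesgue_on I)"
    and B: "unif_loc_norm I r \<le> B"
    and E [measurable]: "E \<in> borel_measurable (lebesgue_on I)" and [measurable]: "\<phi> \<in> borel_measurable (lebesgue_on I)"
    and \<phi>: "\<And>x. x \<in> I \<Longrightarrow> \<phi> x \<le> C * (\<integral>\<^sup>+y. E y * indicator {real_of_int \<lfloor>x\<rfloor> - 1..<real_of_int \<lfloor>x\<rfloor> + 2} y \<partial>lebesgue_on I)"
  shows "(\<integral>\<^sup>+x. ennreal \<bar>r x\<bar> * \<phi> x \<partial>lebesgue_on I) \<le> 3 * C * B * (\<integral>\<^sup>+x. E x \<partial>lebesgue_on I)"
proof -
  let ?M = "lebesgue_on I"
  define cell where "cell k = {real_of_int k..<real_of_int k + 1}" for k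
  define G where "G k = (\<integral>\<^sup>+y. E y * indicator {real_of_int k - 1..<real_of_int k + 2} y \<partial>?M)" for k
  have ind [measurable]: "indicator A \<in> borel_measurable ?M" if "A \<in> sets borel" for A :: "real set"
    using that by (intro measurable_restrict_space1 borel_measurable_indicator) simp
  have ind' [measurable]: "(\<lambda>x. indicator A x :: ennreal) \<in> borel_measurable ?M" if "A \<in> sets borel" for A :: "real set"
    using that by (intro measurable_restrict_space1 borel_measurable_indicator) simp
  have [measurable]: "cell k \<in> sets borel" for k by (simp add: cell_def)
  have one: "(\<Sum>n. indicator (cell (int_decode n + j)) x) = (1::ennreal)" for x j
    unfolding cell_def by (rule suminf_indicator_unit_cells)
  have "(\<integral>\<^sup>+x. ennreal \<bar>r x\<bar> * \<phi> x \<partial>?M) = (\<integral>\<^sup>+x. (\<Sum>n. ennreal \<bar>r x\<bar> * \<phi> x * indicator (cell (int_decode n)) x) \<partial>?M)"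
    using one[of 0] by (intro nn_integral_cong) (simp add: ennreal_suminf_cmult)
  also have "\<dots> = (\<Sum>n. \<integral>\<^sup>+x. ennreal \<bar>r x\<bar> * \<phi> x * indicator (cell (int_decode n)) x \<partial>?M)"
    by (rule nn_integral_suminf) measurable
  also have "\<dots> \<le> (\<Sum>n. C * B * G (int_decode n))"
  proof (rule suminf_le)
    fix n
    let ?k = "int_decode n"
    have "(\<integral>\<^sup>+x. ennreal \<bar>r x\<bar> * \<phi> x * indicator (cell ?k) x \<partial>?M) \<le> (\<integral>\<^sup>+x. (C * G ?k) * (ennreal \<bar>r x\<bar> * indicator (cell ?k) x) \<partial>?M)"
    proof (rule nn_integral_mono)
      fix x assume "x \<in> space ?M"
      then have x: "x \<in> I" by simp
      show "ennreal \<bar>r x\<bar> * \<phi> x * indicator (cell ?k) x \<le> (C * G ?k) * (ennreal \<bar>r x\<bar> * indicator (cell ?k) x)"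
      proof (cases "x \<in> cell ?k")
        case True
        then have "\<lfloor>x\<rfloor> = ?k" by (auto simp: cell_def floor_eq_iff)
        then have "\<phi> x \<le> C * G ?k" using \<phi>[OF x] by (simp add: G_def)
        then show ?thesis using True mult_left_mono[of "\<phi> x" "C * G ?k" "ennreal \<bar>r x\<bar>"] by (simp add: mult.commute)
      qed simp
    qed
    also have "\<dots> = (C * G ?k) * (\<integral>\<^sup>+x. ennreal \<bar>r x\<bar> * indicator (cell ?k) x \<partial>?M)"
      by (rule nn_integral_cmult) measurable
    also have "\<dots> \<le> (C * G ?k) * B"
      unfolding cell_def by (intro mult_left_mono unif_loc_norm_cell[OF I B]) simp
    finally show "(\<integral>\<^sup>+x. ennreal \<bar>r x\<bar> * \<phi> x * indicator (cell ?k) x \<partial>?M) \<le> C * B * G ?k" by (simp add: mult_ac)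
  qed auto
  also have "\<dots> = C * B * (\<Sum>n. G (int_decode n))" by (rule ennreal_suminf_cmult)
  also have "(\<Sum>n. G (int_decode n)) = (\<integral>\<^sup>+y. (\<Sum>n. E y * indicator {real_of_int (int_decode n) - 1..<real_of_int (int_decode n) + 2} y) \<partial>?M)"
    unfolding G_def by (rule nn_integral_suminf[symmetric]) measurable
  also have "\<dots> = (\<integral>\<^sup>+y. 3 * E y \<partial>?M)"
  proof (rule nn_integral_cong)
    fix y
    have "(\<Sum>n. E y * indicator {real_of_int (int_decode n) - 1..<real_of_int (int_decode n) + 2} y) =
       E y * (\<Sum>n. indicator (cell (int_decode n + -1)) y + indicator (cell (int_decode n + 0)) y + indicator (cell (int_decode n + 1)) y)"
      unfolding ennreal_suminf_cmult[symmetric] by (intro suminf_cong) (auto simp: cell_def indicator_def)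
    also have "\<dots> = E y * (1 + 1 + 1)"
      by (subst suminf_add[symmetric], simp, simp, subst suminf_add[symmetric], simp, simp) (simp only: one)
    finally show "(\<Sum>n. E y * indicator {real_of_int (int_decode n) - 1..<real_of_int (int_decode n) + 2} y) = 3 * E y"
      by (simp add: mult.commute)
  qed
  also have "\<dots> = 3 * (\<integral>\<^sup>+y. E y \<partial>?M)" by (rule nn_integral_cmult) measurable
  finally show ?thesis by (simp add: mult_ac)
qed

section \<open>Coefficient triples and the weighted energy\<close>

lemma L1_loc_measurable:
  assumes "h \<in> L1_loc I" "open I"
  shows "h \<in> borel_measurable (lebesgue_on I)"
  by (rule borel_measurable_if_locally_integrable[OF assms(2)]) (use assms(1) in \<open>auto simp: L1_loc_def\<close>)

lemma integrable_imp_absolutely_integrable_subinterval: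
  fixes f :: "real \<Rightarrow> 'a::euclidean_space"
  assumes "integrable (lebesgue_on I) f" "I \<in> sets lebesgue" "{c..d} \<subseteq> I"
  shows "f absolutely_integrable_on {c..d}"
proof -
  have "f absolutely_integrable_on I"
    using assms(1,2) by (simp add: integrable_restrict_space set_integrable_def)
  then show ?thesis using assms(3) by (rule absolutely_integrable_on_subinterval)
qed

lemma nn_integral_subinterval:
  fixes f :: "real \<Rightarrow> real"
  assumes "f absolutely_integrable_on {c..d}" "\<And>x. 0 \<le> f x" "{c..d} \<subseteq> I" "I \<in> sets lebesgue"
  shows "(\<integral>\<^sup>+x. ennreal (f x) * indicator {c..d} x \<partial>lebesgue_on I) = ennreal (integral {c..d} f)"
proof -
  have i: "integrable (lebesgue_on {c..d}) f"
    using assms(1) by (simp add: integrable_restrict_space set_integrable_def)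
  have "(\<integral>\<^sup>+x. ennreal (f x) * indicator {c..d} x \<partial>lebesgue_on I) = (\<integral>\<^sup>+x. ennreal (f x) * indicator {c..d} x * indicator I x \<partial>lebesgue)"
    using assms(4) by (intro nn_integral_restrict_space) auto
  also have "\<dots> = (\<integral>\<^sup>+x. ennreal (f x) * indicator {c..d} x \<partial>lebesgue)"
    using assms(3) by (intro nn_integral_cong) (auto simp: indicator_def)
  also have "\<dots> = (\<integral>\<^sup>+x. ennreal (f x) \<partial>lebesgue_on {c..d})"
    by (intro nn_integral_restrict_space[symmetric]) auto
  also have "\<dots> = ennreal (LINT x|lebesgue_on {c..d}. f x)"
    using i assms(2) by (intro nn_integral_eq_integral) auto
  also have "(LINT x|lebesgue_on {c..d}. f x) = integral {c..d} f"
    using i by (intro lebesgue_integral_eq_integral) auto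
  finally show ?thesis .
qed

text \<open>\<gamma> and \<delta> are parameters rather than existentially quantified constants, so
  that bounds computed from them can be compared between different triples.\<close>

locale sl_data =
  fixes a b :: ereal and I :: "real set" and w p q :: "real \<Rightarrow> real" and \<gamma> \<delta> :: real
  assumes ab: "a < b" and I_eq: "I = einterval a b"
    and coeffs: "sl_coeffs I w p q"
    and \<delta>_pos: "\<delta> > 0" and wp_ge: "AE x in lebesgue_on I. w x \<ge> \<delta> \<and> p x \<ge> \<delta>"
    and q_fin: "unif_loc_norm I q < \<infinity>"
    and q_ge: "AE x in lebesgue_on I. q x \<ge> \<gamma>"
begin

abbreviation "M \<equiv> lebesgue_on I"

definition W :: "(real \<Rightarrow> complex) \<Rightarrow> real" where
  "W f = (LINT x|M. w x * (cmod (f x))\<^sup>2 + p x * (cmod (vderiv f x))\<^sup>2)"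

lemma open_I: "open I" by (simp add: I_eq)

lemma I_sets: "I \<in> sets lebesgue" using open_I by auto

lemma Icc_subset_I: "c \<in> I \<Longrightarrow> d \<in> I \<Longrightarrow> {c..d} \<subseteq> I"
  unfolding I_eq einterval_def
  by auto (meson ereal_less_eq(3) less_le_trans order.strict_trans2 order_le_less_trans)+

lemma w_meas [measurable]: "w \<in> borel_measurable M"
  and p_meas [measurable]: "p \<in> borel_measurable M"
  and q_meas [measurable]: "q \<in> borel_measurable M"
proof -
  have "(\<lambda>x. 1 / p x) \<in> borel_measurable M" using coeffs L1_loc_measurable[OF _ open_I] by (simp add: sl_coeffs_def)
  \<comment> \<open>With division by zero equal to 0, 1 / (1 / p x) is p x at every point, also
    where p vanishes.\<close>
  then have "(\<lambda>x. 1 / (1 / p x)) \<in> borel_measurable M" by measurable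
  then show "p \<in> borel_measurable M" by simp
qed (use coeffs L1_loc_measurable[OF _ open_I] in \<open>auto simp: sl_coeffs_def\<close>)

lemma w_pos: "AE x in M. 0 < w x" and p_pos: "AE x in M. 0 < p x"
  using \<delta>_pos by (rule_tac [!] eventually_mono[OF wp_ge]) linarith+

lemma AE_weighted: "(AE x in weighted I w. P x) \<longleftrightarrow> (AE x in M. P x)"
proof -
  have "(AE x in weighted I w. P x) \<longleftrightarrow> (AE x in M. 0 < ennreal (w x) \<longrightarrow> P x)"
    unfolding weighted_def by (rule AE_density) measurable
  also have "\<dots> \<longleftrightarrow> (AE x in M. P x)"
    using w_pos by (auto elim!: eventually_elim2)
  finally show ?thesis .
qed

lemma measurable_weighted [simp]: "borel_measurable (weighted I w) = borel_measurable M"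
  unfolding weighted_def by (rule measurable_cong_sets) auto

text \<open>Positivity of w almost everywhere makes the classes independent of w. This is why the
  identification maps can be taken as the identity on classes.\<close>

lemma ae_class_weighted: "ae_class (weighted I w) f = ae_class M f"
  by (simp add: ae_class_def AE_weighted)

lemma w_nonneg: "AE x in M. 0 \<le> w x" and p_nonneg: "AE x in M. 0 \<le> p x"
  by (rule eventually_mono[OF w_pos], simp) (rule eventually_mono[OF p_pos], simp)

lemma integral_weighted:
  fixes f :: "real \<Rightarrow> 'c::{banach, second_countable_topology}"
  assumes "f \<in> borel_measurable M"
  shows "(LINT x|weighted I w. f x) = (LINT x|M. w x *\<^sub>R f x)"
    and "integrable (weighted I w) f \<longleftrightarrow> integrable M (\<lambda>x. w x *\<^sub>R f x)"
  unfolding weighted_def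
  by (rule integral_density[OF assms w_meas w_nonneg], rule integrable_density[OF assms w_meas w_nonneg])

lemma square_integrable_weighted:
  "square_integrable (weighted I w) f \<longleftrightarrow> f \<in> borel_measurable M \<and> integrable M (\<lambda>x. w x * (cmod (f x))\<^sup>2)"
  unfolding square_integrable_def by (auto simp: integral_weighted(2))

lemma square_integrable_sqrt_p:
  assumes "f \<in> borel_measurable M"
  shows "square_integrable M (\<lambda>x. complex_of_real (sqrt (p x)) * f x) \<longleftrightarrow> integrable M (\<lambda>x. p x * (cmod (f x))\<^sup>2)"
proof -
  have [measurable]: "f \<in> borel_measurable M" by fact
  have "integrable M (\<lambda>x. (cmod (complex_of_real (sqrt (p x)) * f x))\<^sup>2) \<longleftrightarrow> integrable M (\<lambda>x. p x * (cmod (f x))\<^sup>2)"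
  proof (rule integrable_cong_AE)
    show "AE x in M. (cmod (complex_of_real (sqrt (p x)) * f x))\<^sup>2 = p x * (cmod (f x))\<^sup>2"
      using p_nonneg by eventually_elim (simp add: norm_mult power_mult_distrib)
  qed measurable
  then show ?thesis by (simp add: square_integrable_def)
qed

lemma dom_A_plus_iff:
  "f \<in> dom_A_plus I w p \<longleftrightarrow> f \<in> AC_loc I \<and> integrable M (\<lambda>x. w x * (cmod (f x))\<^sup>2) \<and>
     integrable M (\<lambda>x. p x * (cmod (vderiv f x))\<^sup>2)"
  using AC_loc_measurable[OF _ open_I] square_integrable_sqrt_p
  by (auto simp: dom_A_plus_def square_integrable_weighted)

lemma dom_measurable:
  assumes "f \<in> dom_A_plus I w p"
  shows "f \<in> borel_measurable M" "vderiv f \<in> borel_measurable M"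
  using AC_loc_measurable[OF _ open_I] assms by (auto simp: dom_A_plus_iff)

lemma dom_integrable:
  assumes "f \<in> dom_A_plus I w p"
  shows "integrable M (\<lambda>x. (cmod (f x))\<^sup>2 + (cmod (vderiv f x))\<^sup>2)"
    and "(LINT x|M. (cmod (f x))\<^sup>2 + (cmod (vderiv f x))\<^sup>2) \<le> W f / \<delta>"
    and "integrable M (\<lambda>x. w x * (cmod (f x))\<^sup>2 + p x * (cmod (vderiv f x))\<^sup>2)"
    and "(LINT x|M. w x * (cmod (f x))\<^sup>2) \<le> W f" "(LINT x|M. p x * (cmod (vderiv f x))\<^sup>2) \<le> W f"
    and "0 \<le> W f"
    and "W f = (LINT x|M. w x * (cmod (f x))\<^sup>2) + (LINT x|M. p x * (cmod (vderiv f x))\<^sup>2)"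
proof -
  note [measurable] = dom_measurable[OF assms]
  have i: "integrable M (\<lambda>x. w x * (cmod (f x))\<^sup>2)" "integrable M (\<lambda>x. p x * (cmod (vderiv f x))\<^sup>2)"
    using assms by (auto simp: dom_A_plus_iff)
  show i3: "integrable M (\<lambda>x. w x * (cmod (f x))\<^sup>2 + p x * (cmod (vderiv f x))\<^sup>2)" using i by simp
  have le: "AE x in M. (cmod (f x))\<^sup>2 + (cmod (vderiv f x))\<^sup>2 \<le> (w x * (cmod (f x))\<^sup>2 + p x * (cmod (vderiv f x))\<^sup>2) / \<delta>"
    using wp_ge
  proof eventually_elim
    case (elim x)
    then have "\<delta> * (cmod (f x))\<^sup>2 + \<delta> * (cmod (vderiv f x))\<^sup>2 \<le> w x * (cmod (f x))\<^sup>2 + p x * (cmod (vderiv f x))\<^sup>2"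
      by (intro add_mono mult_right_mono) auto
    then show ?case using \<delta>_pos by (simp add: field_simps)
  qed
  have i4: "integrable M (\<lambda>x. (w x * (cmod (f x))\<^sup>2 + p x * (cmod (vderiv f x))\<^sup>2) / \<delta>)" using i3 by simp
  show E: "integrable M (\<lambda>x. (cmod (f x))\<^sup>2 + (cmod (vderiv f x))\<^sup>2)"
  proof (rule Bochner_Integration.integrable_bound[OF i4])
    show "AE x in M. norm ((cmod (f x))\<^sup>2 + (cmod (vderiv f x))\<^sup>2) \<le> norm ((w x * (cmod (f x))\<^sup>2 + p x * (cmod (vderiv f x))\<^sup>2) / \<delta>)"
      using le
    proof eventually_elim
      case (elim x)
      moreover have "0 \<le> (cmod (f x))\<^sup>2 + (cmod (vderiv f x))\<^sup>2" by simp
      ultimately show ?case unfolding real_norm_def by linarith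
    qed
  qed measurable
  have "(LINT x|M. (cmod (f x))\<^sup>2 + (cmod (vderiv f x))\<^sup>2) \<le> (LINT x|M. (w x * (cmod (f x))\<^sup>2 + p x * (cmod (vderiv f x))\<^sup>2) / \<delta>)"
    using E i4 le by (rule integral_mono_AE)
  then show "(LINT x|M. (cmod (f x))\<^sup>2 + (cmod (vderiv f x))\<^sup>2) \<le> W f / \<delta>" by (simp add: W_def)
  show W: "W f = (LINT x|M. w x * (cmod (f x))\<^sup>2) + (LINT x|M. p x * (cmod (vderiv f x))\<^sup>2)"
    unfolding W_def using i by simp
  have "0 \<le> (LINT x|M. w x * (cmod (f x))\<^sup>2)" "0 \<le> (LINT x|M. p x * (cmod (vderiv f x))\<^sup>2)"
    by (rule integral_nonneg_AE, rule eventually_mono[OF w_nonneg], simp)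
      (rule integral_nonneg_AE, rule eventually_mono[OF p_nonneg], simp)
  then show "(LINT x|M. w x * (cmod (f x))\<^sup>2) \<le> W f" "(LINT x|M. p x * (cmod (vderiv f x))\<^sup>2) \<le> W f" "0 \<le> W f"
    using W by auto
qed

text \<open>Fix u < v in I. A point left of their midpoint has an interval of length (v - u) / 2,
  capped at 1, to its right inside I; any other point has one to its left. Thus one L serves all
  points of I.\<close>

lemma sobolev_length:
  "\<exists>L>0. L \<le> 1 \<and> (\<forall>x\<in>I. \<exists>c. x \<in> {c..c+L} \<and> {c..c+L} \<subseteq> I)"
proof -
  obtain u where u: "a < ereal u" "ereal u < b" using ab by (meson ereal_dense2)
  obtain v where v: "u < v" "ereal v < b" using ereal_dense2[OF u(2)] by auto
  have uvI: "u \<in> I" "v \<in> I" using u v by (auto simp: I_eq einterval_def less_trans[of a "ereal u" "ereal v"])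
  define L where "L = min 1 ((v - u) / 2)"
  have L: "L > 0" "L \<le> 1" "2 * L \<le> v - u" using v by (auto simp: L_def min_def)
  have "\<exists>c. x \<in> {c..c+L} \<and> {c..c+L} \<subseteq> I" if x: "x \<in> I" for x
  proof (cases "x \<le> (u + v) / 2")
    case True
    have "{x..x+L} \<subseteq> {x..max x v}" using True L by auto
    also have "\<dots> \<subseteq> I" using x uvI by (intro Icc_subset_I) (auto simp: max_def)
    finally show ?thesis using L by (intro exI[of _ x]) auto
  next
    case False
    have "{x-L..x-L+L} \<subseteq> {min x u..x}" using False L by (auto simp: min_def)
    also have "\<dots> \<subseteq> I" using x uvI by (intro Icc_subset_I) (auto simp: min_def)
    finally show ?thesis using L by (intro exI[of _ "x - L"]) auto
  qed
  then show ?thesis using L by blast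
qed

text \<open>K is chosen before f, r and B: the same constant serves q and all differences of
  potentials, with the smallness of a difference entering through B. The interval around x has
  length at most 1, hence meets only the cell of x and its two neighbours.\<close>

lemma sobolev_sup_bound: "\<exists>K>0. \<forall>f\<in>dom_A_plus I w p. \<forall>x\<in>I. (cmod (f x))\<^sup>2 \<le> K * W f"
  and potential_bound: "\<exists>K>0. \<forall>f\<in>dom_A_plus I w p. \<forall>r B. r \<in> borel_measurable M \<longrightarrow> 0 \<le> B \<longrightarrow>
       unif_loc_norm I r \<le> ennreal B \<longrightarrow>
       integrable M (\<lambda>x. \<bar>r x\<bar> * (cmod (f x))\<^sup>2) \<and> (LINT x|M. \<bar>r x\<bar> * (cmod (f x))\<^sup>2) \<le> K * B * W f"
proof -
  obtain L where L: "L > 0" "L \<le> 1" "\<And>x. x \<in> I \<Longrightarrow> \<exists>c. x \<in> {c..c+L} \<and> {c..c+L} \<subseteq> I"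
    using sobolev_length by blast
  let ?E = "\<lambda>f x. (cmod (f x))\<^sup>2 + (cmod (vderiv f x))\<^sup>2"
  have local: "\<exists>c. x \<in> {c..c+L} \<and> {c..c+L} \<subseteq> I \<and> ?E f absolutely_integrable_on {c..c+L} \<and>
      (cmod (f x))\<^sup>2 \<le> 2 / L * integral {c..c+L} (?E f)" if f: "f \<in> dom_A_plus I w p" and x: "x \<in> I" for f x
  proof -
    obtain c where c: "x \<in> {c..c+L}" "{c..c+L} \<subseteq> I" using L(3)[OF x] by blast
    have fAC: "f \<in> AC_loc I" using f by (simp add: dom_A_plus_iff)
    have E: "?E f absolutely_integrable_on {c..c+L}"
      by (rule integrable_imp_absolutely_integrable_subinterval[OF dom_integrable(1)[OF f] I_sets c(2)])
    have cf: "continuous_on {c..c+L} f" using AC_loc_continuous[OF fAC open_I] c(2) continuous_on_subset by blast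
    have "(\<lambda>y. (cmod (f y))\<^sup>2) absolutely_integrable_on {c..c+L}"
      by (intro absolutely_integrable_continuous_real continuous_intros cf)
    from set_integral_diff(1)[OF E this]
    have "(\<lambda>y. (cmod (vderiv f y))\<^sup>2) absolutely_integrable_on {c..c+L}" by simp
    from sobolev_interval[OF fAC L(1,2) c(2,1) this open_I]
    have "(cmod (f x))\<^sup>2 \<le> 2 / L * integral {c..c+L} (?E f)" using L(1) by (simp add: field_simps)
    then show ?thesis using c E by blast
  qed
  show "\<exists>K>0. \<forall>f\<in>dom_A_plus I w p. \<forall>x\<in>I. (cmod (f x))\<^sup>2 \<le> K * W f"
  \<comment> \<open>The factor 2 / L is that of the interval estimate, and 1 / \<delta> passes from
    the unweighted energy to W.\<close>
  proof (intro exI[of _ "2 / (L * \<delta>)"] conjI ballI)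
    show "0 < 2 / (L * \<delta>)" using L \<delta>_pos by simp
    fix f x assume f: "f \<in> dom_A_plus I w p" and x: "x \<in> I"
    obtain c where c: "{c..c+L} \<subseteq> I" "?E f absolutely_integrable_on {c..c+L}"
      "(cmod (f x))\<^sup>2 \<le> 2 / L * integral {c..c+L} (?E f)" using local[OF f x] by blast
    have EI: "?E f integrable_on I" using dom_integrable(1)[OF f] I_sets by (intro integrable_on_lebesgue_on)
    have "integral {c..c+L} (?E f) \<le> integral I (?E f)"
      using c EI by (intro integral_subset_le) (auto simp: absolutely_integrable_on_def)
    also have "\<dots> = (LINT x|M. ?E f x)" using dom_integrable(1)[OF f] I_sets by (intro lebesgue_integral_eq_integral[symmetric])
    also have "\<dots> \<le> W f / \<delta>" by (rule dom_integrable(2)[OF f])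
    finally have "2 / L * integral {c..c+L} (?E f) \<le> 2 / L * (W f / \<delta>)" using L by (intro mult_left_mono) auto
    then show "(cmod (f x))\<^sup>2 \<le> 2 / (L * \<delta>) * W f" using c(3) by simp
  qed
  show "\<exists>K>0. \<forall>f\<in>dom_A_plus I w p. \<forall>r B. r \<in> borel_measurable M \<longrightarrow> 0 \<le> B \<longrightarrow>
       unif_loc_norm I r \<le> ennreal B \<longrightarrow>
       integrable M (\<lambda>x. \<bar>r x\<bar> * (cmod (f x))\<^sup>2) \<and> (LINT x|M. \<bar>r x\<bar> * (cmod (f x))\<^sup>2) \<le> K * B * W f"
  \<comment> \<open>The same two factors, with an additional 3 for the overlap of the cells.\<close>
  proof (intro exI[of _ "6 / (L * \<delta>)"] conjI ballI allI impI)
    show "0 < 6 / (L * \<delta>)" using L \<delta>_pos by simp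
    fix f r B assume f: "f \<in> dom_A_plus I w p" and rm [measurable]: "r \<in> borel_measurable M" and B: "0 \<le> B" "unif_loc_norm I r \<le> ennreal B"
    note [measurable] = dom_measurable[OF f]
    let ?E' = "\<lambda>x. ennreal (?E f x)"
    have "(\<integral>\<^sup>+x. ennreal \<bar>r x\<bar> * ennreal ((cmod (f x))\<^sup>2) \<partial>M) \<le> 3 * ennreal (2 / L) * ennreal B * (\<integral>\<^sup>+x. ?E' x \<partial>M)"
    proof (rule nn_integral_potential_le[OF I_sets rm B(2)])
      fix x assume x: "x \<in> I"
      obtain c where c: "x \<in> {c..c+L}" "{c..c+L} \<subseteq> I" "?E f absolutely_integrable_on {c..c+L}"
        "(cmod (f x))\<^sup>2 \<le> 2 / L * integral {c..c+L} (?E f)" using local[OF f x] by blast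
      have "ennreal ((cmod (f x))\<^sup>2) \<le> ennreal (2 / L * integral {c..c+L} (?E f))" using c(4) by (rule ennreal_leI)
      also have "\<dots> = ennreal (2 / L) * ennreal (integral {c..c+L} (?E f))"
        using c(3) L by (intro ennreal_mult integral_nonneg) (auto simp: absolutely_integrable_on_def)
      also have "ennreal (integral {c..c+L} (?E f)) = (\<integral>\<^sup>+y. ?E' y * indicator {c..c+L} y \<partial>M)"
        using c by (intro nn_integral_subinterval[symmetric] I_sets) auto
      also have "\<dots> \<le> (\<integral>\<^sup>+y. ?E' y * indicator {real_of_int \<lfloor>x\<rfloor> - 1..<real_of_int \<lfloor>x\<rfloor> + 2} y \<partial>M)"
      proof (intro nn_integral_mono mult_left_mono)
        fix y :: real
        have "real_of_int \<lfloor>x\<rfloor> - 1 \<le> y \<and> y < real_of_int \<lfloor>x\<rfloor> + 2" if "y \<in> {c..c+L}"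
          using that c(1) L(1,2) floor_correct[of x] unfolding atLeastAtMost_iff by linarith
        then show "indicator {c..c+L} y \<le> (indicator {real_of_int \<lfloor>x\<rfloor> - 1..<real_of_int \<lfloor>x\<rfloor> + 2} y :: ennreal)"
          by (auto simp: indicator_def)
      qed auto
      finally show "ennreal ((cmod (f x))\<^sup>2) \<le> ennreal (2 / L) * (\<integral>\<^sup>+y. ?E' y * indicator {real_of_int \<lfloor>x\<rfloor> - 1..<real_of_int \<lfloor>x\<rfloor> + 2} y \<partial>M)"
        by (auto simp: mult_left_mono)
    qed measurable
    also have "(\<integral>\<^sup>+x. ?E' x \<partial>M) = ennreal (LINT x|M. ?E f x)"
      using dom_integrable(1)[OF f] by (intro nn_integral_eq_integral) auto
    also have "\<dots> \<le> ennreal (W f / \<delta>)" using dom_integrable(2)[OF f] by (rule ennreal_leI)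
    finally have "(\<integral>\<^sup>+x. ennreal (\<bar>r x\<bar> * (cmod (f x))\<^sup>2) \<partial>M) \<le> 3 * ennreal (2 / L) * ennreal B * ennreal (W f / \<delta>)"
      by (simp add: ennreal_mult mult_left_mono)
    also have "\<dots> = ennreal (6 / (L * \<delta>) * B * W f)"
    proof -
      have "(3::ennreal) = ennreal 3" by simp
      then have "3 * ennreal (2 / L) * ennreal B * ennreal (W f / \<delta>) = ennreal (3 * (2 / L) * B * (W f / \<delta>))"
        using L B \<delta>_pos dom_integrable(6)[OF f] by (simp only: ennreal_mult[symmetric] divide_nonneg_pos mult_nonneg_nonneg zero_le_numeral less_imp_le)
      then show ?thesis by (simp add: field_simps)
    qed
    finally have fin: "(\<integral>\<^sup>+x. ennreal (\<bar>r x\<bar> * (cmod (f x))\<^sup>2) \<partial>M) \<le> ennreal (6 / (L * \<delta>) * B * W f)" .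
    show i: "integrable M (\<lambda>x. \<bar>r x\<bar> * (cmod (f x))\<^sup>2)"
      using le_less_trans[OF fin] by (intro integrableI_nonneg) auto
    have "0 \<le> 6 / (L * \<delta>) * B * W f" using L \<delta>_pos B dom_integrable(6)[OF f] by simp
    then show "(LINT x|M. \<bar>r x\<bar> * (cmod (f x))\<^sup>2) \<le> 6 / (L * \<delta>) * B * W f"
      using fin nn_integral_eq_integral[OF i] by simp
  qed
qed

end

section \<open>Cauchy--Schwarz estimates and the quadratic form\<close>

lemma L2_cauchy_schwarz:
  assumes "square_integrable M f" "square_integrable M g"
  shows "(LINT x|M. cmod (f x) * cmod (g x)) \<le> sqrt (LINT x|M. (cmod (f x))\<^sup>2) * sqrt (LINT x|M. (cmod (g x))\<^sup>2)"
proof -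
  interpret L: semi_inner "hcarrier (L2_space M)" "hadd (L2_space M)" "hscale (L2_space M)" "hinner (L2_space M)"
    by (rule semi_inner_L2)
  define F where "F x = complex_of_real (cmod (f x))" for x
  define G where "G x = complex_of_real (cmod (g x))" for x
  have [measurable]: "f \<in> borel_measurable M" "g \<in> borel_measurable M" using assms by (auto simp: square_integrable_def)
  have Fm: "F \<in> borel_measurable M" "G \<in> borel_measurable M" unfolding F_def[abs_def] G_def[abs_def] by measurable
  have sq: "square_integrable M F" "square_integrable M G"
    using assms Fm by (auto simp: square_integrable_def F_def G_def)
  have n: "L.nrm (ae_class M F) = sqrt (LINT x|M. (cmod (f x))\<^sup>2)" "L.nrm (ae_class M G) = sqrt (LINT x|M. (cmod (g x))\<^sup>2)"
    using L2_norm[OF Fm(1)] L2_norm[OF Fm(2)] by (auto simp: L.nrm_def L.Q_def hnorm_def F_def G_def)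
  have "(LINT x|M. cnj (F x) * G x) = complex_of_real (LINT x|M. cmod (f x) * cmod (g x))"
    unfolding F_def G_def by (simp flip: of_real_mult)
  then have "cmod (hinner (L2_space M) (ae_class M F) (ae_class M G)) = \<bar>LINT x|M. cmod (f x) * cmod (g x)\<bar>"
    using Fm by (simp add: L2_inner)
  then show ?thesis
    using L.cauchy_schwarz[OF L2_carrierI[OF sq(1)] L2_carrierI[OF sq(2)]] unfolding n by simp
qed

text \<open>The root of |r| is distributed over both factors, which admits coefficients r of either
  sign, such as q or differences of coefficients.\<close>

lemma weighted_cauchy_schwarz:
  fixes r :: "'a \<Rightarrow> real"
  assumes [measurable]: "r \<in> borel_measurable M" "f \<in> borel_measurable M" "g \<in> borel_measurable M"
    and i: "integrable M (\<lambda>x. \<bar>r x\<bar> * (cmod (f x))\<^sup>2)" "integrable M (\<lambda>x. \<bar>r x\<bar> * (cmod (g x))\<^sup>2)"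
  shows "integrable M (\<lambda>x. \<bar>r x\<bar> * cmod (f x) * cmod (g x))"
    and "(LINT x|M. \<bar>r x\<bar> * cmod (f x) * cmod (g x)) \<le>
       sqrt (LINT x|M. \<bar>r x\<bar> * (cmod (f x))\<^sup>2) * sqrt (LINT x|M. \<bar>r x\<bar> * (cmod (g x))\<^sup>2)"
    and "integrable M (\<lambda>x. complex_of_real (r x) * cnj (f x) * g x)"
proof -
  let ?F = "\<lambda>h x. complex_of_real (sqrt \<bar>r x\<bar>) * h x"
  have e: "(cmod (?F h x))\<^sup>2 = \<bar>r x\<bar> * (cmod (h x))\<^sup>2" for h x by (simp add: norm_mult power_mult_distrib)
  have sq: "square_integrable M (?F f)" "square_integrable M (?F g)" using i by (auto simp: square_integrable_def e simp del: norm_mult)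
  have e2: "cmod (?F f x) * cmod (?F g x) = \<bar>r x\<bar> * cmod (f x) * cmod (g x)" for x
  proof -
    have "cmod (?F f x) * cmod (?F g x) = (sqrt \<bar>r x\<bar> * sqrt \<bar>r x\<bar>) * cmod (f x) * cmod (g x)" by (simp add: norm_mult)
    then show ?thesis by simp
  qed
  show int: "integrable M (\<lambda>x. \<bar>r x\<bar> * cmod (f x) * cmod (g x))" using square_integrable_mult(2)[OF sq] unfolding e2 .
  show "(LINT x|M. \<bar>r x\<bar> * cmod (f x) * cmod (g x)) \<le>
       sqrt (LINT x|M. \<bar>r x\<bar> * (cmod (f x))\<^sup>2) * sqrt (LINT x|M. \<bar>r x\<bar> * (cmod (g x))\<^sup>2)"
    using L2_cauchy_schwarz[OF sq] unfolding e2 e .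
  show "integrable M (\<lambda>x. complex_of_real (r x) * cnj (f x) * g x)"
    by (rule Bochner_Integration.integrable_bound[OF int]) (auto simp: norm_mult)
qed

context sl_data
begin

abbreviation "Dp \<equiv> dom_A_plus I w p"
abbreviation "form \<equiv> sl_form I p q"

lemma dom_add:
  assumes "f \<in> Dp" "g \<in> Dp"
  shows "(\<lambda>x. f x + g x) \<in> Dp" "AE x in M. vderiv (\<lambda>x. f x + g x) x = vderiv f x + vderiv g x"
proof -
  have AC: "f \<in> AC_loc I" "g \<in> AC_loc I" using assms by (auto simp: dom_A_plus_iff)
  show v: "AE x in M. vderiv (\<lambda>x. f x + g x) x = vderiv f x + vderiv g x" by (rule AC_loc_add(2)[OF AC open_I])
  have s: "square_integrable M (\<lambda>x. complex_of_real (sqrt (p x)) * vderiv f x)" "square_integrable M (\<lambda>x. complex_of_real (sqrt (p x)) * vderiv g x)"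
     "square_integrable (weighted I w) f" "square_integrable (weighted I w) g"
    using assms by (auto simp: dom_A_plus_def)
  have AC': "(\<lambda>x. f x + g x) \<in> AC_loc I" by (rule AC_loc_add(1)[OF AC open_I])
  note [measurable] = AC_loc_measurable(2)[OF AC' open_I]
  have "square_integrable M (\<lambda>x. complex_of_real (sqrt (p x)) * vderiv (\<lambda>x. f x + g x) x)"
    by (rule square_integrable_cong_AE[OF square_integrable_add[OF s(1,2)]])
      (measurable, use v in \<open>eventually_elim, simp add: ring_distribs\<close>)
  then show "(\<lambda>x. f x + g x) \<in> Dp"
    using AC' square_integrable_add[OF s(3,4)] by (simp add: dom_A_plus_def)
qed

lemma dom_scale:
  assumes "f \<in> Dp"
  shows "(\<lambda>x. c * f x) \<in> Dp" "AE x in M. vderiv (\<lambda>x. c * f x) x = c * vderiv f x"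
proof -
  have AC: "f \<in> AC_loc I" using assms by (auto simp: dom_A_plus_iff)
  show v: "AE x in M. vderiv (\<lambda>x. c * f x) x = c * vderiv f x" by (rule AC_loc_scale(2)[OF AC open_I])
  have s: "square_integrable M (\<lambda>x. complex_of_real (sqrt (p x)) * vderiv f x)" "square_integrable (weighted I w) f"
    using assms by (auto simp: dom_A_plus_def)
  have AC': "(\<lambda>x. c * f x) \<in> AC_loc I" by (rule AC_loc_scale(1)[OF AC open_I])
  note [measurable] = AC_loc_measurable(2)[OF AC' open_I]
  have "square_integrable M (\<lambda>x. complex_of_real (sqrt (p x)) * vderiv (\<lambda>x. c * f x) x)"
    by (rule square_integrable_cong_AE[OF square_integrable_scale[OF s(1), of c]])
      (measurable, use v in \<open>eventually_elim, simp add: mult_ac\<close>)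
  then show "(\<lambda>x. c * f x) \<in> Dp"
    using AC' square_integrable_scale[OF s(2)] by (simp add: dom_A_plus_def)
qed

lemma dom_diff:
  assumes "f \<in> Dp" "g \<in> Dp"
  shows "(\<lambda>x. f x + - 1 * g x) \<in> Dp" "AE x in M. vderiv (\<lambda>x. f x + - 1 * g x) x = vderiv f x - vderiv g x"
proof -
  note s = dom_scale[OF assms(2), of "- 1"]
  show "(\<lambda>x. f x + - 1 * g x) \<in> Dp" by (rule dom_add(1)[OF assms(1) s(1)])
  show "AE x in M. vderiv (\<lambda>x. f x + - 1 * g x) x = vderiv f x - vderiv g x"
    using dom_add(2)[OF assms(1) s(1)] s(2) by eventually_elim simp
qed

lemma W_diff:
  assumes "f \<in> Dp" "g \<in> Dp"
  shows "W (\<lambda>x. f x + - 1 * g x) = (LINT x|M. w x * (cmod (f x - g x))\<^sup>2) + (LINT x|M. p x * (cmod (vderiv f x - vderiv g x))\<^sup>2)"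
proof -
  note d = dom_diff[OF assms]
  note [measurable] = dom_measurable[OF assms(1)] dom_measurable[OF assms(2)] dom_measurable[OF d(1)]
  have "(LINT x|M. p x * (cmod (vderiv (\<lambda>x. f x + - 1 * g x) x))\<^sup>2) = (LINT x|M. p x * (cmod (vderiv f x - vderiv g x))\<^sup>2)"
    by (rule integral_cong_AE) (measurable, use d(2) in \<open>eventually_elim, simp\<close>)
  then show ?thesis unfolding dom_integrable(7)[OF d(1)] by simp
qed

text \<open>The relative bound of |q| with respect to W, fixed by choice so that it can occur in
  later statements.\<close>

definition q_bound :: real where
  "q_bound = (SOME K. 0 < K \<and> (\<forall>f\<in> Dp. integrable M (\<lambda>x. \<bar>q x\<bar> * (cmod (f x))\<^sup>2) \<and> (LINT x|M. \<bar>q x\<bar> * (cmod (f x))\<^sup>2) \<le> K * W f))"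

lemma q_bound:
  shows "0 < q_bound" "f \<in> Dp \<Longrightarrow> integrable M (\<lambda>x. \<bar>q x\<bar> * (cmod (f x))\<^sup>2)"
  "f \<in> Dp \<Longrightarrow> (LINT x|M. \<bar>q x\<bar> * (cmod (f x))\<^sup>2) \<le> q_bound * W f"
proof -
  obtain K where K: "K > 0" "\<And>f r B. f\<in> Dp \<Longrightarrow> r \<in> borel_measurable M \<Longrightarrow> 0 \<le> B \<Longrightarrow>
       unif_loc_norm I r \<le> ennreal B \<Longrightarrow>
       integrable M (\<lambda>x. \<bar>r x\<bar> * (cmod (f x))\<^sup>2) \<and> (LINT x|M. \<bar>r x\<bar> * (cmod (f x))\<^sup>2) \<le> K * B * W f"
    using potential_bound by blast
  define B where "B = enn2real (unif_loc_norm I q) + 1"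
  have B: "B > 0" by (simp add: B_def add_nonneg_pos)
  have "unif_loc_norm I q = ennreal (enn2real (unif_loc_norm I q))" using q_fin by simp
  also have "\<dots> \<le> ennreal B" by (intro ennreal_leI) (simp add: B_def)
  finally have "\<exists>K. 0 < K \<and> (\<forall>f\<in> Dp. integrable M (\<lambda>x. \<bar>q x\<bar> * (cmod (f x))\<^sup>2) \<and> (LINT x|M. \<bar>q x\<bar> * (cmod (f x))\<^sup>2) \<le> K * W f)"
    using K(1) B K(2)[rule_format, OF _ q_meas less_imp_le[OF B]] by (intro exI[of _ "K * B"]) simp
  from someI_ex[OF this, folded q_bound_def]
  show "0 < q_bound" "f \<in> Dp \<Longrightarrow> integrable M (\<lambda>x. \<bar>q x\<bar> * (cmod (f x))\<^sup>2)"
    "f \<in> Dp \<Longrightarrow> (LINT x|M. \<bar>q x\<bar> * (cmod (f x))\<^sup>2) \<le> q_bound * W f" by auto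
qed

lemma p_abs_integrable:
  assumes "f \<in> Dp" shows "integrable M (\<lambda>x. \<bar>p x\<bar> * (cmod (vderiv f x))\<^sup>2)"
proof -
  note [measurable] = dom_measurable[OF assms]
  have "integrable M (\<lambda>x. p x * (cmod (vderiv f x))\<^sup>2)" using assms by (simp add: dom_A_plus_iff)
  then show ?thesis
    by (rule integrable_cong_AE_imp) (measurable, use p_nonneg in \<open>eventually_elim, simp\<close>)
qed

lemma form_integrable:
  assumes "f \<in> Dp" "g \<in> Dp"
  shows "integrable M (\<lambda>x. complex_of_real (p x) * cnj (vderiv f x) * vderiv g x)"
    "integrable M (\<lambda>x. complex_of_real (q x) * cnj (f x) * g x)"
    "integrable M (\<lambda>x. complex_of_real (p x) * cnj (vderiv f x) * vderiv g x + complex_of_real (q x) * cnj (f x) * g x)"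
proof -
  show a: "integrable M (\<lambda>x. complex_of_real (p x) * cnj (vderiv f x) * vderiv g x)"
    by (rule weighted_cauchy_schwarz(3)) (use dom_measurable assms p_abs_integrable in auto)
  show b: "integrable M (\<lambda>x. complex_of_real (q x) * cnj (f x) * g x)"
    by (rule weighted_cauchy_schwarz(3)) (use dom_measurable assms q_bound(2) in auto)
  show "integrable M (\<lambda>x. complex_of_real (p x) * cnj (vderiv f x) * vderiv g x + complex_of_real (q x) * cnj (f x) * g x)"
    by (rule Bochner_Integration.integrable_add[OF a b])
qed

lemma form_add:
  assumes "f \<in> Dp" "g \<in> Dp" "h \<in> Dp"
  shows "form f (\<lambda>x. g x + h x) = form f g + form f h"
proof -
  note d = dom_add[OF assms(2,3)]
  note [measurable] = dom_measurable[OF assms(1)] dom_measurable[OF assms(2)] dom_measurable[OF assms(3)] dom_measurable[OF d(1)]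
  have "form f (\<lambda>x. g x + h x) = (LINT x|M. (complex_of_real (p x) * cnj (vderiv f x) * vderiv g x + complex_of_real (q x) * cnj (f x) * g x)
      + (complex_of_real (p x) * cnj (vderiv f x) * vderiv h x + complex_of_real (q x) * cnj (f x) * h x))"
    unfolding sl_form_def
    by (rule integral_cong_AE) (measurable, use d(2) in \<open>eventually_elim, simp add: ring_distribs\<close>)
  also have "\<dots> = form f g + form f h"
    unfolding sl_form_def by (rule Bochner_Integration.integral_add) (intro form_integrable assms)+
  finally show ?thesis .
qed

lemma form_scale:
  assumes "f \<in> Dp" "g \<in> Dp"
  shows "form f (\<lambda>x. c * g x) = c * form f g"
proof -
  note d = dom_scale[OF assms(2), of c]
  note [measurable] = dom_measurable[OF assms(1)] dom_measurable[OF assms(2)] dom_measurable[OF d(1)]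
  have "form f (\<lambda>x. c * g x) = (LINT x|M. c * (complex_of_real (p x) * cnj (vderiv f x) * vderiv g x + complex_of_real (q x) * cnj (f x) * g x))"
    unfolding sl_form_def
    by (rule integral_cong_AE) (measurable, use d(2) in \<open>eventually_elim, simp add: ring_distribs mult_ac\<close>)
  also have "\<dots> = c * form f g"
    unfolding sl_form_def by (rule Bochner_Integration.integral_mult_right) (intro form_integrable assms)
  finally show ?thesis .
qed

lemma form_cnj: "cnj (form f g) = form g f"
  unfolding sl_form_def Bochner_Integration.integral_cnj[symmetric]
  by (intro Bochner_Integration.integral_cong refl) (simp add: mult_ac)

lemma form_self:
  assumes "f \<in> Dp"
  shows "Re (form f f) = (LINT x|M. p x * (cmod (vderiv f x))\<^sup>2) + (LINT x|M. q x * (cmod (f x))\<^sup>2)"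
    and "integrable M (\<lambda>x. q x * (cmod (f x))\<^sup>2)"
proof -
  note [measurable] = dom_measurable[OF assms]
  show q: "integrable M (\<lambda>x. q x * (cmod (f x))\<^sup>2)"
    by (rule Bochner_Integration.integrable_bound[OF q_bound(2)[OF assms]]) (auto simp: abs_mult)
  have c: "cnj z * z = complex_of_real ((cmod z)\<^sup>2)" for z by (metis complex_norm_square mult.commute)
  have "form f f = (LINT x|M. complex_of_real (p x * (cmod (vderiv f x))\<^sup>2 + q x * (cmod (f x))\<^sup>2))"
    unfolding sl_form_def by (intro Bochner_Integration.integral_cong refl) (simp only: mult.assoc c of_real_add of_real_mult)
  then have "form f f = complex_of_real (LINT x|M. p x * (cmod (vderiv f x))\<^sup>2 + q x * (cmod (f x))\<^sup>2)"
    by (simp only: integral_complex_of_real)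
  then have "Re (form f f) = (LINT x|M. p x * (cmod (vderiv f x))\<^sup>2 + q x * (cmod (f x))\<^sup>2)" by (simp only: Re_complex_of_real)
  then show "Re (form f f) = (LINT x|M. p x * (cmod (vderiv f x))\<^sup>2) + (LINT x|M. q x * (cmod (f x))\<^sup>2)"
    using q assms by (simp add: dom_A_plus_iff)
qed

text \<open>From q \<ge> \<gamma> and w \<ge> \<delta> one gets q \<ge> -|\<gamma>| \<ge> lb w. The
  absolute value makes lb nonpositive, as the second inequality requires.\<close>

definition lb :: real where "lb = - \<bar>\<gamma>\<bar> / \<delta>"

text \<open>The derivative term is kept rather than estimated by 0, so that the form plus a multiple
  of the norm controls all of W.\<close>

lemma form_lower_bound:
  assumes "f \<in> Dp"
  shows "(LINT x|M. p x * (cmod (vderiv f x))\<^sup>2) + lb * (LINT x|M. w x * (cmod (f x))\<^sup>2) \<le> Re (form f f)"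
proof -
  note [measurable] = dom_measurable[OF assms]
  have i: "integrable M (\<lambda>x. w x * (cmod (f x))\<^sup>2)" using assms by (simp add: dom_A_plus_iff)
  have "(LINT x|M. lb * (w x * (cmod (f x))\<^sup>2)) \<le> (LINT x|M. q x * (cmod (f x))\<^sup>2)"
  proof (rule integral_mono_AE)
    show "AE x in M. lb * (w x * (cmod (f x))\<^sup>2) \<le> q x * (cmod (f x))\<^sup>2"
      using wp_ge q_ge
    proof eventually_elim
      case (elim x)
      have "lb * w x \<le> lb * \<delta>" using elim \<delta>_pos by (intro mult_left_mono_neg) (auto simp: lb_def)
      also have "\<dots> \<le> q x" using elim \<delta>_pos by (simp add: lb_def)
      finally show ?case by (simp add: mult.assoc[symmetric] mult_right_mono)
    qed
  qed (use i form_self(2)[OF assms] in auto)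
  then show ?thesis using form_self(1)[OF assms] i by simp
qed

lemma form_upper_bound:
  assumes "f \<in> Dp" shows "Re (form f f) \<le> (1 + q_bound) * W f"
proof -
  note [measurable] = dom_measurable[OF assms]
  have "(LINT x|M. q x * (cmod (f x))\<^sup>2) \<le> (LINT x|M. \<bar>q x\<bar> * (cmod (f x))\<^sup>2)"
    by (rule integral_mono[OF form_self(2)[OF assms] q_bound(2)[OF assms]]) (simp add: mult_right_mono)
  then show ?thesis
    using form_self(1)[OF assms] q_bound(3)[OF assms] dom_integrable(5)[OF assms] by (simp add: ring_distribs)
qed

lemma square_integrable_locally:
  fixes k :: "real \<Rightarrow> complex"
  assumes k: "square_integrable M k" and cd: "{c..d} \<subseteq> I"
  shows "k absolutely_integrable_on {c..d}"
proof -
  have m: "k \<in> borel_measurable (lebesgue_on {c..d})"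
    using square_integrable_measurable[OF k] cd by (rule measurable_restrict_mono)
  have "(\<lambda>x. (cmod (k x))\<^sup>2) absolutely_integrable_on {c..d}"
    using k I_sets cd by (intro integrable_imp_absolutely_integrable_subinterval) (auto simp: square_integrable_def)
  then have i: "(\<lambda>x. 1 + (cmod (k x))\<^sup>2) integrable_on {c..d}"
    by (intro integrable_add) (auto simp: absolutely_integrable_on_def)
  show ?thesis
  proof (rule measurable_bounded_by_integrable_imp_absolutely_integrable[OF m _ i])
    fix x
    \<comment> \<open>This square yields |k| \<le> 1/4 + |k|^2, so local integrability of |k|^2
      gives that of k.\<close>
    have "0 \<le> (cmod (k x) - 1 / 2)\<^sup>2" by simp
    then show "cmod (k x) \<le> 1 + (cmod (k x))\<^sup>2" by (simp add: power2_diff power_divide)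
  qed auto
qed

lemma integral_subinterval_le:
  assumes "integrable M g" "\<And>x. 0 \<le> (g x :: real)" "{c..d} \<subseteq> I"
  shows "integral {c..d} g \<le> (LINT x|M. g x)"
proof -
  have "integral {c..d} g \<le> integral I g"
    using assms integrable_on_lebesgue_on[OF assms(1) I_sets] integrable_imp_absolutely_integrable_subinterval[OF assms(1) I_sets assms(3)]
    by (intro integral_subset_le) (auto simp: absolutely_integrable_on_def)
  also have "\<dots> = (LINT x|M. g x)" using assms(1) I_sets by (intro lebesgue_integral_eq_integral[symmetric])
  finally show ?thesis .
qed

lemma norm_integral_subinterval_le:
  fixes k :: "real \<Rightarrow> complex"
  assumes k: "square_integrable M k" and cd: "{c..d} \<subseteq> I" "c \<le> d"
  shows "cmod (integral {c..d} k) \<le> sqrt (d - c) * sqrt (LINT x|M. (cmod (k x))\<^sup>2)"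
proof -
  note [measurable] = square_integrable_measurable[OF k]
  have ki: "k absolutely_integrable_on {c..d}" by (rule square_integrable_locally[OF k cd(1)])
  have im: "(\<lambda>x. indicator {c..d} x :: real) \<in> borel_measurable M"
    by (intro measurable_restrict_space1 borel_measurable_indicator) simp
  have ie: "(LINT x|M. indicator {c..d} x :: real) = d - c" and ii: "integrable M (\<lambda>x. indicator {c..d} x :: real)"
  proof -
    have e: "emeasure M {c..d} = ennreal (d - c)"
      using cd I_sets by (subst emeasure_restrict_space) auto
    have s: "{c..d} \<in> sets M" using cd I_sets by (auto simp: sets_restrict_space_iff)
    show "(LINT x|M. indicator {c..d} x :: real) = d - c" using s e cd by (simp add: measure_def Int_absorb2)
    show "integrable M (\<lambda>x. indicator {c..d} x :: real)" using s e by (intro integrable_real_indicator) auto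
  qed
  let ?i = "\<lambda>x. complex_of_real (indicator {c..d} x)"
  have isq: "(cmod (?i x))\<^sup>2 = indicator {c..d} x" for x by (simp add: indicator_def)
  have sqi: "square_integrable M ?i" using im ii unfolding square_integrable_def isq by auto
  have "cmod (integral {c..d} k) \<le> integral {c..d} (\<lambda>x. cmod (k x))"
    using ki by (intro integral_norm_bound_integral) (auto simp: absolutely_integrable_on_def)
  also have "\<dots> = integral {c..d} (\<lambda>x. cmod (?i x) * cmod (k x))" by (intro integral_cong) auto
  also have "\<dots> \<le> (LINT x|M. cmod (?i x) * cmod (k x))"
    by (rule integral_subinterval_le[OF square_integrable_mult(2)[OF sqi k] _ cd(1)]) auto
  also have "\<dots> \<le> sqrt (LINT x|M. (cmod (?i x))\<^sup>2) * sqrt (LINT x|M. (cmod (k x))\<^sup>2)"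
    by (rule L2_cauchy_schwarz[OF sqi k])
  finally show ?thesis unfolding isq ie .
qed

text \<open>Three limits are taken: of the root of p times the derivative of u n in L2, of u n in
  L2(w), and of u n pointwise on I by the sup bound. The pointwise limit is a primitive of the limit
  of the derivatives, hence absolutely continuous, and Fatou identifies it with the L2(w)
  limit.\<close>

lemma dom_complete:
  assumes u: "\<And>n::nat. u n \<in> Dp"
    and cauchy: "\<And>e. e > 0 \<Longrightarrow> \<exists>N. \<forall>j\<ge>N. \<forall>k\<ge>N. W (\<lambda>x. u j x + - 1 * u k x) < e"
  shows "\<exists>f\<in> Dp. (\<lambda>n. W (\<lambda>x. u n x + - 1 * f x)) \<longlonglongrightarrow> 0"
proof -
  note [measurable] = dom_measurable[OF u]
  have uAC: "u n \<in> AC_loc I" for n using u by (simp add: dom_A_plus_iff)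
  define v where "v n x = complex_of_real (sqrt (p x)) * vderiv (u n) x" for n x
  have [measurable]: "v n \<in> borel_measurable M" for n unfolding v_def[abs_def] by measurable
  have v_sq: "square_integrable M (v n)" for n using u[of n] by (simp add: dom_A_plus_def v_def[abs_def])
  have u_sq: "square_integrable (weighted I w) (u n)" for n using u[of n] by (simp add: dom_A_plus_def)
  have nn: "0 \<le> (LINT x|M. w x * (cmod (f x))\<^sup>2)" "0 \<le> (LINT x|M. p x * (cmod (f x))\<^sup>2)" for f
    by (rule integral_nonneg_AE, rule eventually_mono[OF w_nonneg], simp)
      (rule integral_nonneg_AE, rule eventually_mono[OF p_nonneg], simp)
  have v_int: "(LINT x|M. (cmod (v j x - complex_of_real (sqrt (p x)) * k x))\<^sup>2) = (LINT x|M. p x * (cmod (vderiv (u j) x - k x))\<^sup>2)"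
    if [measurable]: "k \<in> borel_measurable M" for j k
  proof (rule integral_cong_AE)
    show "AE x in M. (cmod (v j x - complex_of_real (sqrt (p x)) * k x))\<^sup>2 = p x * (cmod (vderiv (u j) x - k x))\<^sup>2"
      using p_nonneg
    proof eventually_elim
      case (elim x)
      have "v j x - complex_of_real (sqrt (p x)) * k x = complex_of_real (sqrt (p x)) * (vderiv (u j) x - k x)"
        by (simp add: v_def algebra_simps)
      then show ?case using elim by (simp add: norm_mult power_mult_distrib)
    qed
  qed measurable
  have "\<exists>h. square_integrable M h \<and> (\<lambda>n. LINT x|M. (cmod (v n x - h x))\<^sup>2) \<longlonglongrightarrow> 0"
  proof (rule square_integrable_complete[OF v_sq])
    fix e :: real assume "e > 0"
    then obtain N where N: "\<And>j k. j \<ge> N \<Longrightarrow> k \<ge> N \<Longrightarrow> W (\<lambda>x. u j x + - 1 * u k x) < e" using cauchy by meson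
    have "(LINT x|M. (cmod (v j x - v k x))\<^sup>2) \<le> W (\<lambda>x. u j x + - 1 * u k x)" for j k
      using v_int[of "vderiv (u k)" j] nn(1)[of "\<lambda>x. u j x - u k x"] unfolding W_diff[OF u u] by (simp add: v_def)
    then show "\<exists>N. \<forall>j\<ge>N. \<forall>k\<ge>N. (LINT x|M. (cmod (v j x - v k x))\<^sup>2) < e"
      using N by (meson le_less_trans)
  qed
  then obtain h where h: "square_integrable M h" "(\<lambda>n. LINT x|M. (cmod (v n x - h x))\<^sup>2) \<longlonglongrightarrow> 0" by blast
  have "\<exists>F. square_integrable (weighted I w) F \<and> (\<lambda>n. LINT x|weighted I w. (cmod (u n x - F x))\<^sup>2) \<longlonglongrightarrow> 0"
  proof (rule square_integrable_complete[OF u_sq])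
    fix e :: real assume "e > 0"
    then obtain N where N: "\<And>j k. j \<ge> N \<Longrightarrow> k \<ge> N \<Longrightarrow> W (\<lambda>x. u j x + - 1 * u k x) < e" using cauchy by meson
    have "(LINT x|weighted I w. (cmod (u j x - u k x))\<^sup>2) \<le> W (\<lambda>x. u j x + - 1 * u k x)" for j k
      using nn(2)[of "\<lambda>x. vderiv (u j) x - vderiv (u k) x"] unfolding W_diff[OF u u] by (subst integral_weighted) auto
    then show "\<exists>N. \<forall>j\<ge>N. \<forall>k\<ge>N. (LINT x|weighted I w. (cmod (u j x - u k x))\<^sup>2) < e"
      using N by (meson le_less_trans)
  qed
  then obtain F where F: "square_integrable (weighted I w) F" "(\<lambda>n. LINT x|weighted I w. (cmod (u n x - F x))\<^sup>2) \<longlonglongrightarrow> 0" by blast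
  have hm [measurable]: "h \<in> borel_measurable M" using h by (rule_tac square_integrable_measurable)
  have Fm [measurable]: "F \<in> borel_measurable M" using F by (simp add: square_integrable_def)
  \<comment> \<open>The candidate for the derivative of the limit. Only its product with the root of
    p arises as a limit; p \<ge> \<delta> makes k itself square integrable.\<close>
  define k where "k x = h x / complex_of_real (sqrt (p x))" for x
  have km [measurable]: "k \<in> borel_measurable M" unfolding k_def[abs_def] by measurable
  have kh: "AE x in M. complex_of_real (sqrt (p x)) * k x = h x"
    using p_pos by eventually_elim (simp add: k_def)
  have lim_v: "(\<lambda>n. LINT x|M. p x * (cmod (vderiv (u n) x - k x))\<^sup>2) \<longlonglongrightarrow> 0"
  proof -
    have "(LINT x|M. (cmod (v n x - h x))\<^sup>2) = (LINT x|M. (cmod (v n x - complex_of_real (sqrt (p x)) * k x))\<^sup>2)" for n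
      by (rule integral_cong_AE) (measurable, use kh in \<open>eventually_elim, simp\<close>)
    then show ?thesis using h(2) by (simp add: v_int)
  qed
  have p_int_k: "integrable M (\<lambda>x. p x * (cmod (k x))\<^sup>2)"
    using square_integrable_cong_AE[OF h(1) _ kh] square_integrable_sqrt_p[OF km] by simp
  have sq_if: "square_integrable M g \<and> (LINT x|M. (cmod (g x))\<^sup>2) \<le> (LINT x|M. p x * (cmod (g x))\<^sup>2) / \<delta>"
    if [measurable]: "g \<in> borel_measurable M" and i: "integrable M (\<lambda>x. p x * (cmod (g x))\<^sup>2)" for g
  proof -
    have le: "AE x in M. (cmod (g x))\<^sup>2 \<le> p x * (cmod (g x))\<^sup>2 / \<delta>"
      using wp_ge
    proof eventually_elim
      case (elim x)
      then have "\<delta> * (cmod (g x))\<^sup>2 \<le> p x * (cmod (g x))\<^sup>2" by (intro mult_right_mono) auto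
      then show ?case using \<delta>_pos by (simp add: field_simps)
    qed
    have i': "integrable M (\<lambda>x. p x * (cmod (g x))\<^sup>2 / \<delta>)" using i by simp
    have s: "integrable M (\<lambda>x. (cmod (g x))\<^sup>2)"
    proof (rule Bochner_Integration.integrable_bound[OF i'])
      show "AE x in M. norm ((cmod (g x))\<^sup>2) \<le> norm (p x * (cmod (g x))\<^sup>2 / \<delta>)"
        using le
      proof eventually_elim
        case (elim x)
        then show ?case unfolding real_norm_def using zero_le_power2[of "cmod (g x)"] by linarith
      qed
    qed measurable
    show ?thesis using s integral_mono_AE[OF s i' le] by (simp add: square_integrable_def)
  qed
  have k_sq: "square_integrable M k" using sq_if[OF km p_int_k] by simp
  have k_loc: "k absolutely_integrable_on {c..d}" if "{c..d} \<subseteq> I" for c d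
    by (rule square_integrable_locally[OF k_sq that])
  obtain K where K: "K > 0" "\<And>f x. f \<in> Dp \<Longrightarrow> x \<in> I \<Longrightarrow> (cmod (f x))\<^sup>2 \<le> K * W f" using sobolev_sup_bound by blast
  \<comment> \<open>Outside I this may be an unspecified default; the statements about f concern
    points of I.\<close>
  define f where "f x = lim (\<lambda>n. u n x)" for x
  have lim_f: "(\<lambda>n. u n x) \<longlonglongrightarrow> f x" if x: "x \<in> I" for x
  proof -
    have "Cauchy (\<lambda>n. u n x)"
    proof (rule metric_CauchyI)
      fix e :: real assume "e > 0"
      then have "e\<^sup>2 / K > 0" using K by simp
      then obtain N where N: "\<And>j k. j \<ge> N \<Longrightarrow> k \<ge> N \<Longrightarrow> W (\<lambda>x. u j x + - 1 * u k x) < e\<^sup>2 / K" using cauchy by meson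
      have "dist (u j x) (u k x) < e" if "j \<ge> N" "k \<ge> N" for j k
      proof -
        have "(cmod (u j x - u k x))\<^sup>2 \<le> K * W (\<lambda>x. u j x + - 1 * u k x)" using K(2)[OF dom_diff(1)[OF u u] x, of j k] by simp
        also have "\<dots> < K * (e\<^sup>2 / K)" using N[OF that] K(1) by (intro mult_strict_left_mono)
        also have "\<dots> = e\<^sup>2" using K by simp
        finally show ?thesis using \<open>e > 0\<close> by (simp add: dist_norm power2_less_imp_less)
      qed
      then show "\<exists>N. \<forall>j\<ge>N. \<forall>k\<ge>N. dist (u j x) (u k x) < e" by blast
    qed
    then show ?thesis unfolding f_def by (simp add: Cauchy_convergent_iff convergent_LIMSEQ_iff)
  qed
  have f_int: "(k has_integral (f d - f c)) {c..d}" if cd: "c \<le> d" "{c..d} \<subseteq> I" for c d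
  proof -
    have ki: "k integrable_on {c..d}" using k_loc[OF cd(2)] by (simp add: absolutely_integrable_on_def)
    \<comment> \<open>The difference of the two integrals is at most the root of d - c times the L2
      distance of the integrands, which \<delta> compares with the distance weighted by p.\<close>
    have "(\<lambda>n. integral {c..d} (vderiv (u n)) - integral {c..d} k) \<longlonglongrightarrow> 0"
    proof (rule Lim_null_comparison)
      show "\<forall>\<^sub>F n in sequentially. norm (integral {c..d} (vderiv (u n)) - integral {c..d} k) \<le>
          sqrt (d - c) * sqrt ((LINT x|M. p x * (cmod (vderiv (u n) x - k x))\<^sup>2) / \<delta>)"
      proof (rule always_eventually, rule allI)
        fix n
        have "(vderiv (u n)) integrable_on {c..d}" using AC_loc_has_integral[OF uAC cd] by blast
        then have "integral {c..d} (vderiv (u n)) - integral {c..d} k = integral {c..d} (\<lambda>x. vderiv (u n) x - k x)"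
          using ki by (simp add: Henstock_Kurzweil_Integration.integral_diff)
        note * = this
        have "square_integrable M (\<lambda>x. complex_of_real (sqrt (p x)) * (vderiv (u n) x - k x))"
          using square_integrable_diff[OF v_sq[of n], of "\<lambda>x. complex_of_real (sqrt (p x)) * k x"] square_integrable_sqrt_p[OF km] p_int_k
          by (simp add: v_def[abs_def] right_diff_distrib)
        then have i: "integrable M (\<lambda>x. p x * (cmod (vderiv (u n) x - k x))\<^sup>2)"
          by (subst (asm) square_integrable_sqrt_p) auto
        have "cmod (integral {c..d} (\<lambda>x. vderiv (u n) x - k x)) \<le> sqrt (d - c) * sqrt (LINT x|M. (cmod (vderiv (u n) x - k x))\<^sup>2)"
          using sq_if[OF _ i] by (intro norm_integral_subinterval_le cd) auto
        also have "\<dots> \<le> sqrt (d - c) * sqrt ((LINT x|M. p x * (cmod (vderiv (u n) x - k x))\<^sup>2) / \<delta>)"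
          using sq_if[OF _ i] cd by (intro mult_left_mono real_sqrt_le_mono) auto
        finally show "norm (integral {c..d} (vderiv (u n)) - integral {c..d} k) \<le>
          sqrt (d - c) * sqrt ((LINT x|M. p x * (cmod (vderiv (u n) x - k x))\<^sup>2) / \<delta>)" unfolding * .
      qed
      have "(\<lambda>n. sqrt (d - c) * sqrt ((LINT x|M. p x * (cmod (vderiv (u n) x - k x))\<^sup>2) / \<delta>)) \<longlonglongrightarrow> sqrt (d - c) * sqrt (0 / \<delta>)"
        using \<delta>_pos by (intro tendsto_intros lim_v) auto
      then show "(\<lambda>n. sqrt (d - c) * sqrt ((LINT x|M. p x * (cmod (vderiv (u n) x - k x))\<^sup>2) / \<delta>)) \<longlonglongrightarrow> 0" by simp
    qed
    then have "(\<lambda>n. u n d - u n c) \<longlonglongrightarrow> integral {c..d} k"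
      using integral_unique[OF AC_loc_has_integral[OF uAC cd]] by (simp add: Lim_null[symmetric])
    moreover have "(\<lambda>n. u n d - u n c) \<longlonglongrightarrow> f d - f c" using cd by (intro tendsto_diff lim_f) auto
    ultimately have "integral {c..d} k = f d - f c" by (rule LIMSEQ_unique)
    then show ?thesis using ki by (metis integrable_integral)
  qed
  have fAC: "f \<in> AC_loc I" "AE x in M. vderiv f x = k x"
    by (rule AC_loc_indefinite_integral[OF open_I k_loc f_int]; assumption)+
  note [measurable] = AC_loc_measurable[OF fAC(1) open_I]
  have fF: "AE x in M. f x = F x"
  proof -
    have "(\<integral>\<^sup>+x. ennreal ((cmod (f x - F x))\<^sup>2) \<partial>weighted I w) = (\<integral>\<^sup>+x. liminf (\<lambda>n. ennreal ((cmod (u n x - F x))\<^sup>2)) \<partial>weighted I w)"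
    proof (rule nn_integral_cong)
      fix x assume "x \<in> space (weighted I w)"
      then have "x \<in> I" by (simp add: weighted_def)
      then have "(\<lambda>n. ennreal ((cmod (u n x - F x))\<^sup>2)) \<longlonglongrightarrow> ennreal ((cmod (f x - F x))\<^sup>2)"
        by (intro tendsto_intros lim_f)
      then show "ennreal ((cmod (f x - F x))\<^sup>2) = liminf (\<lambda>n. ennreal ((cmod (u n x - F x))\<^sup>2))"
        using lim_imp_Liminf[OF sequentially_bot] by metis
    qed
    also have "\<dots> \<le> liminf (\<lambda>n. \<integral>\<^sup>+x. ennreal ((cmod (u n x - F x))\<^sup>2) \<partial>weighted I w)"
      by (rule nn_integral_liminf) simp
    also have "(\<lambda>n. \<integral>\<^sup>+x. ennreal ((cmod (u n x - F x))\<^sup>2) \<partial>weighted I w) = (\<lambda>n. ennreal (LINT x|weighted I w. (cmod (u n x - F x))\<^sup>2))"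
    proof
      fix n show "(\<integral>\<^sup>+x. ennreal ((cmod (u n x - F x))\<^sup>2) \<partial>weighted I w) = ennreal (LINT x|weighted I w. (cmod (u n x - F x))\<^sup>2)"
        using square_integrable_diff[OF u_sq F(1), of n] by (intro nn_integral_eq_integral) (auto simp: square_integrable_def)
    qed
    also have "liminf \<dots> = ennreal 0" by (rule lim_imp_Liminf[OF sequentially_bot tendsto_ennrealI[OF F(2)]])
    finally have "(\<integral>\<^sup>+x. ennreal ((cmod (f x - F x))\<^sup>2) \<partial>weighted I w) = 0" by simp
    then have "AE x in weighted I w. ennreal ((cmod (f x - F x))\<^sup>2) = 0"
      by (subst (asm) nn_integral_0_iff_AE) auto
    then show ?thesis unfolding AE_weighted by (auto elim!: eventually_mono)
  qed
  have f_dom: "f \<in> Dp"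
    unfolding dom_A_plus_iff
  proof (intro conjI fAC(1))
    have "square_integrable (weighted I w) f"
      by (rule square_integrable_cong_AE[OF F(1)]) (use fF in \<open>auto simp: AE_weighted\<close>)
    then show "integrable M (\<lambda>x. w x * (cmod (f x))\<^sup>2)" by (simp add: square_integrable_weighted)
    show "integrable M (\<lambda>x. p x * (cmod (vderiv f x))\<^sup>2)"
      by (rule integrable_cong_AE_imp[OF p_int_k]) (measurable, use fAC(2) in \<open>eventually_elim, simp\<close>)
  qed
  have "W (\<lambda>x. u n x + - 1 * f x) = (LINT x|weighted I w. (cmod (u n x - F x))\<^sup>2) + (LINT x|M. p x * (cmod (vderiv (u n) x - k x))\<^sup>2)" for n
  proof -
    have "(LINT x|M. w x * (cmod (u n x - f x))\<^sup>2) = (LINT x|weighted I w. (cmod (u n x - f x))\<^sup>2)"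
      by (subst integral_weighted) auto
    also have "\<dots> = (LINT x|weighted I w. (cmod (u n x - F x))\<^sup>2)"
      by (rule integral_cong_AE) (simp, simp, use fF in \<open>unfold AE_weighted, eventually_elim, simp\<close>)
    finally have 1: "(LINT x|M. w x * (cmod (u n x - f x))\<^sup>2) = (LINT x|weighted I w. (cmod (u n x - F x))\<^sup>2)" .
    have 2: "(LINT x|M. p x * (cmod (vderiv (u n) x - vderiv f x))\<^sup>2) = (LINT x|M. p x * (cmod (vderiv (u n) x - k x))\<^sup>2)"
      by (rule integral_cong_AE) (measurable, use fAC(2) in \<open>eventually_elim, simp\<close>)
    show ?thesis unfolding W_diff[OF u f_dom] 1 2 ..
  qed
  then have "(\<lambda>n. W (\<lambda>x. u n x + - 1 * f x)) \<longlonglongrightarrow> 0"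
    using tendsto_add[OF F(2) lim_v] by simp
  then show ?thesis using f_dom by blast
qed

end

section \<open>Boundary conditions and closedness of the form domains\<close>

context sl_data
begin

text \<open>Membership in \<open>dom_A_minus\<close> provides the integrability condition for some
  absolutely continuous version. Versions agree almost everywhere, hence on I by continuity, and so
  do their derivatives; the condition therefore holds for every version.\<close>

lemma ac_version_square_integrable:
  assumes g: "g \<in> dom_A_minus I w p" and G: "ac_version I w p g G"
  shows "square_integrable M (\<lambda>x. vderiv G x / complex_of_real (sqrt (w x)))"
proof -
  obtain H where H: "ac_version I w p g H" "square_integrable M (\<lambda>x. vderiv H x / complex_of_real (sqrt (w x)))"
    using g by (auto simp: dom_A_minus_def)
  have AC: "G \<in> AC_loc I" "H \<in> AC_loc I" using G H by (auto simp: ac_version_def)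
  have "AE x in M. G x = H x" using G H(1) unfolding ac_version_def by (auto elim: eventually_elim2)
  then have eq: "G x = H x" if "x \<in> I" for x
    using AE_eq_continuous_open[OF open_I AC_loc_continuous[OF AC(1) open_I] AC_loc_continuous[OF AC(2) open_I] _ that] by blast
  note [measurable] = AC_loc_measurable[OF AC(1) open_I]
  have "AE x in M. vderiv G x = vderiv H x"
    using AC_loc_AE_vector_derivative[OF AC(2) open_I] AE_space
  proof eventually_elim
    case (elim x)
    then have "x \<in> I" by simp
    have "(G has_vector_derivative vderiv H x) (at x)"
      by (rule has_vector_derivative_transform_within_open[OF elim(1) open_I \<open>x \<in> I\<close>]) (simp add: eq)
    then show ?case by (subst vderiv_def) (rule vector_derivative_at)
  qed
  then show ?thesis
    by (intro square_integrable_cong_AE[OF H(2)]) (measurable, auto elim!: eventually_mono)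
qed

text \<open>The derivative of G f is (G' / sqrt w) (sqrt w f) + (sqrt w g) (sqrt p f'), so by
  Cauchy--Schwarz its L1 norm is at most a constant times sqrt (W f). Together with the sup bound at
  one point x0 this controls G f on all of I, up to the end points, with a constant that does not
  depend on f.\<close>

lemma boundary_product_bound:
  assumes g: "g \<in> dom_A_minus I w p" and G: "ac_version I w p g G"
  shows "\<exists>K\<ge>0. \<forall>f\<in>Dp. \<forall>x\<in>I. cmod (G x * f x) \<le> K * sqrt (W f)"
proof -
  have GAC: "G \<in> AC_loc I" and Gg: "AE x in M. G x = complex_of_real (sqrt (w x * p x)) * g x"
    using G by (auto simp: ac_version_def)
  have gm [measurable]: "g \<in> borel_measurable M" and gi: "integrable M (\<lambda>x. w x * (cmod (g x))\<^sup>2)"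
    using g by (auto simp: dom_A_minus_def square_integrable_weighted)
  note [measurable] = AC_loc_measurable[OF GAC open_I]
  let ?A = "\<lambda>x. vderiv G x / complex_of_real (sqrt (w x))"
  let ?sw = "\<lambda>h x. complex_of_real (sqrt (w x)) * h x" and ?sp = "\<lambda>h x. complex_of_real (sqrt (p x)) * h x"
  have A: "square_integrable M ?A" by (rule ac_version_square_integrable[OF g G])
  have sw: "square_integrable M (?sw h) \<and> (LINT x|M. (cmod (?sw h x))\<^sup>2) = (LINT x|M. w x * (cmod (h x))\<^sup>2)"
    if [measurable]: "h \<in> borel_measurable M" and i: "integrable M (\<lambda>x. w x * (cmod (h x))\<^sup>2)" for h
  proof -
    have e: "AE x in M. (cmod (?sw h x))\<^sup>2 = w x * (cmod (h x))\<^sup>2"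
      using w_nonneg by eventually_elim (simp add: norm_mult power_mult_distrib)
    have "integrable M (\<lambda>x. (cmod (?sw h x))\<^sup>2)"
      by (rule integrable_cong_AE_imp[OF i]) (measurable, use e in \<open>eventually_elim, simp\<close>)
    moreover have "(LINT x|M. (cmod (?sw h x))\<^sup>2) = (LINT x|M. w x * (cmod (h x))\<^sup>2)"
      by (rule integral_cong_AE[OF _ _ e]) measurable
    ultimately show ?thesis by (simp add: square_integrable_def)
  qed
  have sp: "(LINT x|M. (cmod (?sp h x))\<^sup>2) = (LINT x|M. p x * (cmod (h x))\<^sup>2)"
    if [measurable]: "h \<in> borel_measurable M" for h
    by (rule integral_cong_AE) (measurable, use p_nonneg in \<open>eventually_elim, simp add: norm_mult power_mult_distrib\<close>)
  obtain x0 where x0: "x0 \<in> I"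
    using ereal_dense2[OF ab] by (auto simp: I_eq einterval_def)
  obtain K where K: "K > 0" "\<And>f x. f \<in> Dp \<Longrightarrow> x \<in> I \<Longrightarrow> (cmod (f x))\<^sup>2 \<le> K * W f" using sobolev_sup_bound by blast
  define k1 where "k1 = sqrt (LINT x|M. (cmod (?A x))\<^sup>2)"
  define k2 where "k2 = sqrt (LINT x|M. w x * (cmod (g x))\<^sup>2)"
  have k: "k1 \<ge> 0" "k2 \<ge> 0"
  proof -
    show "k1 \<ge> 0" by (simp add: k1_def integral_nonneg_AE)
    have "0 \<le> (LINT x|M. w x * (cmod (g x))\<^sup>2)" by (rule integral_nonneg_AE, rule eventually_mono[OF w_nonneg]) simp
    then show "k2 \<ge> 0" by (simp add: k2_def)
  qed
  have main: "cmod (G x * f x) \<le> (cmod (G x0) * sqrt K + (k1 + k2)) * sqrt (W f)" if f: "f \<in> Dp" and x: "x \<in> I" for f x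
  proof -
    have fAC: "f \<in> AC_loc I" using f by (simp add: dom_A_plus_iff)
    note [measurable] = dom_measurable[OF f]
    let ?D = "\<lambda>x. vderiv G x * f x + G x * vderiv f x"
    have sqf: "square_integrable M (?sw f)" "square_integrable M (?sp (vderiv f))"
      using sw[of f] f by (simp add: dom_A_plus_iff) (use f in \<open>simp add: dom_A_plus_def\<close>)
    have sqg: "square_integrable M (?sw g)" using sw[OF gm gi] by simp
    have i1: "integrable M (\<lambda>x. cmod (?A x) * cmod (?sw f x))" by (rule square_integrable_mult(2)[OF A sqf(1)])
    have i2: "integrable M (\<lambda>x. cmod (?sw g x) * cmod (?sp (vderiv f) x))" by (rule square_integrable_mult(2)[OF sqg sqf(2)])
    have le: "AE x in M. cmod (?D x) \<le> cmod (?A x) * cmod (?sw f x) + cmod (?sw g x) * cmod (?sp (vderiv f) x)"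
      using w_pos p_pos Gg
    proof eventually_elim
      case (elim x)
      have "cmod (?D x) \<le> cmod (vderiv G x) * cmod (f x) + cmod (G x) * cmod (vderiv f x)"
        by (metis norm_mult norm_triangle_ineq)
      also have "cmod (vderiv G x) * cmod (f x) = cmod (?A x) * cmod (?sw f x)"
        using elim by (simp add: norm_mult norm_divide)
      also have "cmod (G x) * cmod (vderiv f x) = cmod (?sw g x) * cmod (?sp (vderiv f) x)"
        using elim by (simp add: norm_mult real_sqrt_mult)
      finally show ?case .
    qed
    have iD: "integrable M (\<lambda>x. cmod (?D x))"
      by (rule Bochner_Integration.integrable_bound[OF Bochner_Integration.integrable_add[OF i1 i2]])
         (measurable, use le in \<open>eventually_elim, simp\<close>)
    have "(LINT x|M. cmod (?D x)) \<le> (LINT x|M. cmod (?A x) * cmod (?sw f x) + cmod (?sw g x) * cmod (?sp (vderiv f) x))"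
      by (rule integral_mono_AE[OF iD Bochner_Integration.integrable_add[OF i1 i2] le])
    also have "\<dots> = (LINT x|M. cmod (?A x) * cmod (?sw f x)) + (LINT x|M. cmod (?sw g x) * cmod (?sp (vderiv f) x))"
      by (rule Bochner_Integration.integral_add[OF i1 i2])
    also have "\<dots> \<le> k1 * sqrt (W f) + k2 * sqrt (W f)"
    proof (rule add_mono)
      have "(LINT x|M. cmod (?A x) * cmod (?sw f x)) \<le> k1 * sqrt (LINT x|M. (cmod (?sw f x))\<^sup>2)"
        unfolding k1_def by (rule L2_cauchy_schwarz[OF A sqf(1)])
      also have "(LINT x|M. (cmod (?sw f x))\<^sup>2) = (LINT x|M. w x * (cmod (f x))\<^sup>2)"
        using sw[of f] f by (simp add: dom_A_plus_iff)
      also have "k1 * sqrt (LINT x|M. w x * (cmod (f x))\<^sup>2) \<le> k1 * sqrt (W f)"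
        using dom_integrable(4)[OF f] k by (intro mult_left_mono real_sqrt_le_mono)
      finally show "(LINT x|M. cmod (?A x) * cmod (?sw f x)) \<le> k1 * sqrt (W f)" .
      have "(LINT x|M. cmod (?sw g x) * cmod (?sp (vderiv f) x)) \<le> sqrt (LINT x|M. (cmod (?sw g x))\<^sup>2) * sqrt (LINT x|M. (cmod (?sp (vderiv f) x))\<^sup>2)"
        by (rule L2_cauchy_schwarz[OF sqg sqf(2)])
      also have "sqrt (LINT x|M. (cmod (?sw g x))\<^sup>2) = k2" using sw[OF gm gi] by (simp add: k2_def)
      also have "(LINT x|M. (cmod (?sp (vderiv f) x))\<^sup>2) = (LINT x|M. p x * (cmod (vderiv f x))\<^sup>2)"
        by (rule sp) measurable
      also have "k2 * sqrt (LINT x|M. p x * (cmod (vderiv f x))\<^sup>2) \<le> k2 * sqrt (W f)"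
        using dom_integrable(5)[OF f] k by (intro mult_left_mono real_sqrt_le_mono)
      finally show "(LINT x|M. cmod (?sw g x) * cmod (?sp (vderiv f) x)) \<le> k2 * sqrt (W f)" .
    qed
    finally have DI: "(LINT x|M. cmod (?D x)) \<le> (k1 + k2) * sqrt (W f)" by (simp add: ring_distribs)
    have GfAC: "(\<lambda>x. G x * f x) \<in> AC_loc I" "AE x in M. vderiv (\<lambda>x. G x * f x) x = ?D x"
      using AC_loc_mult[OF GAC fAC open_I] by auto
    note [measurable] = AC_loc_measurable[OF GfAC(1) open_I]
    have iV: "integrable M (\<lambda>x. cmod (vderiv (\<lambda>x. G x * f x) x))"
      by (rule integrable_cong_AE_imp[OF iD]) (measurable, use GfAC(2) in \<open>eventually_elim, simp\<close>)
    have eV: "(LINT x|M. cmod (vderiv (\<lambda>x. G x * f x) x)) = (LINT x|M. cmod (?D x))"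
      by (rule integral_cong_AE) (measurable, use GfAC(2) in \<open>eventually_elim, simp\<close>)
    have diff: "cmod (G d * f d - G c * f c) \<le> (k1 + k2) * sqrt (W f)" if cd: "c \<in> I" "d \<in> I" "c \<le> d" for c d
    proof -
      note sub = Icc_subset_I[OF cd(1,2)]
      have "cmod (G d * f d - G c * f c) \<le> integral {c..d} (\<lambda>x. cmod (vderiv (\<lambda>x. G x * f x) x))"
        unfolding integral_unique[OF AC_loc_has_integral[OF GfAC(1) cd(3) sub], symmetric]
        using AC_loc_integrable[OF GfAC(1) sub] by (intro integral_norm_bound_integral) (auto simp: absolutely_integrable_on_def)
      also have "\<dots> \<le> (LINT x|M. cmod (vderiv (\<lambda>x. G x * f x) x))" by (rule integral_subinterval_le[OF iV _ sub]) simp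
      finally show ?thesis using DI eV by simp
    qed
    have "cmod (G x * f x - G x0 * f x0) \<le> (k1 + k2) * sqrt (W f)"
      using diff[OF x0 x] diff[OF x x0] by (cases "x0 \<le> x") (auto simp: norm_minus_commute)
    moreover have "cmod (G x0 * f x0) \<le> cmod (G x0) * (sqrt K * sqrt (W f))"
      unfolding norm_mult using K(2)[OF f x0] by (intro mult_left_mono) (auto simp: real_le_rsqrt real_sqrt_mult[symmetric])
    moreover have "cmod (G x * f x) \<le> cmod (G x * f x - G x0 * f x0) + cmod (G x0 * f x0)"
      by (metis diff_add_cancel norm_triangle_ineq)
    ultimately show ?thesis by (simp add: ring_distribs mult.assoc)
  qed
  show ?thesis
    using main k K(1) by (intro exI[of _ "cmod (G x0) * sqrt K + (k1 + k2)"]) (auto intro!: add_nonneg_nonneg)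
qed

abbreviation "FD ty \<equiv> form_dom ty a b w p"

lemma form_dom_subset: "f \<in> FD ty \<Longrightarrow> f \<in> Dp"
  by (cases ty) (auto simp: form_dom_def I_eq)

lemma form_dom_Q0_iff:
  "f \<in> FD Type_Q0 \<longleftrightarrow> f \<in> Dp \<and> (\<forall>g\<in>dom_A_minus I w p. \<forall>G. ac_version I w p g G \<longrightarrow>
     ((\<lambda>x. G (real_of_ereal x) * f (real_of_ereal x)) \<longlongrightarrow> 0) (at_right a) \<and>
     ((\<lambda>x. G (real_of_ereal x) * f (real_of_ereal x)) \<longlongrightarrow> 0) (at_left b))"
  by (simp add: form_dom_def I_eq)

lemma form_dom_Q_eq: "FD Type_Q = Dp"
  by (simp add: form_dom_def I_eq)

lemma form_dom_add: "f \<in> FD ty \<Longrightarrow> g \<in> FD ty \<Longrightarrow> (\<lambda>x. f x + g x) \<in> FD ty"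
proof (cases ty)
  case Type_Q0
  assume "f \<in> FD ty" "g \<in> FD ty"
  then show ?thesis unfolding Type_Q0 form_dom_Q0_iff
    using tendsto_add[where a="0::complex" and b="0::complex"] by (auto simp: dom_add ring_distribs) fastforce+
qed (simp add: form_dom_Q_eq dom_add)

lemma form_dom_scale: "f \<in> FD ty \<Longrightarrow> (\<lambda>x. c * f x) \<in> FD ty"
proof (cases ty)
  case Type_Q0
  assume "f \<in> FD ty"
  then show ?thesis unfolding Type_Q0 form_dom_Q0_iff
    by (auto simp: dom_scale mult.left_commute[of _ c] intro!: tendsto_mult_right_zero)
qed (simp add: form_dom_Q_eq dom_scale)

lemma real_of_ereal_in_I:
  assumes "a < x" "x < b" shows "real_of_ereal x \<in> I"
  using assms by (cases x) (auto simp: I_eq einterval_def)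

lemma eventually_in_I:
  "eventually (\<lambda>x. real_of_ereal x \<in> I) (at_right a)" "eventually (\<lambda>x. real_of_ereal x \<in> I) (at_left b)"
  using real_of_ereal_in_I ab eventually_at_right[of a b] eventually_at_left[of a b] by blast+

text \<open>Since G (u n - f) is small uniformly on I once u n is close to f in the energy W, the
  product G f inherits the limit 0 at an end point from G u n.\<close>

lemma form_dom_closed:
  assumes u: "\<And>n::nat. u n \<in> FD ty" and f: "f \<in> Dp" and lim: "(\<lambda>n. W (\<lambda>x. u n x + - 1 * f x)) \<longlonglongrightarrow> 0"
  shows "f \<in> FD ty"
proof (cases ty)
  case Type_Q then show ?thesis using f by (simp add: form_dom_Q_eq)
next
  case Type_Q0
  show ?thesis unfolding Type_Q0 form_dom_Q0_iff
  proof (intro conjI ballI allI impI f)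
    fix g G assume g: "g \<in> dom_A_minus I w p" "ac_version I w p g G"
    obtain K where K: "K \<ge> 0" "\<And>h x. h \<in> Dp \<Longrightarrow> x \<in> I \<Longrightarrow> cmod (G x * h x) \<le> K * sqrt (W h)"
      using boundary_product_bound[OF g] by blast
    have *: "((\<lambda>x. G (real_of_ereal x) * f (real_of_ereal x)) \<longlongrightarrow> 0) F"
      if un: "\<And>n. ((\<lambda>x. G (real_of_ereal x) * u n (real_of_ereal x)) \<longlongrightarrow> 0) F"
        and F: "eventually (\<lambda>x. real_of_ereal x \<in> I) F" for F
    proof (rule tendstoI)
      fix e :: real assume "e > 0"
      have "(\<lambda>n. K * sqrt (W (\<lambda>x. u n x + - 1 * f x))) \<longlonglongrightarrow> K * sqrt 0" by (intro tendsto_intros lim)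
      then obtain n where n: "K * sqrt (W (\<lambda>x. u n x + - 1 * f x)) < e / 2"
        using order_tendstoD(2)[of _ 0 sequentially "e/2"] \<open>e > 0\<close> by (force simp: eventually_sequentially)
      have "eventually (\<lambda>x. dist (G (real_of_ereal x) * u n (real_of_ereal x)) 0 < e / 2) F"
        using tendstoD[OF un[of n], of "e/2"] \<open>e > 0\<close> by simp
      then show "eventually (\<lambda>x. dist (G (real_of_ereal x) * f (real_of_ereal x)) 0 < e) F"
        using F
      proof eventually_elim
        case (elim x)
        let ?y = "real_of_ereal x"
        have "cmod (G ?y * (u n ?y + - 1 * f ?y)) \<le> K * sqrt (W (\<lambda>x. u n x + - 1 * f x))"
          by (rule K(2)[OF dom_diff(1)[OF form_dom_subset[OF u] f] elim(2)])
        moreover have "G ?y * f ?y = G ?y * u n ?y - G ?y * (u n ?y + - 1 * f ?y)" by (simp add: algebra_simps)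
        then have "cmod (G ?y * f ?y) \<le> cmod (G ?y * u n ?y) + cmod (G ?y * (u n ?y + - 1 * f ?y))"
          by (metis norm_triangle_ineq4)
        ultimately show ?case using elim(1) n by simp
      qed
    qed
    show "((\<lambda>x. G (real_of_ereal x) * f (real_of_ereal x)) \<longlongrightarrow> 0) (at_right a)"
      by (rule *[OF _ eventually_in_I(1)]) (use u g in \<open>simp add: Type_Q0 form_dom_Q0_iff\<close>)
    show "((\<lambda>x. G (real_of_ereal x) * f (real_of_ereal x)) \<longlongrightarrow> 0) (at_left b)"
      by (rule *[OF _ eventually_in_I(2)]) (use u g in \<open>simp add: Type_Q0 form_dom_Q0_iff\<close>)
  qed
qed

text \<open>Near the end points the product with any G vanishes identically, so the boundary
  condition holds for either type of form domain. This supplies the test functions for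
  density.\<close>

lemma compact_support_in_form_dom:
  assumes f: "f \<in> Dp" and c: "c \<in> I" "d \<in> I" and 0: "\<And>x. x < c \<or> d < x \<Longrightarrow> f x = 0"
  shows "f \<in> FD ty"
proof (cases ty)
  case Type_Q0
  have cb: "a < ereal c" "ereal d < b" using c by (auto simp: I_eq einterval_def)
  have "eventually (\<lambda>x. f (real_of_ereal x) = 0) (at_right a)"
    unfolding eventually_at_right[OF cb(1)]
  proof (intro exI[of _ "ereal c"] conjI allI impI cb(1))
    fix y :: ereal assume "a < y" "y < ereal c"
    then show "f (real_of_ereal y) = 0" by (cases y) (auto intro: 0)
  qed
  then have A: "((\<lambda>x. G (real_of_ereal x) * f (real_of_ereal x)) \<longlongrightarrow> 0) (at_right a)" for G
    by (intro tendsto_eventually) (auto elim: eventually_mono)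
  have "eventually (\<lambda>x. f (real_of_ereal x) = 0) (at_left b)"
    unfolding eventually_at_left[OF cb(2)]
  proof (intro exI[of _ "ereal d"] conjI allI impI cb(2))
    fix y :: ereal assume "ereal d < y" "y < b"
    then show "f (real_of_ereal y) = 0" by (cases y) (auto intro: 0)
  qed
  then have B: "((\<lambda>x. G (real_of_ereal x) * f (real_of_ereal x)) \<longlongrightarrow> 0) (at_left b)" for G
    by (intro tendsto_eventually) (auto elim: eventually_mono)
  show ?thesis unfolding Type_Q0 form_dom_Q0_iff using f A B by blast
qed (simp add: form_dom_Q_eq f)

end

section \<open>Density of the form domain\<close>

text \<open>For x < c the interval from c to x is empty and its integral is 0. Hence this is a
  primitive on the whole line that vanishes left of c and is constant right of d.\<close>

definition cutoff_primitive :: "real \<Rightarrow> real \<Rightarrow> (real \<Rightarrow> complex) \<Rightarrow> real \<Rightarrow> complex" where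
  "cutoff_primitive c d g x = integral {c..x} (\<lambda>y. if y \<in> {c..d} then g y else 0)"

lemma cutoff_primitive:
  assumes g: "g absolutely_integrable_on {c..d}" and "c < d"
  shows "cutoff_primitive c d g \<in> AC_loc UNIV"
    "AE x in lebesgue. vderiv (cutoff_primitive c d g) x = (if x \<in> {c..d} then g x else 0)"
    "x \<le> c \<Longrightarrow> cutoff_primitive c d g x = 0"
    "x \<in> {c..d} \<Longrightarrow> cutoff_primitive c d g x = integral {c..x} g"
    "d \<le> x \<Longrightarrow> cutoff_primitive c d g x = integral {c..d} g"
proof -
  let ?h = "\<lambda>y. if y \<in> {c..d} then g y else 0"
  have hU: "?h absolutely_integrable_on UNIV" using g by (simp only: absolutely_integrable_restrict_UNIV)
  have h: "?h absolutely_integrable_on {s..t}" for s t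
    using hU by (rule absolutely_integrable_on_subinterval) simp
  then have hi: "?h integrable_on {s..t}" for s t by (simp add: absolutely_integrable_on_def)
  have zero: "(?h has_integral 0) {s..t}" if "t \<le> c \<or> d \<le> s" for s t
    by (rule has_integral_spike[of "{c,d}" _ _ "\<lambda>_. 0"]) (use that in auto)
  have P: "(?h has_integral (cutoff_primitive c d g t - cutoff_primitive c d g s)) {s..t}" if st: "s \<le> t" for s t
  proof -
    \<comment> \<open>Intervals starting left of c need separate treatment, because
      \<open>integral {c..x}\<close> is not a signed integral.\<close>
    consider "c \<le> s" | "s < c" "c \<le> t" | "t < c" by linarith
    then show ?thesis
    proof cases
      case 1
      have "integral {c..s} ?h + integral {s..t} ?h = integral {c..t} ?h"
        using 1 st hi by (intro Henstock_Kurzweil_Integration.integral_combine)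
      then have "integral {s..t} ?h = cutoff_primitive c d g t - cutoff_primitive c d g s"
        by (simp add: cutoff_primitive_def algebra_simps)
      then show ?thesis using integrable_integral[OF hi[of s t]] by simp
    next
      case 2
      have "(?h has_integral (0 + integral {c..t} ?h)) {s..t}"
        by (rule has_integral_combine[of s c t]) (use 2 zero[of c s] integrable_integral[OF hi[of c t]] in auto)
      then show ?thesis using 2 by (simp add: cutoff_primitive_def)
    next
      case 3
      then show ?thesis using zero[of t s] st by (simp add: cutoff_primitive_def)
    qed
  qed
  have "cutoff_primitive c d g \<in> AC_loc UNIV" "AE x in lebesgue_on UNIV. vderiv (cutoff_primitive c d g) x = ?h x"
    by (rule AC_loc_indefinite_integral[OF open_UNIV h P]; assumption)+
  then show "cutoff_primitive c d g \<in> AC_loc UNIV" "AE x in lebesgue. vderiv (cutoff_primitive c d g) x = ?h x"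
    by (simp_all only: lebesgue_on_UNIV_eq)
  show 0: "cutoff_primitive c d g x = 0" if "x \<le> c" for x
    using zero[of x c] that by (auto simp: cutoff_primitive_def integral_unique)
  show 1: "cutoff_primitive c d g x = integral {c..x} g" if "x \<in> {c..d}" for x
    unfolding cutoff_primitive_def using that by (intro integral_cong) auto
  show "cutoff_primitive c d g x = integral {c..d} g" if "d \<le> x" for x
  proof -
    have "cutoff_primitive c d g x - cutoff_primitive c d g d = 0"
      using has_integral_unique[OF P[OF that] zero[of x d]] by simp
    then show ?thesis using 1[of d] \<open>c < d\<close> by simp
  qed
qed

lemma integral_eq_0_AE:
  fixes g :: "real \<Rightarrow> real"
  assumes g: "g absolutely_integrable_on {c..d}" and "AE x in lebesgue_on {c..d}. 0 \<le> g x" and "integral {c..d} g = 0"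
  shows "AE x in lebesgue_on {c..d}. g x = 0"
proof -
  have i: "integrable (lebesgue_on {c..d}) g"
    using g by (simp add: integrable_restrict_space set_integrable_def)
  have "(LINT x|lebesgue_on {c..d}. g x) = 0"
    using lebesgue_integral_eq_integral[OF i] assms(3) by simp
  then show ?thesis using integral_nonneg_eq_0_iff_AE[OF i assms(2)] by simp
qed

lemma AE_lebesgue_on_mono:
  assumes "AE x in lebesgue_on I. P x" "J \<subseteq> I" "I \<in> sets lebesgue" "J \<in> sets lebesgue"
  shows "AE x in lebesgue_on J. P x"
  using assms by (auto simp: AE_restrict_space_iff elim!: eventually_mono)

context sl_data
begin

lemma integrable_cutoff:
  fixes g :: "real \<Rightarrow> real"
  assumes "g absolutely_integrable_on {c..d}" "{c..d} \<subseteq> I"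
  shows "integrable M (\<lambda>x. if x \<in> {c..d} then g x else 0)"
proof -
  have "(\<lambda>x. if x \<in> {c..d} then g x else 0) absolutely_integrable_on UNIV"
    using assms(1) by (simp only: absolutely_integrable_restrict_UNIV)
  then have "(\<lambda>x. if x \<in> {c..d} then g x else 0) absolutely_integrable_on I"
    using I_sets by (rule set_integrable_subset) auto
  then show ?thesis using I_sets by (simp add: integrable_restrict_space set_integrable_def)
qed

lemma coefficient_integrable:
  assumes "{c..d} \<subseteq> I"
  shows "w absolutely_integrable_on {c..d}" "(\<lambda>x. 1 / p x) absolutely_integrable_on {c..d}"
  using coeffs assms by (auto simp: sl_coeffs_def L1_loc_def)

text \<open>With \<open>U' = w u\<close> and \<open>\<kappa>\<close> the mean of \<open>U\<close> with respect to \<open>dx / p\<close>, the test function with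
  \<open>f' = (U - \<kappa>) / p\<close> on \<open>[c, d]\<close> has compact support; integrating by parts,
  \<open>\<integral> |U - \<kappa>|\<^sup>2 / p = 0\<close>.\<close>

lemma form_dom_dense_interval:
  assumes u: "square_integrable (weighted I w) u"
    and orth: "\<And>f. f \<in> FD ty \<Longrightarrow> (LINT x|M. w x *\<^sub>R (cnj (f x) * u x)) = 0"
    and cd: "c < d" "{c..d} \<subseteq> I"
  shows "AE x in lebesgue_on {c<..<d}. u x = 0"
proof -
  let ?J = "{c..d}"
  let ?L = "lebesgue_on ?J"
  have um [measurable]: "u \<in> borel_measurable M" and ui: "integrable M (\<lambda>x. w x * (cmod (u x))\<^sup>2)"
    using u by (auto simp: square_integrable_weighted)
  have J: "?J \<in> sets lebesgue" by simp
  have toL: "f \<in> borel_measurable ?L" if "f \<in> borel_measurable M" for f :: "real \<Rightarrow> 'b::{banach, second_countable_topology}"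
    using that cd(2) by (rule measurable_restrict_mono)
  define wu where "wu x = w x *\<^sub>R u x" for x
  \<comment> \<open>w u is integrable on the interval because |u| \<le> 1 + |u|^2 and both w and w
    |u|^2 are integrable there.\<close>
  have wu: "wu absolutely_integrable_on ?J"
  proof (rule measurable_bounded_by_integrable_imp_absolutely_integrable)
    show "wu \<in> borel_measurable ?L" unfolding wu_def[abs_def] by (rule toL) measurable
    have "(\<lambda>x. \<bar>w x\<bar> + \<bar>w x * (cmod (u x))\<^sup>2\<bar>) absolutely_integrable_on ?J"
      using absolutely_integrable_norm[OF coefficient_integrable(1)[OF cd(2)]]
        absolutely_integrable_norm[OF integrable_imp_absolutely_integrable_subinterval[OF ui I_sets cd(2)]]
      by (intro set_integral_add) (auto simp: o_def)
    then show "(\<lambda>x. \<bar>w x\<bar> + \<bar>w x * (cmod (u x))\<^sup>2\<bar>) integrable_on ?J" by (simp add: absolutely_integrable_on_def)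
    fix x
    have "0 \<le> (cmod (u x) - 1 / 2)\<^sup>2" by simp
    then have "cmod (u x) \<le> 1 + (cmod (u x))\<^sup>2" by (simp add: power2_diff power_divide)
    then have "\<bar>w x\<bar> * cmod (u x) \<le> \<bar>w x\<bar> * (1 + (cmod (u x))\<^sup>2)" by (rule mult_left_mono) simp
    then show "norm (wu x) \<le> \<bar>w x\<bar> + \<bar>w x * (cmod (u x))\<^sup>2\<bar>" by (simp add: wu_def abs_mult ring_distribs)
  qed auto
  define U where "U = cutoff_primitive c d wu"
  note UP = cutoff_primitive[OF wu cd(1), folded U_def]
  have contU: "continuous_on UNIV U" by (rule AC_loc_continuous[OF UP(1) open_UNIV])
  have contU': "continuous_on S U" for S using contU continuous_on_subset by blast
  have pi: "(\<lambda>x. 1 / p x) absolutely_integrable_on ?J" by (rule coefficient_integrable(2)[OF cd(2)])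
  have p_posL: "AE x in ?L. 0 < p x" by (rule AE_lebesgue_on_mono[OF p_pos cd(2) I_sets J])
  define c0 where "c0 = integral ?J (\<lambda>x. 1 / p x)"
  \<comment> \<open>c0 is the total mass of dx / p on [c, d]; it is not 0 because 1 / p is positive
    almost everywhere on an interval of positive length.\<close>
  have c0: "c0 \<noteq> 0"
  proof
    assume "c0 = 0"
    then have "AE x in ?L. 1 / p x = 0"
      unfolding c0_def by (intro integral_eq_0_AE[OF pi]) (use p_posL in \<open>auto elim: eventually_mono\<close>)
    with p_posL have "AE x in ?L. False" by eventually_elim simp
    then have "emeasure ?L {x \<in> space ?L. True} = 0" by (intro emeasure_eq_0_AE) simp
    moreover have "{x \<in> space ?L. True} = ?J" by auto
    ultimately show False using cd(1) by (simp add: emeasure_restrict_space)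
  qed
  have prod: "(\<lambda>x. (1 / p x) *\<^sub>R V x) absolutely_integrable_on ?J" if V: "continuous_on ?J V" for V :: "real \<Rightarrow> complex"
  proof -
    have "(\<lambda>x. (\<lambda>v r. r *\<^sub>R v) (V x) (1 / p x)) absolutely_integrable_on ?J"
    proof (rule absolutely_integrable_bounded_measurable_product[where h="\<lambda>(v::complex) (r::real). r *\<^sub>R v", OF _ _ _ _ pi])
      show "bilinear (\<lambda>(v::complex) (r::real). r *\<^sub>R v)"
        unfolding bilinear_def by (auto intro!: linearI simp: algebra_simps)
      show "V \<in> borel_measurable ?L" using V by (intro continuous_imp_measurable_on_sets_lebesgue) auto
      show "bounded (V ` ?J)" using V by (intro compact_imp_bounded compact_continuous_image) auto
    qed simp
    then show ?thesis by simp
  qed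
  define \<kappa> where "\<kappa> = integral ?J (\<lambda>x. (1 / p x) *\<^sub>R U x) / complex_of_real c0"
  define h where "h x = (1 / p x) *\<^sub>R (U x - \<kappa>)" for x
  have h: "h absolutely_integrable_on ?J" unfolding h_def[abs_def] by (intro prod continuous_intros contU')
  \<comment> \<open>The mean \<kappa> is subtracted exactly for this: the primitive f of h returns
    to 0 at d and can be continued by 0.\<close>
  have int_h: "integral ?J h = 0"
  proof -
    have "((\<lambda>x. (1 / p x) *\<^sub>R U x - (1 / p x) *\<^sub>R \<kappa>) has_integral (integral ?J (\<lambda>x. (1 / p x) *\<^sub>R U x) - c0 *\<^sub>R \<kappa>)) ?J"
      using prod[OF contU'] pi unfolding c0_def
      by (intro has_integral_diff has_integral_scaleR_left integrable_integral) (auto simp: absolutely_integrable_on_def)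
    then have "integral ?J h = integral ?J (\<lambda>x. (1 / p x) *\<^sub>R U x) - c0 *\<^sub>R \<kappa>"
      unfolding h_def by (simp add: integral_unique scaleR_right_diff_distrib)
    also have "\<dots> = 0" using c0 by (simp add: \<kappa>_def scaleR_conv_of_real)
    finally show ?thesis .
  qed
  have ch: "(\<lambda>x. cnj (h x)) absolutely_integrable_on ?J"
  proof -
    have "(\<lambda>x. (1 / p x) *\<^sub>R cnj (U x - \<kappa>)) absolutely_integrable_on ?J" by (intro prod continuous_intros contU')
    moreover have "(\<lambda>x. (1 / p x) *\<^sub>R cnj (U x - \<kappa>)) = (\<lambda>x. cnj (h x))" by (auto simp: h_def fun_eq_iff scaleR_conv_of_real)
    ultimately show ?thesis by simp
  qed
  define f where "f = cutoff_primitive c d h"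
  \<comment> \<open>F is the conjugate of f, built as a primitive of its own so that its derivative
    comes without differentiating a conjugate.\<close>
  define F where "F = cutoff_primitive c d (\<lambda>x. cnj (h x))"
  note fP = cutoff_primitive[OF h cd(1), folded f_def] and FP = cutoff_primitive[OF ch cd(1), folded F_def]
  have Ff: "F x = cnj (f x)" for x
    unfolding F_def f_def cutoff_primitive_def Henstock_Kurzweil_Integration.integral_cnj
    by (intro integral_cong) auto
  have f0: "f x = 0" if "x \<le> c \<or> d \<le> x" for x using fP(3)[of x] fP(5)[of x] that int_h by auto
  have fAC: "f \<in> AC_loc I" using fP(1) by (auto simp: AC_loc_def)
  have vf: "AE x in M. vderiv f x = (if x \<in> ?J then h x else 0)"
    using fP(2) I_sets by (auto simp: AE_restrict_space_iff elim: eventually_mono)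
  note [measurable] = AC_loc_measurable[OF fAC open_I]
  have "f \<in> Dp"
    unfolding dom_A_plus_iff
  proof (intro conjI fAC)
    have cf: "continuous_on ?J f" using AC_loc_continuous[OF fAC open_I] cd(2) continuous_on_subset by blast
    have "bounded (f ` ?J)" by (intro compact_imp_bounded compact_continuous_image cf) simp
    then obtain B where B: "\<And>x. x \<in> ?J \<Longrightarrow> cmod (f x) \<le> B" unfolding bounded_iff by blast
    have iB: "integrable M (\<lambda>x. B\<^sup>2 * (if x \<in> ?J then w x else 0))"
      by (intro integrable_mult_right integrable_cutoff[OF coefficient_integrable(1)[OF cd(2)] cd(2)])
    show "integrable M (\<lambda>x. w x * (cmod (f x))\<^sup>2)"
    proof (rule Bochner_Integration.integrable_bound[OF iB])
      have "norm (w x * (cmod (f x))\<^sup>2) \<le> norm (B\<^sup>2 * (if x \<in> ?J then w x else 0))" for x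
      proof (cases "x \<in> ?J")
        case True
        then have "(cmod (f x))\<^sup>2 \<le> B\<^sup>2" using B by (intro power_mono) auto
        then show ?thesis using True by (simp add: abs_mult mult.commute mult_left_mono)
      qed (use f0 in auto)
      then show "AE x in M. norm (w x * (cmod (f x))\<^sup>2) \<le> norm (B\<^sup>2 * (if x \<in> ?J then w x else 0))" by simp
    qed measurable
    have "bounded ((\<lambda>x. U x - \<kappa>) ` ?J)" by (intro compact_imp_bounded compact_continuous_image continuous_intros contU') simp
    then obtain A where A: "\<And>x. x \<in> ?J \<Longrightarrow> cmod (U x - \<kappa>) \<le> A" unfolding bounded_iff by blast
    have iA: "integrable M (\<lambda>x. A\<^sup>2 * (if x \<in> ?J then 1 / p x else 0))"
      by (intro integrable_mult_right integrable_cutoff[OF pi cd(2)])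
    show "integrable M (\<lambda>x. p x * (cmod (vderiv f x))\<^sup>2)"
    proof (rule Bochner_Integration.integrable_bound[OF iA])
      show "AE x in M. norm (p x * (cmod (vderiv f x))\<^sup>2) \<le> norm (A\<^sup>2 * (if x \<in> ?J then 1 / p x else 0))"
        using vf p_pos
      proof eventually_elim
        case (elim x)
        show ?case
        proof (cases "x \<in> ?J")
          case True
          have "p x * (cmod (vderiv f x))\<^sup>2 = (cmod (U x - \<kappa>))\<^sup>2 / p x"
            using True elim by (simp add: h_def power_mult_distrib power2_eq_square)
          moreover have "(cmod (U x - \<kappa>))\<^sup>2 \<le> A\<^sup>2" using A[OF True] by (intro power_mono) auto
          ultimately show ?thesis using True elim by (simp add: divide_right_mono)
        qed (use elim in auto)
      qed
    qed measurable
  qed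
  moreover have "c \<in> I" "d \<in> I" using cd by auto
  ultimately have f_FD: "f \<in> FD ty" by (rule compact_support_in_form_dom) (use f0 in auto)
  have Fwu: "(\<lambda>x. F x * wu x) absolutely_integrable_on ?J"
  proof (rule absolutely_integrable_bounded_measurable_product[where h="\<lambda>(v::complex) r. v * r", OF _ _ _ _ wu])
    have cF: "continuous_on ?J F" using AC_loc_continuous[OF FP(1) open_UNIV] continuous_on_subset by blast
    show "bilinear (\<lambda>(v::complex) r. v * r)"
      unfolding bilinear_def by (auto intro!: linearI simp: algebra_simps)
    show "F \<in> borel_measurable ?L" using cF by (intro continuous_imp_measurable_on_sets_lebesgue) auto
    show "bounded (F ` ?J)" using cF by (intro compact_imp_bounded compact_continuous_image) auto
  qed simp
  have "integral ?J (\<lambda>x. F x * wu x) = 0"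
  proof -
    have "integral ?J (\<lambda>x. F x * wu x) = (LINT x|?L. F x * wu x)"
      using Fwu by (intro lebesgue_integral_eq_integral[symmetric]) (auto simp: integrable_restrict_space set_integrable_def)
    also have "\<dots> = (LINT x|lebesgue. indicator ?J x *\<^sub>R (F x * wu x))" by (rule integral_restrict_space) simp
    also have "\<dots> = (LINT x|lebesgue. indicator I x *\<^sub>R (w x *\<^sub>R (cnj (f x) * u x)))"
    proof (rule Bochner_Integration.integral_cong[OF refl])
      fix x show "indicator ?J x *\<^sub>R (F x * wu x) = indicator I x *\<^sub>R (w x *\<^sub>R (cnj (f x) * u x))"
      proof (cases "x \<in> ?J")
        case True
        then have "x \<in> I" using cd(2) by auto
        then show ?thesis using True by (simp add: Ff wu_def)
      next
        case False
        then have "f x = 0" using f0[of x] by auto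
        then show ?thesis using False by simp
      qed
    qed
    also have "\<dots> = (LINT x|M. w x *\<^sub>R (cnj (f x) * u x))" by (rule integral_restrict_space[symmetric]) (use I_sets in simp)
    finally show ?thesis using orth[OF f_FD] by simp
  qed
  note FU = AC_loc_mult[OF FP(1) UP(1) open_UNIV]
  \<comment> \<open>The boundary terms vanish with F, and the term F w u has integral 0 by
    orthogonality, which leaves the integral of cnj h times U. Subtracting \<kappa> from U does not
    change it, as h has integral 0.\<close>
  have "(vderiv (\<lambda>x. F x * U x) has_integral (F d * U d - F c * U c)) ?J"
    by (rule AC_loc_has_integral[OF FU(1)]) (use cd in auto)
  moreover have "F d = 0" "F c = 0" using f0 by (auto simp: Ff)
  moreover obtain N where N: "negligible N" "\<And>x. x \<in> ?J - N \<Longrightarrow> vderiv (\<lambda>x. F x * U x) x = cnj (h x) * U x + F x * wu x"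
  proof -
    have "AE x in lebesgue. x \<in> ?J \<longrightarrow> vderiv (\<lambda>x. F x * U x) x = cnj (h x) * U x + F x * wu x"
      using FU(2) FP(2) UP(2) unfolding lebesgue_on_UNIV_eq by eventually_elim auto
    then obtain N where "N \<in> null_sets lebesgue" "{x. \<not> (x \<in> ?J \<longrightarrow> vderiv (\<lambda>x. F x * U x) x = cnj (h x) * U x + F x * wu x)} \<subseteq> N"
      by (auto simp: eventually_ae_filter)
    then show ?thesis using that[of N] by (auto simp: negligible_iff_null_sets)
  qed
  ultimately have "((\<lambda>x. cnj (h x) * U x + F x * wu x) has_integral 0) ?J"
    using has_integral_spike[of N ?J "\<lambda>x. cnj (h x) * U x + F x * wu x" "vderiv (\<lambda>x. F x * U x)" 0] by auto
  moreover have "((\<lambda>x. F x * wu x) has_integral 0) ?J"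
    using Fwu \<open>integral ?J (\<lambda>x. F x * wu x) = 0\<close> by (metis absolutely_integrable_on_def integrable_integral)
  ultimately have "((\<lambda>x. cnj (h x) * U x) has_integral 0) ?J"
    using has_integral_diff[of "\<lambda>x. cnj (h x) * U x + F x * wu x" 0 ?J "\<lambda>x. F x * wu x" 0] by simp
  moreover have "((\<lambda>x. cnj (h x) * \<kappa>) has_integral 0) ?J"
  proof -
    have "((\<lambda>x. cnj (h x)) has_integral cnj (integral ?J h)) ?J"
      using ch Henstock_Kurzweil_Integration.integral_cnj[of ?J h] by (simp add: absolutely_integrable_on_def has_integral_iff)
    then show ?thesis using int_h has_integral_mult_left[of "\<lambda>x. cnj (h x)" 0 ?J \<kappa>] by simp
  qed
  ultimately have "((\<lambda>x. cnj (h x) * U x - cnj (h x) * \<kappa>) has_integral 0) ?J"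
    using has_integral_diff[of "\<lambda>x. cnj (h x) * U x" 0 ?J "\<lambda>x. cnj (h x) * \<kappa>" 0] by simp
  moreover have "cnj (h x) * U x - cnj (h x) * \<kappa> = complex_of_real ((cmod (U x - \<kappa>))\<^sup>2 / p x)" for x
  proof -
    have "cnj (h x) * U x - cnj (h x) * \<kappa> = complex_of_real (1 / p x) * ((U x - \<kappa>) * cnj (U x - \<kappa>))"
    proof -
      have "cnj (h x) * U x - cnj (h x) * \<kappa> = cnj (h x) * (U x - \<kappa>)" by (simp only: right_diff_distrib)
      moreover have "cnj (h x) = complex_of_real (1 / p x) * cnj (U x - \<kappa>)"
        by (simp only: h_def scaleR_conv_of_real complex_cnj_mult complex_cnj_complex_of_real)
      then have "cnj (h x) * (U x - \<kappa>) = complex_of_real (1 / p x) * ((U x - \<kappa>) * cnj (U x - \<kappa>))"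
        by (simp only: mult_ac)
      ultimately show ?thesis by (rule trans)
    qed
    then show ?thesis by (simp only: complex_norm_square[symmetric] of_real_mult[symmetric]) simp
  qed
  ultimately have "((\<lambda>x. complex_of_real ((cmod (U x - \<kappa>))\<^sup>2 / p x)) has_integral 0) ?J" by simp
  from has_integral_Re[OF this] have i0: "integral ?J (\<lambda>x. (cmod (U x - \<kappa>))\<^sup>2 / p x) = 0" by (simp add: integral_unique)
  have ai: "(\<lambda>x. (cmod (U x - \<kappa>))\<^sup>2 / p x) absolutely_integrable_on ?J"
  proof -
    have "(\<lambda>x. (1 / p x) *\<^sub>R complex_of_real ((cmod (U x - \<kappa>))\<^sup>2)) absolutely_integrable_on ?J" by (intro prod continuous_intros contU')
    then have "(\<lambda>x. complex_of_real ((cmod (U x - \<kappa>))\<^sup>2 / p x)) absolutely_integrable_on ?J" by (simp add: scaleR_conv_of_real)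
    from absolutely_integrable_linear[OF this bounded_linear_Re] show ?thesis by (simp add: o_def)
  qed
  have "AE x in ?L. (cmod (U x - \<kappa>))\<^sup>2 / p x = 0"
    by (rule integral_eq_0_AE[OF ai _ i0]) (use p_posL in \<open>auto elim: eventually_mono\<close>)
  with p_posL have "AE x in ?L. U x = \<kappa>" by eventually_elim auto
  then have "AE x in lebesgue_on {c<..<d}. U x = \<kappa>" by (rule AE_lebesgue_on_mono) auto
  note AEk = this
  \<comment> \<open>An almost everywhere identity of continuous functions holds everywhere on the
    open interval, so U has derivative 0 there; with U' = w u and w > 0 almost everywhere this gives
    u = 0.\<close>
  have Ueq: "U x = \<kappa>" if "x \<in> {c<..<d}" for x
    by (rule AE_eq_continuous_open[OF _ contU' continuous_on_const AEk that]) simp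
  have vU: "vderiv U x = 0" if "x \<in> {c<..<d}" for x
  proof -
    have "(U has_vector_derivative 0) (at x)"
      by (rule has_vector_derivative_transform_within_open[of "\<lambda>_. \<kappa>" _ _ "{c<..<d}"]) (use that Ueq in auto)
    then show ?thesis unfolding vderiv_def by (rule vector_derivative_at)
  qed
  have "AE x in lebesgue_on {c<..<d}. vderiv U x = wu x"
    using UP(2) by (auto simp: AE_restrict_space_iff elim!: eventually_mono)
  moreover have "AE x in lebesgue_on {c<..<d}. 0 < w x"
    by (rule AE_lebesgue_on_mono[OF w_pos]) (use cd I_sets in auto)
  moreover have "AE x in lebesgue_on {c<..<d}. x \<in> {c<..<d}" by (rule AE_I2) simp
  ultimately show ?thesis by eventually_elim (auto simp: vU wu_def)
qed

lemma form_dom_dense: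
  assumes u: "square_integrable (weighted I w) u"
    and orth: "\<And>f. f \<in> FD ty \<Longrightarrow> (LINT x|M. w x *\<^sub>R (cnj (f x) * u x)) = 0"
  shows "AE x in M. u x = 0"
proof -
  obtain C where C: "countable C" "\<forall>(c,d)\<in>C. c < d \<and> {c..d} \<subseteq> I" "I = (\<Union>(c,d)\<in>C. {c<..<d})"
    using open_real_covering[OF open_I] by blast
  have "AE x in lebesgue. x \<in> {fst p<..<snd p} \<longrightarrow> u x = 0" if "p \<in> C" for p
    using form_dom_dense_interval[OF assms, where c="fst p" and d="snd p"] C(2) that
    by (auto simp: AE_restrict_space_iff split_beta)
  then have "AE x in lebesgue. \<forall>p\<in>C. x \<in> {fst p<..<snd p} \<longrightarrow> u x = 0"
    unfolding AE_ball_countable[OF C(1)] by blast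
  then have "AE x in lebesgue. x \<in> I \<longrightarrow> u x = 0"
  proof eventually_elim
    case (elim x)
    show ?case
    proof
      assume "x \<in> I"
      then obtain c d where "(c,d) \<in> C" "x \<in> {c<..<d}" using C(3) by auto
      then show "u x = 0" using elim by force
    qed
  qed
  then show ?thesis using I_sets by (simp add: AE_restrict_space_iff)
qed

section \<open>The associated operator and its resolvent set\<close>

abbreviation "cls \<equiv> ae_class (weighted I w)"
abbreviation "H \<equiv> sl_space a b w"

lemma H_eq: "H = L2_space (weighted I w)" by (simp add: sl_space_def I_eq)

lemma dom_class: "f \<in> Dp \<Longrightarrow> cls f \<in> hcarrier H"
  by (simp add: H_eq L2_carrierI dom_A_plus_def)

sublocale hilbert H
  unfolding H_eq by (rule hilbert_L2)

lemma Q_class: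
  assumes "square_integrable (weighted I w) f"
  shows "Q (cls f) = (LINT x|M. w x * (cmod (f x))\<^sup>2)"
proof -
  have fm [measurable]: "f \<in> borel_measurable M" using assms by (simp add: square_integrable_def)
  have "sqrt (Q (cls f)) = sqrt (LINT x|weighted I w. (cmod (f x))\<^sup>2)"
    using L2_norm[of f "weighted I w"] fm unfolding H_eq[symmetric] hnorm_eq by (simp add: nrm_def)
  then show ?thesis by (simp add: integral_weighted)
qed

lemma inner_class:
  assumes "f \<in> borel_measurable M" "g \<in> borel_measurable M"
  shows "hinner H (cls f) (cls g) = (LINT x|M. w x *\<^sub>R (cnj (f x) * g x))"
proof -
  note [measurable] = assms
  have "hinner H (cls f) (cls g) = (LINT x|weighted I w. cnj (f x) * g x)"
    using assms by (simp add: H_eq L2_inner)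
  also have "\<dots> = (LINT x|M. w x *\<^sub>R (cnj (f x) * g x))" by (rule integral_weighted) measurable
  finally show ?thesis .
qed

text \<open>A continuous function that vanishes almost everywhere on I vanishes on I, and then so
  does its derivative. Off I nothing is known about f, but the form integrates over I only.\<close>

lemma form_kernel:
  assumes f: "f \<in> Dp" and "Q (cls f) = 0"
  shows "form g f = 0"
proof -
  have fAC: "f \<in> AC_loc I" and i: "integrable M (\<lambda>x. w x * (cmod (f x))\<^sup>2)" using f by (auto simp: dom_A_plus_iff)
  have "(LINT x|M. w x * (cmod (f x))\<^sup>2) = 0"
    using assms(2) f by (subst (asm) Q_class) (auto simp: dom_A_plus_def)
  then have "AE x in M. w x * (cmod (f x))\<^sup>2 = 0"
    using integral_nonneg_eq_0_iff_AE[OF i eventually_mono[OF w_nonneg]] by simp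
  with w_pos have "AE x in M. f x = 0" by eventually_elim auto
  then have f0: "f x = 0" if "x \<in> I" for x
    using AE_eq_continuous_open[OF open_I AC_loc_continuous[OF fAC open_I] _ _ that, of "\<lambda>_. 0"] by auto
  have v0: "vderiv f x = 0" if "x \<in> I" for x
  proof -
    have "(f has_vector_derivative 0) (at x)"
      by (rule has_vector_derivative_transform_within_open[of "\<lambda>_. 0" _ _ I]) (use that f0 open_I in auto)
    then show ?thesis unfolding vderiv_def by (rule vector_derivative_at)
  qed
  have "form g f = (LINT x|M. 0)"
    unfolding sl_form_def by (rule Bochner_Integration.integral_cong) (auto simp: f0 v0)
  then show ?thesis by simp
qed

text \<open>These two inequalities make the abstract form norm equivalent to W, in terms of which
  completeness and the later energy estimates are carried out.\<close>

lemma form_norm_bounds: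
  assumes "f \<in> Dp"
  shows "W f \<le> Re (form f f) + (1 - lb) * Q (cls f)" "Re (form f f) + (1 - lb) * Q (cls f) \<le> (2 + q_bound - lb) * W f"
proof -
  have Qf: "Q (cls f) = (LINT x|M. w x * (cmod (f x))\<^sup>2)" by (rule Q_class) (use assms in \<open>simp add: dom_A_plus_def\<close>)
  show "W f \<le> Re (form f f) + (1 - lb) * Q (cls f)"
    using form_lower_bound[OF assms] dom_integrable(7)[OF assms] Qf by (simp add: algebra_simps)
  have "lb \<le> 0" using \<delta>_pos by (simp add: lb_def)
  then have "(1 - lb) * Q (cls f) \<le> (1 - lb) * W f" using dom_integrable(4)[OF assms] Qf by (intro mult_left_mono) auto
  then show "Re (form f f) + (1 - lb) * Q (cls f) \<le> (2 + q_bound - lb) * W f"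
    using form_upper_bound[OF assms] by (simp add: algebra_simps)
qed

lemma zero_in_form_dom: "(\<lambda>x. 0) \<in> FD ty"
proof -
  obtain x0 where x0: "x0 \<in> I"
    using ereal_dense2[OF ab] by (auto simp: I_eq einterval_def)
  have v: "vderiv (\<lambda>x. 0) = (\<lambda>x. 0)" unfolding vderiv_def by (auto intro!: vector_derivative_at)
  have "(\<lambda>x. 0) \<in> AC_loc I" by (rule AC_locI[where k="\<lambda>_. 0"]) auto
  then have "(\<lambda>x. 0) \<in> Dp" by (simp add: dom_A_plus_iff v)
  then show ?thesis by (rule compact_support_in_form_dom[OF _ x0 x0]) simp
qed

text \<open>Beyond linearity, the type of the form domain enters at two places: form limits must
  stay in it, by \<open>form_dom_closed\<close>, and compactly supported functions must belong to
  it, which density uses.\<close>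

lemma closed_form_sl: "closed_form H (FD ty) (\<lambda>f g x. f x + g x) (\<lambda>c f x. c * f x) cls form lb"
proof (intro closed_form.intro closed_form_axioms.intro hilbert_axioms)
  show "FD ty \<noteq> {}" using zero_in_form_dom by blast
next
  fix f g assume "f \<in> FD ty" "g \<in> FD ty"
  then show "(\<lambda>x. f x + g x) \<in> FD ty" by (rule form_dom_add)
next
  fix f c assume "f \<in> FD ty"
  then show "(\<lambda>x. c * f x) \<in> FD ty" by (rule form_dom_scale)
next
  fix f assume "f \<in> FD ty"
  then show "cls f \<in> hcarrier H" using form_dom_subset dom_class by blast
next
  fix f g assume "f \<in> FD ty" "g \<in> FD ty"
  then show "cls (\<lambda>x. f x + g x) = hadd H (cls f) (cls g)"
    using form_dom_subset dom_measurable by (simp add: H_eq L2_add)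
next
  fix f c assume "f \<in> FD ty"
  then show "cls (\<lambda>x. c * f x) = hscale H c (cls f)"
    using form_dom_subset dom_measurable by (simp add: H_eq L2_scale)
next
  fix f g h assume "f \<in> FD ty" "g \<in> FD ty" "h \<in> FD ty"
  then show "form f (\<lambda>x. g x + h x) = form f g + form f h" using form_dom_subset by (intro form_add) auto
next
  fix f g c assume "f \<in> FD ty" "g \<in> FD ty"
  then show "form f (\<lambda>x. c * g x) = c * form f g" using form_dom_subset by (intro form_scale) auto
next
  fix f g show "cnj (form f g) = form g f" by (rule form_cnj)
next
  fix f assume "f \<in> FD ty"
  then have f: "f \<in> Dp" by (rule form_dom_subset)
  have "Q (cls f) = (LINT x|M. w x * (cmod (f x))\<^sup>2)" by (rule Q_class) (use f in \<open>simp add: dom_A_plus_def\<close>)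
  moreover have "0 \<le> (LINT x|M. p x * (cmod (vderiv f x))\<^sup>2)" by (rule integral_nonneg_AE, rule eventually_mono[OF p_nonneg]) simp
  ultimately show "lb * Q (cls f) \<le> Re (form f f)" using form_lower_bound[OF f] by simp
next
  fix u :: "nat \<Rightarrow> real \<Rightarrow> complex"
  assume u: "\<And>n. u n \<in> FD ty" and cauchy: "\<And>e. e > 0 \<Longrightarrow> \<exists>N. \<forall>j\<ge>N. \<forall>k\<ge>N.
    (let d = \<lambda>x. u j x + - 1 * u k x in Re (form d d) + (1 - lb) * Q (cls d)) < e"
  have uD: "u n \<in> Dp" for n using u by (rule form_dom_subset)
  have "\<exists>f\<in>Dp. (\<lambda>n. W (\<lambda>x. u n x + - 1 * f x)) \<longlonglongrightarrow> 0"
  proof (rule dom_complete[OF uD])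
    fix e :: real assume "e > 0"
    from cauchy[OF this] show "\<exists>N. \<forall>j\<ge>N. \<forall>k\<ge>N. W (\<lambda>x. u j x + - 1 * u k x) < e"
      unfolding Let_def using form_norm_bounds(1)[OF dom_diff(1)[OF uD uD]] by (meson le_less_trans)
  qed
  then obtain f where f: "f \<in> Dp" "(\<lambda>n. W (\<lambda>x. u n x + - 1 * f x)) \<longlonglongrightarrow> 0" by blast
  have "f \<in> FD ty" by (rule form_dom_closed[OF u f])
  moreover have "(\<lambda>n. let d = \<lambda>x. u n x + - 1 * f x in Re (form d d) + (1 - lb) * Q (cls d)) \<longlonglongrightarrow> 0"
    unfolding Let_def
  proof (rule tendsto_sandwich[OF _ _ tendsto_const])
    show "(\<lambda>n. (2 + q_bound - lb) * W (\<lambda>x. u n x + - 1 * f x)) \<longlonglongrightarrow> 0" using f(2) by (rule tendsto_mult_right_zero)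
    show "\<forall>\<^sub>F n in sequentially. 0 \<le> Re (form (\<lambda>x. u n x + - 1 * f x) (\<lambda>x. u n x + - 1 * f x)) + (1 - lb) * Q (cls (\<lambda>x. u n x + - 1 * f x))"
      using form_norm_bounds(1)[OF dom_diff(1)[OF uD f(1)]] dom_integrable(6)[OF dom_diff(1)[OF uD f(1)]]
      by (intro always_eventually allI) (meson order_trans)
    show "\<forall>\<^sub>F n in sequentially. Re (form (\<lambda>x. u n x + - 1 * f x) (\<lambda>x. u n x + - 1 * f x)) + (1 - lb) * Q (cls (\<lambda>x. u n x + - 1 * f x))
        \<le> (2 + q_bound - lb) * W (\<lambda>x. u n x + - 1 * f x)"
      by (intro always_eventually allI form_norm_bounds(2)[OF dom_diff(1)[OF uD f(1)]])
  qed
  ultimately show "\<exists>f\<in>FD ty. (\<lambda>n. let d = \<lambda>x. u n x + - 1 * f x in Re (form d d) + (1 - lb) * Q (cls d)) \<longlonglongrightarrow> 0" by blast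
next
  fix x assume x: "x \<in> hcarrier H" and orth: "\<And>f. f \<in> FD ty \<Longrightarrow> hinner H (cls f) x = 0"
  obtain u where u: "square_integrable (weighted I w) u" "x = cls u"
    using x unfolding H_eq by (rule L2_carrierE)
  have um: "u \<in> borel_measurable M" using u by (simp add: square_integrable_def)
  have "AE x in M. u x = 0"
  proof (rule form_dom_dense[OF u(1)])
    fix f assume f: "f \<in> FD ty"
    show "(LINT x|M. w x *\<^sub>R (cnj (f x) * u x)) = 0"
      using orth[OF f] inner_class[OF dom_measurable(1)[OF form_dom_subset[OF f]] um] u(2) by simp
  qed
  then have "AE x in M. w x * (cmod (u x))\<^sup>2 = 0" by eventually_elim simp
  then have "(LINT x|M. w x * (cmod (u x))\<^sup>2) = 0" by (rule integral_eq_zero_AE)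
  then show "Q x = 0" using Q_class[OF u(1)] u(2) by simp
next
  fix f g assume "f \<in> FD ty" "Q (cls f) = 0"
  then show "form g f = 0" using form_dom_subset form_kernel by blast
qed

abbreviation "T ty \<equiv> sl_operator ty a b w p q"

lemma op_eq: "closed_form.op H (FD ty) cls form = T ty"
  unfolding closed_form.op_def[OF closed_form_sl] sl_operator_def I_eq[symmetric] ..

lemma self_adjoint_T: "self_adjoint H (T ty)"
  using closed_form.self_adjoint_op[OF closed_form_sl] unfolding op_eq .

lemma resolvent_set_T: "z0 < lb \<Longrightarrow> 2 * cmod (z - complex_of_real z0) \<le> lb - z0 \<Longrightarrow> z \<in> resolvent_set H (T ty)"
  using closed_form.resolvent_set_op[OF closed_form_sl] unfolding op_eq by blast

lemma resolvent_T:
  assumes "z < lb" "x \<in> hcarrier H"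
  shows "\<exists>f\<in>FD ty. resolvent H (T ty) (complex_of_real z) x = cls f \<and>
     (\<forall>g\<in>FD ty. form g f - complex_of_real z * hinner H (cls g) (cls f) = hinner H (cls g) x)"
  using closed_form.resolvent_form[OF closed_form_sl assms] unfolding op_eq closed_form.shifted_def[OF closed_form_sl] .

end

section \<open>Comparison of two coefficient triples\<close>

text \<open>The transfers between two triples, of weights, reciprocals and differences, go through
  this one comparison; the absolute value admits differences of either sign.\<close>

lemma integrable_weight_le:
  fixes r r' g :: "real \<Rightarrow> real"
  assumes i: "integrable M (\<lambda>x. r x * g x)" and [measurable]: "r' \<in> borel_measurable M" "g \<in> borel_measurable M"
    and le: "AE x in M. \<bar>r' x\<bar> \<le> C * r x" and "\<And>x. 0 \<le> g x"
  shows "integrable M (\<lambda>x. r' x * g x)" "integrable M (\<lambda>x. \<bar>r' x\<bar> * g x)"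
    "(LINT x|M. \<bar>r' x\<bar> * g x) \<le> C * (LINT x|M. r x * g x)"
proof -
  have i': "integrable M (\<lambda>x. C * (r x * g x))" using i by simp
  have ae: "AE x in M. \<bar>r' x\<bar> * g x \<le> C * (r x * g x)"
    using le
  proof eventually_elim
    case (elim x)
    from mult_right_mono[OF this assms(5)[of x]] show ?case by (simp add: mult.assoc)
  qed
  have ae': "AE x in M. norm (\<bar>r' x\<bar> * g x) \<le> norm (C * (r x * g x))"
    using ae
  proof eventually_elim
    case (elim x)
    have "0 \<le> \<bar>r' x\<bar> * g x" using assms(5)[of x] by simp
    with elim show ?case unfolding real_norm_def by linarith
  qed
  show a: "integrable M (\<lambda>x. \<bar>r' x\<bar> * g x)"
    by (rule Bochner_Integration.integrable_bound[OF i' _ ae']) measurable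
  show "integrable M (\<lambda>x. r' x * g x)"
    by (rule Bochner_Integration.integrable_bound[OF a]) (auto simp: abs_mult assms(5))
  show "(LINT x|M. \<bar>r' x\<bar> * g x) \<le> C * (LINT x|M. r x * g x)"
    using integral_mono_AE[OF a i' ae] i by simp
qed

context sl_data
begin

text \<open>Eliminating g = G / sqrt (w p) turns the two conditions on g into integrability of |G|^2
  / p and |G'|^2 / w. In this form the admissible G visibly depend on the coefficients only up to
  comparability.\<close>

lemma ac_version_exists_iff:
  "(\<exists>g\<in>dom_A_minus I w p. ac_version I w p g G) \<longleftrightarrow>
     G \<in> AC_loc I \<and> integrable M (\<lambda>x. 1 / p x * (cmod (G x))\<^sup>2) \<and> integrable M (\<lambda>x. 1 / w x * (cmod (vderiv G x))\<^sup>2)"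
    (is "?L \<longleftrightarrow> ?R")
proof -
  have sq: "square_integrable M (\<lambda>x. vderiv G x / complex_of_real (sqrt (w x))) \<longleftrightarrow> integrable M (\<lambda>x. 1 / w x * (cmod (vderiv G x))\<^sup>2)"
    if "G \<in> AC_loc I"
  proof -
    note [measurable] = AC_loc_measurable[OF that open_I]
    have "integrable M (\<lambda>x. (cmod (vderiv G x / complex_of_real (sqrt (w x))))\<^sup>2) \<longleftrightarrow> integrable M (\<lambda>x. 1 / w x * (cmod (vderiv G x))\<^sup>2)"
      by (rule integrable_cong_AE)
         (measurable, use w_pos in \<open>eventually_elim, simp add: norm_divide power_divide\<close>)
    then show ?thesis by (simp add: square_integrable_def)
  qed
  show ?thesis
  proof
    assume ?L
    then obtain g where g: "g \<in> dom_A_minus I w p" "ac_version I w p g G" by blast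
    have AC: "G \<in> AC_loc I" and Gg: "AE x in M. G x = complex_of_real (sqrt (w x * p x)) * g x"
      using g by (auto simp: ac_version_def)
    note [measurable] = AC_loc_measurable[OF AC open_I]
    have gi: "integrable M (\<lambda>x. w x * (cmod (g x))\<^sup>2)"
      using g by (auto simp: dom_A_minus_def square_integrable_weighted)
    have "integrable M (\<lambda>x. 1 / p x * (cmod (G x))\<^sup>2)"
    proof (rule integrable_cong_AE_imp[OF gi])
      show "AE x in M. w x * (cmod (g x))\<^sup>2 = 1 / p x * (cmod (G x))\<^sup>2"
        using Gg w_pos p_pos by eventually_elim (simp add: norm_mult power_mult_distrib)
    qed measurable
    then show ?R using AC sq[OF AC] ac_version_square_integrable[OF g] by blast
  next
    assume R: ?R
    then have AC: "G \<in> AC_loc I" by blast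
    note [measurable] = AC_loc_measurable[OF AC open_I]
    define g where "g x = G x / complex_of_real (sqrt (w x * p x))" for x
    have [measurable]: "g \<in> borel_measurable M" unfolding g_def[abs_def] by measurable
    have ac: "ac_version I w p g G"
      unfolding ac_version_def
    proof (intro conjI AC)
      show "AE x in M. G x = complex_of_real (sqrt (w x * p x)) * g x"
        using w_pos p_pos by eventually_elim (simp add: g_def)
    qed
    have iG: "integrable M (\<lambda>x. 1 / p x * (cmod (G x))\<^sup>2)" using R by blast
    have "integrable M (\<lambda>x. w x * (cmod (g x))\<^sup>2)"
    proof (rule integrable_cong_AE_imp[OF iG])
      show "AE x in M. 1 / p x * (cmod (G x))\<^sup>2 = w x * (cmod (g x))\<^sup>2"
        using w_pos p_pos by eventually_elim (simp add: g_def norm_divide power_divide)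
    qed measurable
    then have "g \<in> dom_A_minus I w p"
      using ac sq[OF AC] R by (auto simp: dom_A_minus_def square_integrable_weighted)
    then show ?L using ac by blast
  qed
qed

lemma form_dom_Q0_iff':
  "f \<in> FD Type_Q0 \<longleftrightarrow> f \<in> Dp \<and> (\<forall>G. G \<in> AC_loc I \<and> integrable M (\<lambda>x. 1 / p x * (cmod (G x))\<^sup>2) \<and>
       integrable M (\<lambda>x. 1 / w x * (cmod (vderiv G x))\<^sup>2) \<longrightarrow>
     ((\<lambda>x. G (real_of_ereal x) * f (real_of_ereal x)) \<longlongrightarrow> 0) (at_right a) \<and>
     ((\<lambda>x. G (real_of_ereal x) * f (real_of_ereal x)) \<longlongrightarrow> 0) (at_left b))"
  unfolding ac_version_exists_iff[symmetric] form_dom_Q0_iff by blast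

text \<open>A constant independent of r and B, fixed by choice so that it can enter the resolvent
  estimate and be shared by the whole sequence.\<close>

definition pot_bound :: real where
  "pot_bound = (SOME K. 0 < K \<and> (\<forall>f\<in>Dp. \<forall>r B. r \<in> borel_measurable M \<longrightarrow> 0 \<le> B \<longrightarrow>
       unif_loc_norm I r \<le> ennreal B \<longrightarrow>
       integrable M (\<lambda>x. \<bar>r x\<bar> * (cmod (f x))\<^sup>2) \<and> (LINT x|M. \<bar>r x\<bar> * (cmod (f x))\<^sup>2) \<le> K * B * W f))"

lemma pot_bound:
  shows "0 < pot_bound"
    "\<lbrakk>f \<in> Dp; r \<in> borel_measurable M; 0 \<le> B; unif_loc_norm I r \<le> ennreal B\<rbrakk> \<Longrightarrow>
       integrable M (\<lambda>x. \<bar>r x\<bar> * (cmod (f x))\<^sup>2)"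
    "\<lbrakk>f \<in> Dp; r \<in> borel_measurable M; 0 \<le> B; unif_loc_norm I r \<le> ennreal B\<rbrakk> \<Longrightarrow>
       (LINT x|M. \<bar>r x\<bar> * (cmod (f x))\<^sup>2) \<le> pot_bound * B * W f"
  using someI_ex[OF potential_bound, folded pot_bound_def] by blast+

lemma carrier_iff: "x \<in> hcarrier H \<longleftrightarrow> (\<exists>u. u \<in> borel_measurable M \<and> integrable M (\<lambda>x. w x * (cmod (u x))\<^sup>2) \<and> x = ae_class M u)"
  unfolding H_eq by (auto simp: L2_space_def square_integrable_weighted ae_class_weighted)

lemma H_add: "hadd H x y = ae_class M (\<lambda>s. ae_rep x s + ae_rep y s)"
  and H_scale: "hscale H c x = ae_class M (\<lambda>s. c * ae_rep x s)"
  by (simp_all add: H_eq L2_space_def ae_class_weighted)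

lemma nrm_class:
  assumes "u \<in> borel_measurable M"
  shows "hnorm H (ae_class M u) = sqrt (LINT x|M. w x * (cmod (u x))\<^sup>2)"
proof -
  note [measurable] = assms
  have "hnorm H (ae_class M u) = sqrt (LINT x|weighted I w. (cmod (u x))\<^sup>2)"
    using L2_norm[of u "weighted I w"] assms by (simp add: H_eq ae_class_weighted)
  then show ?thesis by (simp add: integral_weighted)
qed

lemma diff_class:
  assumes "u \<in> borel_measurable M" "v \<in> borel_measurable M"
  shows "hdiff H (ae_class M u) (ae_class M v) = ae_class M (\<lambda>x. u x - v x)"
  using L2_diff[of u "weighted I w" v] assms by (simp add: H_eq ae_class_weighted)

lemma inner_ae_class:
  assumes "f \<in> borel_measurable M" "g \<in> borel_measurable M"
  shows "hinner H (ae_class M f) (ae_class M g) = (LINT x|M. complex_of_real (w x) * cnj (f x) * g x)"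
  using inner_class[OF assms] by (simp add: ae_class_weighted scaleR_conv_of_real mult.assoc)

end

text \<open>\<open>opnorm\<close> is a real supremum, hence informative only over a nonempty bounded
  set: 0 times any vector lies in the unit ball, and c bounds the values.\<close>

lemma opnorm_bounds:
  assumes "hilbert H" "hilbert K" "c \<ge> 0"
    and B: "\<And>x. x \<in> hcarrier H \<Longrightarrow> B x \<in> hcarrier K \<and> hnorm K (B x) \<le> c * hnorm H x"
  shows "0 \<le> opnorm H K B" "opnorm H K B \<le> c"
proof -
  interpret H: hilbert H by fact
  interpret K: hilbert K by fact
  let ?S = "{x \<in> hcarrier H. hnorm H x \<le> 1}"
  obtain x where x: "x \<in> hcarrier H" using H.carrier_ne by blast
  have z: "hscale H 0 x \<in> ?S" using x by (simp add: H.scl_closed H.hnorm_eq H.nrm_scl)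
  have le: "hnorm K (B y) \<le> c" if "y \<in> ?S" for y
  proof -
    have "c * hnorm H y \<le> c * 1" using that \<open>c \<ge> 0\<close> by (intro mult_left_mono) auto
    then show ?thesis using B[of y] that by auto
  qed
  show "opnorm H K B \<le> c" unfolding opnorm_def using z le by (intro cSUP_least) auto
  have "hnorm K (B (hscale H 0 x)) \<le> opnorm H K B" unfolding opnorm_def
    using z le by (intro cSUP_upper bdd_aboveI2[of _ _ c])
  moreover have "0 \<le> hnorm K (B (hscale H 0 x))"
    using B[of "hscale H 0 x"] z by (simp add: K.hnorm_eq K.nrm_nonneg)
  ultimately show "0 \<le> opnorm H K B" by simp
qed

text \<open>One \<epsilon> measures all three distances, so that the later bounds are linear in it.
  The second triple gets the constant \<delta>/2 because \<epsilon> \<le> 1/2 leaves at least half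
  of w and p; this keeps its lower bound independent of the triple.\<close>

locale sl_pair = S: sl_data a b I w p q \<gamma> \<delta> + S': sl_data a b I w' p' q' \<gamma> "\<delta> / 2"
  for a b :: ereal and I :: "real set" and w p q :: "real \<Rightarrow> real" and \<gamma> \<delta> :: real
    and w' p' q' :: "real \<Rightarrow> real" +
  fixes \<epsilon> :: real
  assumes \<epsilon>: "0 \<le> \<epsilon>" "\<epsilon> \<le> 1 / 2"
    and w_ratio: "AE x in lebesgue_on I. \<bar>w' x / w x - 1\<bar> \<le> \<epsilon>"
    and p_ratio: "AE x in lebesgue_on I. \<bar>p' x / p x - 1\<bar> \<le> \<epsilon>"
    and q_close: "unif_loc_norm I (\<lambda>x. q' x - q x) \<le> ennreal \<epsilon>"
begin

abbreviation "M \<equiv> lebesgue_on I"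

lemma ratio_bounds:
  fixes r r' :: real
  assumes "\<bar>r' / r - 1\<bar> \<le> \<epsilon>" "0 < r"
  shows "\<bar>r' - r\<bar> \<le> \<epsilon> * r" "r \<le> 2 * r'" "r' \<le> 3 / 2 * r"
proof -
  have "\<bar>r' - r\<bar> = \<bar>r' / r - 1\<bar> * r" using assms(2) by (simp add: field_simps abs_mult[symmetric])
  also have "\<dots> \<le> \<epsilon> * r" using assms by (intro mult_right_mono) auto
  finally show 1: "\<bar>r' - r\<bar> \<le> \<epsilon> * r" .
  have "\<epsilon> * r \<le> 1 / 2 * r" using \<epsilon> assms(2) by (intro mult_right_mono) auto
  with 1 show "r \<le> 2 * r'" "r' \<le> 3 / 2 * r" by linarith+
qed

lemma w_compare: "AE x in M. \<bar>w' x - w x\<bar> \<le> \<epsilon> * w x \<and> 0 < w x \<and> 0 < w' x \<and> w x \<le> 2 * w' x \<and> w' x \<le> 3 / 2 * w x"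
  using w_ratio S.w_pos S'.w_pos by eventually_elim (use ratio_bounds in blast)

lemma p_compare: "AE x in M. \<bar>p' x - p x\<bar> \<le> \<epsilon> * p x \<and> 0 < p x \<and> 0 < p' x \<and> p x \<le> 2 * p' x \<and> p' x \<le> 3 / 2 * p x"
  using p_ratio S.p_pos S'.p_pos by eventually_elim (use ratio_bounds in blast)

lemma w_abs: "AE x in M. \<bar>w' x\<bar> \<le> 3 / 2 * w x" "AE x in M. \<bar>w x\<bar> \<le> 2 * w' x" "AE x in M. \<bar>w' x - w x\<bar> \<le> \<epsilon> * w x"
    "AE x in M. \<bar>1 / w' x\<bar> \<le> 2 * (1 / w x)" "AE x in M. \<bar>1 / w x\<bar> \<le> 3 / 2 * (1 / w' x)"
  by (rule eventually_mono[OF w_compare], auto simp: field_simps)+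

lemma p_abs: "AE x in M. \<bar>p' x\<bar> \<le> 3 / 2 * p x" "AE x in M. \<bar>p x\<bar> \<le> 2 * p' x" "AE x in M. \<bar>p' x - p x\<bar> \<le> \<epsilon> * p x"
    "AE x in M. \<bar>1 / p' x\<bar> \<le> 2 * (1 / p x)" "AE x in M. \<bar>1 / p x\<bar> \<le> 3 / 2 * (1 / p' x)"
  by (rule eventually_mono[OF p_compare], auto simp: field_simps)+

lemma w_integrable_iff:
  assumes "u \<in> borel_measurable M"
  shows "integrable M (\<lambda>x. w' x * (cmod (u x))\<^sup>2) \<longleftrightarrow> integrable M (\<lambda>x. w x * (cmod (u x))\<^sup>2)"
  using integrable_weight_le(1)[OF _ _ _ w_abs(1)] integrable_weight_le(1)[OF _ _ _ w_abs(2)] assms by auto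

lemma p_integrable_iff:
  assumes "u \<in> borel_measurable M"
  shows "integrable M (\<lambda>x. p' x * (cmod (u x))\<^sup>2) \<longleftrightarrow> integrable M (\<lambda>x. p x * (cmod (u x))\<^sup>2)"
  using integrable_weight_le(1)[OF _ _ _ p_abs(1)] integrable_weight_le(1)[OF _ _ _ p_abs(2)] assms by auto

lemma inverse_integrable_iff:
  assumes "u \<in> borel_measurable M"
  shows "integrable M (\<lambda>x. 1 / w' x * (cmod (u x))\<^sup>2) \<longleftrightarrow> integrable M (\<lambda>x. 1 / w x * (cmod (u x))\<^sup>2)"
    "integrable M (\<lambda>x. 1 / p' x * (cmod (u x))\<^sup>2) \<longleftrightarrow> integrable M (\<lambda>x. 1 / p x * (cmod (u x))\<^sup>2)"
  using integrable_weight_le(1)[OF _ _ _ w_abs(4)] integrable_weight_le(1)[OF _ _ _ w_abs(5)]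
    integrable_weight_le(1)[OF _ _ _ p_abs(4)] integrable_weight_le(1)[OF _ _ _ p_abs(5)] assms by auto

lemma dom_eq: "dom_A_plus I w' p' = dom_A_plus I w p"
  using w_integrable_iff p_integrable_iff AC_loc_measurable[OF _ S.open_I]
  by (auto simp: S.dom_A_plus_iff S'.dom_A_plus_iff)

text \<open>The test functions G are the same for both triples, since the weights 1/w' and 1/p' are
  comparable with 1/w and 1/p.\<close>

lemma form_dom_eq: "form_dom ty a b w' p' = form_dom ty a b w p"
proof (cases ty)
  case Type_Q0
  have "(G \<in> AC_loc I \<and> integrable M (\<lambda>x. 1 / p' x * (cmod (G x))\<^sup>2) \<and> integrable M (\<lambda>x. 1 / w' x * (cmod (vderiv G x))\<^sup>2)) \<longleftrightarrow>
     (G \<in> AC_loc I \<and> integrable M (\<lambda>x. 1 / p x * (cmod (G x))\<^sup>2) \<and> integrable M (\<lambda>x. 1 / w x * (cmod (vderiv G x))\<^sup>2))" for G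
    using inverse_integrable_iff(2)[of G] inverse_integrable_iff(1)[of "vderiv G"] AC_loc_measurable[OF _ S.open_I, of G] by blast
  then have "f \<in> form_dom Type_Q0 a b w' p' \<longleftrightarrow> f \<in> form_dom Type_Q0 a b w p" for f
    unfolding S.form_dom_Q0_iff' S'.form_dom_Q0_iff' dom_eq by simp
  then show ?thesis using Type_Q0 by auto
qed (simp add: S.form_dom_Q_eq S'.form_dom_Q_eq dom_eq)

lemma carrier_eq: "hcarrier S'.H = hcarrier S.H"
  by (auto simp: set_eq_iff S.carrier_iff S'.carrier_iff w_integrable_iff cong: conj_cong)

lemma norm_compare:
  assumes "u \<in> borel_measurable M" "integrable M (\<lambda>x. w x * (cmod (u x))\<^sup>2)"
  shows "hnorm S'.H (ae_class M u) \<le> sqrt (3 / 2) * hnorm S.H (ae_class M u)"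
proof -
  have "(LINT x|M. w' x * (cmod (u x))\<^sup>2) = (LINT x|M. \<bar>w' x\<bar> * (cmod (u x))\<^sup>2)"
    using assms(1) by (intro integral_cong_AE) (auto intro: eventually_mono[OF w_compare])
  also have "\<dots> \<le> 3 / 2 * (LINT x|M. w x * (cmod (u x))\<^sup>2)"
    by (rule integrable_weight_le(3)[OF assms(2) _ _ w_abs(1)]) (use assms in auto)
  finally show ?thesis unfolding S.nrm_class[OF assms(1)] S'.nrm_class[OF assms(1)] real_sqrt_mult[symmetric]
    by (rule real_sqrt_le_mono)
qed

lemma J_bounded:
  "bounded_op S.H S'.H (\<lambda>f. f)" "opnorm S.H S'.H (\<lambda>f. f) \<le> 2"
proof -
  have le: "hnorm S'.H x \<le> 2 * hnorm S.H x" if x: "x \<in> hcarrier S.H" for x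
  proof -
    obtain u where u: "u \<in> borel_measurable M" "integrable M (\<lambda>x. w x * (cmod (u x))\<^sup>2)" "x = ae_class M u"
      using x by (auto simp: S.carrier_iff)
    have "sqrt (3 / 2) \<le> 2" by (rule real_le_lsqrt) auto
    then have "sqrt (3 / 2) * hnorm S.H x \<le> 2 * hnorm S.H x"
      using S.nrm_nonneg[OF x] by (intro mult_right_mono) (auto simp: S.hnorm_eq)
    then show ?thesis using norm_compare[OF u(1,2)] u(3) by simp
  qed
  then show "bounded_op S.H S'.H (\<lambda>f. f)"
    \<comment> \<open>Linearity is immediate, since sums and multiples of classes are computed by
      the same formulas in both spaces.\<close>
    unfolding bounded_op_def by (auto simp: carrier_eq S.H_add S'.H_add S.H_scale S'.H_scale)
  show "opnorm S.H S'.H (\<lambda>f. f) \<le> 2"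
    by (rule opnorm_bounds(2)[OF S.hilbert_axioms S'.hilbert_axioms]) (use le carrier_eq in auto)
qed

abbreviation "\<rho> x \<equiv> complex_of_real (w' x / w x)"

text \<open>Multiplication by \<rho> - 1 shrinks by the factor \<epsilon> at almost every point;
  square integrability of \<rho> u then follows by adding u back.\<close>

lemma rho_integrable:
  assumes [measurable]: "u \<in> borel_measurable M" and i: "integrable M (\<lambda>x. w x * (cmod (u x))\<^sup>2)"
  shows "integrable M (\<lambda>x. w x * (cmod (\<rho> x * u x))\<^sup>2)"
    "integrable M (\<lambda>x. w x * (cmod (\<rho> x * u x - u x))\<^sup>2)"
    "(LINT x|M. w x * (cmod (\<rho> x * u x - u x))\<^sup>2) \<le> \<epsilon>\<^sup>2 * (LINT x|M. w x * (cmod (u x))\<^sup>2)"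
proof -
  have i': "integrable M (\<lambda>x. \<epsilon>\<^sup>2 * (w x * (cmod (u x))\<^sup>2))" using i by simp
  have le: "AE x in M. w x * (cmod (\<rho> x * u x - u x))\<^sup>2 \<le> \<epsilon>\<^sup>2 * (w x * (cmod (u x))\<^sup>2)"
    using w_ratio S.w_pos
  proof eventually_elim
    case (elim x)
    have "\<rho> x * u x - u x = complex_of_real (w' x / w x - 1) * u x" by (simp add: algebra_simps)
    then have "cmod (\<rho> x * u x - u x) = \<bar>w' x / w x - 1\<bar> * cmod (u x)" by (simp only: norm_mult norm_of_real)
    moreover have "\<bar>w' x / w x - 1\<bar>\<^sup>2 \<le> \<epsilon>\<^sup>2" using elim by (intro power_mono) auto
    ultimately have "(cmod (\<rho> x * u x - u x))\<^sup>2 \<le> \<epsilon>\<^sup>2 * (cmod (u x))\<^sup>2"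
      by (simp add: power_mult_distrib mult_right_mono)
    then show ?case using elim by (simp add: mult.left_commute mult_left_mono)
  qed
  show d: "integrable M (\<lambda>x. w x * (cmod (\<rho> x * u x - u x))\<^sup>2)"
  proof (rule Bochner_Integration.integrable_bound[OF i'])
    show "AE x in M. norm (w x * (cmod (\<rho> x * u x - u x))\<^sup>2) \<le> norm (\<epsilon>\<^sup>2 * (w x * (cmod (u x))\<^sup>2))"
      using le S.w_pos
    proof eventually_elim
      case (elim x)
      have "0 \<le> w x * (cmod (\<rho> x * u x - u x))\<^sup>2" using elim by simp
      with elim show ?case unfolding real_norm_def by linarith
    qed
  qed measurable
  show "(LINT x|M. w x * (cmod (\<rho> x * u x - u x))\<^sup>2) \<le> \<epsilon>\<^sup>2 * (LINT x|M. w x * (cmod (u x))\<^sup>2)"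
    using integral_mono_AE[OF d i' le] i by simp
  have "square_integrable (weighted I w) (\<lambda>x. (\<rho> x * u x - u x) + u x)"
    by (rule square_integrable_add) (use d i in \<open>simp_all add: S.square_integrable_weighted\<close>)
  then show "integrable M (\<lambda>x. w x * (cmod (\<rho> x * u x))\<^sup>2)" by (simp add: S.square_integrable_weighted)
qed

text \<open>The weight is moved: w' = w \<rho> with \<rho> real, so the inner product of L2(w')
  becomes one of L2(w). Uniqueness of the representing vector makes the definite description in
  \<open>hadjoint\<close> pick it.\<close>

lemma adjoint_J:
  assumes [measurable]: "v \<in> borel_measurable M" and i: "integrable M (\<lambda>x. w x * (cmod (v x))\<^sup>2)"
  shows "hadjoint S.H S'.H (\<lambda>f. f) (ae_class M v) = ae_class M (\<lambda>x. \<rho> x * v x)"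
proof -
  have mem: "ae_class M (\<lambda>x. \<rho> x * v x) \<in> hcarrier S.H"
    unfolding S.carrier_iff using rho_integrable(1)[OF assms] by (intro exI[of _ "\<lambda>x. \<rho> x * v x"]) simp
  have eq: "hinner S'.H (ae_class M v) u = hinner S.H (ae_class M (\<lambda>x. \<rho> x * v x)) u" if u: "u \<in> hcarrier S.H" for u
  proof -
    obtain y where y: "y \<in> borel_measurable M" "u = ae_class M y" using u by (auto simp: S.carrier_iff)
    note [measurable] = y(1)
    have "(LINT x|M. complex_of_real (w' x) * cnj (v x) * y x) = (LINT x|M. complex_of_real (w x) * cnj (\<rho> x * v x) * y x)"
      by (rule integral_cong_AE) (measurable, use S.w_pos in \<open>eventually_elim, simp\<close>)
    moreover have "(\<lambda>x. \<rho> x * v x) \<in> borel_measurable M" by measurable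
    ultimately show ?thesis unfolding y(2) by (simp only: S'.inner_ae_class[OF assms(1) y(1)] S.inner_ae_class[OF _ y(1)])
  qed
  show ?thesis unfolding hadjoint_def
  proof (rule the_equality)
    show "ae_class M (\<lambda>x. \<rho> x * v x) \<in> hcarrier S.H \<and> (\<forall>u\<in>hcarrier S.H. hinner S'.H (ae_class M v) u = hinner S.H (ae_class M (\<lambda>x. \<rho> x * v x)) u)"
      using mem eq by blast
    fix x assume x: "x \<in> hcarrier S.H \<and> (\<forall>u\<in>hcarrier S.H. hinner S'.H (ae_class M v) u = hinner S.H x u)"
    show "x = ae_class M (\<lambda>x. \<rho> x * v x)"
      by (rule S.vec_eqI_left[OF _ mem]) (use x eq in auto)
  qed
qed

lemma mult_rho_bound:
  assumes "x \<in> hcarrier S.H"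
  shows "hdiff S.H (hadjoint S.H S'.H (\<lambda>f. f) x) x \<in> hcarrier S.H \<and>
     hnorm S.H (hdiff S.H (hadjoint S.H S'.H (\<lambda>f. f) x) x) \<le> \<epsilon> * hnorm S.H x"
proof -
  obtain u where u: "u \<in> borel_measurable M" "integrable M (\<lambda>x. w x * (cmod (u x))\<^sup>2)" "x = ae_class M u"
    using assms by (auto simp: S.carrier_iff)
  note [measurable] = u(1)
  have m: "(\<lambda>x. \<rho> x * u x) \<in> borel_measurable M" "(\<lambda>x. \<rho> x * u x - u x) \<in> borel_measurable M" by measurable
  have eq: "hdiff S.H (hadjoint S.H S'.H (\<lambda>f. f) x) x = ae_class M (\<lambda>x. \<rho> x * u x - u x)"
    unfolding u(3) adjoint_J[OF u(1,2)] by (rule S.diff_class[OF m(1) u(1)])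
  have "sqrt (LINT x|M. w x * (cmod (\<rho> x * u x - u x))\<^sup>2) \<le> sqrt (\<epsilon>\<^sup>2 * (LINT x|M. w x * (cmod (u x))\<^sup>2))"
    using rho_integrable(3)[OF u(1,2)] by (rule real_sqrt_le_mono)
  then have "hnorm S.H (ae_class M (\<lambda>x. \<rho> x * u x - u x)) \<le> \<epsilon> * hnorm S.H x"
    unfolding S.nrm_class[OF m(2)] u(3) S.nrm_class[OF u(1)] real_sqrt_mult using \<epsilon> by simp
  moreover have "ae_class M (\<lambda>x. \<rho> x * u x - u x) \<in> hcarrier S.H"
    unfolding S.carrier_iff using m(2) rho_integrable(2)[OF u(1,2)] by (intro exI[of _ "\<lambda>x. \<rho> x * u x - u x"]) simp
  ultimately show ?thesis unfolding eq by simp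
qed

lemma JJ_opnorm:
  "0 \<le> opnorm S.H S.H (\<lambda>x. hdiff S.H (hadjoint S.H S'.H (\<lambda>f. f) x) x)"
  "opnorm S.H S.H (\<lambda>x. hdiff S.H (hadjoint S.H S'.H (\<lambda>f. f) x) x) \<le> \<epsilon>"
  using opnorm_bounds[OF S.hilbert_axioms S.hilbert_axioms \<epsilon>(1), of "\<lambda>x. hdiff S.H (hadjoint S.H S'.H (\<lambda>f. f) x) x"] mult_rho_bound
  by auto

text \<open>Multiplication by \<open>(w / w')\<^sup>\<onehalf>\<close> is unitary from \<open>L\<^sup>2(w)\<close> to \<open>L\<^sup>2(w')\<close> and commutes with multiplication by \<open>w' / w - 1\<close>.\<close>

lemma JJ_opnorm_eq:
  "opnorm S.H S.H (\<lambda>x. hdiff S.H (hadjoint S.H S'.H (\<lambda>f. f) x) x) =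
   opnorm S'.H S'.H (\<lambda>y. hdiff S'.H (hadjoint S.H S'.H (\<lambda>f. f) y) y)"
proof -
  have isom: "integrable M (\<lambda>x. r x * (cmod (complex_of_real (sqrt (r' x / r x)) * v x))\<^sup>2) \<and>
      (LINT x|M. r x * (cmod (complex_of_real (sqrt (r' x / r x)) * v x))\<^sup>2) = (LINT x|M. r' x * (cmod (v x))\<^sup>2)"
    if [measurable]: "r \<in> borel_measurable M" "r' \<in> borel_measurable M" "v \<in> borel_measurable M"
      and pos: "AE x in M. 0 < r x" "AE x in M. 0 < r' x" and i: "integrable M (\<lambda>x. r' x * (cmod (v x))\<^sup>2)" for r r' v
  proof -
    have e: "AE x in M. r' x * (cmod (v x))\<^sup>2 = r x * (cmod (complex_of_real (sqrt (r' x / r x)) * v x))\<^sup>2"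
      using pos by eventually_elim (simp add: norm_mult power_mult_distrib)
    show ?thesis
      using integrable_cong_AE_imp[OF i _ e] integral_cong_AE[OF _ _ e] by simp
  qed
  let ?S = "\<lambda>x. ae_class M x"
  have img: "hnorm S.H (hdiff S.H (hadjoint S.H S'.H (\<lambda>f. f) (?S u)) (?S u)) = sqrt (LINT x|M. w x * (cmod (\<rho> x * u x - u x))\<^sup>2)"
    "hnorm S'.H (hdiff S'.H (hadjoint S.H S'.H (\<lambda>f. f) (?S u)) (?S u)) = sqrt (LINT x|M. w' x * (cmod (\<rho> x * u x - u x))\<^sup>2)"
    if [measurable]: "u \<in> borel_measurable M" and i: "integrable M (\<lambda>x. w x * (cmod (u x))\<^sup>2)" for u
  proof -
    have m: "(\<lambda>x. \<rho> x * u x) \<in> borel_measurable M" "(\<lambda>x. \<rho> x * u x - u x) \<in> borel_measurable M" by measurable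
    show "hnorm S.H (hdiff S.H (hadjoint S.H S'.H (\<lambda>f. f) (?S u)) (?S u)) = sqrt (LINT x|M. w x * (cmod (\<rho> x * u x - u x))\<^sup>2)"
      unfolding adjoint_J[OF that] S.diff_class[OF m(1) that(1)] by (rule S.nrm_class[OF m(2)])
    show "hnorm S'.H (hdiff S'.H (hadjoint S.H S'.H (\<lambda>f. f) (?S u)) (?S u)) = sqrt (LINT x|M. w' x * (cmod (\<rho> x * u x - u x))\<^sup>2)"
      unfolding adjoint_J[OF that] S'.diff_class[OF m(1) that(1)] by (rule S'.nrm_class[OF m(2)])
  qed
  have factor: "r * (s * y) - s * y = s * (r * y - y)" for r s y :: complex by (simp add: algebra_simps)
  \<comment> \<open>The sets of values on the two unit balls are shown to coincide, so their suprema
    agree.\<close>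
  have "(\<lambda>x. hnorm S.H (hdiff S.H (hadjoint S.H S'.H (\<lambda>f. f) x) x)) ` {x \<in> hcarrier S.H. hnorm S.H x \<le> 1} =
        (\<lambda>y. hnorm S'.H (hdiff S'.H (hadjoint S.H S'.H (\<lambda>f. f) y) y)) ` {y \<in> hcarrier S'.H. hnorm S'.H y \<le> 1}"
    (is "?L = ?R")
  proof (intro equalityI subsetI)
    fix c assume "c \<in> ?L"
    then obtain u where u: "u \<in> borel_measurable M" "integrable M (\<lambda>x. w x * (cmod (u x))\<^sup>2)" "hnorm S.H (?S u) \<le> 1"
      "c = hnorm S.H (hdiff S.H (hadjoint S.H S'.H (\<lambda>f. f) (?S u)) (?S u))"
      by (auto simp: S.carrier_iff)
    note [measurable] = u(1)
    define v where "v x = complex_of_real (sqrt (w x / w' x)) * u x" for x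
    have vm [measurable]: "v \<in> borel_measurable M" unfolding v_def[abs_def] by measurable
    have iv: "integrable M (\<lambda>x. w' x * (cmod (v x))\<^sup>2)" "(LINT x|M. w' x * (cmod (v x))\<^sup>2) = (LINT x|M. w x * (cmod (u x))\<^sup>2)"
      using isom[OF S'.w_meas S.w_meas u(1) S'.w_pos S.w_pos u(2)] by (auto simp: v_def)
    have ivw: "integrable M (\<lambda>x. w x * (cmod (v x))\<^sup>2)" using w_integrable_iff[OF vm] iv(1) by simp
    have "(LINT x|M. w' x * (cmod (\<rho> x * v x - v x))\<^sup>2) = (LINT x|M. w x * (cmod (\<rho> x * u x - u x))\<^sup>2)"
      unfolding v_def factor
      by (rule conjunct2[OF isom[OF S'.w_meas S.w_meas _ S'.w_pos S.w_pos rho_integrable(2)[OF u(1,2)]]]) measurable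
    then have "c = hnorm S'.H (hdiff S'.H (hadjoint S.H S'.H (\<lambda>f. f) (?S v)) (?S v))"
      unfolding u(4) img(1)[OF u(1,2)] img(2)[OF vm ivw] by simp
    moreover have "hnorm S'.H (?S v) \<le> 1" using u(3) unfolding S.nrm_class[OF u(1)] S'.nrm_class[OF vm] iv(2) .
    moreover have "?S v \<in> hcarrier S'.H" unfolding S'.carrier_iff using iv(1) vm by blast
    ultimately show "c \<in> ?R" by blast
  next
    fix c assume "c \<in> ?R"
    then obtain u where u: "u \<in> borel_measurable M" "integrable M (\<lambda>x. w' x * (cmod (u x))\<^sup>2)" "hnorm S'.H (?S u) \<le> 1"
      "c = hnorm S'.H (hdiff S'.H (hadjoint S.H S'.H (\<lambda>f. f) (?S u)) (?S u))"
      by (auto simp: S'.carrier_iff)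
    note [measurable] = u(1)
    have uw: "integrable M (\<lambda>x. w x * (cmod (u x))\<^sup>2)" using w_integrable_iff[OF u(1)] u(2) by simp
    define v where "v x = complex_of_real (sqrt (w' x / w x)) * u x" for x
    have vm [measurable]: "v \<in> borel_measurable M" unfolding v_def[abs_def] by measurable
    have iv: "integrable M (\<lambda>x. w x * (cmod (v x))\<^sup>2)" "(LINT x|M. w x * (cmod (v x))\<^sup>2) = (LINT x|M. w' x * (cmod (u x))\<^sup>2)"
      using isom[OF S.w_meas S'.w_meas u(1) S.w_pos S'.w_pos u(2)] by (auto simp: v_def)
    have m: "(\<lambda>x. \<rho> x * u x - u x) \<in> borel_measurable M" by measurable
    have i2: "integrable M (\<lambda>x. w' x * (cmod (\<rho> x * u x - u x))\<^sup>2)"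
      using w_integrable_iff[OF m] rho_integrable(2)[OF u(1) uw] by simp
    have "(LINT x|M. w x * (cmod (\<rho> x * v x - v x))\<^sup>2) = (LINT x|M. w' x * (cmod (\<rho> x * u x - u x))\<^sup>2)"
      unfolding v_def factor by (rule conjunct2[OF isom[OF S.w_meas S'.w_meas m S.w_pos S'.w_pos i2]])
    then have "c = hnorm S.H (hdiff S.H (hadjoint S.H S'.H (\<lambda>f. f) (?S v)) (?S v))"
      unfolding u(4) img(2)[OF u(1) uw] img(1)[OF vm iv(1)] by simp
    moreover have "hnorm S.H (?S v) \<le> 1" using u(3) unfolding S'.nrm_class[OF u(1)] S.nrm_class[OF vm] iv(2) .
    moreover have "?S v \<in> hcarrier S.H" unfolding S.carrier_iff using iv(1) vm by blast
    ultimately show "c \<in> ?L" by blast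
  qed
  then show ?thesis unfolding opnorm_def by simp
qed

text \<open>The factor 2 comes from w \<le> 2 w' and p \<le> 2 p'.\<close>

lemma W_compare:
  assumes "f \<in> S.Dp" shows "S.W f \<le> 2 * S'.W f"
proof -
  have f': "f \<in> S'.Dp" using assms dom_eq by simp
  note [measurable] = S.dom_measurable[OF assms]
  have "S.W f = (LINT x|M. \<bar>w x\<bar> * (cmod (f x))\<^sup>2) + (LINT x|M. \<bar>p x\<bar> * (cmod (vderiv f x))\<^sup>2)"
    unfolding S.dom_integrable(7)[OF assms]
    by (intro arg_cong2[where f="(+)"] integral_cong_AE) (auto intro: eventually_mono[OF w_compare] eventually_mono[OF p_compare])
  also have "\<dots> \<le> 2 * (LINT x|M. w' x * (cmod (f x))\<^sup>2) + 2 * (LINT x|M. p' x * (cmod (vderiv f x))\<^sup>2)"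
    using f' by (intro add_mono integrable_weight_le(3) w_abs p_abs) (auto simp: S'.dom_A_plus_iff)
  finally show ?thesis unfolding S'.dom_integrable(7)[OF f'] by simp
qed

text \<open>Cauchy--Schwarz with the weight |r' - r|, which is at most \<epsilon> r: each factor
  contributes a root of \<epsilon>.\<close>

lemma weight_difference_bound:
  assumes [measurable]: "r \<in> borel_measurable M" "r' \<in> borel_measurable M" "f \<in> borel_measurable M" "g \<in> borel_measurable M"
    and i: "integrable M (\<lambda>x. r x * (cmod (f x))\<^sup>2)" "integrable M (\<lambda>x. r x * (cmod (g x))\<^sup>2)"
    and le: "AE x in M. \<bar>r' x - r x\<bar> \<le> \<epsilon> * r x"
    and A: "(LINT x|M. r x * (cmod (f x))\<^sup>2) \<le> A\<^sup>2" "(LINT x|M. r x * (cmod (g x))\<^sup>2) \<le> B\<^sup>2" "0 \<le> A" "0 \<le> B"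
  shows "cmod (LINT x|M. complex_of_real (r' x - r x) * cnj (f x) * g x) \<le> \<epsilon> * A * B"
proof -
  have m [measurable]: "(\<lambda>x. r' x - r x) \<in> borel_measurable M" by measurable
  have s: "integrable M (\<lambda>x. \<bar>r' x - r x\<bar> * (cmod (h x))\<^sup>2)" "(LINT x|M. \<bar>r' x - r x\<bar> * (cmod (h x))\<^sup>2) \<le> \<epsilon> * (LINT x|M. r x * (cmod (h x))\<^sup>2)"
    if "h \<in> borel_measurable M" "integrable M (\<lambda>x. r x * (cmod (h x))\<^sup>2)" for h
    using integrable_weight_le(2,3)[OF that(2) m _ le] that(1) by auto
  note cs = weighted_cauchy_schwarz[OF m assms(3,4) s(1)[OF assms(3) i(1)] s(1)[OF assms(4) i(2)]]
  have "cmod (LINT x|M. complex_of_real (r' x - r x) * cnj (f x) * g x) \<le> (LINT x|M. cmod (complex_of_real (r' x - r x) * cnj (f x) * g x))"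
    by (rule integral_norm_bound)
  also have "\<dots> = (LINT x|M. \<bar>r' x - r x\<bar> * cmod (f x) * cmod (g x))"
    by (simp only: norm_mult norm_of_real complex_mod_cnj)
  also have "\<dots> \<le> sqrt (LINT x|M. \<bar>r' x - r x\<bar> * (cmod (f x))\<^sup>2) * sqrt (LINT x|M. \<bar>r' x - r x\<bar> * (cmod (g x))\<^sup>2)" by (rule cs(2))
  also have "\<dots> \<le> sqrt (\<epsilon> * A\<^sup>2) * sqrt (\<epsilon> * B\<^sup>2)"
    using s(2)[OF assms(3) i(1)] s(2)[OF assms(4) i(2)] mult_left_mono[OF A(1) \<epsilon>(1)] mult_left_mono[OF A(2) \<epsilon>(1)]
    by (intro mult_mono real_sqrt_le_mono) (auto intro!: real_sqrt_ge_zero mult_nonneg_nonneg \<epsilon>(1) integral_nonneg_AE)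
  also have "\<dots> = \<epsilon> * A * B" using A(3,4) \<epsilon>(1) by (simp add: real_sqrt_mult mult_ac)
  finally show ?thesis .
qed

text \<open>Let d be the difference of the two weak solutions f' and f. Testing both equations with
  d and subtracting leaves only differences of coefficients, each bounded by a constant times
  \<epsilon> N X, where N is the root of W d and X the norm of x. Since the left side dominates N^2,
  one factor N cancels; the resulting constant depends only on the first triple and z.\<close>

lemma resolvent_difference:
  assumes z: "z \<le> 2 * S.lb - 1" and x: "x \<in> hcarrier S.H"
  shows "hdiff S.H (hadjoint S.H S'.H (\<lambda>f. f) (resolvent S'.H (S'.T ty) (complex_of_real z) x)) (resolvent S.H (S.T ty) (complex_of_real z) x) \<in> hcarrier S.H \<and>
     hnorm S.H (hdiff S.H (hadjoint S.H S'.H (\<lambda>f. f) (resolvent S'.H (S'.T ty) (complex_of_real z) x)) (resolvent S.H (S.T ty) (complex_of_real z) x))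
       \<le> \<epsilon> * (5 + 2 * S.pot_bound + 2 * \<bar>z\<bar>) * hnorm S.H x"
proof -
  obtain u where u: "u \<in> borel_measurable M" "integrable M (\<lambda>x. w x * (cmod (u x))\<^sup>2)" "x = ae_class M u"
    using x by (auto simp: S.carrier_iff)
  note [measurable] = u(1)
  \<comment> \<open>Halving \<delta> doubles the lower bound -|\<gamma>| / \<delta>.\<close>
  have lb': "S'.lb = 2 * S.lb" using S.\<delta>_pos by (simp add: S.lb_def S'.lb_def)
  have "S.lb \<le> 0" using S.\<delta>_pos by (simp add: S.lb_def)
  \<comment> \<open>This is why z \<le> 2 lb - 1 is required: beyond lying below both bounds, -z is
    at least 1 minus either bound, so each form shifted by z dominates its own energy W.\<close>
  then have zl: "z < S.lb" "z < S'.lb" "1 - S'.lb \<le> - z" "1 - S.lb \<le> - z" using z lb' by auto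
  define K where "K = S.pot_bound"
  have K: "K > 0" using S.pot_bound(1) by (simp add: K_def)
  define X where "X = hnorm S.H x"
  have X: "X \<ge> 0" "(LINT x|M. w x * (cmod (u x))\<^sup>2) = X\<^sup>2"
  proof -
    show X0: "X \<ge> 0" using S.nrm_nonneg[OF x] by (simp add: X_def S.hnorm_eq)
    have "0 \<le> (LINT x|M. w x * (cmod (u x))\<^sup>2)" by (rule integral_nonneg_AE, rule eventually_mono[OF S.w_nonneg]) simp
    then show "(LINT x|M. w x * (cmod (u x))\<^sup>2) = X\<^sup>2" by (simp add: X_def u(3) S.nrm_class[OF u(1)])
  qed
  have x': "x \<in> hcarrier S'.H" using x carrier_eq by simp
  obtain f where f: "f \<in> S.FD ty" "resolvent S.H (S.T ty) (complex_of_real z) x = S.cls f"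
    "\<And>g. g \<in> S.FD ty \<Longrightarrow> S.form g f - complex_of_real z * hinner S.H (S.cls g) (S.cls f) = hinner S.H (S.cls g) x"
    using S.resolvent_T[OF zl(1) x, of ty] by blast
  obtain f' where f': "f' \<in> S.FD ty" "resolvent S'.H (S'.T ty) (complex_of_real z) x = S'.cls f'"
    "\<And>g. g \<in> S.FD ty \<Longrightarrow> S'.form g f' - complex_of_real z * hinner S'.H (S'.cls g) (S'.cls f') = hinner S'.H (S'.cls g) x"
    using S'.resolvent_T[OF zl(2) x', of ty] form_dom_eq[of ty] by auto
  have D: "f \<in> S.Dp" "f' \<in> S.Dp" "f' \<in> S'.Dp" using S.form_dom_subset[OF f(1)] S.form_dom_subset[OF f'(1)] dom_eq by auto
  \<comment> \<open>Testing the equation of f' with f' itself bounds its own energy by the squared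
    norm of x in L2(w'), which is at most 3/2 X^2. Passing to the energy of the first triple costs a
    factor 2, and 3 \<le> 4.\<close>
  have Wf': "S.W f' \<le> (2 * X)\<^sup>2"
  proof -
    have c: "S'.cls f' \<in> hcarrier S'.H" by (rule S'.dom_class[OF D(3)])
    have Qf: "S'.Q (S'.cls f') \<le> S'.W f'"
      using S'.dom_integrable(4)[OF D(3)] D(3) by (subst S'.Q_class) (auto simp: dom_A_plus_def)
    have "S'.W f' \<le> Re (S'.form f' f') + (1 - S'.lb) * S'.Q (S'.cls f')" by (rule S'.form_norm_bounds(1)[OF D(3)])
    also have "\<dots> \<le> Re (S'.form f' f') + (- z) * S'.Q (S'.cls f')"
      using zl(3) S'.Q_nonneg[OF c] by (intro add_mono mult_right_mono) auto
    also have "\<dots> = Re (hinner S'.H (S'.cls f') x)"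
      unfolding f'(3)[OF f'(1), symmetric] by (simp add: S'.E_self[OF c])
    also have "\<dots> \<le> S'.nrm (S'.cls f') * S'.nrm x"
      using S'.cauchy_schwarz[OF c x'] complex_Re_le_cmod order_trans by blast
    also have "\<dots> \<le> sqrt (S'.W f') * S'.nrm x"
      unfolding S'.nrm_def[of "S'.cls f'"] using Qf S'.nrm_nonneg[OF x'] by (intro mult_right_mono real_sqrt_le_mono)
    finally have *: "S'.W f' \<le> sqrt (S'.W f') * S'.nrm x" .
    have W0: "0 \<le> S'.W f'" by (rule S'.dom_integrable(6)[OF D(3)])
    have "sqrt (S'.W f') \<le> S'.nrm x"
    proof (cases "S'.W f' = 0")
      case True then show ?thesis using S'.nrm_nonneg[OF x'] by simp
    next
      case False
      then have "0 < sqrt (S'.W f')" using W0 by simp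
      moreover have "sqrt (S'.W f') * sqrt (S'.W f') \<le> sqrt (S'.W f') * S'.nrm x" using * W0 by simp
      ultimately show ?thesis by (metis mult_left_le_imp_le)
    qed
    also have "S'.nrm x \<le> sqrt (3 / 2) * X" using norm_compare[OF u(1,2)] u(3) by (simp add: X_def S'.hnorm_eq)
    finally have "(sqrt (S'.W f'))\<^sup>2 \<le> (sqrt (3 / 2) * X)\<^sup>2" using W0 by (intro power_mono) auto
    then have "S'.W f' \<le> 3 / 2 * X\<^sup>2" using W0 by (simp add: power_mult_distrib)
    then have "S.W f' \<le> 2 * (3 / 2 * X\<^sup>2)" using W_compare[OF D(2)] by simp
    also have "\<dots> \<le> (2 * X)\<^sup>2" by (simp add: power_mult_distrib)
    finally show ?thesis .
  qed
  \<comment> \<open>The difference is an admissible test function for both forms because the form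
    domains coincide.\<close>
  define d where "d = (\<lambda>x. f' x + - 1 * f x)"
  have dF: "d \<in> S.FD ty" unfolding d_def by (intro S.form_dom_add S.form_dom_scale f(1) f'(1))
  then have dD: "d \<in> S.Dp" "d \<in> S'.Dp" using S.form_dom_subset dom_eq by auto
  note [measurable] = S.dom_measurable[OF D(1)] S.dom_measurable[OF D(2)] S.dom_measurable[OF dD(1)]
  define N where "N = sqrt (S.W d)"
  have N: "N \<ge> 0" "S.W d = N\<^sup>2" using S.dom_integrable(6)[OF dD(1)] by (auto simp: N_def)
  have int: "integrable M (\<lambda>x. w x * (cmod (g x))\<^sup>2)" "integrable M (\<lambda>x. p x * (cmod (vderiv g x))\<^sup>2)" if "g \<in> S.Dp" for g
    using that by (auto simp: S.dom_A_plus_iff)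
  have NX: "(LINT x|M. w x * (cmod (d x))\<^sup>2) \<le> N\<^sup>2" "(LINT x|M. p x * (cmod (vderiv d x))\<^sup>2) \<le> N\<^sup>2"
    "(LINT x|M. w x * (cmod (f' x))\<^sup>2) \<le> (2 * X)\<^sup>2" "(LINT x|M. p x * (cmod (vderiv f' x))\<^sup>2) \<le> (2 * X)\<^sup>2"
    using S.dom_integrable(4,5)[OF dD(1)] S.dom_integrable(4,5)[OF D(2)] N(2) Wf' by linarith+
  have X2: "0 \<le> 2 * X" using X by simp
  \<comment> \<open>Four error terms: from p, from q, from w in the term with z, and from w on the
    right-hand side.\<close>
  define Ip where "Ip = (LINT x|M. complex_of_real (p' x - p x) * cnj (vderiv d x) * vderiv f' x)"
  define Iq where "Iq = (LINT x|M. complex_of_real (q' x - q x) * cnj (d x) * f' x)"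
  define Iw where "Iw = (LINT x|M. complex_of_real (w' x - w x) * cnj (d x) * f' x)"
  define Iu where "Iu = (LINT x|M. complex_of_real (w' x - w x) * cnj (d x) * u x)"
  have bIp: "cmod Ip \<le> \<epsilon> * N * (2 * X)" unfolding Ip_def
    by (rule weight_difference_bound[OF S.p_meas S'.p_meas _ _ int(2)[OF dD(1)] int(2)[OF D(2)] p_abs(3) NX(2,4) N(1) X2]) measurable
  have bIw: "cmod Iw \<le> \<epsilon> * N * (2 * X)" unfolding Iw_def
    by (rule weight_difference_bound[OF S.w_meas S'.w_meas _ _ int(1)[OF dD(1)] int(1)[OF D(2)] w_abs(3) NX(1,3) N(1) X2]) measurable
  have bIu: "cmod Iu \<le> \<epsilon> * N * X" unfolding Iu_def
    by (rule weight_difference_bound[OF S.w_meas S'.w_meas _ _ int(1)[OF dD(1)] u(2) w_abs(3) NX(1) eq_refl[OF X(2)] N(1) X(1)]) measurable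
  have rm: "(\<lambda>x. q' x - q x) \<in> borel_measurable M" by measurable
  note pd = S.pot_bound(2,3)[OF dD(1) rm \<epsilon>(1) q_close] and pf = S.pot_bound(2,3)[OF D(2) rm \<epsilon>(1) q_close]
  note cs = weighted_cauchy_schwarz[OF rm S.dom_measurable(1)[OF dD(1)] S.dom_measurable(1)[OF D(2)] pd(1) pf(1)]
  \<comment> \<open>The difference of the potentials is small only in the uniform local norm, not
    relative to q, so the Sobolev type bound \<open>pot_bound\<close> takes the place of a pointwise
    comparison.\<close>
  have bIq: "cmod Iq \<le> K * \<epsilon> * N * (2 * X)"
  proof -
    have "cmod Iq \<le> (LINT x|M. cmod (complex_of_real (q' x - q x) * cnj (d x) * f' x))"
      unfolding Iq_def by (rule integral_norm_bound)
    also have "\<dots> = (LINT x|M. \<bar>q' x - q x\<bar> * cmod (d x) * cmod (f' x))"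
      by (simp only: norm_mult norm_of_real complex_mod_cnj)
    also have "\<dots> \<le> sqrt (LINT x|M. \<bar>q' x - q x\<bar> * (cmod (d x))\<^sup>2) * sqrt (LINT x|M. \<bar>q' x - q x\<bar> * (cmod (f' x))\<^sup>2)" by (rule cs(2))
    also have "\<dots> \<le> sqrt (K * \<epsilon> * N\<^sup>2) * sqrt (K * \<epsilon> * (2 * X)\<^sup>2)"
    proof (intro mult_mono real_sqrt_le_mono)
      show "(LINT x|M. \<bar>q' x - q x\<bar> * (cmod (d x))\<^sup>2) \<le> K * \<epsilon> * N\<^sup>2" using pd(2) by (simp add: K_def N(2))
      have "K * \<epsilon> * S.W f' \<le> K * \<epsilon> * (2 * X)\<^sup>2" using Wf' K \<epsilon> by (intro mult_left_mono) auto
      then show "(LINT x|M. \<bar>q' x - q x\<bar> * (cmod (f' x))\<^sup>2) \<le> K * \<epsilon> * (2 * X)\<^sup>2" using pf(2) by (simp add: K_def)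
    qed (use K \<epsilon> in \<open>auto intro!: integral_nonneg_AE real_sqrt_ge_zero mult_nonneg_nonneg\<close>)
    also have "\<dots> = K * \<epsilon> * N * (2 * X)" using K \<epsilon> N(1) X(1) by (simp add: real_sqrt_mult mult_ac)
    finally show ?thesis .
  qed
  have form_diff: "S'.form d f' - S.form d f' = Ip + Iq"
  proof -
    have "S'.form d f' - S.form d f' =
      (LINT x|M. (complex_of_real (p' x) * cnj (vderiv d x) * vderiv f' x + complex_of_real (q' x) * cnj (d x) * f' x) -
        (complex_of_real (p x) * cnj (vderiv d x) * vderiv f' x + complex_of_real (q x) * cnj (d x) * f' x))"
      unfolding sl_form_def by (rule Bochner_Integration.integral_diff[symmetric]) (rule S'.form_integrable(3)[OF dD(2) D(3)] S.form_integrable(3)[OF dD(1) D(2)])+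
    also have "\<dots> = (LINT x|M. complex_of_real (p' x - p x) * cnj (vderiv d x) * vderiv f' x + complex_of_real (q' x - q x) * cnj (d x) * f' x)"
      by (intro Bochner_Integration.integral_cong refl) (simp add: algebra_simps)
    also have "\<dots> = Ip + Iq" unfolding Ip_def Iq_def
    proof (rule Bochner_Integration.integral_add)
      show "integrable M (\<lambda>x. complex_of_real (q' x - q x) * cnj (d x) * f' x)" by (rule cs(3))
      have "integrable M (\<lambda>x. complex_of_real (p' x) * cnj (vderiv d x) * vderiv f' x - complex_of_real (p x) * cnj (vderiv d x) * vderiv f' x)"
        by (rule Bochner_Integration.integrable_diff[OF S'.form_integrable(1)[OF dD(2) D(3)] S.form_integrable(1)[OF dD(1) D(2)]])
      then show "integrable M (\<lambda>x. complex_of_real (p' x - p x) * cnj (vderiv d x) * vderiv f' x)" by (simp add: algebra_simps)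
    qed
    finally show ?thesis .
  qed
  have inner_diff: "hinner S'.H (ae_class M d) (ae_class M g) - hinner S.H (ae_class M d) (ae_class M g) =
      (LINT x|M. complex_of_real (w' x - w x) * cnj (d x) * g x)"
    if gm: "g \<in> borel_measurable M" and gi: "integrable M (\<lambda>x. w x * (cmod (g x))\<^sup>2)" for g
  proof -
    note [measurable] = gm
    have di: "integrable M (\<lambda>x. w x * (cmod (d x))\<^sup>2)" by (rule int(1)[OF dD(1)])
    have abs: "integrable M (\<lambda>x. \<bar>w x\<bar> * (cmod (h x))\<^sup>2)" "integrable M (\<lambda>x. \<bar>w' x\<bar> * (cmod (h x))\<^sup>2)"
      if "integrable M (\<lambda>x. w x * (cmod (h x))\<^sup>2)" "h \<in> borel_measurable M" for h
      using integrable_weight_le(2)[OF that(1) S.w_meas, of 1] integrable_weight_le(2)[OF that(1) S'.w_meas _ w_abs(1)] that(2) S.w_nonneg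
      by auto
    have "hinner S'.H (ae_class M d) (ae_class M g) - hinner S.H (ae_class M d) (ae_class M g) =
       (LINT x|M. complex_of_real (w' x) * cnj (d x) * g x) - (LINT x|M. complex_of_real (w x) * cnj (d x) * g x)"
      by (simp only: S.inner_ae_class[OF S.dom_measurable(1)[OF dD(1)] gm] S'.inner_ae_class[OF S.dom_measurable(1)[OF dD(1)] gm])
    also have "\<dots> = (LINT x|M. complex_of_real (w' x) * cnj (d x) * g x - complex_of_real (w x) * cnj (d x) * g x)"
      by (rule Bochner_Integration.integral_diff[symmetric])
        (rule weighted_cauchy_schwarz(3)[OF _ _ _ abs(2)[OF di] abs(2)[OF gi]] weighted_cauchy_schwarz(3)[OF _ _ _ abs(1)[OF di] abs(1)[OF gi]]; measurable)+
    finally show ?thesis by (simp add: algebra_simps)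
  qed
  have Iw: "hinner S'.H (ae_class M d) (ae_class M f') - hinner S.H (ae_class M d) (ae_class M f') = Iw"
    unfolding Iw_def by (rule inner_diff[OF S.dom_measurable(1)[OF D(2)] int(1)[OF D(2)]])
  have Iu: "hinner S'.H (ae_class M d) x - hinner S.H (ae_class M d) x = Iu"
    unfolding Iu_def u(3) by (rule inner_diff[OF u(1,2)])
  have c: "ae_class M d \<in> hcarrier S.H" "ae_class M f' \<in> hcarrier S.H" "ae_class M f \<in> hcarrier S.H"
    using S.dom_class[OF dD(1)] S.dom_class[OF D(2)] S.dom_class[OF D(1)] by (simp_all add: S.ae_class_weighted)
  have cd: "ae_class M d = hadd S.H (ae_class M f') (hscale S.H (- 1) (ae_class M f))"
    using S.diff_class[OF S.dom_measurable(1)[OF D(2)] S.dom_measurable(1)[OF D(1)]] by (simp add: hdiff_def d_def)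
  have E1: "S.form d f - complex_of_real z * hinner S.H (ae_class M d) (ae_class M f) = hinner S.H (ae_class M d) x"
    using f(3)[OF dF] by (simp add: S.ae_class_weighted)
  have E2: "S'.form d f' - complex_of_real z * hinner S'.H (ae_class M d) (ae_class M f') = hinner S'.H (ae_class M d) x"
    using f'(3)[OF dF] by (simp add: S'.ae_class_weighted)
  have fdd: "S.form d d = S.form d f' - S.form d f"
  proof -
    have "S.form d d = S.form d f' + S.form d (\<lambda>x. - 1 * f x)"
      unfolding d_def[THEN arg_cong[where f="S.form d"]] by (rule S.form_add[OF dD(1) D(2) S.dom_scale(1)[OF D(1)]])
    then show ?thesis using S.form_scale[OF dD(1) D(1), of "- 1"] by simp
  qed
  have idd: "hinner S.H (ae_class M d) (ae_class M d) = hinner S.H (ae_class M d) (ae_class M f') - hinner S.H (ae_class M d) (ae_class M f)"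
    using S.E_dif[OF c(1,2,3)] unfolding S.dif_def cd[symmetric] .
  \<comment> \<open>Subtraction of the two tested equations; exactly the four error terms
    survive.\<close>
  have Edd: "S.form d d - complex_of_real z * hinner S.H (ae_class M d) (ae_class M d) = Iu + complex_of_real z * Iw - Ip - Iq"
    using E1 E2 form_diff Iw Iu unfolding fdd idd by (simp add: algebra_simps)
  have "N\<^sup>2 \<le> Re (S.form d d) + (1 - S.lb) * S.Q (ae_class M d)"
    using S.form_norm_bounds(1)[OF dD(1)] N(2) by (simp add: S.ae_class_weighted)
  also have "\<dots> \<le> Re (S.form d d) + (- z) * S.Q (ae_class M d)"
    using zl(4) S.Q_nonneg[OF c(1)] by (intro add_mono mult_right_mono) auto
  also have "\<dots> = Re (S.form d d - complex_of_real z * hinner S.H (ae_class M d) (ae_class M d))"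
    by (simp add: S.E_self[OF c(1)])
  also have "\<dots> \<le> cmod (Iu + complex_of_real z * Iw - Ip - Iq)" unfolding Edd by (rule complex_Re_le_cmod)
  also have "\<dots> \<le> cmod Iu + \<bar>z\<bar> * cmod Iw + cmod Ip + cmod Iq"
    using norm_triangle_ineq4[of "Iu + complex_of_real z * Iw - Ip" Iq] norm_triangle_ineq4[of "Iu + complex_of_real z * Iw" Ip]
      norm_triangle_ineq[of Iu "complex_of_real z * Iw"] by (simp add: norm_mult)
  also have "\<dots> \<le> \<epsilon> * N * X + \<bar>z\<bar> * (\<epsilon> * N * (2 * X)) + \<epsilon> * N * (2 * X) + K * \<epsilon> * N * (2 * X)"
    using bIp bIq bIw bIu by (intro add_mono mult_left_mono) auto
  \<comment> \<open>The constants are 1 from Iu, 2 |z| from Iw, 2 from Ip and 2 K from Iq.\<close>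
  finally have "N * N \<le> N * (\<epsilon> * (3 + 2 * K + 2 * \<bar>z\<bar>) * X)" by (simp add: power2_eq_square algebra_simps)
  moreover have "0 \<le> \<epsilon> * (3 + 2 * K + 2 * \<bar>z\<bar>) * X" using \<epsilon>(1) K X(1) by simp
  ultimately have NB: "N \<le> \<epsilon> * (3 + 2 * K + 2 * \<bar>z\<bar>) * X" using N(1) by (cases "N = 0") auto
  have m1 [measurable]: "(\<lambda>x. \<rho> x * f' x) \<in> borel_measurable M" by measurable
  have m2: "(\<lambda>x. \<rho> x * f' x - f' x) \<in> borel_measurable M" by measurable
  \<comment> \<open>The adjoint of J applied to f', minus f, splits into (\<rho> - 1) f' and d; the
    first summand adds 2 to the constant 3, giving 5.\<close>
  define R where "R = hdiff S.H (hadjoint S.H S'.H (\<lambda>f. f) (ae_class M f')) (ae_class M f)"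
  have R: "R = ae_class M (\<lambda>x. \<rho> x * f' x - f x)"
    unfolding R_def adjoint_J[OF S.dom_measurable(1)[OF D(2)] int(1)[OF D(2)]] by (rule S.diff_class[OF m1 S.dom_measurable(1)[OF D(1)]])
  also have "\<dots> = hadd S.H (ae_class M (\<lambda>x. \<rho> x * f' x - f' x)) (ae_class M d)"
    using L2_add[of "\<lambda>x. \<rho> x * f' x - f' x" "weighted I w" d] m2 S.dom_measurable(1)[OF dD(1)]
    by (simp add: S.H_eq S.ae_class_weighted d_def)
  finally have R2: "R = hadd S.H (ae_class M (\<lambda>x. \<rho> x * f' x - f' x)) (ae_class M d)" .
  have g1: "ae_class M (\<lambda>x. \<rho> x * f' x - f' x) \<in> hcarrier S.H" "hnorm S.H (ae_class M (\<lambda>x. \<rho> x * f' x - f' x)) \<le> \<epsilon> * hnorm S.H (ae_class M f')"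
    using mult_rho_bound[OF c(2)] unfolding adjoint_J[OF S.dom_measurable(1)[OF D(2)] int(1)[OF D(2)]]
      S.diff_class[OF m1 S.dom_measurable(1)[OF D(2)]] by auto
  have "hnorm S.H (ae_class M f') \<le> 2 * X"
    unfolding S.nrm_class[OF S.dom_measurable(1)[OF D(2)]] using NX(3) X2 by (intro real_le_lsqrt) auto
  then have "\<epsilon> * hnorm S.H (ae_class M f') \<le> \<epsilon> * (2 * X)" using \<epsilon>(1) by (rule mult_left_mono)
  moreover have "hnorm S.H (ae_class M d) \<le> N"
    unfolding S.nrm_class[OF S.dom_measurable(1)[OF dD(1)]] using NX(1) N(1) by (intro real_le_lsqrt) auto
  moreover have "hnorm S.H R \<le> hnorm S.H (ae_class M (\<lambda>x. \<rho> x * f' x - f' x)) + hnorm S.H (ae_class M d)"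
    unfolding R2 S.hnorm_eq by (rule S.nrm_add[OF g1(1) c(1)])
  ultimately have "hnorm S.H R \<le> \<epsilon> * (2 * X) + \<epsilon> * (3 + 2 * K + 2 * \<bar>z\<bar>) * X" using g1(2) NB by linarith
  also have "\<dots> = \<epsilon> * (5 + 2 * K + 2 * \<bar>z\<bar>) * X" by (simp add: algebra_simps)
  finally have "hnorm S.H R \<le> \<epsilon> * (5 + 2 * K + 2 * \<bar>z\<bar>) * X" .
  moreover have "R \<in> hcarrier S.H" unfolding R2 by (rule S.add_closed[OF g1(1) c(1)])
  ultimately show ?thesis
    unfolding f(2) f'(2) S.ae_class_weighted S'.ae_class_weighted R_def[symmetric] X_def K_def by blast
qed

end

section \<open>From pairs of coefficient triples to the sequence of operators\<close>

theorem theorem3p4: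
  fixes a b :: ereal and I :: "real set"
    and w p q :: "real \<Rightarrow> real" and wn pn qn :: "nat \<Rightarrow> real \<Rightarrow> real"
    and \<gamma> :: real and ty :: form_dom_type
  assumes "a < b" and "I = einterval a b"
    and "sl_coeffs I w p q" and "\<And>n. sl_coeffs I (wn n) (pn n) (qn n)"
    and "sl_bounds I w p q" and "\<And>n. sl_bounds I (wn n) (pn n) (qn n)"
    and "AE x in lebesgue_on I. q x \<ge> \<gamma>" and "\<And>n. AE x in lebesgue_on I. qn n x \<ge> \<gamma>"
    and "\<And>e. e > 0 \<Longrightarrow>
           \<forall>\<^sub>F n in sequentially. AE x in lebesgue_on I. \<bar>wn n x / w x - 1\<bar> < e"
    and "\<And>e. e > 0 \<Longrightarrow>
           \<forall>\<^sub>F n in sequentially. AE x in lebesgue_on I. \<bar>pn n x / p x - 1\<bar> < e"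
    and "(\<lambda>n. unif_loc_norm I (\<lambda>x. qn n x - q x)) \<longlonglongrightarrow> 0"
  shows "gen_norm_resolvent_conv
           (sl_space a b w) (sl_operator ty a b w p q)
           (\<lambda>n. sl_space a b (wn n)) (\<lambda>n. sl_operator ty a b (wn n) (pn n) (qn n))
           (\<lambda>n f. f)"
proof -
  let ?H = "sl_space a b w" and ?A = "sl_operator ty a b w p q"
  let ?Hn = "\<lambda>n. sl_space a b (wn n)" and ?An = "\<lambda>n. sl_operator ty a b (wn n) (pn n) (qn n)"
  let ?JJ = "\<lambda>n. opnorm ?H ?H (\<lambda>x. hdiff ?H (hadjoint ?H (?Hn n) (\<lambda>f. f) x) x)"
  obtain \<delta> where \<delta>: "\<delta> > 0" "AE x in lebesgue_on I. w x \<ge> \<delta> \<and> p x \<ge> \<delta>" "unif_loc_norm I q < \<infinity>"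
    using assms(5) by (auto simp: sl_bounds_def)
  interpret S: sl_data a b I w p q \<gamma> \<delta>
    by unfold_locales (use assms(1-3,7) \<delta> in auto)
  have "\<forall>n. \<exists>d>0. AE x in lebesgue_on I. wn n x \<ge> d \<and> pn n x \<ge> d"
    using assms(6) by (auto simp: sl_bounds_def)
  \<comment> \<open>Each index keeps its own \<delta>n, for the finitely many n that are not yet
    close to the limit and for self-adjointness of every operator.\<close>
  then obtain \<delta>n where \<delta>n: "\<And>n. \<delta>n n > 0" "\<And>n. AE x in lebesgue_on I. wn n x \<ge> \<delta>n n \<and> pn n x \<ge> \<delta>n n" by metis
  have Sn: "sl_data a b I (wn n) (pn n) (qn n) \<gamma> d"
    if "d > 0" "AE x in lebesgue_on I. wn n x \<ge> d \<and> pn n x \<ge> d" for n d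
    by unfold_locales (use assms(1,2) assms(4,6,8)[of n] that in \<open>auto simp: sl_bounds_def\<close>)
  \<comment> \<open>For every prescribed e the late triples form a pair with the limit triple;
    closeness of the quotients to 1 within 1/2 gives the lower bound \<delta>/2 whatever the
    individual \<delta>n are.\<close>
  have pair: "\<forall>\<^sub>F n in sequentially. sl_pair a b I w p q \<gamma> \<delta> (wn n) (pn n) (qn n) e"
    if e: "0 < e" "e \<le> 1 / 2" for e
  proof -
    have "\<forall>\<^sub>F n in sequentially. unif_loc_norm I (\<lambda>x. qn n x - q x) < ennreal e"
      using order_tendstoD(2)[OF assms(11), of "ennreal e"] e by simp
    with assms(9)[OF e(1)] assms(10)[OF e(1)] show ?thesis
    proof eventually_elim
      case (elim n)
      have low: "AE x in lebesgue_on I. wn n x \<ge> \<delta> / 2 \<and> pn n x \<ge> \<delta> / 2"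
        using elim(1,2) \<delta>(2)
      proof eventually_elim
        case (elim x)
        have "\<delta> / 2 \<le> r'" if "\<bar>r' / r - 1\<bar> < e" "\<delta> \<le> r" for r r' :: real
        proof -
          have "1 / 2 \<le> r' / r" using that(1) e(2) by linarith
          then have "1 / 2 * r \<le> r'" using that(2) \<delta>(1) by (simp add: pos_le_divide_eq)
          then show ?thesis using that(2) by simp
        qed
        then show ?case using elim by blast
      qed
      interpret S': sl_data a b I "wn n" "pn n" "qn n" \<gamma> "\<delta> / 2"
        by (rule Sn[OF _ low]) (use \<delta>(1) in simp)
      show ?case
        by unfold_locales (use e elim in \<open>auto intro: less_imp_le eventually_mono\<close>)
    qed
  qed
  obtain N where N: "\<And>n. n \<ge> N \<Longrightarrow> sl_pair a b I w p q \<gamma> \<delta> (wn n) (pn n) (qn n) (1 / 2)"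
    using pair[of "1 / 2"] by (auto simp: eventually_sequentially)
  \<comment> \<open>A common lower bound of all operators: 2 lb serves the limit and every n \<ge>
    N, and the finitely many earlier ones enter with their own bounds.\<close>
  define m where "m = Min (insert (2 * S.lb) ((\<lambda>n. - \<bar>\<gamma>\<bar> / \<delta>n n) ` {..<N}))"
  \<comment> \<open>Distance 1 from m puts the disc of radius 1/2 about z into every resolvent
    set.\<close>
  define z where "z = m - 1"
  have lb0: "S.lb \<le> 0" using \<delta>(1) by (simp add: S.lb_def)
  have m: "m \<le> 2 * S.lb" "\<And>n. n < N \<Longrightarrow> m \<le> - \<bar>\<gamma>\<bar> / \<delta>n n" unfolding m_def by (auto intro!: Min_le)
  have res: "\<zeta> \<in> resolvent_set ?H ?A" "\<zeta> \<in> resolvent_set (?Hn n) (?An n)"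
    if \<zeta>: "dist (complex_of_real z) \<zeta> < 1 / 2" for \<zeta> :: complex and n
  proof -
    have close: "2 * cmod (\<zeta> - complex_of_real z) \<le> 1" using \<zeta> by (simp add: dist_norm norm_minus_commute)
    show "\<zeta> \<in> resolvent_set ?H ?A"
      by (rule S.resolvent_set_T[of z]) (use close m(1) lb0 in \<open>auto simp: z_def\<close>)
    show "\<zeta> \<in> resolvent_set (?Hn n) (?An n)"
    proof (cases "n < N")
      case True
      interpret S': sl_data a b I "wn n" "pn n" "qn n" \<gamma> "\<delta>n n" by (rule Sn[OF \<delta>n])
      show ?thesis
        by (rule S'.resolvent_set_T[of z]) (use close m(2)[OF True] in \<open>auto simp: z_def S'.lb_def\<close>)
    next
      case False
      interpret P: sl_pair a b I w p q \<gamma> \<delta> "wn n" "pn n" "qn n" "1 / 2" by (rule N) (use False in simp)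
      have "P.S'.lb = 2 * S.lb" using \<delta>(1) by (simp add: S.lb_def P.S'.lb_def)
      then show ?thesis
        by (intro P.S'.resolvent_set_T[of z]) (use close m(1) in \<open>auto simp: z_def\<close>)
    qed
  qed
  \<comment> \<open>The closure of the union of the spectra is avoided because the radius 1/2 is the
    same for all operators.\<close>
  have z_mem: "complex_of_real z \<in> - closure (spectrum ?H ?A \<union> (\<Union>n. spectrum (?Hn n) (?An n)))"
  proof -
    have "\<not> (\<exists>y\<in>spectrum ?H ?A \<union> (\<Union>n. spectrum (?Hn n) (?An n)). dist y z < 1 / 2)"
      using res by (auto simp: spectrum_def dist_commute)
    moreover have "\<exists>y\<in>spectrum ?H ?A \<union> (\<Union>n. spectrum (?Hn n) (?An n)). dist y z < 1 / 2"
      if "complex_of_real z \<in> closure (spectrum ?H ?A \<union> (\<Union>n. spectrum (?Hn n) (?An n)))"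
      using that[unfolded closure_approachable, rule_format, of "1 / 2"] by simp
    ultimately show ?thesis by blast
  qed
  \<comment> \<open>A quantity between 0 and \<epsilon> C, for every \<epsilon> that makes a pair,
    tends to 0. The two limits to be shown have this form, with constant 1 for the adjoint of J
    composed with J and the constant of the resolvent estimate for the resolvents.\<close>
  have small: "\<forall>\<^sub>F n in sequentially. \<bar>g n\<bar> < e"
    if g: "\<And>n \<epsilon>. sl_pair a b I w p q \<gamma> \<delta> (wn n) (pn n) (qn n) \<epsilon> \<Longrightarrow> 0 \<le> g n \<and> g n \<le> \<epsilon> * C" and C: "C > 0" and e: "e > 0"
    for g :: "nat \<Rightarrow> real" and C e :: real
  proof -
    define \<epsilon> where "\<epsilon> = min (1 / 2) (e / (2 * C))"
    have \<epsilon>: "0 < \<epsilon>" "\<epsilon> \<le> 1 / 2" "\<epsilon> * C < e"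
    proof -
      show "0 < \<epsilon>" "\<epsilon> \<le> 1 / 2" using e C by (auto simp: \<epsilon>_def)
      have "\<epsilon> * C \<le> e / (2 * C) * C" using C by (intro mult_right_mono) (auto simp: \<epsilon>_def)
      also have "\<dots> < e" using C e by simp
      finally show "\<epsilon> * C < e" .
    qed
    show ?thesis using pair[OF \<epsilon>(1,2)]
    proof eventually_elim
      case (elim n)
      then show ?case using g[OF elim] \<epsilon>(3) by simp
    qed
  qed
  show ?thesis
    unfolding gen_norm_resolvent_conv_def
  proof (intro conjI bexI[OF _ z_mem])
    show "self_adjoint ?H ?A" by (rule S.self_adjoint_T)
    show "\<forall>n. self_adjoint (?Hn n) (?An n)"
    proof
      fix n
      interpret S': sl_data a b I "wn n" "pn n" "qn n" \<gamma> "\<delta>n n" by (rule Sn[OF \<delta>n])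
      show "self_adjoint (?Hn n) (?An n)" by (rule S'.self_adjoint_T)
    qed
    show "\<exists>C>0. \<forall>\<^sub>F n in sequentially. bounded_op ?H (?Hn n) (\<lambda>f. f) \<and> opnorm ?H (?Hn n) (\<lambda>f. f) \<le> C"
    proof (intro exI[of _ 2] conjI eventually_sequentiallyI[of N])
      fix n assume "N \<le> n"
      then interpret P: sl_pair a b I w p q \<gamma> \<delta> "wn n" "pn n" "qn n" "1 / 2" by (rule N)
      show "bounded_op ?H (?Hn n) (\<lambda>f. f)" "opnorm ?H (?Hn n) (\<lambda>f. f) \<le> 2" by (rule P.J_bounded)+
    qed simp
    show "\<forall>\<^sub>F n in sequentially. ?JJ n = opnorm (?Hn n) (?Hn n) (\<lambda>y. hdiff (?Hn n) (hadjoint ?H (?Hn n) (\<lambda>f. f) y) y)"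
    proof (rule eventually_sequentiallyI[of N])
      fix n assume "N \<le> n"
      then interpret P: sl_pair a b I w p q \<gamma> \<delta> "wn n" "pn n" "qn n" "1 / 2" by (rule N)
      show "?JJ n = opnorm (?Hn n) (?Hn n) (\<lambda>y. hdiff (?Hn n) (hadjoint ?H (?Hn n) (\<lambda>f. f) y) y)" by (rule P.JJ_opnorm_eq)
    qed
    have JJ: "0 \<le> ?JJ n \<and> ?JJ n \<le> \<epsilon> * 1" if "sl_pair a b I w p q \<gamma> \<delta> (wn n) (pn n) (qn n) \<epsilon>" for n \<epsilon>
    proof -
      interpret P: sl_pair a b I w p q \<gamma> \<delta> "wn n" "pn n" "qn n" \<epsilon> by fact
      show ?thesis using P.JJ_opnorm by simp
    qed
    show "?JJ \<longlonglongrightarrow> 0"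
      by (rule tendstoI) (use small[OF JJ zero_less_one] in \<open>simp add: dist_real_def\<close>)
    define C where "C = 5 + 2 * S.pot_bound + 2 * \<bar>z\<bar>"
    have C: "C > 0" using S.pot_bound(1) by (simp add: C_def)
    let ?R = "\<lambda>n. opnorm ?H ?H (\<lambda>x. hdiff ?H (hadjoint ?H (?Hn n) (\<lambda>f. f) (resolvent (?Hn n) (?An n) (complex_of_real z) x))
                        (resolvent ?H ?A (complex_of_real z) x))"
    have R: "0 \<le> ?R n \<and> ?R n \<le> \<epsilon> * C" if "sl_pair a b I w p q \<gamma> \<delta> (wn n) (pn n) (qn n) \<epsilon>" for n \<epsilon>
    proof -
      interpret P: sl_pair a b I w p q \<gamma> \<delta> "wn n" "pn n" "qn n" \<epsilon> by fact
      have "0 \<le> \<epsilon> * C" using P.\<epsilon>(1) C by simp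
      note ob = opnorm_bounds[OF S.hilbert_axioms S.hilbert_axioms this]
      have zb: "z \<le> 2 * S.lb - 1" using m(1) by (simp add: z_def)
      show ?thesis
        by (intro conjI ob) (use P.resolvent_difference[OF zb, of _ ty] in \<open>auto simp: C_def\<close>)
    qed
    show "?R \<longlonglongrightarrow> 0"
      by (rule tendstoI) (use small[OF R C] in \<open>simp add: dist_real_def\<close>)
  qed
qed

end
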